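(* Let $A$ be any C$^*$-algebra with $\mathrm{sr}(A)=1$ and let $X$ be a compact metric space of (covering) dimension one. Then $\mathrm{sr}(\mathrm{C}(X,A))=1$ if $A$ has no $\mathrm{K}_1$-obstructions, and $\mathrm{sr}(\mathrm{C}(X,A))=2$ otherwise.
   Context: A C$^*$-algebra $A$ has no $\mathrm{K}_1$-obstructions if its stable rank is one and $\mathrm{K}_1(B)=0$ for every hereditary C$^*$-subalgebra $B$ of $A$ (equivalently, $\mathrm{K}_1(I)=0$ for every closed two-sided ideal $I$). *)

theory Defs
  imports "HOL-Analysis.Analysis" "HOL-Library.Extended_Nat"
begin

record 'a cstar_alg =
  carrier :: "'a set"
  zero :: 'a
  add :: "'a \<Rightarrow> 'a \<Rightarrow> 'a"
  mul :: "'a \<Rightarrow> 'a \<Rightarrow> 'a"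
  smul :: "complex \<Rightarrow> 'a \<Rightarrow> 'a"
  star :: "'a \<Rightarrow> 'a"
  nrm :: "'a \<Rightarrow> real"

definition sub :: "'a cstar_alg \<Rightarrow> 'a \<Rightarrow> 'a \<Rightarrow> 'a" where
  "sub A x y = add A x (smul A (-1) y)"

definition cstar_algebra :: "'a cstar_alg \<Rightarrow> bool" where
  "cstar_algebra A \<longleftrightarrow>
     zero A \<in> carrier A \<and>
     (\<forall>x\<in>carrier A. \<forall>y\<in>carrier A. add A x y \<in> carrier A \<and> mul A x y \<in> carrier A) \<and>
     (\<forall>c. \<forall>x\<in>carrier A. smul A c x \<in> carrier A) \<and>
     (\<forall>x\<in>carrier A. star A x \<in> carrier A) \<and>
     \<comment> \<open>complex vector space\<close>
     (\<forall>x\<in>carrier A. \<forall>y\<in>carrier A. \<forall>z\<in>carrier A. add A (add A x y) z = add A x (add A y z)) \<and>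
     (\<forall>x\<in>carrier A. \<forall>y\<in>carrier A. add A x y = add A y x) \<and>
     (\<forall>x\<in>carrier A. add A x (zero A) = x) \<and>
     (\<forall>x\<in>carrier A. add A x (smul A (-1) x) = zero A) \<and>
     (\<forall>c. \<forall>x\<in>carrier A. \<forall>y\<in>carrier A. smul A c (add A x y) = add A (smul A c x) (smul A c y)) \<and>
     (\<forall>c d. \<forall>x\<in>carrier A. smul A (c + d) x = add A (smul A c x) (smul A d x)) \<and>
     (\<forall>c d. \<forall>x\<in>carrier A. smul A (c * d) x = smul A c (smul A d x)) \<and>
     (\<forall>x\<in>carrier A. smul A 1 x = x) \<and>
     \<comment> \<open>associative algebra\<close>
     (\<forall>x\<in>carrier A. \<forall>y\<in>carrier A. \<forall>z\<in>carrier A. mul A (mul A x y) z = mul A x (mul A y z)) \<and>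
     (\<forall>x\<in>carrier A. \<forall>y\<in>carrier A. \<forall>z\<in>carrier A. mul A x (add A y z) = add A (mul A x y) (mul A x z)) \<and>
     (\<forall>x\<in>carrier A. \<forall>y\<in>carrier A. \<forall>z\<in>carrier A. mul A (add A x y) z = add A (mul A x z) (mul A y z)) \<and>
     (\<forall>c. \<forall>x\<in>carrier A. \<forall>y\<in>carrier A. mul A (smul A c x) y = smul A c (mul A x y) \<and> mul A x (smul A c y) = smul A c (mul A x y)) \<and>
     \<comment> \<open>involution\<close>
     (\<forall>x\<in>carrier A. star A (star A x) = x) \<and>
     (\<forall>x\<in>carrier A. \<forall>y\<in>carrier A. star A (add A x y) = add A (star A x) (star A y)) \<and>
     (\<forall>c. \<forall>x\<in>carrier A. star A (smul A c x) = smul A (cnj c) (star A x)) \<and>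
     (\<forall>x\<in>carrier A. \<forall>y\<in>carrier A. star A (mul A x y) = mul A (star A y) (star A x)) \<and>
     \<comment> \<open>submultiplicative norm\<close>
     (\<forall>x\<in>carrier A. nrm A x \<ge> 0 \<and> (nrm A x = 0 \<longleftrightarrow> x = zero A)) \<and>
     (\<forall>x\<in>carrier A. \<forall>y\<in>carrier A. nrm A (add A x y) \<le> nrm A x + nrm A y) \<and>
     (\<forall>c. \<forall>x\<in>carrier A. nrm A (smul A c x) = cmod c * nrm A x) \<and>
     (\<forall>x\<in>carrier A. \<forall>y\<in>carrier A. nrm A (mul A x y) \<le> nrm A x * nrm A y) \<and>
     \<comment> \<open>C*-identity\<close>
     (\<forall>x\<in>carrier A. nrm A (mul A (star A x) x) = (nrm A x)\<^sup>2) \<and>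
     \<comment> \<open>completeness\<close>
     (\<forall>f. (\<forall>n. f n \<in> carrier A) \<and>
          (\<forall>e>0. \<exists>N. \<forall>m\<ge>N. \<forall>n\<ge>N. nrm A (sub A (f m) (f n)) < e) \<longrightarrow>
          (\<exists>x\<in>carrier A. (\<lambda>n. nrm A (sub A (f n) x)) \<longlonglongrightarrow> 0))"

section \<open>Forced unitization \<open>A\<^sup>~ = A \<oplus> \<complex>\<close> (with an equivalent l1-norm)\<close>

definition uadd :: "'a cstar_alg \<Rightarrow> 'a \<times> complex \<Rightarrow> 'a \<times> complex \<Rightarrow> 'a \<times> complex" where
  "uadd A x y = (add A (fst x) (fst y), snd x + snd y)"

definition uneg :: "'a cstar_alg \<Rightarrow> 'a \<times> complex \<Rightarrow> 'a \<times> complex" where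
  "uneg A x = (smul A (-1) (fst x), - snd x)"

definition umul :: "'a cstar_alg \<Rightarrow> 'a \<times> complex \<Rightarrow> 'a \<times> complex \<Rightarrow> 'a \<times> complex" where
  "umul A x y = (add A (add A (mul A (fst x) (fst y)) (smul A (snd x) (fst y))) (smul A (snd y) (fst x)),
                 snd x * snd y)"

definition ustar :: "'a cstar_alg \<Rightarrow> 'a \<times> complex \<Rightarrow> 'a \<times> complex" where
  "ustar A x = (star A (fst x), cnj (snd x))"

definition uone :: "'a cstar_alg \<Rightarrow> 'a \<times> complex" where
  "uone A = (zero A, 1)"

definition uzero :: "'a cstar_alg \<Rightarrow> 'a \<times> complex" where
  "uzero A = (zero A, 0)"

definition unorm :: "'a cstar_alg \<Rightarrow> 'a \<times> complex \<Rightarrow> real" where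
  "unorm A x = nrm A (fst x) + cmod (snd x)"

definition udist :: "'a cstar_alg \<Rightarrow> 'a \<times> complex \<Rightarrow> 'a \<times> complex \<Rightarrow> real" where
  "udist A x y = unorm A (uadd A x (uneg A y))"

primrec usum :: "'a cstar_alg \<Rightarrow> (nat \<Rightarrow> 'a \<times> complex) \<Rightarrow> nat \<Rightarrow> 'a \<times> complex" where
  "usum A f 0 = uzero A"
| "usum A f (Suc n) = uadd A (usum A f n) (f n)"

definition Lg :: "'a cstar_alg \<Rightarrow> nat \<Rightarrow> (nat \<Rightarrow> 'a \<times> complex) set" where
  "Lg A n = {v. (\<forall>i<n. v i \<in> carrier A \<times> UNIV) \<and>
      (\<exists>w. (\<forall>i<n. w i \<in> carrier A \<times> UNIV) \<and> usum A (\<lambda>i. umul A (w i) (v i)) n = uone A)}"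

definition Lg_dense :: "'a cstar_alg \<Rightarrow> nat \<Rightarrow> bool" where
  "Lg_dense A n \<longleftrightarrow> (\<forall>v. (\<forall>i<n. v i \<in> carrier A \<times> UNIV) \<longrightarrow>
      (\<forall>e>0. \<exists>w\<in>Lg A n. \<forall>i<n. udist A (v i) (w i) < e))"

definition stable_rank :: "'a cstar_alg \<Rightarrow> enat" where
  "stable_rank A = (INF n \<in> {n. n \<ge> 1 \<and> Lg_dense A n}. enat n)"

type_synonym 'a umat = "nat \<Rightarrow> nat \<Rightarrow> 'a \<times> complex"

definition mat_mul :: "'a cstar_alg \<Rightarrow> nat \<Rightarrow> 'a umat \<Rightarrow> 'a umat \<Rightarrow> 'a umat" where
  "mat_mul A m P Q = (\<lambda>i j. usum A (\<lambda>k. umul A (P i k) (Q k j)) m)"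

definition mat_one :: "'a cstar_alg \<Rightarrow> 'a umat" where
  "mat_one A = (\<lambda>i j. if i = j then uone A else uzero A)"

definition mat_star :: "'a cstar_alg \<Rightarrow> 'a umat \<Rightarrow> 'a umat" where
  "mat_star A P = (\<lambda>i j. ustar A (P j i))"

definition mat_eq :: "nat \<Rightarrow> 'a umat \<Rightarrow> 'a umat \<Rightarrow> bool" where
  "mat_eq m P Q \<longleftrightarrow> (\<forall>i<m. \<forall>j<m. P i j = Q i j)"

definition unitary_mat :: "'a cstar_alg \<Rightarrow> 'a set \<Rightarrow> nat \<Rightarrow> 'a umat \<Rightarrow> bool" where
  "unitary_mat A B m U \<longleftrightarrow> (\<forall>i<m. \<forall>j<m. U i j \<in> B \<times> UNIV) \<and>
     mat_eq m (mat_mul A m (mat_star A U) U) (mat_one A) \<and>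
     mat_eq m (mat_mul A m U (mat_star A U)) (mat_one A)"

text \<open>U is in the path component of the identity of the unitary group U_m(B~)
  (topology from the entrywise norm, which is equivalent to the C*-norm).\<close>
definition unitary_conn_one :: "'a cstar_alg \<Rightarrow> 'a set \<Rightarrow> nat \<Rightarrow> 'a umat \<Rightarrow> bool" where
  "unitary_conn_one A B m U \<longleftrightarrow> (\<exists>\<gamma> :: real \<Rightarrow> 'a umat.
     (\<forall>t\<in>{0..1}. unitary_mat A B m (\<gamma> t)) \<and>
     (\<forall>t\<in>{0..1}. \<forall>e>0. \<exists>d>0. \<forall>s\<in>{0..1}. \<bar>s - t\<bar> < d \<longrightarrow>
         (\<forall>i<m. \<forall>j<m. udist A (\<gamma> s i j) (\<gamma> t i j) < e)) \<and>
     mat_eq m (\<gamma> 0) (mat_one A) \<and> mat_eq m (\<gamma> 1) U)"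

definition mat_ext :: "'a cstar_alg \<Rightarrow> nat \<Rightarrow> 'a umat \<Rightarrow> 'a umat" where
  "mat_ext A n U = (\<lambda>i j. if i < n \<and> j < n then U i j else mat_one A i j)"

definition K1_zero :: "'a cstar_alg \<Rightarrow> 'a set \<Rightarrow> bool" where
  "K1_zero A B \<longleftrightarrow> (\<forall>n U. unitary_mat A B n U \<longrightarrow>
      (\<exists>m\<ge>n. unitary_conn_one A B m (mat_ext A n U)))"

definition positive :: "'a cstar_alg \<Rightarrow> 'a \<Rightarrow> bool" where
  "positive A x \<longleftrightarrow> (\<exists>y\<in>carrier A. x = mul A (star A y) y)"

definition hereditary_subalg :: "'a cstar_alg \<Rightarrow> 'a set \<Rightarrow> bool" where
  "hereditary_subalg A B \<longleftrightarrow> B \<subseteq> carrier A \<and> zero A \<in> B \<and>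
     (\<forall>x\<in>B. \<forall>y\<in>B. add A x y \<in> B \<and> mul A x y \<in> B) \<and>
     (\<forall>c. \<forall>x\<in>B. smul A c x \<in> B) \<and> (\<forall>x\<in>B. star A x \<in> B) \<and>
     (\<forall>f x. (\<forall>n. f n \<in> B) \<and> x \<in> carrier A \<and> (\<lambda>n. nrm A (sub A (f n) x)) \<longlonglongrightarrow> 0 \<longrightarrow> x \<in> B) \<and>
     (\<forall>a\<in>carrier A. \<forall>b\<in>B. positive A a \<and> positive A (sub A b a) \<longrightarrow> a \<in> B)"

definition no_K1_obstructions :: "'a cstar_alg \<Rightarrow> bool" where
  "no_K1_obstructions A \<longleftrightarrow> stable_rank A = 1 \<and>
     (\<forall>B. hereditary_subalg A B \<longrightarrow> K1_zero A B)"

definition CX :: "'x::metric_space set \<Rightarrow> 'a cstar_alg \<Rightarrow> ('x \<Rightarrow> 'a) cstar_alg" where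
  "CX X A = \<lparr> carrier = {f. (\<forall>x\<in>X. f x \<in> carrier A) \<and> (\<forall>x. x \<notin> X \<longrightarrow> f x = zero A) \<and>
                  (\<forall>x\<in>X. \<forall>e>0. \<exists>d>0. \<forall>y\<in>X. dist y x < d \<longrightarrow> nrm A (sub A (f y) (f x)) < e)},
              zero = (\<lambda>x. zero A),
              add = (\<lambda>f g x. if x \<in> X then add A (f x) (g x) else zero A),
              mul = (\<lambda>f g x. if x \<in> X then mul A (f x) (g x) else zero A),
              smul = (\<lambda>c f x. if x \<in> X then smul A c (f x) else zero A),
              star = (\<lambda>f x. if x \<in> X then star A (f x) else zero A),
              nrm = (\<lambda>f. Sup ((\<lambda>x. nrm A (f x)) ` X)) \<rparr>"

definition covering_dim_le :: "'x::topological_space set \<Rightarrow> nat \<Rightarrow> bool" where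
  "covering_dim_le X n \<longleftrightarrow> (\<forall>\<U>. finite \<U> \<and> (\<forall>U\<in>\<U>. openin (top_of_set X) U) \<and> \<Union>\<U> = X \<longrightarrow>
     (\<exists>\<V>. finite \<V> \<and> (\<forall>V\<in>\<V>. openin (top_of_set X) V) \<and> \<Union>\<V> = X \<and>
          (\<forall>V\<in>\<V>. \<exists>U\<in>\<U>. V \<subseteq> U) \<and> (\<forall>x\<in>X. card {V\<in>\<V>. x \<in> V} \<le> n + 1)))"

definition covering_dim_one :: "'x::topological_space set \<Rightarrow> bool" where
  "covering_dim_one X \<longleftrightarrow> covering_dim_le X 1 \<and> \<not> covering_dim_le X 0"

end

theory Submission
 imports Defs "HOL-Complex_Analysis.Complex_Analysis" "HOL-Computational_Algebra.Polynomial"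
begin

text \<open>
 In the unitization of a C*-algebra of stable rank one, two invertible elements close to \<open>x\<close> have polar
 decompositions that almost agree on the support of \<open>x\<close>, so up to a short path they differ by a unitary of
 the unitized annihilator of \<open>x\<close>, which is hereditary. If \<open>K\<^sub>1\<close> of every hereditary subalgebra
 vanishes, this unitary is connected to 1, because \<open>U/U\<^sub>0\<close> embeds into \<open>K\<^sub>1\<close> in
 stable rank one; hence the invertible elements near \<open>x\<close> are connected inside a small ball. Over a
 one-dimensional space this suffices to approximate a continuous function by an invertible one: choose
 invertible values on the vertices of the nerve of a fine cover and join them along its edges. For pairs of
 elements the connecting paths always exist (move one entry at a time), so the stable rank is at most two.

 Conversely, a compact metric space that is not zero-dimensional contains a connected set joining two points
 \<open>p\<close>, \<open>q\<close>. Stable rank one passes to the hereditary subalgebra \<open>C(X, B)\<close>, so a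
 function equal to 1 at \<open>p\<close> and to a given unitary at \<open>q\<close> is close to an invertible one, which
 connects the unitary to 1 and gives \<open>K\<^sub>1(B) = 0\<close>.
\<close>

section \<open>Unital C*-algebras as a type class\<close>

text \<open>Two obstacles shape the development. Vanishing of \<open>K1_zero\<close> connects a
  unitary to 1 only after stabilisation, in matrices of unknown size, whereas the local argument
  needs a path of unitaries of the algebra itself. The way back down is an argument over the circle:
  the last column of a path from 1 to diag(u, 1, ..., 1) is a unimodular loop, Laurent polynomials
  are dense among loops, and in stable rank one leading coefficients can be perturbed to invertible
  ones. Euclid's algorithm then completes the column to an invertible matrix loop, whose inverse
  strips one dimension off the path. Secondly, algebras are records, usually without unit, to which
  type classes do not apply. All C*-structures on a given type are therefore multiplied into one
  bounded product, which is unitized once; a given algebra, its hereditary subalgebras and their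
  unitizations become subsets of one unital type. The functional calculus there avoids spectra: the
  norm bound for polynomials comes from Cauchy's estimate on the unit circle, and functions are
  taken on all of [-1,1].\<close>

class ucstar = real_normed_algebra_1 + banach +
 fixes adj :: "'a => 'a" and J :: 'a
 assumes adj_add: "adj (x + y) = adj x + adj y"
  and adj_scaleR: "adj (r *\<^sub>R x) = r *\<^sub>R adj x"
  and adj_mult: "adj (x * y) = adj y * adj x"
  and adj_adj [simp]: "adj (adj x) = x"
  and cstar: "norm (adj x * x) = (norm x)\<^sup>2"
  and J_central: "J * x = x * J"
  and J_J: "J * J = - 1"
  and adj_J: "adj J = - J"

lemma adj_0 [simp]: "adj 0 = (0::'a::ucstar)"
 using adj_scaleR[of 0 "0::'a"] by simp

lemma adj_minus [simp]: "adj (- x) = - adj (x::'a::ucstar)"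
 using adj_scaleR[of "-1" x] by simp

lemma adj_diff: "adj (x - y) = adj x - adj (y::'a::ucstar)"
 using adj_add[of x "- y"] by simp

lemma adj_1 [simp]: "adj 1 = (1::'a::ucstar)"
 by (metis adj_adj adj_mult mult.right_neutral)

lemma norm_adj [simp]: "norm (adj x) = norm (x::'a::ucstar)"
proof -
 have le: "norm y <= norm (adj y)" for y :: 'a
 proof (cases "norm y = 0")
  case False
  have "norm y * norm y <= norm (adj y) * norm y"
   using cstar[of y] norm_mult_ineq[of "adj y" y] by (simp add: power2_eq_square)
  then show ?thesis using False by (simp add: mult_le_cancel_right)
 qed simp
 show ?thesis using le[of x] le[of "adj x"] by simp
qed

lemma adj_mult_eq_0: "adj x * x = 0 ==> x = 0"
 using cstar[of x] by simp

lemma norm_sa_square: "adj x = x ==> norm (x * x) = (norm x)\<^sup>2"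
 using cstar[of x] by simp

lemma adj_power: "adj (x ^ n) = adj x ^ n"
 by (induction n) (simp_all add: adj_mult power_commutes)

lemma norm_sa_power2: "adj x = x ==> norm (x ^ (2 ^ n)) = norm x ^ (2 ^ n)"
proof (induction n)
 case (Suc n)
 have "x ^ (2 ^ Suc n) = x ^ (2 ^ n) * x ^ (2 ^ n)"
  by (simp add: mult_2 power_add[symmetric])
 then show ?case
  using Suc norm_sa_square[of "x ^ (2 ^ n)"]
  by (simp add: adj_power power_mult[symmetric] mult.commute)
qed simp

lemma isometry_norm: "adj u * u = 1 ==> norm u = 1"
 using cstar[of u] by (simp add: power2_eq_1_iff) (smt (verit) norm_ge_zero)

lemma bounded_linear_adj: "bounded_linear (adj :: 'a::ucstar => 'a)"
 by (rule bounded_linear_intro[where K = 1]) (simp_all add: adj_add adj_scaleR)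

lemmas continuous_on_adj [continuous_intros] = bounded_linear.continuous_on[OF bounded_linear_adj]
lemmas tendsto_adj [tendsto_intros] = bounded_linear.tendsto[OF bounded_linear_adj]

text \<open>Complex scalars act through the central element \<open>J\<close>, which plays the
  imaginary unit; this keeps the algebra inside the real normed type classes while still describing
  a complex C*-algebra.\<close>

definition cplx :: "complex => 'a::ucstar" where
 "cplx c = Re c *\<^sub>R 1 + Im c *\<^sub>R J"

lemma cplx_add: "cplx (c + d) = cplx c + cplx d"
 by (simp add: cplx_def algebra_simps)

lemma cplx_mult: "cplx (c * d) = cplx c * cplx d"
 by (simp add: cplx_def algebra_simps J_J)

lemma cplx_0 [simp]: "cplx 0 = 0" and cplx_1 [simp]: "cplx 1 = 1"
 by (simp_all add: cplx_def)

lemma cplx_of_real: "cplx (of_real r) = r *\<^sub>R 1"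
 by (simp add: cplx_def)

lemma cplx_minus: "cplx (- c) = - cplx c"
 by (simp add: cplx_def)

lemma cplx_central: "cplx c * x = x * cplx c"
 by (simp add: cplx_def algebra_simps J_central)

lemma adj_cplx: "adj (cplx c) = cplx (cnj c)"
 by (simp add: cplx_def adj_add adj_scaleR adj_J)

lemma norm_cplx [simp]: "norm (cplx c) = cmod c"
proof -
 have "(norm (cplx c :: 'a))\<^sup>2 = norm (cplx (cnj c * c) :: 'a)"
  using cstar[of "cplx c :: 'a"] by (simp add: adj_cplx cplx_mult)
 also have "cnj c * c = of_real ((cmod c)\<^sup>2)"
  by (metis complex_norm_square mult.commute)
 finally have "(norm (cplx c :: 'a))\<^sup>2 = (cmod c)\<^sup>2"
  by (simp only: cplx_of_real) simp
 then show ?thesis by simp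
qed

lemma norm_cplx_mult [simp]: "norm (cplx c * x) = cmod c * norm (x::'a::ucstar)"
proof -
 have "(norm (cplx c * x))\<^sup>2 = norm (adj x * (cplx (cnj c * c) * x))"
  using cstar[of "cplx c * x"] by (simp add: adj_mult adj_cplx cplx_mult mult.assoc)
 also have "cnj c * c = of_real ((cmod c)\<^sup>2)"
  by (metis complex_norm_square mult.commute)
 finally have "(norm (cplx c * x))\<^sup>2 = (cmod c)\<^sup>2 * (norm x)\<^sup>2"
  by (simp only: cplx_of_real) (simp add: cstar)
 then show ?thesis by (simp add: power_mult_distrib[symmetric])
qed

lemma bounded_linear_cplx: "bounded_linear (cplx :: complex => 'a::ucstar)"
 by (rule bounded_linear_intro[where K = 1])
  (simp_all add: cplx_add, simp add: cplx_def algebra_simps)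

lemmas continuous_on_cplx [continuous_intros] = bounded_linear.continuous_on[OF bounded_linear_cplx]

section \<open>Functional calculus for self-adjoint contractions\<close>

definition pev :: "real poly => 'a::ucstar => 'a" where
 "pev p h = fold_coeffs (%a y. a *\<^sub>R 1 + h * y) p 0"

lemma pev_0 [simp]: "pev 0 h = 0"
 by (simp add: pev_def)

lemma pev_pCons [simp]: "pev (pCons a p) h = a *\<^sub>R 1 + h * pev p h"
 by (cases "p = 0 & a = 0") (auto simp: pev_def)

lemma pev_add: "pev (p + q) h = pev p h + pev q h"
proof (induction p arbitrary: q)
 case (pCons a p)
 then show ?case by (cases q) (simp_all add: algebra_simps)
qed simp

lemma pev_smult: "pev (smult c p) h = c *\<^sub>R pev p h"
 by (induction p) (simp_all add: algebra_simps)

lemma pev_minus: "pev (- p) h = - pev p h"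
 by (induction p) simp_all

lemma pev_diff: "pev (p - q) h = pev p h - pev q h"
 using pev_add[of p "- q" h] by (simp add: pev_minus)

lemma pev_mult: "pev (p * q) h = pev p h * pev q h"
 by (induction p) (simp_all add: algebra_simps pev_add pev_smult)

lemma pev_1 [simp]: "pev 1 h = 1"
 by (simp add: one_pCons)

lemma pev_power: "pev (p ^ n) h = pev p h ^ n"
 by (induction n) (simp_all add: pev_mult)

lemma pev_monom: "pev (monom a n) h = a *\<^sub>R h ^ n"
 by (induction n) (simp_all add: monom_0 monom_Suc)

lemma pev_intertwine: "x * h = k * x ==> x * pev p h = pev p k * x"
 by (induction p) (simp_all add: algebra_simps, metis mult.assoc)

lemma pev_adj: "adj h = h ==> adj (pev p h) = pev p h"
proof (induction p)
 case (pCons a p)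
 have "h * pev p h = pev p h * h" by (rule pev_intertwine) simp
 then show ?case using pCons by (simp add: adj_add adj_scaleR adj_mult)
qed simp

lemma pev_eq_sum: "pev p h = (\<Sum>i\<le>degree p. coeff p i *\<^sub>R h ^ i)"
proof (induction p)
 case (pCons a p)
 show ?case
 proof (cases "p = 0")
  case False
  have "(\<Sum>i\<le>degree (pCons a p). coeff (pCons a p) i *\<^sub>R h ^ i)
    = a *\<^sub>R 1 + (\<Sum>i\<le>degree p. coeff p i *\<^sub>R h ^ Suc i)"
   using False by (simp add: sum.atMost_Suc_shift del: sum.atMost_Suc)
  also have "\<dots> = pev (pCons a p) h"
   using pCons by (simp add: sum_distrib_left)
  finally show ?thesis by simp
 qed simp
qed simp

text \<open>On the unit ball one constant per polynomial is enough: in Horner's scheme the inner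
  value is bounded there by \<open>M\<close>, and the Lipschitz constant grows by \<open>M\<close>
  with each coefficient. This later yields uniform continuity of the functional calculus.\<close>

lemma pev_lipschitz:
 "\<exists>L\<ge>0. \<forall>h k :: 'a::ucstar. norm h <= 1 --> norm k <= 1 --> norm (pev p h - pev p k) <= L * norm (h - k)"
proof (induction p)
 case 0
 show ?case by (intro exI[of _ 0]) simp
next
 case (pCons a p)
 then obtain L where L: "L >= 0"
  "\<And>h k :: 'a. norm h <= 1 ==> norm k <= 1 ==> norm (pev p h - pev p k) <= L * norm (h - k)"
  by blast
 define M where "M = norm (pev p (0::'a)) + L"
 have M: "norm (pev p k) <= M" if "norm k <= 1" for k :: 'a
 proof -
  have "norm (pev p k - pev p 0) <= L * norm k" using L(2)[OF that, of 0] by simp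
  also have "\<dots> <= L * 1" using that L(1) by (intro mult_left_mono) auto
  finally show ?thesis unfolding M_def
   by (smt (verit) norm_triangle_sub mult.right_neutral)
 qed
 have "M >= 0" using L(1) by (simp add: M_def)
 show ?case
 proof (intro exI[of _ "L + M"] conjI allI impI)
  fix h k :: 'a assume hk: "norm h <= 1" "norm k <= 1"
  have "pev (pCons a p) h - pev (pCons a p) k = h * (pev p h - pev p k) + (h - k) * pev p k"
   by (simp add: algebra_simps)
  also have "norm \<dots> <= norm h * norm (pev p h - pev p k) + norm (h - k) * norm (pev p k)"
   by (intro order_trans[OF norm_triangle_ineq] add_mono norm_mult_ineq)
  also have "\<dots> <= 1 * (L * norm (h - k)) + norm (h - k) * M"
   using hk L M by (intro add_mono mult_mono) auto
  finally show "norm (pev (pCons a p) h - pev (pCons a p) k) <= (L + M) * norm (h - k)"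
   by (simp add: algebra_simps)
 qed (use L \<open>M >= 0\<close> in auto)
qed

text \<open>The solution of $y = (x + y^2)/2$ satisfies $(1 - y)^2 = 1 - x$.\<close>

lemma sqrt_one_minus_exists:
 fixes x :: "'a::ucstar"
 assumes "adj x = x" "norm x < 1"
 obtains s where "adj s = s" "s * s = 1 - x" "\<And>w. w * x = x * w ==> w * s = s * w"
proof -
 define r where "r = norm x"
 define f where "f y = (1/2) *\<^sub>R (x + y * y)" for y
 \<comment> \<open>Self-adjointness and commutation with the commutant of \<open>x\<close> are
   closed conditions preserved by \<open>f\<close>, so they are built into the complete set on which
   the contraction acts.\<close>
 define S where "S = cball 0 r \<inter> {y. adj y = y} \<inter> (\<Inter>w\<in>{w. w * x = x * w}. {y. w * y = y * w})"
 have "closed {y. adj y = (y::'a)}"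
  by (intro closed_Collect_eq continuous_intros continuous_on_adj)
 moreover have "closed {y. w * y = y * w}" for w :: 'a
  by (intro closed_Collect_eq continuous_intros)
 ultimately have "closed S" unfolding S_def by auto
 then have "complete S" by (simp add: complete_eq_closed)
 have r: "0 <= r" "r < 1" using assms by (auto simp: r_def)
 have "\<exists>!y\<in>S. f y = y"
 proof (rule Banach_fix[OF \<open>complete S\<close> _ r])
  have "0 \<in> S" using r by (auto simp: S_def)
  then show "S ~= {}" by blast
  show "f ` S \<subseteq> S"
  proof clarify
   fix y assume y: "y \<in> S"
   have ny: "norm y <= r" and ay: "adj y = y" and cy: "\<And>w. w * x = x * w ==> w * y = y * w"
    using y unfolding S_def mem_cball_0[symmetric] by blast+
   have "norm (y * y) <= r * r"
    using mult_mono[OF ny ny] norm_mult_ineq[of y y] r by simp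
   then have "norm (x + y * y) <= r + r * r"
    by (intro norm_triangle_le) (simp add: r_def)
   moreover have "r * r <= r" using r by (simp add: mult_left_le)
   ultimately have 1: "norm (f y) <= r" by (simp add: f_def)
   have 2: "adj (f y) = f y"
    using ay assms by (simp add: f_def adj_add adj_scaleR adj_mult)
   have 3: "w * f y = f y * w" if w: "w * x = x * w" for w
   proof -
    have "w * y = y * w" using cy w by blast
    then have "w * (y * y) = y * y * w" by (metis mult.assoc)
    then show ?thesis using w by (simp add: f_def distrib_left distrib_right)
   qed
   show "f y \<in> S" using 1 2 3 unfolding S_def mem_cball_0[symmetric] by blast
  qed
  fix y z assume "y \<in> S" "z \<in> S"
  then have n: "norm y <= r" "norm z <= r" unfolding S_def mem_cball_0[symmetric] by blast+
  have "f y - f z = (1/2) *\<^sub>R (y * (y - z) + (y - z) * z)"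
   by (simp add: f_def algebra_simps)
  then have "norm (f y - f z) <= (1/2) * (norm y * norm (y - z) + norm (y - z) * norm z)"
   by (simp add: norm_triangle_le add_mono norm_mult_ineq)
  also have "\<dots> <= (1/2) * (r * norm (y - z) + norm (y - z) * r)"
   using n r by (intro mult_left_mono add_mono mult_mono) auto
  finally show "dist (f y) (f z) <= r * dist y z" by (simp add: dist_norm mult.commute)
 qed
 then obtain y where y: "y \<in> S" "f y = y" by blast
 have "2 *\<^sub>R f y = x + y * y" by (simp add: f_def)
 then have "(1 - y) * (1 - y) = 1 - x" using y(2) by (simp add: algebra_simps scaleR_2)
 moreover have "adj y = y" using y(1) unfolding S_def by blast
 then have "adj (1 - y) = 1 - y" by (simp add: adj_diff)
 moreover have "w * (1 - y) = (1 - y) * w" if "w * x = x * w" for w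
 proof -
  have "w * y = y * w" using y(1) that unfolding S_def by blast
  then show ?thesis by (simp add: algebra_simps)
 qed
 ultimately show ?thesis using that by blast
qed

section \<open>Norm estimate for real polynomials in a self-adjoint contraction\<close>

lemma coeff_bound_unit_circle:
 fixes Q :: "complex poly"
 assumes "\<And>z. cmod z = 1 ==> cmod (poly Q z) <= S"
 shows "cmod (coeff Q n) <= S"
proof -
 have d: "(deriv ^^ m) (poly Q) = poly ((pderiv ^^ m) Q)" for m
 proof (induction m)
  case (Suc m)
  have "deriv (poly P) = poly (pderiv P)" for P :: "complex poly"
   by (rule ext, rule DERIV_imp_deriv, rule poly_DERIV)
  then show ?case using Suc by simp
 qed simp
 have "cmod ((deriv ^^ n) (poly Q) 0) <= fact n * S / 1 ^ n"
  by (rule Cauchy_inequality) (auto intro!: holomorphic_intros continuous_intros assms)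
 moreover have "(deriv ^^ n) (poly Q) 0 = fact n * coeff Q n"
  using coeff_higher_pderiv[of n Q 0]
  by (simp add: d poly_0_coeff_0 pochhammer_fact[symmetric])
 ultimately show ?thesis by (simp add: norm_mult)
qed

text \<open>For the coefficients of a polynomial p, listed with length n, this is z^n p((z + 1/z)/2)
  with denominators cleared. On the unit circle (z + 1/z)/2 is \<open>Re z\<close>, and for a
  unitary it is the real part, so values of p on [-1,1] control the coefficients of an ordinary
  polynomial in the unitary.\<close>

fun joukowski :: "real list => real poly" where
 "joukowski [] = 0"
| "joukowski (a # as) = monom a (Suc (length as)) + [:1/2, 0, 1/2:] * joukowski as"

lemma degree_joukowski: "degree (joukowski as) <= 2 * length as"
proof (induction as)
 case (Cons a as)
 have "degree ([:1/2, 0, 1/2:] * joukowski as) <= 2 + 2 * length as"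
  using degree_mult_le[of "[:1/2, 0, 1/2::real:]" "joukowski as"] Cons by simp
 then show ?case
  by (auto intro!: degree_add_le order_trans[OF degree_monom_le])
qed simp

lemma map_poly_of_real_add:
 "map_poly (of_real :: real => complex) (p + q) = map_poly of_real p + map_poly of_real q"
 by (rule poly_eqI) (simp add: coeff_map_poly)

lemma map_poly_of_real_mult:
 "map_poly (of_real :: real => complex) (p * q) = map_poly of_real p * map_poly of_real q"
 by (rule poly_eqI) (simp add: coeff_map_poly coeff_mult)

lemma poly_joukowski:
 assumes "cmod z = 1"
 shows "poly (map_poly of_real (joukowski as)) z = z ^ length as * of_real (poly (Poly as) (Re z))"
proof (induction as)
 case (Cons a as)
 have z: "z * cnj z = 1" using assms by (simp add: complex_norm_square[symmetric])
 have "2 * (z * of_real (Re z)) = z * (z + cnj z)"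
  by (simp add: complex_add_cnj)
 then have "z * of_real (Re z) = (1 + z * z) / 2" using z by (simp add: algebra_simps)
 then have 1: "z ^ Suc (length as) * of_real (Re z * poly (Poly as) (Re z))
   = (1 + z * z) / 2 * (z ^ length as * of_real (poly (Poly as) (Re z)))"
  by (simp only: of_real_mult power_Suc) (metis (no_types, lifting) mult.assoc mult.left_commute)
 have "poly (map_poly of_real (joukowski (a # as))) z
  = of_real a * z ^ Suc (length as) + (1 + z * z) / 2 * poly (map_poly of_real (joukowski as)) z"
  by (simp add: map_poly_of_real_add map_poly_of_real_mult poly_monom map_poly_monom map_poly_pCons map_poly_smult algebra_simps add_divide_distrib)
 then show ?case using Cons 1 by (simp add: algebra_simps)
qed simp

lemma pev_joukowski:
 assumes "adj u * u = 1" "u * adj u = 1"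
 shows "pev (joukowski as) u = u ^ length as * pev (Poly as) ((1/2) *\<^sub>R (u + adj u))"
proof (induction as)
 case (Cons a as)
 let ?h = "(1/2) *\<^sub>R (u + adj u)"
 have "u * ?h = (1/2) *\<^sub>R (1 + u * u)" using assms by (simp add: algebra_simps)
 moreover have c: "u * ?h = ?h * u" using assms by (simp add: algebra_simps)
 moreover have "u ^ n * ?h = ?h * u ^ n" for n
  using c by (metis power_commuting_commutes)
 ultimately have uh: "u * ?h = (1/2) *\<^sub>R (1 + u * u)" "u ^ n * ?h = ?h * u ^ n" for n by blast+
 have "u ^ Suc (length as) * (?h * pev (Poly as) ?h) = u * (u ^ length as * ?h) * pev (Poly as) ?h"
  by (simp only: power_Suc mult.assoc)
 also have "\<dots> = (u * ?h) * (u ^ length as * pev (Poly as) ?h)"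
  by (simp only: uh(2) mult.assoc)
 finally have "u ^ Suc (length as) * (?h * pev (Poly as) ?h)
   = (1/2) *\<^sub>R (1 + u * u) * (u ^ length as * pev (Poly as) ?h)"
  by (simp only: uh(1))
 moreover have "pev (joukowski (a # as)) u
   = a *\<^sub>R u ^ Suc (length as) + (1/2) *\<^sub>R (1 + u * u) * pev (joukowski as) u"
  by (simp add: pev_add pev_monom pev_mult pev_smult algebra_simps)
 moreover have "u ^ length (a # as) * pev (Poly (a # as)) ?h
   = a *\<^sub>R u ^ Suc (length as) + u ^ Suc (length as) * (?h * pev (Poly as) ?h)"
  by (simp only: Poly.simps pev_pCons distrib_left list.size) simp
 ultimately show ?case using Cons by simp
qed simp

text \<open>Cauchy's estimate bounds every coefficient of the Joukowski polynomial by
  \<open>S\<close>, and powers of \<open>u\<close> have norm at most 1, so the norm is at most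
  \<open>S\<close> times the number of coefficients; multiplying back by a power of
  \<open>adj u\<close> costs nothing. The factor linear in the degree is removed afterwards.\<close>

lemma crude_bound:
 fixes u :: "'a::ucstar"
 assumes u: "adj u * u = 1" "u * adj u = 1"
  and p: "\<And>x. x \<in> {-1..1} ==> \<bar>poly p x\<bar> <= S"
 shows "norm (pev p ((1/2) *\<^sub>R (u + adj u))) <= (2 * real (degree p) + 3) * S"
proof -
 define as where "as = coeffs p"
 have as: "Poly as = p" by (simp add: as_def)
 have len: "length as <= degree p + 1" by (simp add: as_def length_coeffs_degree coeffs_def)
 let ?Q = "joukowski as" and ?h = "(1/2) *\<^sub>R (u + adj u)"
 have S: "S >= 0" using p[of 0] by simp
 have c: "\<bar>coeff ?Q i\<bar> <= S" for i
 proof -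
  have "cmod (coeff (map_poly of_real ?Q) i) <= S"
  proof (rule coeff_bound_unit_circle)
   fix z :: complex assume z: "cmod z = 1"
   then have "Re z \<in> {-1..1}" using abs_Re_le_cmod[of z] by auto
   then show "cmod (poly (map_poly of_real ?Q) z) <= S"
    using p z by (simp add: poly_joukowski norm_mult norm_power as)
  qed
  then show ?thesis by (simp add: coeff_map_poly)
 qed
 have nu: "norm u = 1" "norm (adj u) = 1" using u isometry_norm by auto
 have nu': "norm (u ^ i) <= 1" "norm (adj u ^ i) <= 1" for i
  using norm_power_ineq[of u i] norm_power_ineq[of "adj u" i] nu by auto
 have "norm (pev ?Q u) <= (\<Sum>i\<le>degree ?Q. S)"
  unfolding pev_eq_sum using c nu' S
  by (intro sum_norm_le) (auto intro!: mult_mono[of _ S _ 1, simplified])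
 also have "\<dots> = (real (degree ?Q) + 1) * S" by simp
 also have "\<dots> <= (2 * real (degree p) + 3) * S"
  using degree_joukowski[of as] len S by (intro mult_right_mono) auto
 finally have 1: "norm (pev ?Q u) <= (2 * real (degree p) + 3) * S" .
 have "adj u ^ n * u ^ n = 1" for n
 proof (induction n)
  case (Suc n)
  have "adj u ^ Suc n * u ^ Suc n = adj u ^ n * (adj u * u) * u ^ n"
   by (simp only: power_Suc2[of "adj u"] power_Suc[of u] mult.assoc)
  then show ?case using Suc u by simp
 qed simp
 then have "pev p ?h = adj u ^ length as * pev ?Q u"
  by (simp add: pev_joukowski[OF u] mult.assoc[symmetric] as)
 then have "norm (pev p ?h) <= 1 * norm (pev ?Q u)"
  using nu'(2)[of "length as"]
  by (simp only:) (rule order_trans[OF norm_mult_ineq], rule mult_right_mono, auto)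
 then show ?thesis using 1 by simp
qed

text \<open>If \<open>x\<close> exceeded 1, then n / x^n would tend to 0 along n = 2^k,
  contradicting the assumed bound.\<close>

lemma le_one_if_powers_linear:
 fixes x C :: real
 assumes "\<And>k. x ^ (2 ^ k) <= C * 2 ^ k"
 shows "x <= 1"
proof (rule ccontr)
 assume "\<not> x <= 1"
 then have x: "x > 1" by simp
 have "(%n. real n * inverse x ^ n) \<longlonglongrightarrow> 0"
  using x by (intro powser_times_n_limit_0) (simp add: field_simps)
 then have lim: "(%k. real (2 ^ k) * inverse x ^ (2 ^ k)) \<longlonglongrightarrow> 0"
  by (rule LIMSEQ_subseq_LIMSEQ[of _ _ "%k. 2 ^ k", unfolded o_def]) (simp add: strict_mono_def)
 have "(%k. C * (real (2 ^ k) * inverse x ^ (2 ^ k))) \<longlonglongrightarrow> C * 0"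
  by (intro tendsto_intros lim)
 moreover have "1 <= C * (real (2 ^ k) * inverse x ^ (2 ^ k))" for k
  using assms[of k] x by (simp add: power_inverse field_simps)
 ultimately have "1 <= C * 0" by (intro LIMSEQ_le_const) auto
 then show False by simp
qed

text \<open>For self-adjoint elements the norm commutes with powers 2^k. Applying the crude bound to
  \<open>p ^ (2 ^ k)\<close>, whose degree grows only linearly in the exponent, and taking roots
  removes the degree factor.\<close>

lemma pev_norm_unitary:
 fixes u :: "'a::ucstar"
 assumes u: "adj u * u = 1" "u * adj u = 1"
  and p: "\<And>x. x \<in> {-1..1} ==> \<bar>poly p x\<bar> <= S" and S: "S > 0"
 shows "norm (pev p ((1/2) *\<^sub>R (u + adj u))) <= S"
proof -
 let ?h = "(1/2) *\<^sub>R (u + adj u)"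
 have h: "adj ?h = ?h" by (simp add: adj_scaleR adj_add add.commute)
 have "(norm (pev p ?h) / S) ^ (2 ^ k) <= (2 * real (degree p) + 3) * 2 ^ k" for k
 proof -
  have "norm (pev p ?h) ^ (2 ^ k) = norm (pev (p ^ (2 ^ k)) ?h)"
   using norm_sa_power2[OF pev_adj[OF h]] by (simp add: pev_power)
  also have "\<dots> <= (2 * real (degree (p ^ (2 ^ k))) + 3) * S ^ (2 ^ k)"
   by (rule crude_bound[OF u]) (simp add: poly_power power_abs power_mono p)
  also have "\<dots> <= ((2 * real (degree p) + 3) * 2 ^ k) * S ^ (2 ^ k)"
  proof (rule mult_right_mono)
   have "real (degree (p ^ (2 ^ k))) <= real (degree p) * 2 ^ k"
    using degree_power_le[of p "2 ^ k"] by (metis of_nat_le_iff of_nat_mult of_nat_numeral of_nat_power)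
   moreover have "(3::real) <= 3 * 2 ^ k" by simp
   ultimately show "2 * real (degree (p ^ (2 ^ k))) + 3 <= (2 * real (degree p) + 3) * 2 ^ k"
    by (simp add: algebra_simps del: one_le_power)
  qed (use S in simp)
  finally show ?thesis using S by (simp add: power_divide field_simps)
 qed
 then have "norm (pev p ?h) / S <= 1" by (rule le_one_if_powers_linear)
 then show ?thesis using S by simp
qed

definition sac :: "'a::ucstar => bool" where
 "sac h \<longleftrightarrow> adj h = h & norm h <= 1"

text \<open>A self-adjoint element of norm below 1 is the real part of the unitary
  \<open>h + J * s\<close>, where \<open>s\<close> is the square root of \<open>1 - h * h\<close>
  supplied by the fixed point argument; strictness of the bound is what makes that argument a
  contraction.\<close>

lemma pev_norm_strict:
 fixes h :: "'a::ucstar"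
 assumes h: "adj h = h" "norm h < 1"
  and p: "\<And>x. x \<in> {-1..1} ==> \<bar>poly p x\<bar> <= S" and S: "S > 0"
 shows "norm (pev p h) <= S"
proof -
 have "norm (h * h) < 1"
  using h(2) norm_mult_ineq[of h h] by (smt (verit) mult_less_cancel_right2 norm_ge_zero mult_left_le)
 moreover have "adj (h * h) = h * h" by (simp add: adj_mult h)
 ultimately obtain s where s: "adj s = s" "s * s = 1 - h * h" "h * s = s * h"
  using sqrt_one_minus_exists by (metis mult.assoc)
 define u where "u = h + J * s"
 have au: "adj u = h - J * s" by (simp add: u_def adj_add adj_mult h s adj_J J_central)
 have JJ: "J * (x * (J * y)) = - (x * y)" for x y :: 'a
 proof -
  have "J * (x * (J * y)) = J * J * (x * y)" by (metis J_central mult.assoc)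
  then show ?thesis by (simp add: J_J)
 qed
 have "h * (J * s) = J * s * h" by (metis J_central s(3) mult.assoc)
 then have "adj u * u = 1" "u * adj u = 1"
  unfolding au unfolding u_def using s JJ[of s s]
  by (simp_all add: algebra_simps)
 moreover have "(1/2) *\<^sub>R (u + adj u) = h" unfolding au unfolding u_def by (simp add: scaleR_2[symmetric])
 ultimately show ?thesis using pev_norm_unitary[of u p S] p S by simp
qed

text \<open>Shrinking \<open>h\<close> by factors \<open>r n\<close> tending to 1 reduces to the
  strict case, and the Lipschitz bound controls the limit. This inequality is the substitute for
  spectral theory in what follows.\<close>

theorem pev_norm_le:
 fixes h :: "'a::ucstar"
 assumes h: "sac h" and p: "\<And>x. x \<in> {-1..1} ==> \<bar>poly p x\<bar> <= S"
 shows "norm (pev p h) <= S"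
proof (rule field_le_epsilon)
 fix e :: real assume e: "e > 0"
 define r where "r n = 1 - inverse (real (Suc n))" for n
 have r: "0 <= r n" "r n < 1" for n by (auto simp: r_def field_simps)
 have S: "S >= 0" using p[of 0] by simp
 have rl: "r \<longlonglongrightarrow> 1" unfolding r_def
  using tendsto_diff[OF tendsto_const LIMSEQ_inverse_real_of_nat, of 1] by simp
 obtain L where L: "\<forall>h k :: 'a. norm h <= 1 --> norm k <= 1 --> norm (pev p h - pev p k) <= L * norm (h - k)"
  using pev_lipschitz by blast
 have b: "norm (pev p (r n *\<^sub>R h)) <= S + e" for n
 proof (rule pev_norm_strict)
  show "norm (r n *\<^sub>R h) < 1" using r[of n] h
   by (auto simp: sac_def) (smt (verit) mult_left_le norm_ge_zero)
 qed (use h S e p in \<open>auto simp: sac_def adj_scaleR intro: order_trans[OF p]\<close>)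
 have b2: "norm (pev p h) <= S + e + L * norm (h - r n *\<^sub>R h)" for n
 proof -
  have "norm (r n *\<^sub>R h) <= 1" using r[of n] h
   by (auto simp: sac_def) (smt (verit) mult_left_le norm_ge_zero)
  then have "norm (pev p h - pev p (r n *\<^sub>R h)) <= L * norm (h - r n *\<^sub>R h)"
   using L h by (simp add: sac_def)
  then show ?thesis using b[of n] norm_triangle_sub[of "pev p h" "pev p (r n *\<^sub>R h)"] by linarith
 qed
 have "(%n. S + e + L * norm (h - r n *\<^sub>R h)) \<longlonglongrightarrow> S + e + L * norm (h - 1 *\<^sub>R h)"
  by (intro tendsto_intros rl)
 then show "norm (pev p h) <= S + e"
  using LIMSEQ_le_const[of _ _ "norm (pev p h)"] b2 by fastforce
qed

section \<open>Continuous functional calculus by uniform approximation\<close>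

lemma weierstrass_poly:
 assumes "continuous_on {-1..1::real} f" "e > 0"
 shows "\<exists>p. \<forall>x\<in>{-1..1}. \<bar>poly p x - f x\<bar> < e"
proof -
 obtain g where g: "real_polynomial_function g" "\<And>x. x \<in> {-1..1} ==> \<bar>f x - g x\<bar> < e"
  using Stone_Weierstrass_real_polynomial_function[OF compact_Icc assms] by blast
 then obtain a n where a: "g = (%x. \<Sum>i\<le>n. a i * x ^ i)"
  using real_polynomial_function_imp_sum by blast
 have "poly (\<Sum>i\<le>n. monom (a i) i) x = g x" for x
  by (simp add: a poly_sum poly_monom)
 then show ?thesis using g(2) by (metis abs_minus_commute)
qed

definition wpoly :: "(real => real) => nat => real poly" where
 "wpoly f n = (SOME p. \<forall>x\<in>{-1..1}. \<bar>poly p x - f x\<bar> < inverse (real (Suc n)))"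

lemma wpoly:
 assumes "continuous_on {-1..1} f" "x \<in> {-1..1}"
 shows "\<bar>poly (wpoly f n) x - f x\<bar> < inverse (real (Suc n))"
 using someI_ex[OF weierstrass_poly[OF assms(1), of "inverse (real (Suc n))"]] assms(2)
 unfolding wpoly_def by auto

text \<open>Functions live on the whole interval [-1,1] instead of the spectrum. Different functions
  may therefore give the same element, which \<open>fc_pos_cong\<close> makes precise for positive
  elements.\<close>

definition fc :: "(real => real) => 'a::ucstar => 'a" where
 "fc f h = lim (%n. pev (wpoly f n) h)"

lemma pev_dist_le:
 assumes "sac h" "\<And>x. x \<in> {-1..1} ==> \<bar>poly p x - poly q x\<bar> <= e"
 shows "norm (pev p h - pev q h) <= e"
 using pev_norm_le[OF assms(1), of "p - q" e] assms(2) by (simp add: pev_diff)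

lemma fc_LIMSEQ:
 assumes h: "sac (h::'a::ucstar)" and f: "continuous_on {-1..1} f"
 shows "(%n. pev (wpoly f n) h) \<longlonglongrightarrow> fc f h"
proof -
 have b: "norm (pev (wpoly f m) h - pev (wpoly f n) h) <= inverse (real (Suc m)) + inverse (real (Suc n))" for m n
 proof (rule pev_dist_le[OF h])
  fix x :: real assume x: "x \<in> {-1..1}"
  show "\<bar>poly (wpoly f m) x - poly (wpoly f n) x\<bar> <= inverse (real (Suc m)) + inverse (real (Suc n))"
   using wpoly[OF f x, of m] wpoly[OF f x, of n] by linarith
 qed
 have "Cauchy (%n. pev (wpoly f n) h)"
 proof (rule CauchyI)
  fix e :: real assume "e > 0"
  then obtain N where N: "inverse (real (Suc N)) < e / 2"
   using reals_Archimedean[of "e / 2"] by auto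
  have "norm (pev (wpoly f m) h - pev (wpoly f n) h) < e" if "m >= N" "n >= N" for m n
  proof -
   have "inverse (real (Suc m)) <= inverse (real (Suc N))" "inverse (real (Suc n)) <= inverse (real (Suc N))"
    using that by (auto intro!: le_imp_inverse_le)
   then show ?thesis using b[of m n] N by linarith
  qed
  then show "\<exists>M. \<forall>m\<ge>M. \<forall>n\<ge>M. norm (pev (wpoly f m) h - pev (wpoly f n) h) < e" by blast
 qed
 then show ?thesis unfolding fc_def by (simp add: Cauchy_convergent_iff convergent_LIMSEQ_iff)
qed

lemma fc_approx:
 assumes h: "sac (h::'a::ucstar)" and f: "continuous_on {-1..1} f"
  and p: "\<And>x. x \<in> {-1..1} ==> \<bar>poly p x - f x\<bar> <= e"
 shows "norm (pev p h - fc f h) <= e"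
proof -
 have "norm (pev p h - pev (wpoly f n) h) <= e + inverse (real (Suc n))" for n
 proof (rule pev_dist_le[OF h])
  fix x :: real assume x: "x \<in> {-1..1}"
  show "\<bar>poly p x - poly (wpoly f n) x\<bar> <= e + inverse (real (Suc n))"
   using wpoly[OF f x, of n] p[OF x] by linarith
 qed
 moreover have "(%n. norm (pev p h - pev (wpoly f n) h)) \<longlonglongrightarrow> norm (pev p h - fc f h)"
  by (intro tendsto_intros fc_LIMSEQ h f)
 moreover have "(%n. e + inverse (real (Suc n))) \<longlonglongrightarrow> e + 0"
  by (intro tendsto_intros LIMSEQ_inverse_real_of_nat)
 ultimately show ?thesis using LIMSEQ_le by fastforce
qed

lemma fc_limit:
 assumes h: "sac (h::'a::ucstar)" and f: "continuous_on {-1..1} f"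
  and p: "uniform_limit {-1..1} (%n. poly (p n)) f sequentially"
 shows "(%n. pev (p n) h) \<longlonglongrightarrow> fc f h"
proof (rule LIMSEQ_I)
 fix e :: real assume "e > 0"
 then obtain N where N: "\<And>n x. n >= N ==> x \<in> {-1..1} ==> dist (poly (p n) x) (f x) < e / 2"
  using p unfolding uniform_limit_sequentially_iff by (meson half_gt_zero)
 have "norm (pev (p n) h - fc f h) <= e / 2" if "n >= N" for n
  using N[OF that] by (intro fc_approx[OF h f]) (fastforce simp: dist_real_def)
 then show "\<exists>N. \<forall>n\<ge>N. norm (pev (p n) h - fc f h) < e"
  using \<open>e > 0\<close> by (metis field_sum_of_halves less_add_same_cancel1 half_gt_zero order_le_less_trans)
qed

lemma wpoly_uniform_limit:
 assumes f: "continuous_on {-1..1} f"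
 shows "uniform_limit {-1..1} (%n. poly (wpoly f n)) f sequentially"
proof (unfold uniform_limit_sequentially_iff, intro allI impI)
 fix e :: real assume "e > 0"
 then obtain N where N: "inverse (real (Suc N)) < e" using reals_Archimedean by blast
 have "dist (poly (wpoly f n) x) (f x) < e" if "n >= N" "x \<in> {-1..1}" for n x
 proof -
  have "inverse (real (Suc n)) <= inverse (real (Suc N))" using that by (auto intro!: le_imp_inverse_le)
  then show ?thesis using wpoly[OF f that(2), of n] N unfolding dist_real_def by linarith
 qed
 then show "\<exists>N. \<forall>n\<ge>N. \<forall>x\<in>{-1..1}. dist (poly (wpoly f n) x) (f x) < e" by blast
qed

lemma fc_add:
 assumes h: "sac h" and f: "continuous_on {-1..1} f" and g: "continuous_on {-1..1} g"
 shows "fc (%x. f x + g x) h = fc f h + fc g h"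
proof -
 have "uniform_limit {-1..1} (%n. poly (wpoly f n + wpoly g n)) (%x. f x + g x) sequentially"
  by (simp add: uniform_limit_add wpoly_uniform_limit f g poly_add[abs_def])
 then have "(%n. pev (wpoly f n + wpoly g n) h) \<longlonglongrightarrow> fc (%x. f x + g x) h"
  by (intro fc_limit h continuous_intros f g)
 moreover have "(%n. pev (wpoly f n) h + pev (wpoly g n) h) \<longlonglongrightarrow> fc f h + fc g h"
  by (intro tendsto_intros fc_LIMSEQ h f g)
 ultimately show ?thesis by (simp add: pev_add LIMSEQ_unique)
qed

lemma fc_mult:
 assumes h: "sac h" and f: "continuous_on {-1..1} f" and g: "continuous_on {-1..1} g"
 shows "fc (%x. f x * g x) h = fc f h * fc g h"
proof -
 have "bounded (f ` {-1..1})" "bounded (g ` {-1..1})"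
  using f g by (auto intro!: compact_imp_bounded compact_continuous_image)
 then have "uniform_limit {-1..1} (%n x. poly (wpoly f n) x * poly (wpoly g n) x) (%x. f x * g x) sequentially"
  by (intro bounded_bilinear.bounded_uniform_limit[OF bounded_bilinear_mult] wpoly_uniform_limit f g)
 then have "(%n. pev (wpoly f n * wpoly g n) h) \<longlonglongrightarrow> fc (%x. f x * g x) h"
  by (intro fc_limit h continuous_intros f g) (simp add: poly_mult[abs_def])
 moreover have "(%n. pev (wpoly f n) h * pev (wpoly g n) h) \<longlonglongrightarrow> fc f h * fc g h"
  by (intro tendsto_intros fc_LIMSEQ h f g)
 ultimately show ?thesis by (simp add: pev_mult LIMSEQ_unique)
qed

lemma fc_poly: "sac h ==> fc (poly p) h = pev p h"
 using fc_approx[of h "poly p" p 0] by (simp add: continuous_intros)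

lemma fc_const: "sac h ==> fc (%_. c) h = c *\<^sub>R 1"
 using fc_poly[of h "[:c:]"] by (simp add: poly_pCons[abs_def])

lemma fc_id: "sac h ==> fc (%x. x) h = h"
 using fc_poly[of h "[:0, 1:]"] by (simp add: poly_pCons[abs_def])

lemma fc_cong:
 assumes h: "sac h" and f: "continuous_on {-1..1} f" and eq: "\<And>x. x \<in> {-1..1} ==> f x = g x"
 shows "fc f h = fc g h"
proof -
 have "continuous_on {-1..1} g" using f eq continuous_on_cong by metis
 moreover have "uniform_limit {-1..1} (%n. poly (wpoly f n)) g sequentially"
  using wpoly_uniform_limit[OF f] eq by (simp add: uniform_limit_iff)
 ultimately have "(%n. pev (wpoly f n) h) \<longlonglongrightarrow> fc g h" by (rule fc_limit[OF h])
 then show ?thesis using fc_LIMSEQ[OF h f] LIMSEQ_unique by blast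
qed

lemma fc_norm:
 assumes h: "sac h" and f: "continuous_on {-1..1} f" and b: "\<And>x. x \<in> {-1..1} ==> \<bar>f x\<bar> <= c"
 shows "norm (fc f h) <= c"
proof -
 have "norm (pev (wpoly f n) h) <= c + inverse (real (Suc n))" for n
 proof (rule pev_norm_le[OF h])
  fix x :: real assume x: "x \<in> {-1..1}"
  show "\<bar>poly (wpoly f n) x\<bar> <= c + inverse (real (Suc n))"
   using wpoly[OF f x, of n] b[OF x] by linarith
 qed
 moreover have "(%n. norm (pev (wpoly f n) h)) \<longlonglongrightarrow> norm (fc f h)"
  by (intro tendsto_intros fc_LIMSEQ h f)
 moreover have "(%n. c + inverse (real (Suc n))) \<longlonglongrightarrow> c + 0"
  by (intro tendsto_intros LIMSEQ_inverse_real_of_nat)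
 ultimately show ?thesis using LIMSEQ_le by fastforce
qed

lemma fc_minus:
 assumes h: "sac h" and f: "continuous_on {-1..1} f"
 shows "fc (%x. - f x) h = - fc f h"
 using fc_mult[OF h continuous_on_const f, of "-1"] by (simp add: fc_const[OF h])

lemma fc_diff:
 assumes h: "sac h" and f: "continuous_on {-1..1} f" and g: "continuous_on {-1..1} g"
 shows "fc (%x. f x - g x) h = fc f h - fc g h"
 using fc_add[OF h f continuous_on_minus[OF g]] by (simp add: fc_minus[OF h g])

lemma fc_adj:
 assumes h: "sac h" and f: "continuous_on {-1..1} f"
 shows "adj (fc f h) = fc f h"
proof -
 have "(%n. adj (pev (wpoly f n) h)) \<longlonglongrightarrow> adj (fc f h)"
  by (intro tendsto_intros fc_LIMSEQ h f)
 moreover have "adj (pev (wpoly f n) h) = pev (wpoly f n) h" for n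
  using h by (simp add: sac_def pev_adj)
 ultimately show ?thesis using fc_LIMSEQ[OF h f] LIMSEQ_unique by simp blast
qed

lemma fc_intertwine:
 assumes h: "sac h" and k: "sac k" and f: "continuous_on {-1..1} f" and x: "x * h = k * x"
 shows "x * fc f h = fc f k * x"
proof -
 have "(%n. x * pev (wpoly f n) h) \<longlonglongrightarrow> x * fc f h"
  by (intro tendsto_intros fc_LIMSEQ h f)
 moreover have "(%n. pev (wpoly f n) k * x) \<longlonglongrightarrow> fc f k * x"
  by (intro tendsto_intros fc_LIMSEQ k f)
 ultimately show ?thesis using pev_intertwine[OF x] LIMSEQ_unique by simp
qed

lemma fc_sac:
 assumes "sac h" "continuous_on {-1..1} f" "\<And>x. x \<in> {-1..1} ==> f x \<in> {-1..1}"
 shows "sac (fc f h)"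
 unfolding sac_def using assms by (intro conjI fc_adj fc_norm) (auto simp: abs_le_iff)

text \<open>For polynomial \<open>g\<close> this is an induction on Horner's scheme, since the
  calculus is additive and multiplicative; the general case follows by uniform approximation of
  \<open>g\<close>, which stays uniform after substituting \<open>f\<close>.\<close>

lemma fc_comp:
 assumes h: "sac h" and f: "continuous_on {-1..1} f" and g: "continuous_on {-1..1} g"
  and fI: "\<And>x. x \<in> {-1..1} ==> f x \<in> {-1..1}"
 shows "fc g (fc f h) = fc (%x. g (f x)) h"
proof -
 have cf: "continuous_on {-1..1} (%x. poly p (f x))" for p by (intro continuous_intros f)
 have gf: "continuous_on {-1..1} (%x. g (f x))"
  by (rule continuous_on_compose2[OF g f]) (use fI in blast)
 have pf: "fc (%x. poly p (f x)) h = pev p (fc f h)" for p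
 proof (induction p)
  case (pCons a p)
  have "fc (%x. a + f x * poly p (f x)) h = fc (%x. a) h + fc f h * fc (%x. poly p (f x)) h"
   by (simp add: fc_add[OF h] fc_mult[OF h f cf] continuous_intros f)
  then show ?case using pCons by (simp add: fc_const[OF h])
 qed (simp add: fc_const[OF h])
 have s: "sac (fc f h)" by (rule fc_sac[OF h f fI])
 have "norm (pev (wpoly g n) (fc f h) - fc (%x. g (f x)) h) <= inverse (real (Suc n))" for n
  unfolding pf[symmetric] fc_diff[OF h cf gf, symmetric]
 proof (rule fc_norm[OF h])
  fix x :: real assume "x \<in> {-1..1}"
  then show "\<bar>poly (wpoly g n) (f x) - g (f x)\<bar> <= inverse (real (Suc n))"
   using wpoly[OF g fI] by (simp add: less_imp_le)
 qed (intro continuous_intros f gf)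
 then have "(%n. pev (wpoly g n) (fc f h) - fc (%x. g (f x)) h) \<longlonglongrightarrow> 0"
  by (rule Lim_null_comparison[OF always_eventually LIMSEQ_inverse_real_of_nat, rule_format])
 then have "(%n. pev (wpoly g n) (fc f h)) \<longlonglongrightarrow> fc (%x. g (f x)) h"
  by (simp add: LIM_zero_iff)
 then show ?thesis using fc_LIMSEQ[OF s g] LIMSEQ_unique by blast
qed

text \<open>A polynomial within e/3 of \<open>f\<close> reduces the claim to its Lipschitz constant
  on the unit ball, which does not depend on the elements.\<close>

lemma fc_ucont:
 assumes f: "continuous_on {-1..1} f" and e: "e > 0"
 shows "\<exists>d>0. \<forall>h k :: 'a::ucstar. sac h --> sac k --> norm (h - k) < d --> norm (fc f h - fc f k) < e"
proof -
 obtain p where p: "\<forall>x\<in>{-1..1}. \<bar>poly p x - f x\<bar> < e / 3"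
  using weierstrass_poly[OF f, of "e / 3"] e by auto
 obtain L where L: "L >= 0"
  "\<And>h k :: 'a. norm h <= 1 ==> norm k <= 1 ==> norm (pev p h - pev p k) <= L * norm (h - k)"
  using pev_lipschitz by blast
 show ?thesis
 proof (intro exI[of _ "e / (3 * (L + 1))"] conjI allI impI)
  fix h k :: 'a assume hk: "sac h" "sac k" "norm (h - k) < e / (3 * (L + 1))"
  have ap: "norm (pev p h - fc f h) <= e / 3" if "sac h" for h :: 'a
   using p by (intro fc_approx[OF that f]) (simp add: less_imp_le)
  have "norm (pev p h - pev p k) <= L * norm (h - k)" using L hk by (simp add: sac_def)
  also have "\<dots> <= (L + 1) * norm (h - k)" by (simp add: algebra_simps)
  also have "\<dots> < e / 3" using hk(3) L(1) by (simp add: field_simps)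
  finally have "norm (pev p h - pev p k) < e / 3" .
  moreover have "norm (fc f h - fc f k) <= norm (pev p h - fc f h) + norm (pev p h - pev p k) + norm (pev p k - fc f k)"
   by norm
  ultimately show "norm (fc f h - fc f k) < e" using ap[OF hk(1)] ap[OF hk(2)] by linarith
 qed (use e L in auto)
qed

section \<open>Positive elements\<close>

text \<open>Squares of self-adjoint elements are what the functional calculus produces; closure
  under sums and positivity of \<open>adj x * x\<close> then have to be proved.\<close>

definition pos :: "'a::ucstar => bool" where
 "pos x \<longleftrightarrow> (\<exists>k. adj k = k & x = k * k)"

lemma norm_mult_le_one:
 "norm x <= 1 ==> norm y <= 1 ==> norm (x * y) <= (1::real)" for x y :: "'a::ucstar"
 by (rule order_trans[OF norm_mult_ineq]) (simp add: mult_le_one)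

lemma pos_adj: "pos x ==> adj x = x"
 by (auto simp: pos_def adj_mult)

lemma fc_pos:
 assumes "sac h" "continuous_on {-1..1} f" "\<And>x. x \<in> {-1..1} ==> f x >= 0"
 shows "pos (fc f h)"
proof -
 have c: "continuous_on {-1..1} (%x. sqrt (f x))" by (intro continuous_intros assms)
 have "fc f h = fc (%x. sqrt (f x) * sqrt (f x)) h"
  using assms by (intro fc_cong) auto
 then show ?thesis unfolding pos_def using fc_mult[OF assms(1) c c] fc_adj[OF assms(1) c] by metis
qed

text \<open>Writing \<open>x = k * k\<close>, both sides become functions of \<open>k\<close>
  obtained by substituting \<open>t * t\<close>, and this square runs through [0,1] only.\<close>

lemma fc_pos_cong:
 assumes x: "pos x" "norm x <= 1" and f: "continuous_on {-1..1} f" and g: "continuous_on {-1..1} g"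
  and eq: "\<And>t. t \<in> {0..1} ==> f t = g t"
 shows "fc f x = fc g x"
proof -
 obtain k where k: "adj k = k" "x = k * k" using x by (auto simp: pos_def)
 have "norm k <= 1"
  using norm_sa_square[OF k(1)] x(2) k(2) by (simp add: power2_le_iff_abs_le abs_square_le_1)
 then have sk: "sac k" using k by (simp add: sac_def)
 have xk: "x = fc (%t. t * t) k"
  using fc_mult[OF sk continuous_on_id continuous_on_id] by (simp add: fc_id[OF sk] k)
 have I: "t * t \<in> {0..1}" if "t \<in> {-1..1}" for t :: real
  using that abs_square_le_1[of t] by (auto simp: power2_eq_square)
 have I': "t * t \<in> {-1..1}" if "t \<in> {-1..1}" for t :: real
  using I[OF that] by (meson atLeastAtMost_iff order_trans neg_le_0_iff_le zero_le_one)
 have c: "continuous_on {-1..1} (%t. t * t :: real)" by (intro continuous_intros)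
 have e: "fc F (fc (%t. t * t) k) = fc (%t. F (t * t)) k" if "continuous_on {-1..1} F" for F
  by (rule fc_comp[OF sk c that]) (rule I')
 show ?thesis unfolding xk e[OF f] e[OF g]
  by (rule fc_cong[OF sk continuous_on_compose2[OF f c]]) (use I I' eq in auto)
qed

text \<open>A metric criterion for positivity. The condition on the right is convex, which is how
  sums of positive elements are seen to be positive.\<close>

lemma pos_iff_norm:
 assumes x: "sac x"
 shows "pos x \<longleftrightarrow> norm (1 - x) <= 1"
proof
 assume p: "pos x"
 have "1 - x = fc (%t. 1 - t) x"
  using fc_diff[OF x continuous_on_const continuous_on_id] by (simp add: fc_id fc_const x)
 also have "\<dots> = fc (%t. 1 - max t 0) x"
  by (rule fc_pos_cong[OF p]) (use x in \<open>auto simp: sac_def intro!: continuous_intros\<close>)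
 finally show "norm (1 - x) <= 1"
  by (simp only:) (rule fc_norm[OF x], auto intro!: continuous_intros)
next
 assume n: "norm (1 - x) <= 1"
 then have s: "sac (1 - x)" using x by (simp add: sac_def adj_diff)
 have "x = fc (%t. 1 - t) (1 - x)"
  using fc_diff[OF s continuous_on_const continuous_on_id] by (simp add: fc_id fc_const s)
 moreover have "pos (fc (%t. 1 - t) (1 - x))"
  by (rule fc_pos[OF s]) (auto intro!: continuous_intros)
 ultimately show "pos x" by simp
qed

lemma pos_scaleR: "pos x ==> r >= 0 ==> pos (r *\<^sub>R x)"
 unfolding pos_def by (metis adj_scaleR mult_scaleR_left mult_scaleR_right real_sqrt_mult_self abs_of_nonneg scaleR_scaleR)

lemma pos_add:
 assumes x: "pos x" and y: "pos y"
 shows "pos (x + y)"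
proof -
 define r where "r = norm x + norm y + 1"
 have r: "r > 0" by (simp add: r_def add_nonneg_pos)
 define a b where "a = (1/r) *\<^sub>R x" and "b = (1/r) *\<^sub>R y"
 have n: "norm a <= 1" "norm b <= 1" "norm ((1/2) *\<^sub>R (a + b)) <= 1"
 proof -
  show ab: "norm a <= 1" "norm b <= 1" using r by (auto simp: a_def b_def r_def field_simps)
  show "norm ((1/2) *\<^sub>R (a + b)) <= 1" using norm_triangle_ineq[of a b] ab by simp
 qed
 have "pos a" "pos b" unfolding a_def b_def using x y r by (auto intro!: pos_scaleR)
 then have s: "sac a" "sac b" using n by (auto simp: sac_def pos_adj)
 then have "norm (1 - a) <= 1" "norm (1 - b) <= 1"
  using \<open>pos a\<close> \<open>pos b\<close> by (auto simp: pos_iff_norm)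
 moreover have "1 - (1/2) *\<^sub>R (a + b) = (1/2) *\<^sub>R ((1 - a) + (1 - b))"
  by (simp add: algebra_simps flip: scaleR_2)
 ultimately have "norm (1 - (1/2) *\<^sub>R (a + b)) <= 1"
  using norm_triangle_ineq[of "1 - a" "1 - b"] by simp
 moreover have "sac ((1/2) *\<^sub>R (a + b))" using n s by (simp add: sac_def adj_scaleR adj_add)
 ultimately have "pos ((1/2) *\<^sub>R (a + b))" by (simp only: pos_iff_norm)
 then have "pos ((2 * r) *\<^sub>R ((1/2) *\<^sub>R (a + b)))" by (rule pos_scaleR) (use r in simp)
 moreover have "(2 * r) *\<^sub>R ((1/2) *\<^sub>R (a + b)) = x + y" using r by (simp add: a_def b_def algebra_simps)
 ultimately show ?thesis by simp
qed

lemma pos_sq: "adj k = k ==> pos (k * k)"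
 by (auto simp: pos_def)

text \<open>A self-adjoint \<open>adj y * y\<close> that is negative vanishes, because it has the same functional
 calculus, up to intertwining by \<open>y\<close>, as the positive \<open>y * adj y\<close>.\<close>

lemma neg_adj_mult_eq_0:
 assumes neg: "pos (- (adj y * y))" and y: "norm y <= 1"
 shows "y = 0"
proof -
 let ?K = "y * adj y" and ?L = "adj y * y"
 define c d where "c = (1/2) *\<^sub>R (y + adj y)" and "d = (1/2) *\<^sub>R (J * (adj y - y))"
 have c: "adj c = c" by (simp add: c_def adj_scaleR adj_add add.commute)
 have d: "adj d = d"
  by (simp add: d_def adj_scaleR adj_mult adj_diff adj_J J_central algebra_simps)
 have "(J * m) * (J * m) = - (m * m)" for m :: 'a
  by (metis J_J J_central mult.assoc mult_minus1)
 then have dd: "d * d = - (1/4) *\<^sub>R ((adj y - y) * (adj y - y))"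
  by (simp add: d_def)
 \<comment> \<open>Here \<open>c\<close> and \<open>d\<close> are the real and imaginary parts of
   \<open>y\<close>, so \<open>y * adj y + adj y * y\<close> is twice the sum of their squares;
   together with positivity of \<open>- (adj y * y)\<close> this makes \<open>y * adj y\<close>
   positive.\<close>
 have "?K = 2 *\<^sub>R (c * c) + 2 *\<^sub>R (d * d) + (- ?L)"
  unfolding dd by (simp add: c_def algebra_simps flip: scaleR_add_left)
 then have pK: "pos ?K"
  using neg by (metis pos_add pos_scaleR pos_sq c d zero_le_numeral)
 have nK: "norm ?K <= 1" "norm ?L <= 1"
  using y by (auto intro!: norm_mult_le_one)
 have sK: "sac ?K" and sL: "sac ?L" and sM: "sac (- ?L)" using nK by (auto simp: sac_def adj_mult)
 let ?g = "%t::real. min t 0"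
 have cg: "continuous_on {-1..1} ?g" by (intro continuous_intros)
 have "fc ?g ?K = fc (%_. 0) ?K"
  by (rule fc_pos_cong[OF pK nK(1) cg]) (auto intro!: continuous_intros)
 then have K0: "fc ?g ?K = 0" by (simp add: fc_const sK)
 have mL: "?L = fc (%t. - t) (- ?L)"
  using fc_minus[OF sM continuous_on_id] by (simp add: fc_id sM)
 have "fc ?g ?L = fc (%t. ?g (- t)) (- ?L)"
  by (subst mL, rule fc_comp[OF sM _ cg]) (auto intro!: continuous_intros)
 also have "\<dots> = fc (%t. - t) (- ?L)"
  by (rule fc_pos_cong[OF neg]) (use nK in \<open>auto intro!: continuous_intros\<close>)
 finally have L: "fc ?g ?L = ?L" using mL by simp
 have "y * fc ?g ?L = fc ?g ?K * y"
  by (rule fc_intertwine[OF sL sK cg]) (simp add: mult.assoc)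
 then have "y * ?L = 0" using K0 L by simp
 then have "?L * ?L = 0" by (simp add: mult.assoc)
 then have "?L = 0" using norm_sa_square[of ?L] by (simp add: adj_mult)
 then show "y = 0" by (rule adj_mult_eq_0)
qed

text \<open>Compress by the negative part \<open>n\<close> of \<open>adj x * x\<close>: for
  \<open>y = x * n\<close> the element \<open>adj y * y = n * (adj x * x) * n\<close> is negative,
  so \<open>y = 0\<close> by the previous lemma. This forces \<open>n = 0\<close>, so that
  \<open>adj x * x\<close> equals its positive part.\<close>

theorem pos_adj_mult: "pos (adj x * x)"
proof -
 have main: "pos (adj x * x)" if x: "norm x <= 1" for x :: 'a
 proof -
  let ?H = "adj x * x"
  have s: "sac ?H" using x by (auto simp: sac_def adj_mult intro!: norm_mult_le_one)
  let ?f = "%t::real. max (- t) 0"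
  have cf: "continuous_on {-1..1} ?f" by (intro continuous_intros)
  define n where "n = fc ?f ?H"
  have an: "adj n = n" unfolding n_def by (rule fc_adj[OF s cf])
  have nn: "norm n <= 1" unfolding n_def by (rule fc_norm[OF s cf]) auto
  define y where "y = x * n"
  have ny: "norm y <= 1" unfolding y_def
   using x nn by (rule norm_mult_le_one)
  have "adj y * y = n * ?H * n" by (simp add: y_def adj_mult an mult.assoc)
  also have "\<dots> = fc (%t. ?f t * t * ?f t) ?H"
   unfolding n_def
   by (simp add: fc_mult[OF s] fc_id[OF s] cf continuous_intros)
  finally have "- (adj y * y) = fc (%t. - (?f t * t * ?f t)) ?H"
   by (subst fc_minus[OF s]) (auto intro!: continuous_intros)
  moreover have "pos (fc (%t. - (?f t * t * ?f t)) ?H)"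
  proof (rule fc_pos[OF s])
   show "continuous_on {-1..1} (%t. - (?f t * t * ?f t))" by (intro continuous_intros)
   show "- (?f t * t * ?f t) >= 0" for t :: real
    by (cases "t >= 0") (auto simp: max_def mult_le_0_iff)
  qed
  ultimately have "pos (- (adj y * y))" by simp
  then have "y = 0" using ny by (rule neg_adj_mult_eq_0)
  then have "n * ?H * n = 0" by (simp add: y_def mult.assoc)
  then have z: "fc (%t. ?f t * t * ?f t) ?H = 0"
   unfolding n_def by (simp add: fc_mult[OF s] fc_id[OF s] cf continuous_intros)
  have "(n * n) * (n * n) = fc (%t. (?f t * ?f t) * (?f t * ?f t)) ?H"
   unfolding n_def by (simp add: fc_mult[OF s] cf continuous_intros)
  \<comment> \<open>Where the negative part function is nonzero it equals -t, so its fourth power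
    contains the vanishing product as a factor.\<close>
  also have "\<dots> = fc (%t. - ((?f t * t * ?f t) * ?f t)) ?H"
   by (rule fc_cong[OF s], intro continuous_intros) (auto simp: max_def)
  also have "\<dots> = - (fc (%t. ?f t * t * ?f t) ?H * n)"
   unfolding n_def by (subst fc_minus[OF s]) (auto intro!: continuous_intros simp: fc_mult[OF s] cf continuous_intros)
  finally have "(n * n) * (n * n) = 0" by (simp add: z)
  then have "n * n = 0" using norm_sa_square[of "n * n"] by (simp add: adj_mult an)
  then have "n = 0" using norm_sa_square[of n] an by simp
  have "fc (%t. max t 0) ?H = fc (%t. t + ?f t) ?H"
   by (rule fc_cong[OF s]) (auto intro!: continuous_intros)
  also have "\<dots> = ?H + n" unfolding n_def by (simp add: fc_add[OF s] fc_id[OF s] cf continuous_intros)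
  finally have "fc (%t. max t 0) ?H = ?H" using \<open>n = 0\<close> by simp
  moreover have "pos (fc (%t. max t 0) ?H)"
   by (rule fc_pos[OF s]) (auto intro!: continuous_intros)
  ultimately show ?thesis by simp
 qed
 define r where "r = norm x + 1"
 have r: "r > 0" by (simp add: r_def add_nonneg_pos)
 have "norm ((1/r) *\<^sub>R x) <= 1" using r by (simp add: r_def field_simps)
 then have "pos (r\<^sup>2 *\<^sub>R (adj ((1/r) *\<^sub>R x) * ((1/r) *\<^sub>R x)))" by (intro pos_scaleR main) auto
 then show ?thesis using r by (simp add: adj_scaleR power2_eq_square)
qed

lemma pos_mult_adj: "pos (x * adj x)"
 using pos_adj_mult[of "adj x"] by simp

text \<open>\<open>adj q * q\<close> exhibits the negative of \<open>adj p * p\<close> as positive,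
  so the vanishing criterion applies. This is what makes annihilators hereditary.\<close>

lemma pos_zero_sum:
 assumes "adj p * p + adj q * q = (0 :: 'a::ucstar)"
 shows "p = 0"
proof -
 define r where "r = norm p + 1"
 have r: "r > 0" by (simp add: r_def add_nonneg_pos)
 let ?y = "(1/r) *\<^sub>R p"
 have "- (adj p * p) = adj q * q" using assms by (simp add: eq_neg_iff_add_eq_0 neg_eq_iff_add_eq_0)
 then have "pos ((1/r\<^sup>2) *\<^sub>R (- (adj p * p)))" by (intro pos_scaleR) (simp_all add: pos_adj_mult)
 then have "pos (- (adj ?y * ?y))" by (simp add: adj_scaleR power2_eq_square)
 moreover have "norm ?y <= 1" using r by (simp add: r_def field_simps)
 ultimately have "?y = 0" by (rule neg_adj_mult_eq_0)
 then show ?thesis using r by simp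
qed

section \<open>Functional calculus of positive contractions on [0,1]\<close>

definition pc :: "'a::ucstar => bool" where
 "pc h \<longleftrightarrow> pos h & norm h <= 1"

text \<open>Composing with \<open>max t 0\<close> extends a function on [0,1] by a constant to the
  left, so that continuity on [0,1] is all that has to be checked.\<close>

definition fcal :: "(real => real) => 'a::ucstar => 'a" where
 "fcal f h = fc (%t. f (max t 0)) h"

lemma pc_sac: "pc h ==> sac h"
 by (simp add: pc_def sac_def pos_adj)

lemma pc_adj_mult: "norm x <= 1 ==> pc (adj x * x)"
 by (simp add: pc_def pos_adj_mult norm_mult_le_one)

lemma pc_mult_adj: "norm x <= 1 ==> pc (x * adj x)"
 by (simp add: pc_def pos_mult_adj norm_mult_le_one)

lemma continuous_on_max0:
 fixes f :: "real => real"
 shows "continuous_on {0..1} f ==> continuous_on {-1..1} (%t. f (max t 0))"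
 by (rule continuous_on_compose2[where t = "{0..1}" and g = f]) (auto intro!: continuous_intros)

lemma fcal_add:
 "pc h ==> continuous_on {0..1} f ==> continuous_on {0..1} g ==> fcal (%t. f t + g t) h = fcal f h + fcal g h"
 unfolding fcal_def by (intro fc_add continuous_on_max0 pc_sac)

lemma fcal_diff:
 "pc h ==> continuous_on {0..1} f ==> continuous_on {0..1} g ==> fcal (%t. f t - g t) h = fcal f h - fcal g h"
 unfolding fcal_def by (intro fc_diff continuous_on_max0 pc_sac)

lemma fcal_mult:
 "pc h ==> continuous_on {0..1} f ==> continuous_on {0..1} g ==> fcal (%t. f t * g t) h = fcal f h * fcal g h"
 unfolding fcal_def by (intro fc_mult continuous_on_max0 pc_sac)

lemma fcal_const: "pc h ==> fcal (%_. c) h = c *\<^sub>R 1"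
 unfolding fcal_def by (intro fc_const pc_sac)

lemma fcal_cong:
 assumes "pc h" "continuous_on {0..1} f" "\<And>t. t \<in> {0..1} ==> f t = g t"
 shows "fcal f h = fcal g h"
 unfolding fcal_def using assms by (intro fc_cong continuous_on_max0 pc_sac) auto

lemma fcal_id: "pc h ==> fcal (%t. t) h = h"
proof -
 assume h: "pc h"
 have "fc (%t. max t 0) h = fc (%t. t) h"
  by (rule fc_pos_cong) (use h in \<open>auto simp: pc_def intro!: continuous_intros\<close>)
 then show ?thesis by (simp add: fcal_def fc_id pc_sac h)
qed

lemma fcal_norm:
 assumes "pc h" "continuous_on {0..1} f" "\<And>t. t \<in> {0..1} ==> \<bar>f t\<bar> <= c"
 shows "norm (fcal f h) <= c"
 unfolding fcal_def using assms by (intro fc_norm continuous_on_max0 pc_sac) auto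

lemma fcal_adj: "pc h ==> continuous_on {0..1} f ==> adj (fcal f h) = fcal f h"
 unfolding fcal_def by (intro fc_adj continuous_on_max0 pc_sac)

lemma fcal_intertwine:
 "pc h ==> pc k ==> continuous_on {0..1} f ==> x * h = k * x ==> x * fcal f h = fcal f k * x"
 unfolding fcal_def by (intro fc_intertwine continuous_on_max0 pc_sac)

lemma fcal_commute:
 "pc h ==> continuous_on {0..1} f ==> continuous_on {0..1} g ==> fcal f h * fcal g h = fcal g h * fcal f h"
 by (simp only: fcal_mult[symmetric] mult.commute)

lemma fcal_pos:
 assumes "pc h" "continuous_on {0..1} f" "\<And>t. t \<in> {0..1} ==> f t >= 0"
 shows "pos (fcal f h)"
 unfolding fcal_def using assms by (intro fc_pos continuous_on_max0 pc_sac) auto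

lemma fcal_pc:
 assumes "pc h" "continuous_on {0..1} f" "\<And>t. t \<in> {0..1} ==> f t \<in> {0..1}"
 shows "pc (fcal f h)"
 unfolding pc_def using assms by (intro conjI fcal_pos fcal_norm) auto

lemma fcal_comp:
 assumes h: "pc h" and f: "continuous_on {0..1} f" and g: "continuous_on {0..1} g"
  and fI: "\<And>t. t \<in> {0..1} ==> f t \<in> {0..1}"
 shows "fcal g (fcal f h) = fcal (%t. g (f t)) h"
proof -
 have fI': "f (max t 0) \<in> {0..1}" if "t \<in> {-1..1}" for t using that by (intro fI) auto
 have "fcal g (fcal f h) = fc (%t. g (max (f (max t 0)) 0)) h"
  unfolding fcal_def using fI'
  by (intro fc_comp[of h "%t. f (max t 0)" "%t. g (max t 0)"] continuous_on_max0 f g pc_sac h) fastforce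
 also have "\<dots> = fcal (%t. g (f t)) h" unfolding fcal_def
 proof (rule fc_cong)
  show "continuous_on {-1..1} (%t. g (max (f (max t 0)) 0))"
   using fI' by (intro continuous_on_compose2[OF continuous_on_max0[OF g] continuous_on_max0[OF f]]) fastforce
 qed (use h fI' in \<open>auto simp: pc_sac max_absorb1\<close>)
 finally show ?thesis .
qed

lemma fcal_ucont:
 assumes f: "continuous_on {0..1} f" and e: "e > 0"
 shows "\<exists>d>0. \<forall>h k :: 'a::ucstar. pc h --> pc k --> norm (h - k) < d --> norm (fcal f h - fcal f k) < e"
 using fc_ucont[OF continuous_on_max0[OF f] e, where 'a = 'a] unfolding fcal_def by (meson pc_sac)

lemma continuous_on_fcal:
 fixes g :: "'b::topological_space => 'a::ucstar"
 assumes f: "continuous_on {0..1} f" and g: "continuous_on D g" "\<And>x. x \<in> D ==> pc (g x)"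
 shows "continuous_on D (%x. fcal f (g x))"
proof -
 have "continuous_on {h::'a. pc h} (fcal f)"
  unfolding continuous_on_iff dist_norm using fcal_ucont[OF f, where 'a = 'a] by (metis mem_Collect_eq)
 then show ?thesis by (rule continuous_on_compose2[OF _ g(1)]) (use g(2) in auto)
qed

lemma pc_scalar: "0 <= c ==> c <= 1 ==> pc (c *\<^sub>R 1)"
 unfolding pc_def using pos_scaleR[of 1 c] pos_sq[of 1] by simp

lemma fcal_scalar:
 assumes "0 <= c" "c <= 1" "continuous_on {0..1} f"
 shows "fcal f (c *\<^sub>R 1) = f c *\<^sub>R 1"
proof -
 have p: "pc (0 :: 'a)" using pc_scalar[of 0] by simp
 have "fcal (%_. c) (0 :: 'a) = c *\<^sub>R 1" by (rule fcal_const[OF p])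
 moreover have "fcal f (fcal (%_. c) (0 :: 'a)) = fcal (%_. f c) 0"
  by (rule fcal_comp[OF p]) (use assms in \<open>auto intro!: continuous_intros\<close>)
 ultimately show ?thesis by (simp add: fcal_const[OF p])
qed

text \<open>The equation for \<open>v\<close> says that \<open>v\<close> intertwines the scalar
  \<open>c\<close> with \<open>h\<close>, so the intertwining rule applies.\<close>

lemma fcal_eigen:
 assumes "pc h" "0 <= c" "c <= 1" "continuous_on {0..1} f" "h * v = c *\<^sub>R v"
 shows "fcal f h * v = f c *\<^sub>R v"
proof -
 have "v * fcal f (c *\<^sub>R 1) = fcal f h * v"
  by (rule fcal_intertwine[OF pc_scalar[OF assms(2,3)] assms(1,4)]) (simp add: assms(5))
 then show ?thesis using fcal_scalar[OF assms(2,3,4), where 'a = 'a] by simp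
qed

section \<open>Invertible and unitary elements of a C*-subalgebra\<close>

definition GL :: "'a::ucstar set => 'a set" where
 "GL S = {x \<in> S. \<exists>y\<in>S. x * y = 1 & y * x = 1}"

definition UG :: "'a::ucstar set => 'a set" where
 "UG S = {u \<in> S. adj u * u = 1 & u * adj u = 1}"

definition minv :: "'a::ucstar => 'a" where
 "minv x = (THE y. x * y = 1 & y * x = 1)"

definition GLdense :: "'a::ucstar set => bool" where
 "GLdense S \<longleftrightarrow> (\<forall>x\<in>S. \<forall>e>0. \<exists>y\<in>GL S. norm (x - y) < e)"

lemma minv_eq: "x * y = 1 ==> y * x = 1 ==> minv x = y"
 unfolding minv_def by (rule the_equality) (blast, metis mult.assoc mult_1_left mult_1_right)

lemma minv:
 assumes "x \<in> GL S"
 shows "x * minv x = 1" "minv x * x = 1" "minv x \<in> S" "minv x \<in> GL S"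
 using assms minv_eq unfolding GL_def by fastforce+

lemma GL_subset: "GL S \<subseteq> S" by (auto simp: GL_def)

lemma UG_D: assumes "u \<in> UG S" shows "u \<in> S" "adj u * u = 1" "u * adj u = 1" "norm u = 1"
 using assms isometry_norm[of u] by (auto simp: UG_def)

lemma minv_dist:
 fixes a b x y :: "'a::ucstar"
 assumes x: "x * a = 1" "a * x = 1" and y: "y * b = 1" "b * y = 1" and d: "norm (x - y) * norm a <= 1/2"
 shows "norm (b - a) <= 2 * norm a * norm a * norm (x - y)"
proof -
 have "b * (x - y) * a = b * (x * a) - (b * y) * a" by (simp only: right_diff_distrib left_diff_distrib mult.assoc)
 then have eq: "b - a = b * (x - y) * a" using x y by simp
 have 1: "norm (b - a) <= norm b * (norm (x - y) * norm a)"
  unfolding eq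
  by (rule order_trans[OF norm_mult_ineq], simp only: mult.assoc[symmetric])
   (rule mult_right_mono[OF norm_mult_ineq], simp)
 also have "\<dots> <= norm b * (1/2)" using d by (rule mult_left_mono) simp
 finally have b: "norm b <= 2 * norm a" using norm_triangle_sub[of b a] by simp
 have "norm b * (norm (x - y) * norm a) <= 2 * norm a * (norm (x - y) * norm a)"
  using b by (rule mult_right_mono) simp
 then show ?thesis using 1 by (simp add: ac_simps)
qed

lemma continuous_on_minv:
 fixes g :: "'b::topological_space => 'a::ucstar"
 assumes "continuous_on D g" "\<And>t. t \<in> D ==> g t \<in> GL S"
 shows "continuous_on D (%t. minv (g t))"
proof -
 have "continuous_on (GL S) minv"
  unfolding continuous_on_iff dist_norm
 proof (intro ballI allI impI)
  fix x :: 'a and e :: real assume x: "x \<in> GL S" and e: "e > 0"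
  let ?a = "minv x"
  define c where "c = norm ?a + 1"
  have c: "c > 0" "norm ?a <= c" by (auto simp: c_def add_nonneg_pos)
  define d where "d = min (1 / (2 * c)) (e / (4 * c * c))"
  have d: "d > 0" using c e by (simp add: d_def)
  have "norm (minv y - ?a) < e" if y: "y \<in> GL S" "norm (y - x) < d" for y
  proof -
   have "norm (x - y) * norm ?a <= d * c"
    using y(2) c d by (intro mult_mono) (auto simp: norm_minus_commute)
   also have "\<dots> <= 1 / (2 * c) * c" using c by (intro mult_right_mono) (auto simp: d_def)
   finally have "norm (x - y) * norm ?a <= 1/2" using c by simp
   then have "norm (minv y - ?a) <= 2 * norm ?a * norm ?a * norm (x - y)"
    by (rule minv_dist[OF minv(1,2)[OF x] minv(1,2)[OF y(1)]])
   also have "\<dots> <= 2 * c * c * d"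
    using y(2) c d by (intro mult_mono) (auto simp: norm_minus_commute)
   also have "\<dots> <= 2 * c * c * (e / (4 * c * c))" using c by (intro mult_left_mono) (auto simp: d_def)
   also have "\<dots> < e" using c e by simp
   finally show ?thesis .
  qed
  then show "\<exists>d>0. \<forall>x'\<in>GL S. norm (x' - x) < d --> norm (minv x' - minv x) < e" using d by blast
 qed
 then show ?thesis by (rule continuous_on_compose2[OF _ assms(1)]) (use assms(2) in auto)
qed

text \<open>The absolute value of \<open>z\<close>. The bound \<open>r\<close> on the norm of
  \<open>z\<close> scales \<open>adj z * z\<close> into the domain of the calculus; keeping it as a
  parameter allows one \<open>r\<close> to serve along a whole path.\<close>

definition mabs :: "real => 'a::ucstar => 'a" where
 "mabs r z = r *\<^sub>R fcal sqrt ((1/r\<^sup>2) *\<^sub>R (adj z * z))"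

lemma pc_scaled:
 assumes "norm z <= r" "r > 0"
 shows "pc ((1/r\<^sup>2) *\<^sub>R (adj z * z))"
proof -
 have "norm ((1/r) *\<^sub>R z) <= 1" using assms by (simp add: field_simps)
 from pc_adj_mult[OF this] show ?thesis by (simp add: adj_scaleR power2_eq_square)
qed

lemma csqrt01: "continuous_on {0..1} sqrt" by (intro continuous_intros)

lemma fcal_sqrt_sq: "pc h ==> fcal sqrt h * fcal sqrt h = h"
proof -
 assume h: "pc h"
 have "fcal sqrt h * fcal sqrt h = fcal (%t. sqrt t * sqrt t) h" by (simp only: fcal_mult[OF h csqrt01 csqrt01])
 also have "\<dots> = fcal (%t. t) h" by (rule fcal_cong[OF h]) (auto intro!: continuous_intros)
 finally show ?thesis by (simp add: fcal_id h)
qed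

lemma mabs_sq: "norm z <= r ==> r > 0 ==> mabs r z * mabs r z = adj z * z"
 unfolding mabs_def mult_scaleR_left mult_scaleR_right fcal_sqrt_sq[OF pc_scaled]
 by (simp add: power2_eq_square)

lemma mabs_adj: "norm z <= r ==> r > 0 ==> adj (mabs r z) = mabs r z"
 by (simp add: mabs_def adj_scaleR fcal_adj[OF _ csqrt01] pc_scaled)

lemma mabs_eigen:
 assumes "norm z <= r" "r >= 1" "adj z * z * v = v"
 shows "mabs r z * v = v"
proof -
 have "((1/r\<^sup>2) *\<^sub>R (adj z * z)) * v = (1/r\<^sup>2) *\<^sub>R v" using assms by simp
 then have "fcal sqrt ((1/r\<^sup>2) *\<^sub>R (adj z * z)) * v = sqrt (1/r\<^sup>2) *\<^sub>R v"
  using assms by (intro fcal_eigen pc_scaled csqrt01) (auto simp: field_simps)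
 then show ?thesis using assms by (simp add: mabs_def real_sqrt_divide)
qed

section \<open>Inversion, perturbation and polar decomposition inside a closed unital
  *-subalgebra\<close>

locale csub =
 fixes S :: "'a::ucstar set"
 assumes closed_S: "closed S" and one_S: "1 \<in> S" and J_S: "J \<in> S"
  and add_S: "x \<in> S ==> y \<in> S ==> x + y \<in> S"
  and mult_S: "x \<in> S ==> y \<in> S ==> x * y \<in> S"
  and scaleR_S: "x \<in> S ==> r *\<^sub>R x \<in> S"
  and adj_S: "x \<in> S ==> adj x \<in> S"
begin

lemma zero_S: "0 \<in> S" using scaleR_S[OF one_S, of 0] by simp
lemma minus_S: "x \<in> S ==> - x \<in> S" using scaleR_S[of x "-1"] by simp
lemma diff_S: "x \<in> S ==> y \<in> S ==> x - y \<in> S" using add_S[OF _ minus_S] by force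
lemma cplx_S: "cplx c \<in> S" unfolding cplx_def by (intro add_S scaleR_S one_S J_S)
lemma sum_S: "(\<And>i. i \<in> I ==> f i \<in> S) ==> sum f I \<in> S"
 by (induction I rule: infinite_finite_induct) (auto intro: zero_S add_S)

lemma pev_S: "h \<in> S ==> pev p h \<in> S"
 by (induction p) (auto intro: zero_S add_S scaleR_S one_S mult_S)

lemma fc_S: "h \<in> S ==> sac h ==> continuous_on {-1..1} f ==> fc f h \<in> S"
 using closed_sequentially[OF closed_S _ fc_LIMSEQ] pev_S by blast

lemma fcal_S: "h \<in> S ==> pc h ==> continuous_on {0..1} f ==> fcal f h \<in> S"
 unfolding fcal_def by (intro fc_S continuous_on_max0 pc_sac)

lemmas in_S = zero_S one_S add_S mult_S scaleR_S adj_S minus_S diff_S cplx_S fcal_S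

lemma mabs_S: "z \<in> S ==> norm z <= r ==> r > 0 ==> mabs r z \<in> S"
 unfolding mabs_def by (intro in_S pc_scaled csqrt01)

lemma GL_mult: "x \<in> GL S ==> y \<in> GL S ==> x * y \<in> GL S"
proof -
 assume "x \<in> GL S" "y \<in> GL S"
 then obtain a b where ab: "x \<in> S" "y \<in> S" "a \<in> S" "b \<in> S" "x * a = 1" "a * x = 1" "y * b = 1" "b * y = 1"
  by (auto simp: GL_def)
 have "x * y * (b * a) = x * (y * b) * a" "b * a * (x * y) = b * (a * x) * y" by (simp_all only: mult.assoc)
 then have "x * y * (b * a) = 1" "b * a * (x * y) = 1" using ab by simp_all
 then show ?thesis using ab by (auto simp: GL_def intro!: mult_S bexI[of _ "b * a"])
qed

lemma GL_one: "1 \<in> GL S" using one_S by (auto simp: GL_def)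

lemma GL_cplx: "c ~= 0 ==> cplx c \<in> GL S"
 unfolding GL_def using cplx_S[of c] cplx_S[of "1/c"] by (auto simp: cplx_mult[symmetric] intro!: bexI[of _ "cplx (1/c)"])

lemma UG_GL: "u \<in> UG S ==> u \<in> GL S"
 unfolding UG_def GL_def using adj_S by blast

lemma UG_mult: "u \<in> UG S ==> v \<in> UG S ==> u * v \<in> UG S"
proof -
 assume u: "u \<in> UG S" and v: "v \<in> UG S"
 have "adj (u * v) * (u * v) = adj v * (adj u * u) * v" "u * v * adj (u * v) = u * (v * adj v) * adj u"
  by (simp_all only: adj_mult mult.assoc)
 then show ?thesis using u v by (simp add: UG_def mult_S)
qed

lemma UG_adj: "u \<in> UG S ==> adj u \<in> UG S"
 by (auto simp: UG_def adj_S)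

lemma UG_one: "1 \<in> UG S" by (simp add: UG_def one_S)

lemma GL_near_one: assumes x: "x \<in> S" "norm (1 - x) < 1" shows "x \<in> GL S"
proof -
 let ?y = "%n. (1 - x) ^ n"
 have s: "summable ?y" by (rule complete_algebra_summable_geometric[OF x(2)])
 have p: "?y n \<in> S" for n by (induction n) (auto intro: in_S x)
 have "(\<Sum>i<n. ?y i) \<in> S" for n by (intro sum_S p)
 then have yS: "suminf ?y \<in> S"
  using closed_sequentially[OF closed_S _ summable_LIMSEQ[OF s]] by blast
 have z: "?y \<longlonglongrightarrow> 0" by (rule summable_LIMSEQ_zero[OF s])
 have pc: "?y n * x = x * ?y n" for n by (rule power_commuting_commutes) (simp add: algebra_simps)
 have 1: "x * (\<Sum>i<n. ?y i) = 1 - ?y n" "(\<Sum>i<n. ?y i) * x = 1 - ?y n" for n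
  by (induction n) (simp_all add: algebra_simps pc)
 have "(%n. x * (\<Sum>i<n. ?y i)) \<longlonglongrightarrow> x * suminf ?y" "(%n. (\<Sum>i<n. ?y i) * x) \<longlonglongrightarrow> suminf ?y * x"
  by (intro tendsto_intros summable_LIMSEQ[OF s])+
 moreover have "(%n. 1 - ?y n) \<longlonglongrightarrow> 1 - 0" by (intro tendsto_intros z)
 ultimately have "x * suminf ?y = 1" "suminf ?y * x = 1"
  unfolding 1 using LIMSEQ_unique by fastforce+
 then show ?thesis using x yS by (auto simp: GL_def)
qed

lemma GL_near:
 assumes x: "x \<in> GL S" and y: "y \<in> S" and d: "norm (x - y) * norm (minv x) < 1"
 shows "y \<in> GL S"
proof -
 have "1 - minv x * y = minv x * (x - y)" using minv(2)[OF x] by (simp add: algebra_simps)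
 then have "norm (1 - minv x * y) < 1"
  using norm_mult_ineq[of "minv x" "x - y"] d by (simp add: mult.commute)
 then have "minv x * y \<in> GL S" by (intro GL_near_one mult_S minv(3)[OF x] y)
 then have "x * (minv x * y) \<in> GL S" by (rule GL_mult[OF x])
 then show ?thesis using minv(1)[OF x] by (simp add: mult.assoc[symmetric])
qed

lemma polar:
 assumes z: "z \<in> GL S" and r: "norm z <= r" "r > 0"
 shows "mabs r z \<in> GL S" "z * minv (mabs r z) \<in> UG S" "z = (z * minv (mabs r z)) * mabs r z"
proof -
 let ?m = "mabs r z"
 have zS: "z \<in> S" using z GL_subset by blast
 have m: "?m \<in> S" "adj ?m = ?m" "?m * ?m = adj z * z"
  using mabs_S[OF zS r] mabs_adj[OF r] mabs_sq[OF r] by auto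
 \<comment> \<open>\<open>i\<close> inverts \<open>adj z * z\<close>, the square of the absolute
   value, so \<open>?m * i\<close> inverts the absolute value itself.\<close>
 define i where "i = minv z * adj (minv z)"
 have iS: "i \<in> S" unfolding i_def by (intro in_S minv(3)[OF z])
 have a1: "adj (minv z) * adj z = 1" "adj z * adj (minv z) = 1"
  using minv(1,2)[OF z] by (metis adj_mult adj_1)+
 have "adj z * z * i = adj z * (z * minv z) * adj (minv z)" "i * (adj z * z) = minv z * (adj (minv z) * adj z) * z"
  by (simp_all only: i_def mult.assoc)
 then have i: "adj z * z * i = 1" "i * (adj z * z) = 1" using a1 minv(1,2)[OF z] by simp_all
 have l: "?m * (?m * i) = 1" using i(1) by (simp add: m(3)[symmetric] mult.assoc)
 have rr: "(i * ?m) * ?m = 1" using i(2) by (simp add: m(3)[symmetric] mult.assoc)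
 have "i * ?m = i * ?m * (?m * (?m * i))" using l by simp
 also have "\<dots> = ((i * ?m) * ?m) * (?m * i)" by (simp only: mult.assoc)
 finally have "i * ?m = ?m * i" using rr by simp
 then show g: "?m \<in> GL S" unfolding GL_def using m l rr iS by (auto intro!: bexI[of _ "?m * i"] in_S)
 let ?n = "minv ?m"
 have n: "?m * ?n = 1" "?n * ?m = 1" by (rule minv[OF g])+
 have "adj ?n = ?n"
  using minv_eq[of ?m "adj ?n"] n m(2) by (metis adj_mult adj_1)
 then have "adj (z * ?n) * (z * ?n) = ?n * (adj z * z) * ?n" by (simp add: adj_mult mult.assoc)
 also have "\<dots> = (?n * ?m) * (?m * ?n)" by (simp add: m(3)[symmetric] mult.assoc)
 finally have u: "adj (z * ?n) * (z * ?n) = 1" using n by simp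
 have "z * ?n \<in> GL S" by (intro GL_mult z minv(4)[OF g])
 then have "z * ?n * minv (z * ?n) = 1" by (rule minv)
 then have "(adj (z * ?n) * (z * ?n)) * minv (z * ?n) = adj (z * ?n)" by (simp add: mult.assoc)
 then have "minv (z * ?n) = adj (z * ?n)" using u by simp
 then have "z * ?n * adj (z * ?n) = 1" using \<open>z * ?n * minv (z * ?n) = 1\<close> by simp
 then show "z * ?n \<in> UG S" unfolding UG_def using u by (auto intro!: in_S zS minv(3)[OF g])
 show "z = (z * ?n) * ?m" using n by (simp add: mult.assoc)
qed

lemma pos_plus_GL:
 assumes "h \<in> S" "pos h" "s > 0"
 shows "h + s *\<^sub>R 1 \<in> GL S"
proof -
 define r where "r = norm h + 1"
 have r: "r > 0" by (simp add: r_def add_nonneg_pos)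
 define k where "k = (1/r) *\<^sub>R h"
 have k: "pc k" unfolding k_def pc_def using assms r by (auto simp: r_def field_simps intro!: pos_scaleR)
 have kS: "k \<in> S" unfolding k_def by (intro in_S assms)
 define s' where "s' = s / r"
 have s': "s' > 0" using assms r by (simp add: s'_def)
 let ?g = "%t. 1 / (t + s')"
 have cg: "continuous_on {0..1} ?g" using s' by (intro continuous_intros) auto
 have ci: "continuous_on {0..1} (%t. t + s')" by (intro continuous_intros)
 have e: "k + s' *\<^sub>R 1 = fcal (%t. t + s') k"
  using fcal_add[OF k continuous_on_id continuous_on_const] by (simp add: fcal_id fcal_const k)
 have "(k + s' *\<^sub>R 1) * fcal ?g k = fcal (%t. (t + s') * ?g t) k" "fcal ?g k * (k + s' *\<^sub>R 1) = fcal (%t. ?g t * (t + s')) k"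
  unfolding e by (simp_all only: fcal_mult[OF k ci cg] fcal_mult[OF k cg ci])
 moreover have "fcal (%t. (t + s') * ?g t) k = fcal (%t. 1) k" "fcal (%t. ?g t * (t + s')) k = fcal (%t. 1) k"
  using s' by (auto intro!: fcal_cong[OF k, symmetric] continuous_intros)
 ultimately have "(k + s' *\<^sub>R 1) * fcal ?g k = 1" "fcal ?g k * (k + s' *\<^sub>R 1) = 1" by (simp_all add: fcal_const k)
 then have "k + s' *\<^sub>R 1 \<in> GL S" unfolding GL_def using fcal_S[OF kS k cg] by (auto intro!: in_S kS)
 then have "cplx (of_real r) * (k + s' *\<^sub>R 1) \<in> GL S" using r by (intro GL_mult GL_cplx) auto
 then show ?thesis using r by (simp only: cplx_of_real) (simp add: k_def s'_def algebra_simps)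
qed

text \<open>Replace the path by its unitary parts. One radius \<open>r\<close> bounding the compact
  path makes the absolute value continuous along it, and at the two unitary ends the absolute value
  is 1.\<close>

lemma UG_path_component:
 assumes p: "path_component (GL S) x y" and x: "x \<in> UG S" and y: "y \<in> UG S"
 shows "path_component (UG S) x y"
proof -
 obtain g where g: "path g" "path_image g \<subseteq> GL S" "pathstart g = x" "pathfinish g = y"
  using p by (auto simp: path_component_def)
 have "bounded (path_image g)" using g(1) by (simp add: bounded_path_image)
 then obtain r where r: "r > 0" "\<And>z. z \<in> path_image g ==> norm z <= r" by (auto simp: bounded_pos)
 have gi: "g t \<in> GL S" "norm (g t) <= r" if "t \<in> {0..1}" for t
  using g(2) r(2) that by (auto simp: path_image_def)
 define q where "q t = g t * minv (mabs r (g t))" for t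
 have cg: "continuous_on {0..1} g" using g(1) by (simp add: path_def)
 have "continuous_on {0..1} (%t. mabs r (g t))" unfolding mabs_def
  by (intro continuous_intros continuous_on_fcal csqrt01 continuous_on_adj cg pc_scaled gi r)
 then have "continuous_on {0..1} q" unfolding q_def
  by (intro continuous_intros cg continuous_on_minv[where S = S]) (use polar(1) gi r in blast)+
 then have "path q" by (simp add: path_def)
 moreover have "path_image q \<subseteq> UG S" using polar(2)[OF gi r(1)] by (auto simp: path_image_def q_def)
 moreover have un: "z * minv (mabs r z) = z" if z: "z \<in> UG S" "norm z <= r" for z
 proof -
  have "norm z = 1" using UG_D(4)[OF z(1)] .
  then have "r >= 1" using z(2) by simp
  then have "mabs r z * 1 = 1" by (intro mabs_eigen z(2)) (simp_all add: UG_D(2)[OF z(1)])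
  then show ?thesis using minv_eq[of "1::'a" 1] by simp
 qed
 have "q 0 = x" "q 1 = y"
  using un[of x] un[of y] gi(2)[of 0] gi(2)[of 1] x y g(3,4) by (auto simp: q_def pathstart_def pathfinish_def)
 ultimately show ?thesis unfolding path_component_def
  by (intro exI[of _ q]) (auto simp: pathstart_def pathfinish_def)
qed

text \<open>The unitary part \<open>w\<close> of an invertible element near \<open>a\<close> serves,
  because the square root is uniformly continuous and so the two absolute values are close.\<close>

lemma approx_polar:
 assumes d: "GLdense S" and a: "a \<in> S" "norm a <= 1" and e: "e > 0"
 obtains w where "w \<in> UG S" "norm (a - w * mabs 1 a) <= e"
proof -
 obtain d where d0: "d > 0" and dd: "\<And>h k :: 'a. pc h ==> pc k ==> norm (h - k) < d ==> norm (fcal sqrt h - fcal sqrt k) < e / 2"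
  using fcal_ucont[OF csqrt01, of "e / 2", where 'a = 'a] e by (auto simp: half_gt_zero)
 \<comment> \<open>Rescaling the approximant into the unit ball doubles its distance to at most
   \<open>2 * c\<close>, which is at most e/2; the absolute squares then differ by at most
   \<open>4 * c\<close>, which is below \<open>d\<close>.\<close>
 define c where "c = min (e / 4) (d / 5)"
 have c: "c > 0" "c <= e / 4" "c < d / 4" using e d0 by (auto simp: c_def min_def)
 obtain y where y: "y \<in> GL S" "norm (a - y) < c" using d a c by (auto simp: GLdense_def)
 have ny: "norm y <= 1 + c" using norm_triangle_sub[of y a] y a by (simp add: norm_minus_commute)
 define y' where "y' = (1 / (1 + c)) *\<^sub>R y"
 have "y' = cplx (of_real (1 / (1 + c))) * y" by (simp only: cplx_of_real) (simp add: y'_def)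
 then have y'G: "y' \<in> GL S" using y c by (auto intro!: GL_mult GL_cplx simp del: of_real_divide)
 have ny': "norm y' <= 1" using ny c by (simp add: y'_def field_simps)
 have "norm (y - y') = (c / (1 + c)) * norm y"
 proof -
  have "c / (1 + c) = 1 - 1 / (1 + c)" using c by (simp add: field_simps)
  then have "y - y' = (c / (1 + c)) *\<^sub>R y" by (simp only: y'_def scaleR_left_diff_distrib scaleR_one)
  then show ?thesis using c by simp
 qed
 also have "\<dots> <= (c / (1 + c)) * (1 + c)" using ny c by (intro mult_left_mono) auto
 also have "\<dots> = c" using c by simp
 finally have ay: "norm (a - y') < 2 * c" using norm_triangle_ineq[of "a - y" "y - y'"] y by simp
 have "adj y' * y' - adj a * a = adj y' * (y' - a) + adj (y' - a) * a" by (simp add: algebra_simps adj_diff)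
 also have "norm \<dots> <= norm (adj y') * norm (y' - a) + norm (adj (y' - a)) * norm a"
  by (intro order_trans[OF norm_triangle_ineq] add_mono norm_mult_ineq)
 also have "\<dots> <= 1 * (2 * c) + (2 * c) * 1"
  using ny' ay a c(1) by (intro add_mono mult_mono) (auto simp: norm_minus_commute)
 also have "\<dots> < d" using c by simp
 finally have m: "norm (mabs 1 y' - mabs 1 a) < e / 2"
  using dd[of "adj y' * y'" "adj a * a"] ny' a by (simp add: mabs_def pc_adj_mult)
 define w where "w = y' * minv (mabs 1 y')"
 have w: "w \<in> UG S" "y' = w * mabs 1 y'" unfolding w_def using polar[OF y'G ny'] by auto
 have "a - w * mabs 1 a = (a - y') + w * (mabs 1 y' - mabs 1 a)"
  using w(2) by (simp add: algebra_simps)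
 also have "norm \<dots> <= norm (a - y') + norm w * norm (mabs 1 y' - mabs 1 a)"
  by (intro order_trans[OF norm_triangle_ineq] add_mono norm_mult_ineq order_refl)
 also have "\<dots> <= e / 2 + 1 * (e / 2)"
  using ay c m UG_D(4)[OF w(1)] by (intro add_mono mult_mono) auto
 finally show ?thesis using that[OF w(1)] by simp
qed

end

section \<open>Unitary extensions of approximate polar decompositions\<close>

definition ramp :: "real => real => real => real" where
 "ramp a b t = max 0 (min 1 ((t - a) / (b - a)))"

lemma ramp_cont: "a < b ==> continuous_on A (ramp a b)"
 unfolding ramp_def by (intro continuous_intros) auto

lemma ramp_01: "ramp a b t \<in> {0..1}" "0 <= ramp a b t" "ramp a b t <= 1"
 by (auto simp: ramp_def)

lemma ramp_0: "a < b ==> t <= a ==> ramp a b t = 0"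
 using divide_nonpos_pos[of "t - a" "b - a"] unfolding ramp_def by linarith

lemma ramp_1: "a < b ==> b <= t ==> ramp a b t = 1"
 unfolding ramp_def by (simp add: min_def max_def field_simps)

definition isq :: "real => real => real" where
 "isq e t = 1 / sqrt (max t e)"

lemma isq_cont: "e > 0 ==> continuous_on A (isq e)"
 unfolding isq_def by (intro continuous_intros) auto

lemma isq_pos: "e > 0 ==> isq e t > 0" by (simp add: isq_def)

lemma isq_le: "e > 0 ==> isq e t <= 1 / sqrt e"
 unfolding isq_def by (intro divide_left_mono) auto

lemma sqrt_isq: "e > 0 ==> e <= t ==> sqrt t * isq e t = 1"
 by (simp add: isq_def max_def)

lemma isq_isq: "e > 0 ==> isq e t * t * isq e t = t / max t e"
 by (simp add: isq_def)

text \<open>A bounded substitute for the partial isometry of the polar decomposition: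
  \<open>x\<close> times a truncated inverse of its absolute value. It is isometric where
  \<open>adj x * x\<close> exceeds \<open>e\<close> and tapers off below.\<close>

definition cut :: "real => 'a::ucstar => 'a" where
 "cut e x = x * fcal (isq e) (adj x * x)"

lemma cut_facts:
 fixes x :: "'a::ucstar"
 assumes x: "norm x <= 1" and e: "e > 0"
 defines "H \<equiv> adj x * x" and "K \<equiv> x * adj x"
 shows cut_adj_mult: "adj (cut e x) * cut e x = fcal (%t. t / max t e) H"
  and cut_mult_adj: "cut e x * adj (cut e x) = fcal (%t. t / max t e) K"
  and cut_norm: "norm (cut e x) <= 1"
  and cut_mabs: "mabs 1 (cut e x) = fcal (%t. sqrt t * isq e t) H"
  and cut_intertwine: "continuous_on {0..1} f ==> cut e x * fcal f H = fcal f K * cut e x"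
proof -
 let ?k = "isq e"
 have H: "pc H" and K: "pc K" unfolding H_def K_def using x by (auto intro: pc_adj_mult pc_mult_adj)
 have k: "continuous_on {0..1} ?k" by (rule isq_cont[OF e])
 have i: "continuous_on {0..1} (%t::real. t)" by (rule continuous_on_id)
 have xH: "x * H = K * x" by (simp add: H_def K_def mult.assoc)
 have xf: "x * fcal f H = fcal f K * x" if "continuous_on {0..1} f" for f
  by (rule fcal_intertwine[OF H K that xH])
 have a: "cut e x = x * fcal ?k H" by (simp add: cut_def H_def)
 have a': "cut e x = fcal ?k K * x" using a xf[OF k] by simp
 have iq: "(%t. ?k t * t * ?k t) = (%t. t / max t e)" using isq_isq[OF e] by auto
 have "adj (cut e x) * cut e x = fcal ?k H * H * fcal ?k H"
  unfolding a by (simp only: adj_mult fcal_adj[OF H k]) (simp only: H_def mult.assoc)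
 also have "\<dots> = fcal (%t. ?k t * t * ?k t) H"
  by (simp add: fcal_mult[OF H] fcal_id[OF H] k i continuous_intros)
 finally show 1: "adj (cut e x) * cut e x = fcal (%t. t / max t e) H" unfolding iq .
 have "cut e x * adj (cut e x) = fcal ?k K * K * fcal ?k K"
  unfolding a' by (simp only: adj_mult fcal_adj[OF K k]) (simp only: K_def mult.assoc)
 also have "\<dots> = fcal (%t. ?k t * t * ?k t) K"
  by (simp add: fcal_mult[OF K] fcal_id[OF K] k i continuous_intros)
 finally show "cut e x * adj (cut e x) = fcal (%t. t / max t e) K" unfolding iq .
 have c: "continuous_on {0..1} (%t. t / max t e)" using e by (intro continuous_intros) auto
 have I: "t / max t e \<in> {0..1}" if "t \<in> {0..1}" for t using that e by (auto simp: divide_le_eq max_def)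
 have "norm (adj (cut e x) * cut e x) <= 1" unfolding 1 by (rule fcal_norm[OF H c]) (use I in fastforce)
 then show "norm (cut e x) <= 1" unfolding cstar by (simp add: power2_le_iff_abs_le abs_square_le_1)
 have "mabs 1 (cut e x) = fcal (%t. sqrt (t / max t e)) H"
  unfolding mabs_def 1 by (simp, rule fcal_comp[OF H c csqrt01 I])
 also have "\<dots> = fcal (%t. sqrt t * ?k t) H"
  by (rule fcal_cong[OF H]) (use e in \<open>auto simp: isq_def real_sqrt_divide intro!: continuous_intros\<close>)
 finally show "mabs 1 (cut e x) = fcal (%t. sqrt t * isq e t) H" .
 assume f: "continuous_on {0..1} f"
 have "cut e x * fcal f H = x * (fcal f H * fcal ?k H)"
  unfolding a mult.assoc fcal_commute[OF H k f] ..
 also have "\<dots> = fcal f K * cut e x" by (simp only: mult.assoc[symmetric] xf[OF f] a)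
 finally show "cut e x * fcal f H = fcal f K * cut e x" .
qed

text \<open>For \<open>h = adj z * z / 4\<close> this is the identity 1 - 2 sqrt t = (1 - 4 t) / (1
  + 2 sqrt t), whose denominator is at least 1. The radius 2 leaves room for \<open>z\<close> that
  are slightly longer than a unitary.\<close>

lemma mabs2_dist:
 assumes z: "norm z <= 2"
 shows "norm (1 - mabs 2 z) <= norm (1 - adj z * z)"
proof -
 define h where "h = (1/2\<^sup>2) *\<^sub>R (adj z * z)"
 have h: "pc h" unfolding h_def using z by (intro pc_scaled) auto
 let ?g = "%t. 1 / (1 + 2 * sqrt t)"
 have g: "continuous_on {0..1} ?g"
  by (intro continuous_intros) (auto simp: add_nonneg_eq_0_iff)
 have c4: "continuous_on {0..1} (%t::real. 1 - 4 * t)" by (intro continuous_intros)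
 have c2: "continuous_on {0..1} (%t::real. 1 - 2 * sqrt t)" by (intro continuous_intros)
 have "1 - mabs 2 z = fcal (%t. 1 - 2 * sqrt t) h"
  unfolding mabs_def h_def[symmetric]
  using fcal_diff[OF h continuous_on_const, of "%t. 2 * sqrt t" 1] fcal_mult[OF h continuous_on_const csqrt01, of 2]
  by (simp add: fcal_const[OF h] continuous_intros)
 also have "\<dots> = fcal (%t. ?g t * (1 - 4 * t)) h"
 proof (rule fcal_cong[OF h c2])
  fix t :: real assume "t \<in> {0..1}"
  then have t: "t >= 0" by simp
  then have "1 + 2 * sqrt t > 0" by (simp add: add_pos_nonneg)
  moreover have "(1 - 2 * sqrt t) * (1 + 2 * sqrt t) = 1 - 4 * t" using t by (simp add: algebra_simps)
  ultimately show "1 - 2 * sqrt t = ?g t * (1 - 4 * t)" by (simp add: field_simps)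
 qed
 also have "\<dots> = fcal ?g h * fcal (%t. 1 - 4 * t) h" by (rule fcal_mult[OF h g c4])
 also have "fcal (%t. 1 - 4 * t) h = 1 - adj z * z"
  using fcal_diff[OF h continuous_on_const, of "%t. 4 * t" 1] fcal_mult[OF h continuous_on_const continuous_on_id, of 4]
  by (simp add: fcal_const[OF h] fcal_id[OF h] continuous_intros) (simp add: h_def)
 finally have "norm (1 - mabs 2 z) <= norm (fcal ?g h) * norm (1 - adj z * z)" by (simp add: norm_mult_ineq)
 also have "\<dots> <= 1 * norm (1 - adj z * z)"
 proof (intro mult_right_mono fcal_norm[OF h g])
  fix t :: real assume "t \<in> {0..1}"
  then have "1 + 2 * sqrt t >= 1" by simp
  moreover have "\<bar>1 / y\<bar> <= 1" if "y >= 1" for y :: real using that by simp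
  ultimately show "\<bar>?g t\<bar> <= 1" by blast
 qed simp
 finally show ?thesis by simp
qed

lemma norm_mult3: "norm (x * y) <= norm y" if "norm (x::'a::ucstar) <= 1"
 by (rule order_trans[OF norm_mult_ineq]) (use that in \<open>simp add: mult_left_le_one_le\<close>)

lemma norm_mult3': "norm (x * y) <= norm x" if "norm (y::'a::ucstar) <= 1"
 by (rule order_trans[OF norm_mult_ineq]) (use that in \<open>simp add: mult_left_le\<close>)

text \<open>The element \<open>z = a * F1 + Q1s * w * F1s\<close> below interpolates between \<open>a\<close> and \<open>w\<close>; it agrees with
 \<open>a\<close> on \<open>F0\<close>, and so does its unitary part.\<close>

lemma (in csub) unitary_extension:
 assumes e: "e > 0" and zeta: "\<zeta> > 0"
 shows "\<exists>\<eta>>0. \<forall>x\<in>S. \<forall>w\<in>UG S. norm x <= 1 --> norm (cut e x - w * mabs 1 (cut e x)) <= \<eta> -->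
  (\<exists>u\<in>UG S. norm (u - w) <= \<zeta> \<and>
   u * fcal (ramp (2*e) (3*e)) (adj x * x) = cut e x * fcal (ramp (2*e) (3*e)) (adj x * x) \<and>
   fcal (ramp (2*e) (3*e)) (x * adj x) * u = cut e x * fcal (ramp (2*e) (3*e)) (adj x * x))"
proof -
 let ?s = "%t::real. sqrt (1 - t)"
 have cs: "continuous_on {0..1} ?s" by (intro continuous_intros)
 \<comment> \<open>\<open>z\<close> will be within \<open>\<kappa>\<close> of \<open>w\<close> and
   \<open>u\<close> within \<open>3 * \<kappa>\<close> of \<open>z\<close>, whence the quarter of
   \<open>\<zeta>\<close>; the bound 1/8 keeps \<open>z\<close> invertible and of norm at most
   2.\<close>
 define \<kappa> where "\<kappa> = min (\<zeta> / 4) (1 / 8)"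
 have \<kappa>: "\<kappa> > 0" "\<kappa> <= \<zeta> / 4" "\<kappa> <= 1 / 8" using zeta by (auto simp: \<kappa>_def)
 obtain d where d: "d > 0" and dd: "\<And>h k :: 'a. pc h ==> pc k ==> norm (h - k) < d ==> norm (fcal ?s h - fcal ?s k) < \<kappa> / 2"
  using fcal_ucont[OF cs, of "\<kappa> / 2", where 'a = 'a] \<kappa> by (auto simp: half_gt_zero)
 define \<eta> where "\<eta> = min (\<kappa> / 2) (d / 4)"
 have \<eta>: "\<eta> > 0" "\<eta> <= \<kappa> / 2" "2 * \<eta> < d" using \<kappa> d by (auto simp: \<eta>_def min_def)
 show ?thesis
 proof (intro exI[of _ \<eta>] conjI ballI impI)
  fix x w assume xS: "x \<in> S" and w: "w \<in> UG S" and x: "norm x <= 1"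
   and aw: "norm (cut e x - w * mabs 1 (cut e x)) <= \<eta>"
  define H K a m where "H = adj x * x" and "K = x * adj x" and "a = cut e x" and "m = mabs 1 (cut e x)"
  have H: "pc H" and K: "pc K" unfolding H_def K_def using x by (auto intro: pc_adj_mult pc_mult_adj)
  have HS: "H \<in> S" and KS: "K \<in> S" unfolding H_def K_def by (intro in_S xS)+
  let ?f1 = "ramp e (2*e)" and ?f0 = "ramp (2*e) (3*e)"
  let ?s1 = "%t. sqrt (1 - ?f1 t)"
  have c1: "continuous_on {0..1} ?f1" and c0: "continuous_on {0..1} ?f0" using e by (auto intro!: ramp_cont)
  have c1s: "continuous_on {0..1} ?s1" by (intro continuous_intros c1)
  define F1 F0 F1s Q1 Q0 Q1s where "F1 = fcal ?f1 H" and "F0 = fcal ?f0 H" and "F1s = fcal ?s1 H"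
   and "Q1 = fcal ?f1 K" and "Q0 = fcal ?f0 K" and "Q1s = fcal ?s1 K"
  have aS: "a \<in> S" unfolding a_def cut_def by (intro in_S xS isq_cont e HS[unfolded H_def] H[unfolded H_def])
  have FS: "F1 \<in> S" "F0 \<in> S" "F1s \<in> S" "Q1s \<in> S"
   unfolding F1_def F0_def F1s_def Q1s_def by (intro fcal_S HS KS H K c1 c0 c1s)+
  have na: "norm a <= 1" unfolding a_def by (rule cut_norm[OF x e])
  have nF: "norm F1 <= 1" "norm F0 <= 1" "norm F1s <= 1" "norm Q1s <= 1"
   unfolding F1_def F0_def F1s_def Q1s_def
   using ramp_01[of e "2*e"] ramp_01[of "2*e" "3*e"]
   by (auto intro!: fcal_norm H K c1 c0 c1s simp: abs_le_iff)
  have pF: "pc F1" "pc Q1" unfolding F1_def Q1_def using ramp_01(1) by (auto intro!: fcal_pc H K c1)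
  have sF: "adj F1 = F1" "adj F0 = F0" "adj F1s = F1s" "adj Q1s = Q1s" "adj Q0 = Q0"
   unfolding F1_def F0_def F1s_def Q1s_def Q0_def by (intro fcal_adj H K c1 c0 c1s)+
  have comp: "fcal ?s F1 = F1s" "fcal ?s Q1 = Q1s" unfolding F1_def Q1_def F1s_def Q1s_def
   using ramp_01(1) by (intro fcal_comp H K c1 cs; blast)+
  have ai: "a * F1 = Q1 * a" "a * F0 = Q0 * a"
   unfolding a_def F1_def Q1_def F0_def Q0_def H_def K_def by (intro cut_intertwine x e c1 c0)+
  have cm: "continuous_on {0..1} (%t. sqrt t * isq e t)" by (intro continuous_intros isq_cont e)
  have meq: "m = fcal (%t. sqrt t * isq e t) H" unfolding m_def H_def by (rule cut_mabs[OF x e])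
  have m1: "sqrt t * isq e t * ?f1 t = ?f1 t" "?f1 t * (sqrt t * isq e t) = ?f1 t" for t
   using sqrt_isq[OF e, of t] ramp_0[of e "2*e" t] e by (cases "t <= e"; simp)+
  have mF: "m * F1 = F1" "F1 * m = F1"
   unfolding meq F1_def fcal_mult[OF H cm c1, symmetric] fcal_mult[OF H c1 cm, symmetric] m1 by simp_all
  have cq: "continuous_on {0..1} (%t. t / max t e)" using e by (intro continuous_intros) auto
  have qq: "?f1 t * (t / max t e) = ?f1 t" for t
   using ramp_0[of e "2*e" t] e by (cases "t <= e") (simp_all add: max_def)
  have qq0: "t / max t e * ?f0 t = ?f0 t" for t
   using ramp_0[of "2*e" "3*e" t] e by (cases "t <= e") (simp_all add: max_def)
  have Qa: "Q1 * (a * adj a) = Q1"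
   unfolding a_def cut_mult_adj[OF x e] K_def[symmetric] Q1_def fcal_mult[OF K c1 cq, symmetric] qq ..
  have aF0: "adj a * a * F0 = F0"
   unfolding a_def cut_adj_mult[OF x e] H_def[symmetric] F0_def fcal_mult[OF H cq c0, symmetric] qq0 ..
  have am: "adj m = m" unfolding meq by (rule fcal_adj[OF H cm])
  have f10: "?f1 t * ?f0 t = ?f0 t" "?s1 t * ?f0 t = 0" for t
   using ramp_0[of "2*e" "3*e" t] ramp_1[of e "2*e" t] e by (cases "t <= 2*e"; simp)+
  have F10: "F1 * F0 = F0" "F1s * F0 = 0"
   unfolding F1_def F1s_def F0_def fcal_mult[OF H c1 c0, symmetric] fcal_mult[OF H c1s c0, symmetric] f10
   by (simp_all add: fcal_const[OF H])
  have "Q1s * Q0 = 0"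
   unfolding Q1s_def Q0_def fcal_mult[OF K c1s c0, symmetric] f10 by (simp add: fcal_const[OF K])
  then have Q10: "Q0 * Q1s = 0" unfolding Q1s_def Q0_def by (simp only: fcal_commute[OF K c0 c1s])
  have F01: "F0 * F1 = F0" unfolding F0_def F1_def using F10(1)[unfolded F0_def F1_def]
   by (simp only: fcal_commute[OF H c0 c1])
  have s11: "?s1 t * ?s1 t = 1 - ?f1 t" for t using ramp_01[of e "2*e" t] by simp
  have F1s2: "F1s * F1s = 1 - F1"
   unfolding F1s_def F1_def fcal_mult[OF H c1s c1s, symmetric] s11
   by (simp add: fcal_diff[OF H continuous_on_const c1] fcal_const[OF H])
  note wD = UG_D[OF w]
  have aw': "norm (a - w * m) <= \<eta>" using aw by (simp add: a_def m_def)
  have A: "norm ((a - w) * F1) <= \<eta>"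
  proof -
   have "(a - w) * F1 = (a - w * m) * F1" by (simp add: left_diff_distrib mult.assoc mF)
   then show ?thesis using norm_mult3'[OF nF(1), of "a - w * m"] aw' by simp
  qed
  have B: "norm (Q1 * w - a * F1) <= \<eta>"
  proof -
   have "Q1 * w = (Q1 * a) * (adj a * w)" using Qa by (metis mult.assoc)
   then have "Q1 * w = (a * F1) * (adj a * w)" by (simp add: ai)
   moreover have "a * F1 = (a * F1) * m" by (simp add: mult.assoc mF)
   ultimately have "Q1 * w - a * F1 = (a * F1) * (adj a * w - m)" by (simp add: right_diff_distrib)
   moreover have "adj a * w - m = adj (a - w * m) * w"
    using wD by (simp add: adj_diff adj_mult am left_diff_distrib mult.assoc)
   ultimately have "Q1 * w - a * F1 = (a * F1) * (adj (a - w * m) * w)" by simp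
   moreover have "norm (a * F1) <= 1" by (intro norm_mult_le_one na nF)
   moreover have "norm (adj (a - w * m) * w) <= \<eta>"
    using norm_mult3'[of w "adj (a - w * m)"] wD aw' by simp
   ultimately show ?thesis using norm_mult3[of "a * F1" "adj (a - w * m) * w"] by simp
  qed
  have C: "norm (Q1 * w - w * F1) <= 2 * \<eta>"
  proof -
   have "Q1 * w - w * F1 = (Q1 * w - a * F1) + (a - w) * F1" by (simp add: left_diff_distrib)
   then show ?thesis using norm_triangle_ineq[of "Q1 * w - a * F1" "(a - w) * F1"] A B by (simp only:)
  qed
  \<comment> \<open>\<open>G\<close> is \<open>F1\<close> transported by \<open>w\<close>. As
    \<open>Q1\<close> is close to \<open>G\<close>, uniform continuity of sqrt (1 - t) makes the
    complementary roots close as well, so that \<open>w\<close> almost intertwines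
    \<open>F1s\<close> with \<open>Q1s\<close>.\<close>
  define G where "G = w * F1 * adj w"
  have "G = adj (fcal sqrt F1 * adj w) * (fcal sqrt F1 * adj w)"
  proof -
   have "adj (fcal sqrt F1 * adj w) * (fcal sqrt F1 * adj w) = w * (fcal sqrt F1 * fcal sqrt F1) * adj w"
    by (simp add: adj_mult fcal_adj[OF pF(1) csqrt01] mult.assoc)
   then show ?thesis by (simp add: G_def fcal_sqrt_sq[OF pF(1)])
  qed
  then have pG: "pc G" unfolding pc_def
   by (metis G_def norm_adj norm_mult_le_one nF(1) order_refl pos_adj_mult wD(4))
  have wG: "w * F1 = G * w" using wD by (simp add: G_def mult.assoc)
  have wGs: "w * F1s = fcal ?s G * w" using fcal_intertwine[OF pF(1) pG cs wG] comp by simp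
  have "Q1 - G = (Q1 * w - w * F1) * adj w" using wD by (simp add: G_def left_diff_distrib mult.assoc)
  then have "norm (Q1 - G) <= 2 * \<eta>" using norm_mult3'[of "adj w" "Q1 * w - w * F1"] wD C by simp
  then have "norm (Q1s - fcal ?s G) < \<kappa> / 2" using dd[OF pF(2) pG] comp \<eta> by simp
  moreover have "Q1s * w - w * F1s = (Q1s - fcal ?s G) * w" by (simp add: wGs left_diff_distrib)
  ultimately have D: "norm (Q1s * w - w * F1s) <= \<kappa> / 2"
   using norm_mult3'[of w "Q1s - fcal ?s G"] wD by simp
  define z where "z = a * F1 + Q1s * w * F1s"
  have zS: "z \<in> S" unfolding z_def by (intro in_S aS FS wD)
  have "z - w = (a - w) * F1 + (Q1s * w - w * F1s) * F1s"
  proof -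
   have "(Q1s * w - w * F1s) * F1s = Q1s * w * F1s - w * (F1s * F1s)" by (simp add: left_diff_distrib mult.assoc)
   then show ?thesis unfolding z_def F1s2 by (simp add: left_diff_distrib right_diff_distrib)
  qed
  then have "norm (z - w) <= norm ((a - w) * F1) + norm ((Q1s * w - w * F1s) * F1s)"
   by (simp add: norm_triangle_ineq)
  also have "\<dots> <= \<eta> + \<kappa> / 2"
   using A D norm_mult3'[OF nF(3), of "Q1s * w - w * F1s"] by (intro add_mono) auto
  finally have zw: "norm (z - w) <= \<kappa>" using \<eta> by simp
  have nz: "norm z <= 2" using norm_triangle_sub[of z w] zw wD \<kappa> by simp
  have "z \<in> GL S"
  proof (rule GL_near[OF UG_GL[OF w] zS])
   have "minv w = adj w" using wD by (intro minv_eq)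
   then show "norm (w - z) * norm (minv w) < 1" using zw \<kappa> wD by (simp add: norm_minus_commute)
  qed
  define M where "M = mabs 2 z"
  define n where "n = minv M"
  define u where "u = z * n"
  have "2 > (0::real)" by simp
  from polar[OF \<open>z \<in> GL S\<close> nz this] have M: "M \<in> GL S" "u \<in> UG S" "z = u * M"
   unfolding M_def u_def n_def by auto
  have Mn: "M * n = 1" "n * M = 1" unfolding n_def using minv[OF M(1)] by auto
  have zF: "z * F0 = a * F0" unfolding z_def by (simp add: distrib_right mult.assoc F10)
  have Qz: "Q0 * z = a * F0"
  proof -
   have "Q0 * z = (Q0 * a) * F1 + (Q0 * Q1s) * (w * F1s)" by (simp add: z_def distrib_left mult.assoc)
   then have "Q0 * z = (a * F0) * F1 + 0 * (w * F1s)" by (simp only: ai(2)[symmetric] Q10)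
   then show ?thesis by (simp add: mult.assoc F01)
  qed
  \<comment> \<open>On \<open>F0\<close> the element \<open>adj z * z\<close> acts as the identity,
    hence so do the absolute value \<open>M\<close> and its inverse; passing from \<open>z\<close>
    to its unitary part therefore changes nothing on \<open>F0\<close>.\<close>
  have "adj z * z * F0 = adj z * (Q0 * a)" by (simp add: mult.assoc zF ai)
  also have "\<dots> = adj (Q0 * z) * a" by (simp add: adj_mult sF mult.assoc)
  also have "\<dots> = adj (adj a * a * F0)" by (simp add: Qz adj_mult sF mult.assoc)
  finally have "adj z * z * F0 = F0" by (simp add: aF0 sF)
  then have MF: "M * F0 = F0" unfolding M_def using nz by (intro mabs_eigen) auto
  have aM: "adj M = M" unfolding M_def using nz by (intro mabs_adj) auto
  have "adj (M * F0) = adj F0" using MF by simp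
  then have FM: "F0 * M = F0" by (simp add: adj_mult aM sF)
  have nF0: "n * F0 = F0" "F0 * n = F0"
  proof -
   have "n * (M * F0) = (n * M) * F0" "(F0 * M) * n = F0 * (M * n)" by (simp_all only: mult.assoc)
   then show "n * F0 = F0" "F0 * n = F0" using MF FM Mn by simp_all
  qed
  have uF: "u * F0 = a * F0" unfolding u_def by (simp add: mult.assoc nF0 zF)
  have Qu: "Q0 * u = a * F0"
  proof -
   have "Q0 * u = (Q0 * z) * n" by (simp add: u_def mult.assoc)
   then show ?thesis by (simp add: Qz mult.assoc nF0)
  qed
  have "adj z * z - 1 = adj z * (z - w) + adj (z - w) * w" using wD by (simp add: algebra_simps adj_diff)
  then have "norm (adj z * z - 1) <= norm (adj z) * norm (z - w) + norm (adj (z - w)) * norm w"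
   by (simp only:) (intro order_trans[OF norm_triangle_ineq] add_mono norm_mult_ineq)
  also have "\<dots> <= 2 * \<kappa> + \<kappa> * 1" using nz zw wD \<kappa>(1) by (intro add_mono mult_mono) auto
  finally have "norm (1 - M) <= 3 * \<kappa>" using mabs2_dist[OF nz] by (simp add: M_def norm_minus_commute)
  moreover have "u - z = u * (1 - M)" using M(3) by (simp add: right_diff_distrib)
  ultimately have "norm (u - z) <= 3 * \<kappa>" using norm_mult3[of u "1 - M"] UG_D(4)[OF M(2)] by simp
  then have "norm (u - w) <= \<zeta>" using norm_triangle_ineq[of "u - z" "z - w"] zw \<kappa> by simp
  then show "\<exists>u\<in>UG S. norm (u - w) <= \<zeta> \<and>
   u * fcal ?f0 (adj x * x) = cut e x * fcal ?f0 (adj x * x) \<and>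
   fcal ?f0 (x * adj x) * u = cut e x * fcal ?f0 (adj x * x)"
   using M(2) uF Qu unfolding F0_def Q0_def a_def H_def K_def by blast
 qed (use \<eta> in auto)
qed

section \<open>Hereditary subalgebras\<close>

locale character =
 fixes chi :: "'a::ucstar => complex"
 assumes chi_add: "chi (x + y) = chi x + chi y"
  and chi_mult: "chi (x * y) = chi x * chi y"
  and chi_adj: "chi (adj x) = cnj (chi x)"
  and chi_cplx: "chi (cplx c) = c"
  and chi_bound: "cmod (chi x) <= norm x"
begin

lemma chi_1 [simp]: "chi 1 = 1" and chi_0 [simp]: "chi 0 = 0"
 using chi_cplx[of 1] chi_cplx[of 0] by simp_all

lemma chi_scaleR: "chi (r *\<^sub>R x) = of_real r * chi x"
 using chi_mult[of "cplx (of_real r)" x] chi_cplx[of "of_real r"] unfolding cplx_of_real by simp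

lemma chi_diff: "chi (x - y) = chi x - chi y"
 using chi_add[of "x - y" y] by simp

lemma bounded_linear_chi: "bounded_linear chi"
proof (rule bounded_linear_intro[where K = 1])
 show "chi (r *\<^sub>R x) = r *\<^sub>R chi x" for r x
  by (rule trans[OF chi_scaleR]) (simp add: scaleR_conv_of_real)
qed (simp_all add: chi_add chi_bound)

lemmas continuous_on_chi = bounded_linear.continuous_on[OF bounded_linear_chi]

lemma chi_sa: "adj h = h ==> chi h = of_real (Re (chi h))"
 using chi_adj[of h] by (metis Reals_cnj_iff of_real_Re)

lemma chi_pev: "adj h = h ==> chi (pev p h) = of_real (poly p (Re (chi h)))"
proof (induction p)
 case (pCons a p)
 then show ?case using chi_sa[of h] by (simp add: chi_add chi_mult chi_scaleR)
qed simp

lemma chi_fc: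
 assumes h: "sac h" and f: "continuous_on {-1..1} f"
 shows "chi (fc f h) = of_real (f (Re (chi h)))"
proof -
 let ?r = "Re (chi h)"
 have r: "?r \<in> {-1..1}"
  using h chi_bound[of h] abs_Re_le_cmod[of "chi h"] by (auto simp: sac_def)
 have "(%n. chi (pev (wpoly f n) h)) \<longlonglongrightarrow> chi (fc f h)"
  by (intro bounded_linear.tendsto[OF bounded_linear_chi] fc_LIMSEQ h f)
 moreover have "(%n. complex_of_real (poly (wpoly f n) ?r)) \<longlonglongrightarrow> of_real (f ?r)"
  by (intro tendsto_intros tendsto_uniform_limitI[OF wpoly_uniform_limit[OF f] r])
 ultimately show ?thesis using h by (simp add: chi_pev sac_def LIMSEQ_unique)
qed

lemma chi_fcal:
 assumes h: "pc h" and f: "continuous_on {0..1} f"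
 shows "chi (fcal f h) = of_real (f (Re (chi h)))"
proof -
 obtain k where k: "adj k = k" "h = k * k" using h by (auto simp: pc_def pos_def)
 have "chi h = of_real (Re (chi k) * Re (chi k))" using chi_sa[OF k(1)] by (simp add: k(2) chi_mult)
 then have "Re (chi h) >= 0" by simp
 then show ?thesis unfolding fcal_def using chi_fc[OF pc_sac[OF h] continuous_on_max0[OF f]] by simp
qed

lemma chi_unitary: "adj u * u = 1 ==> cmod (chi u) = 1"
proof -
 assume "adj u * u = 1"
 then have "cnj (chi u) * chi u = 1" using chi_mult[of "adj u" u] by (simp add: chi_adj)
 then have "(cmod (chi u))\<^sup>2 = 1" by (metis complex_norm_square mult.commute of_real_eq_1_iff)
 then show ?thesis by (simp add: power2_eq_1_iff) (smt (verit) norm_ge_zero)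
qed

end

text \<open>The unitization is realized inside the ambient unital algebra, so that all unitizations
  share one type; the character reads off the scalar part.\<close>

definition unz :: "('a::ucstar => complex) => 'a set => 'a set" where
 "unz chi A = {x. x - cplx (chi x) \<in> A}"

text \<open>A C*-algebra, usually without unit, is presented as a closed *-subalgebra in the kernel
  of the character, which makes its sum with the scalars direct. It need not be an ideal of the
  ambient type.\<close>

locale cideal = character +
 fixes A :: "'a::ucstar set"
 assumes closed_A: "closed A" and zero_A: "0 \<in> A"
  and add_A: "x \<in> A ==> y \<in> A ==> x + y \<in> A"
  and mult_A: "x \<in> A ==> y \<in> A ==> x * y \<in> A"
  and cplx_A: "x \<in> A ==> cplx c * x \<in> A"
  and adj_A: "x \<in> A ==> adj x \<in> A"
  and chi_A: "x \<in> A ==> chi x = 0"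
begin

lemma scaleR_A: "x \<in> A ==> r *\<^sub>R x \<in> A"
 using cplx_A[of x "of_real r"] unfolding cplx_of_real by simp

lemma minus_A: "x \<in> A ==> - x \<in> A" using scaleR_A[of x "-1"] by simp

lemma diff_A: "x \<in> A ==> y \<in> A ==> x - y \<in> A" using add_A[OF _ minus_A] by force

lemma unzI: "a \<in> A ==> cplx c + a \<in> unz chi A"
 by (simp add: unz_def chi_add chi_cplx chi_A)

lemma unz_A: "a \<in> A ==> a \<in> unz chi A"
 using unzI[of a 0] by simp

lemma unzE: assumes "x \<in> unz chi A" obtains a where "a \<in> A" "x = cplx (chi x) + a"
 using assms that[of "x - cplx (chi x)"] by (simp add: unz_def)

lemma unz_chi0: "x \<in> unz chi A ==> chi x = 0 ==> x \<in> A"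
 by (simp add: unz_def)

sublocale U: csub "unz chi A"
proof
 have "unz chi A = (%x. x - cplx (chi x)) -` A" by (auto simp: unz_def)
 moreover have "continuous_on UNIV (%x. x - cplx (chi x))"
  by (intro continuous_intros continuous_on_chi)
 ultimately show "closed (unz chi A)" using closed_vimage[OF closed_A] by simp
 have u: "cplx c \<in> unz chi A" for c using unzI[OF zero_A, of c] by simp
 show "1 \<in> unz chi A" "J \<in> unz chi A" using u[of 1] u[of \<i>] by (simp_all add: cplx_def)
 fix x y assume x: "x \<in> unz chi A"
 obtain a where a: "a \<in> A" "x = cplx (chi x) + a" using unzE[OF x] .
 have "adj x = cplx (cnj (chi x)) + adj a" by (subst a(2)) (simp add: adj_add adj_cplx)
 then show "adj x \<in> unz chi A" using unzI[OF adj_A[OF a(1)]] by metis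
 have "r *\<^sub>R x = cplx (of_real r * chi x) + r *\<^sub>R a" for r
  by (subst a(2), simp only: cplx_mult cplx_of_real) (simp add: algebra_simps)
 then show "r *\<^sub>R x \<in> unz chi A" for r using unzI[OF scaleR_A[OF a(1)]] by metis
 assume y: "y \<in> unz chi A"
 obtain b where b: "b \<in> A" "y = cplx (chi y) + b" using unzE[OF y] .
 have "x + y = cplx (chi x + chi y) + (a + b)" by (subst a(2), subst b(2)) (simp add: cplx_add)
 then show "x + y \<in> unz chi A" using unzI[OF add_A[OF a(1) b(1)]] by metis
 have "x * y = cplx (chi x * chi y) + (cplx (chi x) * b + cplx (chi y) * a + a * b)"
  by (subst a(2), subst b(2)) (simp add: cplx_mult algebra_simps cplx_central[of "chi y" a, symmetric])
 moreover have "cplx (chi x) * b + cplx (chi y) * a + a * b \<in> A"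
  by (intro add_A cplx_A mult_A a b)
 ultimately show "x * y \<in> unz chi A" using unzI by metis
qed

end

text \<open>Heredity enters in the algebraic form B A B inside B; \<open>her_ide\<close> obtains it
  from the definition through the order.\<close>

locale her = A: cideal chi A + B: cideal chi B for chi :: "'a::ucstar => complex" and A B +
 assumes B_sub: "B \<subseteq> A" and BAB: "b \<in> B ==> a \<in> A ==> b' \<in> B ==> b * a * b' \<in> B"
begin

lemma unz_sub: "unz chi B \<subseteq> unz chi A"
 using B_sub by (auto simp: unz_def)

text \<open>The approximate polar part of \<open>X\<close> extends to a unitary \<open>u\<close>
  over \<open>A\<close> that agrees with \<open>cut e X\<close> on \<open>F0\<close>. The remaining
  piece of \<open>u\<close> has the form \<open>q * u * p\<close> with \<open>p\<close> and
  \<open>q\<close> in \<open>B\<close>, so heredity puts \<open>u\<close> into the unitization of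
  \<open>B\<close>. Then \<open>X\<close> is close to \<open>u\<close> times its absolute value, and
  a small scalar added to the latter makes the product invertible. The positive scalar part of
  \<open>X\<close> is what gives \<open>F0\<close> and \<open>Q0\<close> scalar part 1.\<close>

lemma approx_hereditary:
 assumes d: "GLdense (unz chi A)" and X: "X \<in> unz chi B" "norm X <= 1"
  and r: "chi X = of_real r" "r > 0" and th: "\<theta> > 0"
 shows "\<exists>y\<in>GL (unz chi B). norm (X - y) < \<theta>"
proof -
 \<comment> \<open>\<open>3 * e <= r\<^sup>2\<close> makes the cut-off equal to 1 at the scalar part
   of \<open>adj X * X\<close>; the other bound gives \<open>sqrt (3 * e) <= \<theta> / 6\<close>,
   the size of what \<open>1 - F0\<close> leaves of \<open>X\<close>.\<close>
 define e where "e = min (r\<^sup>2 / 3) (\<theta>\<^sup>2 / 108)"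
 have e: "e > 0" "3 * e <= r\<^sup>2" "3 * e <= (\<theta> / 6)\<^sup>2" using r th by (auto simp: e_def power2_eq_square)
 have s3: "sqrt (3 * e) <= \<theta> / 6" using real_sqrt_le_mono[OF e(3)] th by simp
 have XA: "X \<in> unz chi A" using X unz_sub by blast
 define H K where "H = adj X * X" and "K = X * adj X"
 have H: "pc H" and K: "pc K" unfolding H_def K_def using X by (auto intro: pc_adj_mult pc_mult_adj)
 have HB: "H \<in> unz chi B" and KB: "K \<in> unz chi B" unfolding H_def K_def by (intro B.U.in_S X)+
 have cH: "Re (chi H) = r\<^sup>2" "Re (chi K) = r\<^sup>2" by (simp_all add: H_def K_def A.chi_mult A.chi_adj r power2_eq_square)
 let ?f0 = "ramp (2*e) (3*e)"
 have c0: "continuous_on {0..1} ?f0" using e by (auto intro!: ramp_cont)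
 define F0 Q0 where "F0 = fcal ?f0 H" and "Q0 = fcal ?f0 K"
 define a where "a = cut e X"
 have aB: "a \<in> unz chi B" unfolding a_def cut_def
  by (intro B.U.in_S X isq_cont e HB[unfolded H_def] H[unfolded H_def])
 have na: "norm a <= 1" unfolding a_def by (rule cut_norm[OF X(2) e(1)])
 obtain \<eta> where \<eta>: "\<eta> > 0" and ext: "\<And>w. w \<in> UG (unz chi A) ==> norm (a - w * mabs 1 a) <= \<eta> ==>
  \<exists>u\<in>UG (unz chi A). u * F0 = a * F0 & Q0 * u = a * F0"
  using A.U.unitary_extension[OF e(1) zero_less_one] XA X(2)
  unfolding a_def F0_def Q0_def H_def K_def by blast
 obtain w where w: "w \<in> UG (unz chi A)" "norm (a - w * mabs 1 a) <= \<eta>"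
  using A.U.approx_polar[OF d _ na \<eta>] aB unz_sub by blast
 obtain u where u: "u \<in> UG (unz chi A)" "u * F0 = a * F0" "Q0 * u = a * F0" using ext[OF w] by blast
 let ?s = "%t::real. sqrt (1 - t)"
 have cs: "continuous_on {0..1} ?s" by (intro continuous_intros)
 have FB: "F0 \<in> unz chi B" unfolding F0_def by (intro B.U.in_S HB H c0)
 have pF: "pc F0" "pc Q0" unfolding F0_def Q0_def using ramp_01(1) by (auto intro!: fcal_pc H K c0)
 have QB: "Q0 \<in> unz chi B" unfolding Q0_def by (intro B.U.in_S KB K c0)
 define p q where "p = fcal ?s F0" and "q = fcal ?s Q0"
 have one: "?f0 (r\<^sup>2) = 1" using e by (intro ramp_1) auto
 have "chi F0 = 1" "chi Q0 = 1" unfolding F0_def Q0_def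
  by (simp_all add: A.chi_fcal[OF H c0] A.chi_fcal[OF K c0] cH one)
 then have "chi p = 0" "chi q = 0" unfolding p_def q_def
  by (simp_all add: A.chi_fcal[OF pF(1) cs] A.chi_fcal[OF pF(2) cs])
 moreover have "p \<in> unz chi B" "q \<in> unz chi B" unfolding p_def q_def by (intro B.U.in_S FB QB pF cs)+
 ultimately have pq: "p \<in> B" "q \<in> B" by (auto intro: B.unz_chi0)
 have "u * F0 = Q0 * u" using u by simp
 then have up: "u * p = q * u" unfolding p_def q_def by (rule fcal_intertwine[OF pF cs])
 have "p * p = fcal (%t. ?s t * ?s t) F0" unfolding p_def by (simp only: fcal_mult[OF pF(1) cs cs])
 also have "\<dots> = fcal (%t. 1 - t) F0" by (rule fcal_cong[OF pF(1)]) (auto intro!: continuous_intros)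
 also have "\<dots> = 1 - F0"
  using fcal_diff[OF pF(1) continuous_on_const continuous_on_id] by (simp add: fcal_const fcal_id pF)
 finally have pp: "p * p = 1 - F0" .
 \<comment> \<open>Split \<open>u\<close> into a scalar and an element of \<open>A\<close>: the
   scalar contributes a multiple of \<open>q * p\<close>, and the other term lies in
   \<open>B\<close> by heredity.\<close>
 obtain a' where a': "a' \<in> A" "u = cplx (chi u) + a'" using A.unzE UG_D(1)[OF u(1)] by metis
 have "q * u * p = cplx (chi u) * (q * p) + q * a' * p"
  by (subst a'(2)) (simp add: distrib_left distrib_right cplx_central[of _ q, symmetric] mult.assoc)
 then have "q * u * p \<in> B" using BAB[OF pq(2) a'(1) pq(1)] pq by (auto intro!: B.add_A B.cplx_A B.mult_A)
 moreover have "u = a * F0 + q * u * p"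
 proof -
  have "q * u * p = u * (1 - F0)" using pp by (simp add: up[symmetric] mult.assoc)
  then show ?thesis using u(2) by (simp add: right_diff_distrib)
 qed
 ultimately have uB: "u \<in> unz chi B" using aB FB by (metis B.U.add_S B.U.mult_S B.unz_A)
 define h where "h = fcal sqrt H"
 have hB: "h \<in> unz chi B" unfolding h_def by (intro B.U.in_S HB H csqrt01)
 have hp: "pos h" unfolding h_def by (intro fcal_pos H csqrt01) auto
 let ?g = "%t. 1 - ?f0 t"
 have cg: "continuous_on {0..1} ?g" by (intro continuous_intros c0)
 have G: "fcal ?g H = 1 - F0" unfolding F0_def by (simp add: fcal_diff[OF H continuous_on_const c0] fcal_const[OF H])
 have ghb: "\<bar>sqrt t * ?g t\<bar> <= sqrt (3 * e)" if "t \<in> {0..1}" for t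
 proof (cases "t <= 3 * e")
  case True
  then have "sqrt t * ?g t <= sqrt (3 * e) * 1" using that e ramp_01[of "2*e" "3*e" t]
   by (intro mult_mono) auto
  then show ?thesis using that ramp_01[of "2*e" "3*e" t] by simp
 next
  case False
  then show ?thesis using ramp_1[of "2*e" "3*e" t] e by simp
 qed
 have n1: "norm (h * (1 - F0)) <= sqrt (3 * e)"
  unfolding h_def G[symmetric] fcal_mult[OF H csqrt01 cg, symmetric]
  by (rule fcal_norm[OF H]) (intro continuous_intros cg, rule ghb)
 have n2: "norm (X * (1 - F0)) <= sqrt (3 * e)"
 proof -
  have hh: "h * h = H" unfolding h_def by (rule fcal_sqrt_sq[OF H])
  have ah: "adj h = h" using hp by (rule pos_adj)
  have "adj (X * (1 - F0)) * (X * (1 - F0)) = adj (1 - F0) * (h * h) * (1 - F0)"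
   by (simp add: hh H_def adj_mult mult.assoc)
  also have "\<dots> = adj (h * (1 - F0)) * (h * (1 - F0))" by (simp add: adj_mult ah mult.assoc)
  finally have "(norm (X * (1 - F0)))\<^sup>2 = (norm (h * (1 - F0)))\<^sup>2" unfolding cstar[symmetric] by simp
  then show ?thesis using n1 by simp
 qed
 have XF: "u * F0 * h = X * F0"
 proof -
  have ci: "continuous_on {0..1} (isq e)" by (rule isq_cont[OF e(1)])
  have "u * F0 * h = X * (fcal (isq e) H * F0 * h)"
   unfolding u(2) a_def cut_def H_def[symmetric] by (simp only: mult.assoc)
  also have "fcal (isq e) H * F0 * h = fcal (%t. isq e t * ?f0 t * sqrt t) H"
   unfolding F0_def h_def by (simp add: fcal_mult[OF H] ci c0 csqrt01 continuous_intros)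
  also have "\<dots> = F0" unfolding F0_def
  proof (rule fcal_cong[OF H])
   show "isq e t * ?f0 t * sqrt t = ?f0 t" for t
    using sqrt_isq[OF e(1), of t] ramp_0[of "2*e" "3*e" t] e(1) by (cases "t <= 2*e") (auto simp: mult.assoc mult.left_commute mult.commute)
  qed (intro continuous_intros ci c0)
  finally show ?thesis .
 qed
 have Fh: "F0 * h = h * F0" unfolding F0_def h_def by (rule fcal_commute[OF H c0 csqrt01])
 have "X - u * h = X * (1 - F0) - u * (h * (1 - F0))"
  using XF Fh by (simp add: right_diff_distrib mult.assoc)
 then have "norm (X - u * h) <= norm (X * (1 - F0)) + norm (u * (h * (1 - F0)))"
  by (simp only: norm_triangle_ineq4)
 also have "\<dots> <= sqrt (3 * e) + sqrt (3 * e)"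
  using n1 n2 norm_mult3[of u "h * (1 - F0)"] UG_D(4)[OF u(1)] by (intro add_mono) auto
 finally have 1: "norm (X - u * h) <= \<theta> / 3" using s3 by simp
 \<comment> \<open>Adding \<theta>/3 to the absolute value makes it invertible and costs another
   third of the tolerance.\<close>
 let ?y = "u * (h + (\<theta> / 3) *\<^sub>R 1)"
 have "u \<in> GL (unz chi B)" using B.U.UG_GL uB UG_D[OF u(1)] by (simp add: UG_def)
 then have "?y \<in> GL (unz chi B)" using th by (intro B.U.GL_mult B.U.pos_plus_GL hB hp) auto
 moreover have "X - ?y = (X - u * h) - (\<theta> / 3) *\<^sub>R u" by (simp add: algebra_simps)
 then have "norm (X - ?y) <= norm (X - u * h) + norm ((\<theta> / 3) *\<^sub>R u)" by (simp only: norm_triangle_ineq4)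
 then have "norm (X - ?y) <= \<theta> / 3 + \<theta> / 3" using 1 UG_D(4)[OF u(1)] th by simp
 ultimately show ?thesis using th by (intro bexI[of _ ?y]) auto
qed

text \<open>The previous lemma asks for norm at most 1 and a positive scalar part. A shift by
  \<theta>/2 makes the scalar part nonzero, and multiplication by a complex number
  \<open>\<kappa>\<close> achieves both; being invertible, this scaling can be undone at the
  end.\<close>

theorem GLdense_hereditary:
 assumes d: "GLdense (unz chi A)"
 shows "GLdense (unz chi B)"
 unfolding GLdense_def
proof (intro ballI allI impI)
 fix x and \<theta> :: real assume x: "x \<in> unz chi B" and th: "\<theta> > 0"
 define x' where "x' = (if chi x = 0 then x + cplx (of_real (\<theta> / 2)) else x)"
 have x': "x' \<in> unz chi B" "chi x' ~= 0" "norm (x - x') <= \<theta> / 2"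
  using th x by (auto simp: x'_def A.chi_add A.chi_cplx intro!: B.U.add_S B.U.cplx_S simp del: of_real_divide)
 define n where "n = norm (cplx (1 / chi x') * x')"
 define \<kappa> where "\<kappa> = of_real (1 / (n + 1)) / chi x'"
 define X where "X = cplx \<kappa> * x'"
 have n0: "n + 1 > 0" unfolding n_def by (intro add_nonneg_pos) auto
 have k0: "\<kappa> ~= 0" using n0 x' unfolding \<kappa>_def by (metis divide_eq_0_iff less_numeral_extra(3) of_real_eq_0_iff zero_neq_one)
 have X: "X \<in> unz chi B" unfolding X_def by (intro B.U.mult_S B.U.cplx_S x')
 have "X = cplx (of_real (1 / (n + 1))) * (cplx (1 / chi x') * x')"
  unfolding X_def \<kappa>_def by (simp only: mult.assoc[symmetric] cplx_mult[symmetric]) simp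
 then have "norm X = cmod (of_real (1 / (n + 1))) * n" by (simp only: norm_cplx_mult n_def[symmetric]) (simp add: n_def)
 then have "norm X = 1 / (n + 1) * n" using n0 by (simp only: norm_of_real) simp
 then have nX: "norm X <= 1" using n0 by (simp add: divide_le_eq)
 have cX: "chi X = of_real (1 / (n + 1))" unfolding X_def A.chi_mult A.chi_cplx \<kappa>_def using x' by simp
 have "\<theta> / 2 * cmod \<kappa> > 0" using th k0 by simp
 then obtain y where y: "y \<in> GL (unz chi B)" "norm (X - y) < \<theta> / 2 * cmod \<kappa>"
  using approx_hereditary[OF d X nX cX] n0 by fastforce
 have "x' - cplx (1 / \<kappa>) * y = cplx (1 / \<kappa>) * (X - y)"
  using k0 by (simp add: X_def right_diff_distrib mult.assoc[symmetric] cplx_mult[symmetric])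
 then have "norm (x' - cplx (1 / \<kappa>) * y) = norm (X - y) / cmod \<kappa>" by (simp add: norm_divide)
 also have "\<dots> < \<theta> / 2" using y(2) k0 by (simp add: divide_less_eq)
 finally have "norm (x - cplx (1 / \<kappa>) * y) < \<theta>"
  using x'(3) norm_triangle_ineq[of "x - x'" "x' - cplx (1 / \<kappa>) * y"] by simp
 moreover have "cplx (1 / \<kappa>) * y \<in> GL (unz chi B)" using k0 by (intro B.U.GL_mult B.U.GL_cplx y) simp
 ultimately show "\<exists>y\<in>GL (unz chi B). norm (x - y) < \<theta>" by blast
qed

end

section \<open>Connecting nearby invertible elements\<close>

lemma norm_adj_mult_diff:
 assumes "norm x <= 1" "norm y <= (1::real)"
 shows "norm (adj x * x - adj y * y) <= 2 * norm (x - (y::'a::ucstar))"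
proof -
 have "adj x * x - adj y * y = adj x * (x - y) + adj (x - y) * y" by (simp add: algebra_simps adj_diff)
 also have "norm \<dots> <= norm (adj x * (x - y)) + norm (adj (x - y) * y)" by (rule norm_triangle_ineq)
 also have "\<dots> <= norm (x - y) + norm (x - y)"
  using norm_mult3[of "adj x" "x - y"] norm_mult3'[OF assms(2), of "adj (x - y)"] assms by simp
 finally show ?thesis by simp
qed

lemma pc_mabs1: "norm x <= 1 ==> pc (mabs 1 x)"
 unfolding mabs_def by (simp, rule fcal_pc[OF pc_adj_mult csqrt01]) auto

lemma fcal_sqrt_square: "pc h ==> fcal sqrt (h * h) = h"
proof -
 assume h: "pc h"
 have c: "continuous_on {0..1} (%t::real. t * t)" by (intro continuous_intros)
 have hh: "h * h = fcal (%t. t * t) h"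
  by (simp add: fcal_mult[OF h continuous_on_id continuous_on_id] fcal_id[OF h])
 have "fcal sqrt (fcal (%t. t * t) h) = fcal (%t. sqrt (t * t)) h"
  by (rule fcal_comp[OF h c csqrt01]) (auto simp: mult_le_one)
 also have "\<dots> = fcal (%t. t) h" by (rule fcal_cong[OF h]) (auto intro!: continuous_intros)
 finally show ?thesis by (simp add: hh fcal_id[OF h])
qed

lemma path_component_linepath_image:
 assumes "\<And>s. s \<in> {0..1} ==> (1 - s) *\<^sub>R a + s *\<^sub>R b \<in> T"
 shows "path_component T a (b :: 'a::real_normed_vector)"
 unfolding path_component_def
 by (intro exI[of _ "linepath a b"] conjI path_linepath pathstart_linepath pathfinish_linepath)
  (auto simp: path_image_def linepath_def intro!: assms)

definition ann :: "'a::ucstar set => 'a => 'a set" where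
 "ann A f = {b \<in> A. b * f = 0 & f * b = 0}"

lemma (in cideal) cideal_ann:
 assumes f: "adj f = f"
 shows "cideal chi (ann A f)"
proof
 have "ann A f = A \<inter> {b. b * f = 0} \<inter> {b. f * b = 0}" by (auto simp: ann_def)
 moreover have "closed {b. b * f = 0}" "closed {b. f * b = 0}"
  by (intro closed_Collect_eq continuous_intros)+
 ultimately show "closed (ann A f)" using closed_A by auto
 fix x y c assume x: "x \<in> ann A f"
 show "cplx c * x \<in> ann A f"
  using x cplx_A by (auto simp: ann_def mult.assoc) (metis cplx_central mult.assoc mult_zero_left)
 have "adj (x * f) = 0" "adj (f * x) = 0" using x by (simp_all add: ann_def)
 then show "adj x \<in> ann A f" using x adj_A f by (auto simp: ann_def adj_mult)
 assume y: "y \<in> ann A f"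
 show "x + y \<in> ann A f" using x y add_A by (auto simp: ann_def algebra_simps)
 have "f * (x * y) = f * x * y" by (simp only: mult.assoc)
 then have "f * (x * y) = 0" using x by (simp add: ann_def)
 then show "x * y \<in> ann A f" using x y mult_A by (auto simp: ann_def mult.assoc)
qed (auto simp: ann_def zero_A chi_A)

text \<open>After polar decomposition the two invertible elements differ by a unitary that is almost the
 identity where \<open>x\<close> is large; up to a small perturbation it lives in the unitized annihilator of
 a spectral cut-off of \<open>x\<close>, where it can be connected to \<open>1\<close> without leaving the ball.\<close>

lemma (in cideal) local_connection:
 assumes conn: "\<And>f u. f \<in> unz chi A ==> adj f = f ==> u \<in> UG (unz chi (ann A f)) ==>
   path_component (UG (unz chi (ann A f))) 1 u"
  and c: "c > 0" and th: "\<theta> > 0"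
 shows "\<exists>\<delta>>0. \<forall>x\<in>unz chi A. norm x <= 1/2 --> chi x = of_real c -->
  (\<forall>y0\<in>GL (unz chi A). \<forall>y1\<in>GL (unz chi A). norm (y0 - x) < \<delta> --> norm (y1 - x) < \<delta> -->
   path_component (GL (unz chi A) \<inter> ball x \<theta>) y0 y1)"
proof -
 let ?S = "unz chi A"
 \<comment> \<open>\<open>3 * e <= c\<^sup>2\<close> makes the cut-off equal to 1 at the scalar part
   of \<open>adj x * x\<close>. The other bound gives \<open>sqrt (3 * e) <= \<theta> / 16\<close>,
   so replacing 1 by any unitary that is trivial on the cut-off moves the product by at most
   \<theta>/8.\<close>
 define e where "e = min (c\<^sup>2 / 3) (\<theta>\<^sup>2 / 768)"
 have e: "e > 0" "3 * e <= c\<^sup>2" "3 * e <= (\<theta> / 16)\<^sup>2" using c th by (auto simp: e_def power2_eq_square)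
 have s3: "sqrt (3 * e) <= \<theta> / 16" using real_sqrt_le_mono[OF e(3)] th by simp
 define \<zeta> where "\<zeta> = min (\<theta> / 8) (1/2)"
 have z: "\<zeta> > 0" "\<zeta> <= \<theta> / 8" "\<zeta> < 1" using th by (auto simp: \<zeta>_def)
 let ?f0 = "ramp (2*e) (3*e)"
 have c0: "continuous_on {0..1} ?f0" using e by (auto intro!: ramp_cont)
 obtain \<eta> where \<eta>: "\<eta> > 0" and ext: "\<And>x w. x \<in> ?S ==> w \<in> UG ?S ==> norm x <= 1 ==>
   norm (cut e x - w * mabs 1 (cut e x)) <= \<eta> ==>
   \<exists>u\<in>UG ?S. norm (u - w) <= \<zeta> & u * fcal ?f0 (adj x * x) = cut e x * fcal ?f0 (adj x * x) \<and>
    fcal ?f0 (x * adj x) * u = cut e x * fcal ?f0 (adj x * x)"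
  using U.unitary_extension[OF e(1) z(1)] by blast
 \<comment> \<open>Multiplication by the truncated inverse square root, of norm at most
   \<open>1 / sqrt e\<close>, must turn the discrepancy \<open>4 * \<omega>\<close> of the two polar
   parts into at most \<open>\<eta>\<close>.\<close>
 define \<omega> where "\<omega> = min (\<theta> / 16) (\<eta> * sqrt e / 4)"
 have \<omega>: "\<omega> > 0" "\<omega> <= \<theta> / 16" "4 * \<omega> <= \<eta> * sqrt e" using th \<eta> e by (auto simp: \<omega>_def min_def field_simps)
 obtain d where d: "d > 0" and dd: "\<And>h k :: 'a. pc h ==> pc k ==> norm (h - k) < d ==> norm (fcal sqrt h - fcal sqrt k) < \<omega>"
  using fcal_ucont[OF csqrt01 \<omega>(1), where 'a = 'a] by auto
 define \<delta> where "\<delta> = min (1/2) (min (d / 2) \<omega>)"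
 have \<delta>: "\<delta> > 0" "\<delta> <= 1/2" "\<delta> <= d / 2" "\<delta> <= \<omega>" using d \<omega> by (auto simp: \<delta>_def)
 define \<tau> where "\<tau> = \<theta> / 16"
 have \<tau>: "\<tau> > 0" using th by (simp add: \<tau>_def)
 show ?thesis
 proof (intro exI[of _ \<delta>] conjI ballI impI)
  fix x y0 y1 assume xS: "x \<in> ?S" and x: "norm x <= 1/2" and chx: "chi x = of_real c"
   and y0: "y0 \<in> GL ?S" "norm (y0 - x) < \<delta>" and y1: "y1 \<in> GL ?S" "norm (y1 - x) < \<delta>"
  let ?T = "GL ?S \<inter> ball x \<theta>"
  have x1: "norm x <= 1" using x by simp
  define h where "h = mabs 1 x"
  have h: "pc h" unfolding h_def by (rule pc_mabs1[OF x1])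
  have hS: "h \<in> ?S" unfolding h_def by (rule U.mabs_S[OF xS x1]) simp
  have hpos: "pos h" and nh: "norm h <= 1" using h by (auto simp: pc_def)
  \<comment> \<open>Move a nearby invertible \<open>y = w * g\<close> to the standard form
    \<open>w * (h + \<tau>)\<close>: first add the scalar \<open>\<tau>\<close> to its absolute
    value \<open>g\<close>, then deform \<open>g\<close> into the absolute value \<open>h\<close> of
    \<open>x\<close>. The added scalar keeps the second segment invertible.\<close>
  have pol: "\<exists>w\<in>UG ?S. norm (w * h - x) <= 2 * \<omega> & path_component ?T y (w * (h + \<tau> *\<^sub>R 1))"
   if y: "y \<in> GL ?S" "norm (y - x) < \<delta>" for y
  proof -
   have ny: "norm y <= 1" using norm_triangle_sub[of y x] y x \<delta> by simp
   define g where "g = mabs 1 y"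
   define w where "w = y * minv g"
   have w: "w \<in> UG ?S" "y = w * g" using U.polar(2,3)[OF y(1) ny] by (auto simp: w_def g_def)
   have yS: "y \<in> ?S" using y GL_subset by blast
   have gS: "g \<in> ?S" unfolding g_def by (rule U.mabs_S[OF yS ny]) simp
   have gpos: "pos g" using pc_mabs1[OF ny] by (simp add: g_def pc_def)
   have "norm (adj y * y - adj x * x) < d"
    using norm_adj_mult_diff[OF ny x1] y(2) \<delta> by simp
   then have gh: "norm (g - h) < \<omega>"
    unfolding g_def h_def mabs_def using dd[of "adj y * y" "adj x * x"] ny x1 by (simp add: pc_adj_mult)
   have nw: "norm w = 1" using UG_D(4)[OF w(1)] .
   have wm: "norm (w * v) <= norm v" for v using norm_mult3[of w v] nw by simp
   have "w * h - x = w * (h - g) + (y - x)" using w(2) by (simp add: algebra_simps)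
   then have "norm (w * h - x) <= norm (w * (h - g)) + norm (y - x)" by (simp only: norm_triangle_ineq)
   then have whx: "norm (w * h - x) <= 2 * \<omega>" using wm[of "h - g"] gh y(2) \<delta> by (simp add: norm_minus_commute)
   have "path_component ?T y (w * (g + \<tau> *\<^sub>R 1))"
   proof (rule path_component_linepath_image)
    fix s :: real assume s: "s \<in> {0..1}"
    have eq: "(1 - s) *\<^sub>R y + s *\<^sub>R (w * (g + \<tau> *\<^sub>R 1)) = w * (g + (s * \<tau>) *\<^sub>R 1)"
     by (subst w(2)) (simp add: algebra_simps)
    have "w * (g + (s * \<tau>) *\<^sub>R 1) \<in> GL ?S"
    proof (cases "s = 0")
     case True
     then show ?thesis using w(2) y(1) by simp
    next
     case False
     then show ?thesis using s \<tau> by (intro U.GL_mult U.UG_GL w U.pos_plus_GL gS gpos) auto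
    qed
    moreover have "norm (w * (g + (s * \<tau>) *\<^sub>R 1) - x) < \<theta>"
    proof -
     have "w * (g + (s * \<tau>) *\<^sub>R 1) - x = (y - x) + (s * \<tau>) *\<^sub>R w"
      by (subst w(2)) (simp add: algebra_simps)
     then have "norm (w * (g + (s * \<tau>) *\<^sub>R 1) - x) <= norm (y - x) + norm ((s * \<tau>) *\<^sub>R w)"
      by (simp only: norm_triangle_ineq)
     also have "norm ((s * \<tau>) *\<^sub>R w) <= 1 * \<tau>" using s \<tau> nw by (auto simp: abs_mult mult_le_cancel_right1)
     finally show ?thesis using y(2) \<delta> \<omega> th by (simp add: \<tau>_def)
    qed
    ultimately show "(1 - s) *\<^sub>R y + s *\<^sub>R (w * (g + \<tau> *\<^sub>R 1)) \<in> ?T"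
     unfolding eq by (simp add: dist_norm norm_minus_commute)
   qed
   moreover have "path_component ?T (w * (g + \<tau> *\<^sub>R 1)) (w * (h + \<tau> *\<^sub>R 1))"
   proof (rule path_component_linepath_image)
    fix s :: real assume s: "s \<in> {0..1}"
    let ?k = "(1 - s) *\<^sub>R g + s *\<^sub>R h"
    have eq: "(1 - s) *\<^sub>R (w * (g + \<tau> *\<^sub>R 1)) + s *\<^sub>R (w * (h + \<tau> *\<^sub>R 1)) = w * (?k + \<tau> *\<^sub>R 1)"
     by (simp add: algebra_simps)
    have "w * (?k + \<tau> *\<^sub>R 1) \<in> GL ?S" using s \<tau>
     by (intro U.GL_mult U.UG_GL w U.pos_plus_GL pos_add pos_scaleR gpos hpos U.in_S gS hS) auto
    moreover have "norm (w * (?k + \<tau> *\<^sub>R 1) - x) < \<theta>"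
    proof -
     have "w * (?k + \<tau> *\<^sub>R 1) - x = (w * h - x) + ((1 - s) *\<^sub>R (w * (g - h)) + \<tau> *\<^sub>R w)"
      by (simp add: algebra_simps)
     then have "norm (w * (?k + \<tau> *\<^sub>R 1) - x) <= norm (w * h - x) + (norm ((1 - s) *\<^sub>R (w * (g - h))) + norm (\<tau> *\<^sub>R w))"
      by (simp only:) (intro order_trans[OF norm_triangle_ineq] add_mono norm_triangle_ineq order_refl)
     moreover have "norm ((1 - s) *\<^sub>R (w * (g - h))) <= 1 * \<omega>"
      unfolding norm_scaleR using s gh wm[of "g - h"] \<omega> by (intro mult_mono) auto
     ultimately show ?thesis using whx \<tau> nw \<omega> th by (simp add: \<tau>_def)
    qed
    ultimately show "(1 - s) *\<^sub>R (w * (g + \<tau> *\<^sub>R 1)) + s *\<^sub>R (w * (h + \<tau> *\<^sub>R 1)) \<in> ?T"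
     unfolding eq by (simp add: dist_norm norm_minus_commute)
   qed
   ultimately show ?thesis using w(1) whx path_component_trans by blast
  qed
  obtain w0 where w0: "w0 \<in> UG ?S" "norm (w0 * h - x) <= 2 * \<omega>" "path_component ?T y0 (w0 * (h + \<tau> *\<^sub>R 1))"
   using pol[OF y0] by blast
  obtain w1 where w1: "w1 \<in> UG ?S" "norm (w1 * h - x) <= 2 * \<omega>" "path_component ?T y1 (w1 * (h + \<tau> *\<^sub>R 1))"
   using pol[OF y1] by blast
  note w0D = UG_D[OF w0(1)]
  \<comment> \<open>\<open>w\<close> compares the two unitary parts and almost fixes
    \<open>h\<close>. Applying the extension result to the positive element \<open>h\<close> instead
    of \<open>x\<close> makes the prescribed value on \<open>F0\<close> the identity.\<close>
  define w where "w = adj w0 * w1"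
  have wU: "w \<in> UG ?S" unfolding w_def by (intro U.UG_mult U.UG_adj w0 w1)
  have w01: "w0 * w = w1" unfolding w_def using w0D by (simp add: mult.assoc[symmetric])
  define H where "H = adj h * h"
  have ah: "adj h = h" by (rule pos_adj[OF hpos])
  have Hh: "H = h * h" "H = h * adj h" by (simp_all add: H_def ah)
  have H: "pc H" unfolding H_def by (rule pc_adj_mult[OF nh])
  have hH: "h = fcal sqrt H" unfolding Hh(1) by (rule fcal_sqrt_square[OF h, symmetric])
  have ci: "continuous_on {0..1} (isq e)" by (rule isq_cont[OF e(1)])
  define F0 where "F0 = fcal ?f0 H"
  have cut: "cut e h = fcal (%t. sqrt t * isq e t) H"
   unfolding cut_def H_def[symmetric] fcal_mult[OF H csqrt01 ci] hH[symmetric] ..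
  have mcut: "mabs 1 (cut e h) = cut e h"
   by (rule trans[OF cut_mabs[OF nh e(1), folded H_def] cut[symmetric]])
  have "adj w0 * (w0 * h) = h" using w0D by (simp add: mult.assoc[symmetric])
  then have "w * h - h = adj w0 * ((w1 * h - x) - (w0 * h - x))"
   unfolding w_def by (simp add: algebra_simps)
  moreover have "norm (adj w0 * v) <= norm v" for v using norm_mult3[of "adj w0" v] w0D by simp
  ultimately have "norm (w * h - h) <= norm ((w1 * h - x) - (w0 * h - x))" by simp
  then have wh: "norm (w * h - h) <= 4 * \<omega>"
   using norm_triangle_ineq4[of "w1 * h - x" "w0 * h - x"] w0(2) w1(2) by simp
  have "norm (cut e h - w * mabs 1 (cut e h)) <= \<eta>"
  proof -
   have "cut e h - w * mabs 1 (cut e h) = (h - w * h) * fcal (isq e) H"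
    unfolding mcut unfolding cut_def H_def by (simp add: left_diff_distrib mult.assoc)
   then have "norm (cut e h - w * mabs 1 (cut e h)) <= norm (h - w * h) * norm (fcal (isq e) H)"
    by (simp only: norm_mult_ineq)
   also have "\<dots> <= (4 * \<omega>) * (1 / sqrt e)"
   proof (intro mult_mono)
    show "norm (fcal (isq e) H) <= 1 / sqrt e"
     using isq_le[OF e(1)] isq_pos[OF e(1)] by (intro fcal_norm[OF H ci]) (simp add: abs_of_pos)
   qed (use wh \<omega> in \<open>auto simp: norm_minus_commute\<close>)
   also have "\<dots> <= \<eta>" using \<omega>(3) e(1) by (simp add: field_simps)
   finally show ?thesis .
  qed
  from ext[OF hS wU nh this] obtain u where u: "u \<in> UG ?S" "norm (u - w) <= \<zeta>"
   "u * F0 = cut e h * F0" "F0 * u = cut e h * F0"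
   unfolding F0_def H_def[symmetric] Hh(2)[symmetric] by blast
  have "cut e h * F0 = fcal (%t. sqrt t * isq e t * ?f0 t) H"
   unfolding cut F0_def by (simp add: fcal_mult[OF H] ci c0 csqrt01 continuous_intros)
  also have "\<dots> = F0" unfolding F0_def
  proof (rule fcal_cong[OF H])
   show "sqrt t * isq e t * ?f0 t = ?f0 t" for t
    using sqrt_isq[OF e(1), of t] ramp_0[of "2*e" "3*e" t] e(1) by (cases "t <= 2*e") auto
  qed (intro continuous_intros ci c0)
  finally have uF: "u * F0 = F0" "F0 * u = F0" using u by simp_all
  have HS: "H \<in> ?S" unfolding H_def by (intro U.in_S hS)
  have FS: "F0 \<in> ?S" unfolding F0_def by (rule U.fcal_S[OF HS H c0])
  have aF: "adj F0 = F0" unfolding F0_def by (rule fcal_adj[OF H c0])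
  interpret N: cideal chi "ann A F0" by (rule cideal_ann[OF aF])
  have "H = adj x * x" unfolding Hh(1) h_def by (rule mabs_sq) (use x1 in auto)
  then have "Re (chi H) = c\<^sup>2" by (simp add: chi_mult chi_adj chx power2_eq_square)
  then have chF: "chi F0 = 1" unfolding F0_def using ramp_1[of "2*e" "3*e" "c\<^sup>2"] e by (simp add: chi_fcal[OF H c0])
  \<comment> \<open>\<open>u\<close> fixes \<open>F0\<close>, which has scalar part 1; hence
    \<open>u\<close> has scalar part 1, and \<open>u - 1\<close> lies in \<open>A\<close> and
    annihilates \<open>F0\<close> on both sides.\<close>
  have chu: "chi u = 1" using arg_cong[OF uF(1), of chi] by (simp add: chi_mult chF)
  have "u - cplx 1 \<in> A" using UG_D(1)[OF u(1)] chu by (simp add: unz_def)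
  then have "u \<in> unz chi (ann A F0)" using uF by (simp add: unz_def ann_def chu algebra_simps)
  then have uU: "u \<in> UG (unz chi (ann A F0))" using UG_D[OF u(1)] by (simp add: UG_def)
  obtain g where g: "path g" "path_image g \<subseteq> UG (unz chi (ann A F0))" "pathstart g = 1" "pathfinish g = u"
   using conn[OF FS aF uU] by (auto simp: path_component_def)
  have hF: "norm ((1 - F0) * h) <= sqrt (3 * e)"
  proof -
   let ?g = "%t. 1 - ?f0 t"
   have cg: "continuous_on {0..1} ?g" by (intro continuous_intros c0)
   have G: "fcal ?g H = 1 - F0" unfolding F0_def by (simp add: fcal_diff[OF H continuous_on_const c0] fcal_const[OF H])
   have "(1 - F0) * h = fcal (%t. ?g t * sqrt t) H"
    by (simp only: fcal_mult[OF H cg csqrt01] G hH[symmetric])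
   moreover have "norm (fcal (%t. ?g t * sqrt t) H) <= sqrt (3 * e)"
   proof (rule fcal_norm[OF H])
    fix t :: real assume t: "t \<in> {0..1}"
    show "\<bar>?g t * sqrt t\<bar> <= sqrt (3 * e)"
    proof (cases "t <= 3 * e")
     case True
     then have "?g t * sqrt t <= 1 * sqrt (3 * e)" using t e ramp_01[of "2*e" "3*e" t]
      by (intro mult_mono) auto
     then show ?thesis using t ramp_01[of "2*e" "3*e" t] by simp
    next
     case False
     then show ?thesis using ramp_1[of "2*e" "3*e" t] e by simp
    qed
   qed (intro continuous_intros cg)
   ultimately show ?thesis by simp
  qed
  have P4: "path_component ?T (w0 * (h + \<tau> *\<^sub>R 1)) (w0 * u * (h + \<tau> *\<^sub>R 1))"
  proof -
   \<comment> \<open>Dividing by the scalar part, a number of modulus 1, puts \<open>v t - 1\<close>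
     itself into the annihilator, so that \<open>v t\<close> moves \<open>h\<close> only below the
     cut-off.\<close>
   define v where "v t = cplx (1 / chi (g t)) * g t" for t
   have gt: "g t \<in> UG (unz chi (ann A F0))" if "t \<in> {0..1}" for t
    using g(2) that by (auto simp: path_image_def)
   have cg: "cmod (chi (g t)) = 1" if "t \<in> {0..1}" for t
    by (rule chi_unitary) (use UG_D[OF gt[OF that]] in auto)
   have cg0: "chi (g t) ~= 0" if "t \<in> {0..1}" for t using cg[OF that] by auto
   have cgc: "continuous_on {0..1} g" using g(1) by (simp add: path_def)
   have cv: "continuous_on {0..1} v" unfolding v_def
    by (intro continuous_intros cgc continuous_on_chi) (use cg0 in auto)
   have vN: "v t \<in> unz chi (ann A F0)" "chi (v t) = 1" "norm (v t) = 1" if "t \<in> {0..1}" for t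
    unfolding v_def using cg0[OF that] cg[OF that] UG_D[OF gt[OF that]]
    by (auto intro!: N.U.in_S simp: chi_mult chi_cplx norm_divide)
   have vann: "v t - 1 \<in> ann A F0" if "t \<in> {0..1}" for t using vN(1,2)[OF that] by (simp add: unz_def)
   have vG: "v t \<in> GL ?S" if "t \<in> {0..1}" for t
   proof -
    have "g t \<in> UG ?S" using gt[OF that] by (auto simp: UG_def unz_def ann_def)
    then show ?thesis unfolding v_def using cg0[OF that] by (intro U.GL_mult U.GL_cplx U.UG_GL) auto
   qed
   have inT: "w0 * v t * (h + \<tau> *\<^sub>R 1) \<in> ?T" if "t \<in> {0..1}" for t
   proof -
    have "w0 * v t * (h + \<tau> *\<^sub>R 1) \<in> GL ?S"
     by (intro U.GL_mult U.UG_GL w0 vG that U.pos_plus_GL hS hpos \<tau>)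
    moreover have "norm (w0 * v t * (h + \<tau> *\<^sub>R 1) - x) < \<theta>"
    proof -
     have "(v t - 1) * F0 = 0" using vann[OF that] by (simp add: ann_def)
     then have "(v t - 1) * h = (v t - 1) * ((1 - F0) * h)"
      by (simp add: left_diff_distrib right_diff_distrib mult.assoc[symmetric])
     then have "norm ((v t - 1) * h) <= norm (v t - 1) * norm ((1 - F0) * h)" by (simp only: norm_mult_ineq)
     also have "\<dots> <= 2 * (\<theta> / 16)"
      using hF s3 norm_triangle_ineq4[of "v t" 1] vN(3)[OF that] by (intro mult_mono) auto
     finally have 1: "norm ((v t - 1) * h) <= \<theta> / 8" by simp
     have "w0 * v t * (h + \<tau> *\<^sub>R 1) - x = (w0 * h - x) + (w0 * ((v t - 1) * h) + \<tau> *\<^sub>R (w0 * v t))"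
      by (simp add: algebra_simps)
     then have "norm (w0 * v t * (h + \<tau> *\<^sub>R 1) - x) <= norm (w0 * h - x) + (norm (w0 * ((v t - 1) * h)) + norm (\<tau> *\<^sub>R (w0 * v t)))"
      by (simp only:) (intro order_trans[OF norm_triangle_ineq] add_mono norm_triangle_ineq order_refl)
     moreover have "norm (w0 * ((v t - 1) * h)) <= \<theta> / 8" using norm_mult3[of w0 "(v t - 1) * h"] 1 w0D by simp
     moreover have "norm (\<tau> *\<^sub>R (w0 * v t)) <= \<tau>" using norm_mult3[of w0 "v t"] w0D vN(3)[OF that] \<tau> by simp
     ultimately show ?thesis using w0(2) \<omega>(2) th \<tau>_def by linarith
    qed
    ultimately show ?thesis by (simp add: dist_norm norm_minus_commute)
   qed
   have "path (%t. w0 * v t * (h + \<tau> *\<^sub>R 1))" unfolding path_def by (intro continuous_intros cv)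
   moreover have "g 0 = 1" "g 1 = u" using g(3,4) by (auto simp: pathstart_def pathfinish_def)
   then have "v 0 = 1" "v 1 = u" by (simp_all add: v_def chu)
   ultimately show ?thesis unfolding path_component_def using inT
    by (intro exI[of _ "%t. w0 * v t * (h + \<tau> *\<^sub>R 1)"]) (auto simp: path_image_def pathstart_def pathfinish_def)
  qed
  \<comment> \<open>\<open>u\<close> is within \<open>\<zeta> < 1\<close> of the unitary
    \<open>w\<close>, so the segment between them consists of invertible elements.\<close>
  have P3: "path_component ?T (w0 * u * (h + \<tau> *\<^sub>R 1)) (w1 * (h + \<tau> *\<^sub>R 1))"
  proof (rule path_component_linepath_image)
   fix s :: real assume s: "s \<in> {0..1}"
   define k where "k = u + s *\<^sub>R (w - u)"
   have eq: "(1 - s) *\<^sub>R (w0 * u * (h + \<tau> *\<^sub>R 1)) + s *\<^sub>R (w1 * (h + \<tau> *\<^sub>R 1)) = w0 * k * (h + \<tau> *\<^sub>R 1)"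
    unfolding w01[symmetric] k_def by (simp add: algebra_simps)
   have uk: "norm (u - k) <= \<zeta>"
    using s u(2) mult_left_le_one_le[of "norm (w - u)" s] by (simp add: k_def norm_minus_commute)
   have kS: "k \<in> ?S" unfolding k_def by (intro U.in_S UG_D(1)[OF u(1)] UG_D(1)[OF wU])
   have "minv u = adj u" using UG_D[OF u(1)] by (intro minv_eq)
   then have kG: "k \<in> GL ?S" using uk z UG_D(4)[OF u(1)] by (intro U.GL_near[OF U.UG_GL[OF u(1)] kS]) simp
   have "k = (1 - s) *\<^sub>R u + s *\<^sub>R w" by (simp add: k_def algebra_simps)
   then have nk: "norm k <= 1"
    using s norm_triangle_ineq[of "(1 - s) *\<^sub>R u" "s *\<^sub>R w"] UG_D(4)[OF u(1)] UG_D(4)[OF wU] by simp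
   have "norm (w - k) <= \<zeta>"
   proof -
    have "w - k = (1 - s) *\<^sub>R (w - u)" by (simp add: k_def algebra_simps)
    then show ?thesis using s u(2) mult_left_le_one_le[of "norm (w - u)" "1 - s"] by (simp add: norm_minus_commute)
   qed
   then have "norm (w0 * ((k - w) * h)) <= \<zeta>"
    using norm_mult3[of w0 "(k - w) * h"] norm_mult3'[OF nh, of "k - w"] w0D by (simp add: norm_minus_commute)
   moreover have "norm (\<tau> *\<^sub>R (w0 * k)) <= \<tau>" using norm_mult3[of w0 k] w0D nk \<tau> by simp
   moreover have "w0 * k * (h + \<tau> *\<^sub>R 1) - x = (w1 * h - x) + (w0 * ((k - w) * h) + \<tau> *\<^sub>R (w0 * k))"
    unfolding w01[symmetric] by (simp add: algebra_simps)
   then have "norm (w0 * k * (h + \<tau> *\<^sub>R 1) - x) <= norm (w1 * h - x) + (norm (w0 * ((k - w) * h)) + norm (\<tau> *\<^sub>R (w0 * k)))"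
    by (simp only:) (intro order_trans[OF norm_triangle_ineq] add_mono norm_triangle_ineq order_refl)
   ultimately have "norm (w0 * k * (h + \<tau> *\<^sub>R 1) - x) < \<theta>" using w1(2) \<omega>(2) z(2) th \<tau>_def by linarith
   moreover have "w0 * k * (h + \<tau> *\<^sub>R 1) \<in> GL ?S"
    by (intro U.GL_mult U.UG_GL w0 kG U.pos_plus_GL hS hpos \<tau>)
   ultimately show "(1 - s) *\<^sub>R (w0 * u * (h + \<tau> *\<^sub>R 1)) + s *\<^sub>R (w1 * (h + \<tau> *\<^sub>R 1)) \<in> ?T"
    unfolding eq by (simp add: dist_norm norm_minus_commute)
  qed
  show "path_component ?T y0 y1"
   using w0(3) P4 P3 w1(3) by (meson path_component_trans path_component_sym)
 qed (use \<delta> in auto)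
qed

section \<open>Matrices over a C*-subalgebra\<close>

type_synonym 'a mtx = "nat => nat => 'a"

text \<open>Matrices vanish outside their index range, so that equality of matrices is equality of functions.\<close>

definition mats :: "nat => 'a::ucstar set => 'a mtx set" where
 "mats m S = {P. (\<forall>i<m. \<forall>j<m. P i j \<in> S) & (\<forall>i j. \<not> (i < m & j < m) --> P i j = 0)}"

definition mm :: "nat => 'a::ucstar mtx => 'a mtx => 'a mtx" where
 "mm m P Q = (%i j. \<Sum>k<m. P i k * Q k j)"

definition mI :: "nat => 'a::ucstar mtx" where
 "mI m = (%i j. if i = j & i < m then 1 else 0)"

definition madj :: "'a::ucstar mtx => 'a mtx" where
 "madj P = (%i j. adj (P j i))"

definition UGM :: "nat => 'a::ucstar set => 'a mtx set" where
 "UGM m S = {P \<in> mats m S. mm m (madj P) P = mI m & mm m P (madj P) = mI m}"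

lemma matsD: "P \<in> mats m S ==> i < m ==> j < m ==> P i j \<in> S"
 "P \<in> mats m S ==> \<not> (i < m & j < m) ==> P i j = 0"
 by (auto simp: mats_def)

lemma mats_eqI:
 assumes "P \<in> mats m S" "Q \<in> mats m S'" "\<And>i j. i < m ==> j < m ==> P i j = Q i j"
 shows "P = Q"
proof (intro ext)
 show "P i j = Q i j" for i j using assms by (cases "i < m & j < m") (auto simp: mats_def)
qed

lemma mm_assoc: "mm m (mm m P Q) R = mm m P (mm m Q R)"
proof (intro ext)
 fix i j
 have "mm m (mm m P Q) R i j = (\<Sum>k<m. \<Sum>l<m. P i l * (Q l k * R k j))"
  by (simp add: mm_def sum_distrib_right mult.assoc)
 also have "\<dots> = (\<Sum>l<m. \<Sum>k<m. P i l * (Q l k * R k j))" by (rule sum.swap)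
 also have "\<dots> = mm m P (mm m Q R) i j" by (simp add: mm_def sum_distrib_left)
 finally show "mm m (mm m P Q) R i j = mm m P (mm m Q R) i j" .
qed

lemma mm_mI_left: assumes "P \<in> mats m S" shows "mm m (mI m) P = P"
proof (intro ext)
 fix i j
 have "mm m (mI m) P i j = (\<Sum>k<m. if k = i then P i j else 0)"
  unfolding mm_def mI_def by (rule sum.cong) auto
 then show "mm m (mI m) P i j = P i j" using matsD(2)[OF assms, of i j] by auto
qed

lemma mm_mI_right: assumes "P \<in> mats m S" shows "mm m P (mI m) = P"
proof (intro ext)
 fix i j
 have "mm m P (mI m) i j = (\<Sum>k<m. if k = j then P i j else 0)"
  unfolding mm_def mI_def by (rule sum.cong) auto
 then show "mm m P (mI m) i j = P i j" using matsD(2)[OF assms, of i j] by auto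
qed

lemma madj_mm: "madj (mm m P Q) = mm m (madj Q) (madj P)"
proof -
 have "adj (sum f I) = (\<Sum>i\<in>I. adj (f i))" for f :: "nat => 'a" and I
  by (induction I rule: infinite_finite_induct) (auto simp: adj_add)
 then show ?thesis by (simp add: madj_def mm_def adj_mult fun_eq_iff)
qed

lemma madj_madj [simp]: "madj (madj P) = P" by (simp add: madj_def)
lemma madj_mI [simp]: "madj (mI m) = mI m" by (auto simp: madj_def mI_def fun_eq_iff)

lemma continuous_on_mtx:
 fixes F :: "'b::topological_space => 'a::topological_space mtx"
 shows "continuous_on D F \<longleftrightarrow> (\<forall>i j. continuous_on D (%t. F t i j))"
proof (intro iffI allI)
 show "continuous_on D (%t. F t i j)" if "continuous_on D F" for i j
  using continuous_on_product_then_coordinatewise[OF continuous_on_product_then_coordinatewise[OF that]] .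
qed (intro continuous_on_coordinatewise_then_product, blast)

lemma continuous_on_if_const:
 "(P ==> continuous_on D f) ==> (\<not> P ==> continuous_on D g) ==> continuous_on D (%t. if P then f t else g t)"
 by (cases P) auto

lemma continuous_on_mm:
 assumes "continuous_on D F" "continuous_on D G"
 shows "continuous_on D (%t. mm m (F t) (G t))"
 using assms unfolding continuous_on_mtx mm_def by (auto intro!: continuous_intros)

lemma continuous_on_madj:
 assumes "continuous_on D F"
 shows "continuous_on D (%t. madj (F t))"
 using assms unfolding continuous_on_mtx madj_def by (auto intro!: continuous_intros continuous_on_adj)

context csub
begin

lemma mm_mats: "P \<in> mats m S ==> Q \<in> mats m S ==> mm m P Q \<in> mats m S"
 unfolding mats_def mm_def by (auto intro!: sum_S mult_S sum.neutral)

lemma mI_mats: "mI m \<in> mats m S" by (auto simp: mats_def mI_def zero_S one_S)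

lemma madj_mats: "P \<in> mats m S ==> madj P \<in> mats m S"
 by (auto simp: mats_def madj_def adj_S)

lemma UGM_mI: "mI m \<in> UGM m S"
 by (simp add: UGM_def mI_mats mm_mI_left[OF mI_mats])

lemma UGM_mm:
 assumes P: "P \<in> UGM m S" and Q: "Q \<in> UGM m S"
 shows "mm m P Q \<in> UGM m S"
proof -
 have "mm m (madj (mm m P Q)) (mm m P Q) = mm m (madj Q) (mm m (mm m (madj P) P) Q)"
  "mm m (mm m P Q) (madj (mm m P Q)) = mm m P (mm m (mm m Q (madj Q)) (madj P))"
  by (simp_all only: madj_mm mm_assoc)
 moreover have "P \<in> mats m S" "Q \<in> mats m S" "madj P \<in> mats m S" using P Q by (auto simp: UGM_def madj_mats)
 ultimately show ?thesis using P Q by (auto simp: UGM_def mm_mats mm_mI_left)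
qed

lemma UGM_madj: "P \<in> UGM m S ==> madj P \<in> UGM m S"
 by (auto simp: UGM_def madj_mats)

definition Conn :: "nat => 'a mtx set" where
 "Conn m = {P. path_component (UGM m S) (mI m) P}"

lemma ConnI:
 fixes g :: "real => 'a mtx"
 assumes "\<And>t. t \<in> {0..1} ==> g t \<in> UGM m S" "continuous_on {0..1} g" "g 0 = mI m" "g 1 = P"
 shows "P \<in> Conn m"
 unfolding Conn_def path_component_def mem_Collect_eq
 by (rule exI[of _ g]) (use assms in \<open>auto simp: path_def path_image_def pathstart_def pathfinish_def\<close>)

lemma ConnE:
 assumes "P \<in> Conn m"
 obtains g :: "real => 'a mtx" where "\<And>t. t \<in> {0..1} ==> g t \<in> UGM m S" "continuous_on {0..1} g" "g 0 = mI m" "g 1 = P"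
proof -
 obtain g where "path g" "path_image g \<subseteq> UGM m S" "pathstart g = mI m" "pathfinish g = P"
  using assms by (auto simp: Conn_def path_component_def)
 then show ?thesis by (intro that[of g]) (auto simp: path_def path_image_def pathstart_def pathfinish_def)
qed

lemma Conn_UGM: "P \<in> Conn m ==> P \<in> UGM m S"
 unfolding Conn_def using path_component_mem(2) by fastforce

lemma Conn_mI: "mI m \<in> Conn m"
 by (rule ConnI[of "%_. mI m"]) (auto simp: UGM_mI)

lemma Conn_mm: assumes "P \<in> Conn m" "Q \<in> Conn m" shows "mm m P Q \<in> Conn m"
proof -
 obtain f :: "real => 'a mtx" where f: "\<And>t. t \<in> {0..1} ==> f t \<in> UGM m S" "continuous_on {0..1} f" "f 0 = mI m" "f 1 = P"
  using ConnE[OF assms(1)] by blast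
 obtain g :: "real => 'a mtx" where g: "\<And>t. t \<in> {0..1} ==> g t \<in> UGM m S" "continuous_on {0..1} g" "g 0 = mI m" "g 1 = Q"
  using ConnE[OF assms(2)] by blast
 show ?thesis
  by (rule ConnI[of "%t. mm m (f t) (g t)"])
   (auto simp: f g UGM_mm continuous_on_mm mm_mI_left[OF mI_mats])
qed

lemma Conn_madj: assumes "P \<in> Conn m" shows "madj P \<in> Conn m"
proof -
 obtain f :: "real => 'a mtx" where f: "\<And>t. t \<in> {0..1} ==> f t \<in> UGM m S" "continuous_on {0..1} f" "f 0 = mI m" "f 1 = P"
  using ConnE[OF assms(1)] by blast
 show ?thesis
  by (rule ConnI[of "%t. madj (f t)"]) (auto simp: f UGM_madj continuous_on_madj)
qed

end

section \<open>Rotations with operator entries and column reduction\<close>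

definition invrt :: "real => 'a::ucstar => 'a" where
 "invrt R x = fcal (%t. 1 / sqrt (1 + R\<^sup>2 * t)) ((1/R\<^sup>2) *\<^sub>R (adj x * x))"

lemma cinvrt: "continuous_on {0..1} (%t. 1 / sqrt (1 + R\<^sup>2 * t))"
proof -
 have "1 + R\<^sup>2 * t > 0" if "t >= 0" for t using that by (simp add: add_pos_nonneg)
 then show ?thesis by (intro continuous_intros) force
qed

lemma invrt_facts:
 fixes x :: "'a::ucstar"
 assumes x: "norm x <= R" "R > 0"
 defines "c \<equiv> invrt R (adj x)" and "d \<equiv> invrt R x"
 shows "adj d = d" "adj c = c" "c * x = x * d" "adj x * c = d * adj x"
  "d * (1 + adj x * x) * d = 1" "c * (1 + x * adj x) * c = 1"
  "d * d * (1 + adj x * x) = 1" "(1 + adj x * x) * (d * d) = 1"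
proof -
 let ?f = "%t. 1 / sqrt (1 + R\<^sup>2 * t)"
 have main: "adj (invrt R y) = invrt R y & invrt R y * (1 + adj y * y) * invrt R y = 1
   & invrt R y * invrt R y * (1 + adj y * y) = 1 & (1 + adj y * y) * (invrt R y * invrt R y) = 1"
  if y: "norm y <= R" for y :: 'a
 proof -
  define h where "h = (1/R\<^sup>2) *\<^sub>R (adj y * y)"
  have h: "pc h" unfolding h_def by (rule pc_scaled[OF y x(2)])
  have cg: "continuous_on {0..1} (%t. 1 + R\<^sup>2 * t)" by (intro continuous_intros)
  have "1 + adj y * y = fcal (%t. 1 + R\<^sup>2 * t) h"
   using fcal_add[OF h continuous_on_const, of "%t. R\<^sup>2 * t" 1] fcal_mult[OF h continuous_on_const continuous_on_id, of "R\<^sup>2"] x(2)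
   by (simp add: fcal_const[OF h] fcal_id[OF h] continuous_intros) (simp add: h_def)
  then have e: "invrt R y = fcal ?f h" "1 + adj y * y = fcal (%t. 1 + R\<^sup>2 * t) h" by (auto simp: invrt_def h_def)
  have pz: "1 + R\<^sup>2 * t > 0" if "t \<in> {0..1}" for t using that by (simp add: add_pos_nonneg)
  have "fcal (%_. 1) h = fcal (%t. ?f t * (1 + R\<^sup>2 * t) * ?f t) h" "fcal (%_. 1) h = fcal (%t. ?f t * ?f t * (1 + R\<^sup>2 * t)) h"
   "fcal (%_. 1) h = fcal (%t. (1 + R\<^sup>2 * t) * (?f t * ?f t)) h"
   using pz by (auto intro!: fcal_cong[OF h] continuous_intros simp: less_imp_le less_imp_neq[symmetric])
  moreover have cf: "continuous_on {0..1} ?f" by (rule cinvrt)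
  ultimately have "fcal ?f h * fcal (%t. 1 + R\<^sup>2 * t) h * fcal ?f h = 1" "fcal ?f h * fcal ?f h * fcal (%t. 1 + R\<^sup>2 * t) h = 1"
   "fcal (%t. 1 + R\<^sup>2 * t) h * (fcal ?f h * fcal ?f h) = 1"
   using cg by (simp_all only: fcal_mult[OF h] continuous_on_mult fcal_const[OF h] scaleR_one)
  then show ?thesis unfolding e using fcal_adj[OF h cf] by blast
 qed
 show "adj d = d" "adj c = c" "d * (1 + adj x * x) * d = 1" "c * (1 + x * adj x) * c = 1"
  "d * d * (1 + adj x * x) = 1" "(1 + adj x * x) * (d * d) = 1"
  using main[of x] main[of "adj x"] x unfolding c_def d_def by simp_all
 have p: "pc ((1/R\<^sup>2) *\<^sub>R (adj x * x))" "pc ((1/R\<^sup>2) *\<^sub>R (x * adj x))"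
  using pc_scaled[of x R] pc_scaled[of "adj x" R] x by simp_all
 have "x * d = c * x" unfolding c_def d_def invrt_def adj_adj
  by (rule fcal_intertwine[OF p cinvrt]) (simp add: mult.assoc)
 then show "c * x = x * d" by simp
 have "adj (c * x) = adj (x * d)" using \<open>c * x = x * d\<close> by simp
 then show "adj x * c = d * adj x" by (simp add: adj_mult \<open>adj d = d\<close> \<open>adj c = c\<close>)
qed

lemma invrt_0: "R > 0 ==> invrt R 0 = 1"
 using fcal_scalar[of 0 "%t. 1 / sqrt (1 + R\<^sup>2 * t)", OF _ _ cinvrt] by (simp add: invrt_def)

text \<open>A rotation in the coordinates i and l with noncommutative slope \<open>x\<close>: its
  block is ((c, x d), (-x' c, d)), where x' is \<open>adj x\<close> and c, d are the inverse square
  roots of 1 + x x' and 1 + x' x. Letting the slope shrink to 0 connects it to the identity.\<close>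

definition givens :: "nat => nat => real => 'a::ucstar => 'a mtx" where
 "givens l i R x = (%a b. if a < Suc l & b < Suc l then
  (if a = i then (if b = i then invrt R (adj x) else if b = l then x * invrt R x else 0)
   else if a = l then (if b = i then - (adj x * invrt R (adj x)) else if b = l then invrt R x else 0)
   else if a = b then 1 else 0) else 0)"

lemma sum_two:
 fixes f :: "nat => 'a::comm_monoid_add"
 assumes "i < l" "\<And>k. k ~= i ==> k ~= l ==> f k = 0"
 shows "(\<Sum>k<Suc l. f k) = f i + f l"
proof -
 have "(\<Sum>k<Suc l. f k) = (\<Sum>k\<in>{i, l}. f k)" using assms by (intro sum.mono_neutral_right) auto
 then show ?thesis using assms(1) by simp
qed

lemma sum_one:
 fixes f :: "nat => 'a::comm_monoid_add"
 assumes "i < n" "\<And>k. k ~= i ==> f k = 0"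
 shows "(\<Sum>k<n. f k) = f i"
proof -
 have "(\<Sum>k<n. f k) = (\<Sum>k\<in>{i}. f k)" using assms by (intro sum.mono_neutral_right) auto
 then show ?thesis by simp
qed

lemma givens_rows:
 assumes i: "i < l" and x: "norm x <= R" "R > 0"
 shows "mm (Suc l) (givens l i R x) P i j = invrt R (adj x) * (P i j + x * P l j)"
  and "mm (Suc l) (givens l i R x) P l j = invrt R x * (P l j - adj x * P i j)"
  and "a ~= i ==> a < l ==> mm (Suc l) (givens l i R x) P a j = P a j"
proof -
 note F = invrt_facts[OF x]
 have "mm (Suc l) (givens l i R x) P i j = invrt R (adj x) * P i j + x * invrt R x * P l j"
  unfolding mm_def using i by (subst sum_two[OF i]) (auto simp: givens_def)
 then show "mm (Suc l) (givens l i R x) P i j = invrt R (adj x) * (P i j + x * P l j)"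
  by (simp add: distrib_left mult.assoc[symmetric] F(3))
 have "mm (Suc l) (givens l i R x) P l j = - (adj x * invrt R (adj x)) * P i j + invrt R x * P l j"
  unfolding mm_def using i by (subst sum_two[OF i]) (auto simp: givens_def)
 then show "mm (Suc l) (givens l i R x) P l j = invrt R x * (P l j - adj x * P i j)"
  by (simp add: right_diff_distrib mult.assoc[symmetric] F(4))
 assume a: "a ~= i" "a < l"
 show "mm (Suc l) (givens l i R x) P a j = P a j"
  unfolding mm_def using a by (subst sum_one[of a]) (auto simp: givens_def)
qed

lemma givens_adj:
 assumes i: "i < l" and x: "norm x <= R" "R > 0"
 shows "madj (givens l i R x) = givens l i R (- x)"
proof -
 note F = invrt_facts[OF x]
 have m: "invrt R (- x) = invrt R x" "invrt R (- adj x) = invrt R (adj x)" by (simp_all add: invrt_def)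
 show ?thesis unfolding madj_def givens_def using i
  by (intro ext) (auto simp: adj_mult F(1-4) m)
qed

lemma givens_unitary:
 assumes i: "i < l" and x: "norm x <= R" "R > 0"
 shows "mm (Suc l) (givens l i R x) (madj (givens l i R x)) = mI (Suc l)"
proof (intro ext)
 fix a j
 note F = invrt_facts[OF x]
 note rows = givens_rows[OF i x]
 have m: "invrt R (- x) = invrt R x" "invrt R (- adj x) = invrt R (adj x)" by (simp_all add: invrt_def)
 let ?c = "invrt R (adj x)" and ?d = "invrt R x" and ?G = "givens l i R (- x)"
 have il: "i ~= l" "l ~= i" using i by auto
 have 1: "?c * (?c + x * (adj x * ?c)) = 1" using F(6) by (simp add: algebra_simps)
 have 2: "?d * (?d + adj x * (x * ?d)) = 1" using F(5) by (simp add: algebra_simps)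
 have Gi: "?G i j = (if j = i then ?c else if j = l then - (x * ?d) else 0)"
  using i il by (auto simp: givens_def m)
 have Gl: "?G l j = (if j = i then adj x * ?c else if j = l then ?d else 0)"
  using i il by (auto simp: givens_def m)
 consider (ci) "a = i" | (cl) "a = l" | (cm) "a ~= i" "a < l" | (co) "a > l" using i by linarith
 then show "mm (Suc l) (givens l i R x) (madj (givens l i R x)) a j = mI (Suc l) a j"
 proof cases
  case ci
  show ?thesis unfolding ci givens_adj[OF i x] rows Gi Gl
   using i il by (auto simp: mI_def 1)
 next
  case cl
  show ?thesis unfolding cl givens_adj[OF i x] rows Gi Gl
   using i il by (auto simp: mI_def 2)
 next
  case cm
  then show ?thesis unfolding givens_adj[OF i x] rows(3)[OF cm] by (auto simp: givens_def mI_def)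
 next
  case co
  then show ?thesis by (simp add: mm_def givens_def mI_def)
 qed
qed

context csub
begin

lemma invrt_S: "x \<in> S ==> norm x <= R ==> R > 0 ==> invrt R x \<in> S"
 unfolding invrt_def by (intro in_S pc_scaled cinvrt)

lemma givens_UGM:
 assumes i: "i < l" and x: "norm x <= R" "R > 0" "x \<in> S"
 shows "givens l i R x \<in> UGM (Suc l) S"
proof -
 have "givens l i R x \<in> mats (Suc l) S"
  unfolding mats_def givens_def using x
  by (auto intro!: invrt_S in_S)
 moreover have "mm (Suc l) (givens l i R (- x)) (madj (givens l i R (- x))) = mI (Suc l)"
  using x by (intro givens_unitary[OF i]) auto
 then have "mm (Suc l) (madj (givens l i R x)) (givens l i R x) = mI (Suc l)"
  using givens_adj[OF i, of x R] givens_adj[OF i, of "- x" R] x by simp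
 ultimately show ?thesis using givens_unitary[OF i x(1,2)] by (simp add: UGM_def)
qed

lemma givens_Conn:
 assumes i: "i < l" and x: "norm x <= R" "R > 0" "x \<in> S"
 shows "givens l i R x \<in> Conn (Suc l)"
proof (rule ConnI[of "%t. givens l i R (t *\<^sub>R x)"])
 have n: "norm (t *\<^sub>R x) <= R" if "t \<in> {0..1}" for t
  using that x mult_left_le_one_le[of "norm x" t] by simp
 show "givens l i R (t *\<^sub>R x) \<in> UGM (Suc l) S" if "t \<in> {0..1}" for t
  using n[OF that] x by (intro givens_UGM[OF i] scaleR_S)
 have c1: "continuous_on {0..1} (%t. invrt R (t *\<^sub>R x))" unfolding invrt_def
  by (intro continuous_on_fcal cinvrt continuous_intros continuous_on_adj pc_scaled n x)
 have c2: "continuous_on {0..1} (%t. invrt R (adj (t *\<^sub>R x)))" unfolding invrt_def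
  by (intro continuous_on_fcal cinvrt continuous_intros continuous_on_adj pc_scaled) (use n x in auto)
 show "continuous_on {0..1} (%t. givens l i R (t *\<^sub>R x))"
  unfolding continuous_on_mtx
  unfolding givens_def by (intro allI continuous_on_if_const continuous_intros c1 c2 continuous_on_adj)
 show "givens l i R (0 *\<^sub>R x) = mI (Suc l)" using x i by (auto simp: givens_def mI_def invrt_0 fun_eq_iff)
qed simp

text \<open>Forgets the square roots: afterwards only invertibility of the normalising factors
  matters, together with that of the factor which the corner acquires when entry i is
  cleared.\<close>

lemma givens_op:
 assumes i: "i < l" and x: "x \<in> S"
 obtains W c d where "W \<in> Conn (Suc l)" "c \<in> GL S" "d \<in> GL S"
  "\<And>P j. mm (Suc l) W P i j = c * (P i j + x * P l j)"
  "\<And>P j. mm (Suc l) W P l j = d * (P l j - adj x * P i j)"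
  "\<And>P a j. a ~= i ==> a < l ==> mm (Suc l) W P a j = P a j"
  "d * (1 + adj x * x) \<in> GL S"
proof -
 define R where "R = norm x + 1"
 have R: "norm x <= R" "R > 0" by (auto simp: R_def add_nonneg_pos)
 have g: "invrt R y \<in> GL S" if y: "norm y <= R" "y \<in> S" for y
 proof -
  let ?d = "invrt R y" and ?p = "1 + adj y * y"
  note F = invrt_facts[OF y(1) R(2)]
  have p: "?p \<in> S" by (intro in_S y)
  have 1: "?d * (?d * ?p) = 1" "(?p * ?d) * ?d = 1" using F(7,8) by (simp_all add: mult.assoc)
  have "?p * ?d = ?p * ?d * (?d * (?d * ?p))" using 1 by simp
  also have "\<dots> = (?p * ?d * ?d) * (?d * ?p)" by (simp only: mult.assoc)
  finally have "?p * ?d = ?d * ?p" using 1 by simp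
  then have "?d * (?d * ?p) = 1" "(?d * ?p) * ?d = 1" using 1 by simp_all
  then show ?thesis unfolding GL_def using invrt_S[OF y(2,1) R(2)] p by (auto intro!: bexI[of _ "?d * ?p"] in_S)
 qed
 have "invrt R x * (1 + adj x * x) \<in> GL S"
 proof (rule GL_mult[OF g[OF R(1) x]])
  have "adj x * x + 1 *\<^sub>R 1 \<in> GL S" by (rule pos_plus_GL) (auto intro!: in_S x pos_adj_mult)
  then show "1 + adj x * x \<in> GL S" by (simp add: add.commute)
 qed
 moreover have "invrt R (adj x) \<in> GL S" using R x by (intro g adj_S) auto
 ultimately show ?thesis using that[OF givens_Conn[OF i R x] _ g[OF R(1) x] givens_rows[OF i R]] by blast
qed

text \<open>The two lemmas below clear the last column of a unitary matrix by rotations: first the corner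
 entry is made invertible, then the other entries are annihilated.\<close>

lemma corner_invertible:
 assumes d: "GLdense S" and U: "U \<in> UGM (Suc l) S"
 obtains W where "W \<in> Conn (Suc l)" "mm (Suc l) W U l l \<in> GL S"
proof -
 define v where "v k = U k l" for k
 have vS: "v k \<in> S" if "k <= l" for k using U that by (auto simp: UGM_def mats_def v_def)
 have "mm (Suc l) (madj U) U l l = mI (Suc l) l l" using U by (simp add: UGM_def)
 then have one: "(\<Sum>k<Suc l. adj (v k) * v k) = 1" by (simp add: mm_def madj_def mI_def v_def)
 define N where "N = norm (v l) + 1"
 have N: "N > 0" by (simp add: N_def add_nonneg_pos)
 obtain y where y: "y \<in> GL S" "norm (v l - y) < 1 / N"
  using d vS[of l] N unfolding GLdense_def by (metis order_refl zero_less_divide_1_iff)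
 define f where "f = y - v l"
 have fS: "f \<in> S" unfolding f_def using y GL_subset vS by (auto intro!: diff_S)
 define q where "q = 1 + f * adj (v l)"
 have "norm (f * adj (v l)) <= norm f * norm (adj (v l))" by (rule norm_mult_ineq)
 also have "\<dots> <= norm f * N" by (intro mult_left_mono) (auto simp: N_def)
 also have "\<dots> < 1" using y(2) N by (simp add: f_def norm_minus_commute field_simps)
 finally have q: "q \<in> GL S" unfolding q_def by (intro GL_near_one in_S fS vS) auto
 define z where "z k = minv q * (f * adj (v k))" for k
 have zS: "z k \<in> S" if "k <= l" for k unfolding z_def by (intro in_S minv(3)[OF q] fS vS that)
 \<comment> \<open>The column has absolute square 1, so the perturbation \<open>f\<close> of the
   corner is itself a left combination of the entries; the summand with index l is absorbed into the
   invertible \<open>q\<close>. Adding the multiples \<open>z k * v k\<close> of the other entries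
   therefore makes the corner invertible.\<close>
 have "y = v l + f * (\<Sum>k<Suc l. adj (v k) * v k)" unfolding one by (simp add: f_def)
 also have "\<dots> = q * v l + (\<Sum>k<l. f * (adj (v k) * v k))"
  by (simp add: q_def algebra_simps sum_distrib_left)
 finally have "minv q * y = minv q * (q * v l) + (\<Sum>k<l. z k * v k)"
  by (simp add: distrib_left sum_distrib_left z_def mult.assoc)
 then have zy: "minv q * y = v l + (\<Sum>k<l. z k * v k)" using minv(2)[OF q] by (simp add: mult.assoc[symmetric])
 have "\<exists>W\<in>Conn (Suc l). \<exists>p\<in>GL S. mm (Suc l) W U l l = p * (v l + (\<Sum>k<j. z k * v k)) \<and>
   (\<forall>k. j <= k & k < l --> mm (Suc l) W U k l = v k)" if "j <= l" for j
  using that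
 proof (induction j)
  case 0
  have "mm (Suc l) (mI (Suc l)) U = U" using U by (intro mm_mI_left) (auto simp: UGM_def)
  then show ?case by (intro bexI[of _ "mI (Suc l)"] bexI[of _ 1] Conn_mI GL_one) (auto simp: v_def)
 next
  case (Suc j)
  then obtain W p where W: "W \<in> Conn (Suc l)" "p \<in> GL S" "mm (Suc l) W U l l = p * (v l + (\<Sum>k<j. z k * v k))"
   "\<And>k. j <= k ==> k < l ==> mm (Suc l) W U k l = v k" by auto
  have jl: "j < l" using Suc by simp
  \<comment> \<open>The rotation adds \<open>- adj x\<close> times entry j to the corner; this slope
    makes the multiple \<open>p * z j\<close>, allowing for the factor \<open>p\<close> accumulated
    so far.\<close>
  define x where "x = - adj (p * z j)"
  have xS: "x \<in> S" unfolding x_def using W(2) GL_subset zS[of j] jl by (auto intro!: in_S)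
  obtain G c d where G: "G \<in> Conn (Suc l)" "c \<in> GL S" "d \<in> GL S"
   "\<And>P k. mm (Suc l) G P l k = d * (P l k - adj x * P j k)"
   "\<And>P a k. a ~= j ==> a < l ==> mm (Suc l) G P a k = P a k"
   using givens_op[OF jl xS] by metis
  have "mm (Suc l) (mm (Suc l) G W) U l l = d * (p * (v l + (\<Sum>k<j. z k * v k)) + p * z j * v j)"
   unfolding mm_assoc G(4) W(3) using W(4)[of j] jl by (simp add: x_def)
  then have "mm (Suc l) (mm (Suc l) G W) U l l = (d * p) * (v l + (\<Sum>k<Suc j. z k * v k))"
   by (simp add: algebra_simps)
  moreover have "mm (Suc l) (mm (Suc l) G W) U k l = v k" if "Suc j <= k" "k < l" for k
   unfolding mm_assoc using G(5)[of k] W(4)[of k] that by simp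
  moreover have "mm (Suc l) G W \<in> Conn (Suc l)" "d * p \<in> GL S" using G W by (auto intro: Conn_mm GL_mult)
  ultimately show ?case by blast
 qed
 from this[OF order_refl] obtain W p where W: "W \<in> Conn (Suc l)" "p \<in> GL S" "mm (Suc l) W U l l = p * (minv q * y)"
  unfolding zy by blast
 have "mm (Suc l) W U l l \<in> GL S" unfolding W(3) by (intro GL_mult W minv(4)[OF q] y)
 then show ?thesis using that W(1) by blast
qed

lemma clear_column:
 assumes U: "U \<in> mats (Suc l) S" "U l l \<in> GL S"
 obtains W where "W \<in> Conn (Suc l)" "mm (Suc l) W U l l \<in> GL S" "\<And>k. k < l ==> mm (Suc l) W U k l = 0"
proof -
 have "\<exists>W\<in>Conn (Suc l). mm (Suc l) W U l l \<in> GL S & (\<forall>k<j. mm (Suc l) W U k l = 0)" if "j <= l" for j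
  using that
 proof (induction j)
  case 0
  have "mm (Suc l) (mI (Suc l)) U = U" using U by (intro mm_mI_left)
  then show ?case using U by (intro bexI[of _ "mI (Suc l)"] Conn_mI) auto
 next
  case (Suc j)
  then obtain W where W: "W \<in> Conn (Suc l)" "mm (Suc l) W U l l \<in> GL S" "\<forall>k<j. mm (Suc l) W U k l = 0" by auto
  have jl: "j < l" using Suc by simp
  define V where "V = mm (Suc l) W U"
  have V: "V \<in> mats (Suc l) S" unfolding V_def using Conn_UGM[OF W(1)] U by (intro mm_mats) (auto simp: UGM_def)
  have Vl: "V l l \<in> GL S" using W by (simp add: V_def)
  \<comment> \<open>This slope kills entry j; the corner becomes
    \<open>d * (1 + adj x * x) * V l l\<close>, with invertible first factor.\<close>
  define x where "x = - (V j l * minv (V l l))"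
  have xS: "x \<in> S" unfolding x_def using V jl by (intro in_S minv(3)[OF Vl]) (auto simp: mats_def)
  have "x * V l l = - V j l" using minv(2)[OF Vl] by (simp add: x_def mult.assoc)
  obtain G c d where G: "G \<in> Conn (Suc l)" "c \<in> GL S" "d \<in> GL S"
   "\<And>P k. mm (Suc l) G P j k = c * (P j k + x * P l k)"
   "\<And>P k. mm (Suc l) G P l k = d * (P l k - adj x * P j k)"
   "\<And>P a k. a ~= j ==> a < l ==> mm (Suc l) G P a k = P a k" "d * (1 + adj x * x) \<in> GL S"
   using givens_op[OF jl xS] by metis
  have "V j l = - (x * V l l)" using \<open>x * V l l = - V j l\<close> by simp
  then have "mm (Suc l) G V l l = (d * (1 + adj x * x)) * V l l" unfolding G(5) by (simp add: algebra_simps)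
  then have 1: "mm (Suc l) G V l l \<in> GL S" using G(7) Vl GL_mult by simp
  have "mm (Suc l) G V k l = 0" if "k < Suc j" for k
  proof (cases "k = j")
   case True
   then show ?thesis using \<open>x * V l l = - V j l\<close> by (simp add: G(4))
  next
   case False
   then show ?thesis using that jl W(3) G(6)[of k V l] by (simp add: V_def)
  qed
  then have "mm (Suc l) (mm (Suc l) G W) U k l = 0" if "k < Suc j" for k
   using that by (simp add: mm_assoc V_def)
  moreover have "mm (Suc l) (mm (Suc l) G W) U l l \<in> GL S" using 1 by (simp add: mm_assoc V_def)
  ultimately show ?case using Conn_mm[OF G(1) W(1)] by blast
 qed
 then show ?thesis using that by (meson order_refl)
qed

definition bdiag :: "nat => 'a mtx => 'a => 'a mtx" where
 "bdiag l P w = (%i j. if i < l & j < l then P i j else if i = l & j = l then w else 0)"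

lemma bdiag_mm: "mm (Suc l) (bdiag l P v) (bdiag l Q w) = bdiag l (mm l P Q) (v * w)"
 by (auto simp: fun_eq_iff mm_def bdiag_def intro!: sum.neutral)

lemma bdiag_mI: "bdiag l (mI l) 1 = mI (Suc l)"
 by (auto simp: bdiag_def mI_def fun_eq_iff)

lemma bdiag_UGM: "P \<in> UGM l S ==> w \<in> UG S ==> bdiag l P w \<in> UGM (Suc l) S"
proof -
 assume P: "P \<in> UGM l S" and w: "w \<in> UG S"
 have "madj (bdiag l P w) = bdiag l (madj P) (adj w)" by (auto simp: madj_def bdiag_def fun_eq_iff)
 then show ?thesis using P UG_D[OF w]
  by (auto simp: UGM_def bdiag_mm bdiag_mI) (auto simp: mats_def bdiag_def less_Suc_eq zero_S)
qed

text \<open>Surjectivity of U/U0 onto K1 in stable rank one: rotations, which are connected to the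
  identity, bring a unitary matrix into block form with a unitary corner, the corner is connected to
  1 by hypothesis, and induction treats the remaining block.\<close>

theorem UGM_connected:
 assumes d: "GLdense S" and conn: "\<And>u. u \<in> UG S ==> path_component (UG S) 1 u"
  and U: "U \<in> UGM n S"
 shows "U \<in> Conn n"
 using U
proof (induction n arbitrary: U)
 case 0
 then have "U = mI 0" by (auto simp: UGM_def mats_def mI_def fun_eq_iff)
 then show ?case using Conn_mI by simp
next
 case (Suc l)
 let ?n = "Suc l"
 obtain W1 where W1: "W1 \<in> Conn ?n" "mm ?n W1 U l l \<in> GL S" using corner_invertible[OF d Suc.prems] by blast
 have "mm ?n W1 U \<in> mats ?n S" using Conn_UGM[OF W1(1)] Suc.prems by (intro mm_mats) (auto simp: UGM_def)
 then obtain W2 where W2: "W2 \<in> Conn ?n" "mm ?n W2 (mm ?n W1 U) l l \<in> GL S"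
  "\<And>k. k < l ==> mm ?n W2 (mm ?n W1 U) k l = 0" using clear_column W1(2) by metis
 define W where "W = mm ?n W2 W1"
 have W: "W \<in> Conn ?n" unfolding W_def by (intro Conn_mm W1 W2)
 define V where "V = mm ?n W U"
 have V: "V \<in> UGM ?n S" unfolding V_def by (intro UGM_mm Conn_UGM W Suc.prems)
 have Vl: "V l l \<in> GL S" "\<And>k. k < l ==> V k l = 0" using W2 by (auto simp: V_def W_def mm_assoc)
 define w where "w = V l l"
 \<comment> \<open>Only the corner of the last column survives, so the last row of the relation
   \<open>mm ?n (madj V) V = mI ?n\<close> reduces to this. It makes the corner unitary and clears
   the last row.\<close>
 have col: "adj w * V l j = mI ?n l j" for j
 proof -
  have "mm ?n (madj V) V l j = mI ?n l j" using V by (simp add: UGM_def)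
  then show ?thesis using Vl(2) by (simp add: mm_def madj_def w_def)
 qed
 have aw: "adj w * w = 1" using col[of l] by (simp add: w_def mI_def)
 then have "adj w * w * minv w = minv w" by simp
 then have "adj w = minv w" using minv(1)[OF Vl(1)] by (simp add: mult.assoc w_def)
 then have wU: "w \<in> UG S" using aw minv(1)[OF Vl(1)] Vl(1) GL_subset by (auto simp: UG_def w_def)
 have row: "V l j = 0" if "j < l" for j
 proof -
  have "w * (adj w * V l j) = 0" using col[of j] that by (simp add: mI_def)
  then show ?thesis using UG_D(3)[OF wU] by (simp add: mult.assoc[symmetric])
 qed
 define P where "P = (%i j. if i < l & j < l then V i j else 0)"
 have VP: "V = bdiag l P w"
 proof (intro ext)
  fix i j
  show "V i j = bdiag l P w i j"
   using V row Vl(2) by (cases "i < ?n & j < ?n") (auto simp: bdiag_def P_def w_def less_Suc_eq UGM_def mats_def)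
 qed
 have mV: "madj V = bdiag l (madj P) (adj w)" unfolding VP by (auto simp: madj_def bdiag_def fun_eq_iff)
 have "bdiag l (mm l (madj P) P) (adj w * w) = bdiag l (mI l) 1" "bdiag l (mm l P (madj P)) (w * adj w) = bdiag l (mI l) 1"
  using V mV VP by (auto simp: UGM_def bdiag_mm bdiag_mI)
 then have "bdiag l (mm l (madj P) P) (adj w * w) i j = bdiag l (mI l) 1 i j"
  "bdiag l (mm l P (madj P)) (w * adj w) i j = bdiag l (mI l) 1 i j" for i j by metis+
 then have "mm l (madj P) P i j = mI l i j" "mm l P (madj P) i j = mI l i j" if "i < l" "j < l" for i j
  using that unfolding bdiag_def by metis+
 moreover have PS: "P \<in> mats l S" using V by (auto simp: P_def UGM_def mats_def)
 ultimately have "P \<in> UGM l S" unfolding UGM_def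
  by (auto intro!: mats_eqI[OF mm_mats mI_mats] madj_mats)
 then have "P \<in> Conn l" by (rule Suc.IH)
 then obtain f :: "real => 'a mtx" where f: "\<And>t. t \<in> {0..1} ==> f t \<in> UGM l S" "continuous_on {0..1} f" "f 0 = mI l" "f 1 = P"
  using ConnE by blast
 obtain g where g: "path g" "path_image g \<subseteq> UG S" "pathstart g = 1" "pathfinish g = w"
  using conn[OF wU] by (auto simp: path_component_def)
 have "V \<in> Conn ?n" unfolding VP
 proof (rule ConnI[of "%t. bdiag l (f t) (g t)"])
  show "bdiag l (f t) (g t) \<in> UGM ?n S" if "t \<in> {0..1}" for t
   using f(1)[OF that] g(2) that by (intro bdiag_UGM) (auto simp: path_image_def)
  show "continuous_on {0..1} (%t. bdiag l (f t) (g t))"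
   using f(2) g(1) unfolding continuous_on_mtx bdiag_def path_def
   by (intro allI continuous_on_if_const continuous_intros) auto
 qed (use f g in \<open>auto simp: pathstart_def pathfinish_def bdiag_mI\<close>)
 then have "mm ?n (madj W) V \<in> Conn ?n" by (intro Conn_mm Conn_madj W)
 moreover have "mm ?n (madj W) V = mm ?n (mm ?n (madj W) W) U" by (simp add: V_def mm_assoc)
 moreover have "\<dots> = U" using Conn_UGM[OF W] Suc.prems mm_mI_left[of U ?n S] by (simp add: UGM_def)
 ultimately show ?case by simp
qed

end

section \<open>Injectivity of \<open>U(S)/U\<^sub>0(S) --> K\<^sub>1(S)\<close> in stable rank one\<close>

abbreviation circ :: "real => complex" where "circ t \<equiv> cis (2 * pi * t)"

text \<open>The coordinate function of the circle as a central unitary loop; it is the variable of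
  the polynomial and Laurent polynomial loops below.\<close>

definition zeta :: "real => 'a::ucstar" where "zeta t = cplx (circ t)"

lemma zeta_cont: "continuous_on A zeta"
 unfolding zeta_def cis_conv_exp by (intro continuous_intros)

lemma zeta_ends: "zeta 0 = 1" "zeta 1 = 1" by (simp_all add: zeta_def)

lemma cplx_power: "cplx c ^ n = cplx (c ^ n)"
 by (induction n) (simp_all add: cplx_mult)

lemma zeta_power: "zeta t ^ n = cplx (circ t ^ n)" by (simp add: zeta_def cplx_power)

lemma zeta_power_central: "zeta t ^ n * x = x * zeta t ^ n" by (simp add: zeta_power cplx_central)

lemma norm_zeta_power: "norm (zeta t ^ n * x) = norm x" "norm (x * zeta t ^ n) = norm x"
proof -
 show "norm (zeta t ^ n * x) = norm x" by (simp add: zeta_power norm_power)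
 then show "norm (x * zeta t ^ n) = norm x" by (simp only: zeta_power_central)
qed

lemma zeta_adj: "zeta t * adj (zeta t) = 1" "adj (zeta t) * zeta t = 1"
 by (simp_all add: zeta_def adj_cplx cplx_mult[symmetric] cis_cnj cis_mult)

text \<open>The points of the circle identify the end points of the interval only.\<close>

lemma circ_eq:
 assumes "circ s = circ t" "s \<in> {0..1}" "t \<in> {0..1}"
 shows "s = t \<or> {s, t} = {0, 1}"
proof -
 have "cos (2 * pi * s) = cos (2 * pi * t) & sin (2 * pi * s) = sin (2 * pi * t)"
  using assms(1) by (metis cis.sel)
 then obtain n where "2 * pi * s = 2 * pi * t + 2 * pi * of_int n"
  using sin_cos_eq_iff by metis
 then have "2 * pi * s = 2 * pi * (t + of_int n)" by (simp add: algebra_simps)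
 then have "s = t + of_int n" by simp
 then have "real_of_int n = s - t" by simp
 then have "\<bar>real_of_int n\<bar> <= 1" using assms by auto
 then have "n = 0 \<or> n = 1 \<or> n = -1" by linarith
 then show ?thesis using \<open>s = t + of_int n\<close> assms by auto
qed

text \<open>Continuity with respect to the circle rather than the interval, so that parameters near
  0 and near 1 count as close. A failing sequence would have limit parameters with the same point on
  the circle, where a loop takes the same value.\<close>

lemma loop_ucont:
 fixes f :: "real => 'a::ucstar"
 assumes f: "continuous_on {0..1} f" "f 0 = f 1" and e: "e > 0"
 shows "\<exists>d>0. \<forall>s\<in>{0..1}. \<forall>t\<in>{0..1}. cmod (circ s - circ t) < d --> norm (f s - f t) < e"
proof (rule ccontr)
 assume "\<not> ?thesis"
 then have "\<forall>n. \<exists>s\<in>{0..1}. \<exists>t\<in>{0..1}. cmod (circ s - circ t) < inverse (real (Suc n)) & \<not> norm (f s - f t) < e"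
  by (metis inverse_positive_iff_positive of_nat_0_less_iff zero_less_Suc)
 then obtain s t where st: "\<And>n. s n \<in> {0..1}" "\<And>n. t n \<in> {0..1}"
  "\<And>n. cmod (circ (s n) - circ (t n)) < inverse (real (Suc n))" "\<And>n. \<not> norm (f (s n) - f (t n)) < e"
  by metis
 have "compact ({0..1::real} \<times> {0..1::real})" by (intro compact_Times compact_Icc)
 moreover have "\<forall>n. (s n, t n) \<in> {0..1} \<times> {0..1}" using st by blast
 ultimately obtain p r where p: "p \<in> {0..1} \<times> {0..1}" "strict_mono (r :: nat => nat)" "((%n. (s n, t n)) \<circ> r) \<longlonglongrightarrow> p"
  unfolding compact_def by meson
 define a b where "a = fst p" and "b = snd p"
 have ab: "a \<in> {0..1}" "b \<in> {0..1}" using p(1) by (auto simp: a_def b_def)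
 have la: "(%n. s (r n)) \<longlonglongrightarrow> a" "(%n. t (r n)) \<longlonglongrightarrow> b"
  using tendsto_fst[OF p(3)] tendsto_snd[OF p(3)] by (simp_all add: a_def b_def o_def)
 have "(%n. circ (s (r n)) - circ (t (r n))) \<longlonglongrightarrow> circ a - circ b"
  unfolding cis_conv_exp by (intro tendsto_intros la)
 moreover have "(%n. circ (s (r n)) - circ (t (r n))) \<longlonglongrightarrow> 0"
 proof (rule Lim_null_comparison)
  show "(%n. inverse (real (Suc (r n)))) \<longlonglongrightarrow> 0"
   using LIMSEQ_subseq_LIMSEQ[OF LIMSEQ_inverse_real_of_nat p(2)] by (simp add: o_def)
 qed (use st(3) in \<open>auto intro!: always_eventually less_imp_le\<close>)
 ultimately have "circ a = circ b" using LIMSEQ_unique by fastforce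
 then have "f a = f b" using circ_eq[OF _ ab] f(2) by (auto simp: doubleton_eq_iff)
 have "(%n. f (s (r n))) \<longlonglongrightarrow> f a" "(%n. f (t (r n))) \<longlonglongrightarrow> f b"
  using continuous_on_tendsto_compose[OF f(1) la(1) ab(1)] continuous_on_tendsto_compose[OF f(1) la(2) ab(2)] st
  by (auto simp: always_eventually)
 then have "(%n. norm (f (s (r n)) - f (t (r n)))) \<longlonglongrightarrow> norm (f a - f b)" by (intro tendsto_intros)
 then have "e <= norm (f a - f b)" using st(4) by (intro LIMSEQ_le_const) (auto simp: not_less)
 then show False using \<open>f a = f b\<close> e by simp
qed

section \<open>Polynomial, Laurent polynomial and continuous loops in a subalgebra\<close>

context csub
begin

lemma zeta_power_S: "zeta t ^ n \<in> S" unfolding zeta_power by (rule cplx_S)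

definition Pol :: "(real => 'a) => bool" where
 "Pol g \<longleftrightarrow> (\<exists>N a. (\<forall>k. a k \<in> S) & (\<forall>t. g t = (\<Sum>k<N. a k * zeta t ^ k)))"

lemma Pol_0: "Pol (%_. 0)"
 unfolding Pol_def by (intro exI[of _ 0] exI[of _ "%_. 0"]) (simp add: zero_S)

lemma Pol_add: assumes "Pol f" "Pol g" shows "Pol (%t. f t + g t)"
proof -
 obtain M a where a: "\<And>k. a k \<in> S" "\<And>t. f t = (\<Sum>k<M. a k * zeta t ^ k)" using assms(1) by (auto simp: Pol_def)
 obtain N b where b: "\<And>k. b k \<in> S" "\<And>t. g t = (\<Sum>k<N. b k * zeta t ^ k)" using assms(2) by (auto simp: Pol_def)
 define c where "c k = (if k < M then a k else 0) + (if k < N then b k else 0)" for k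
 have e1: "(\<Sum>k<M + N. (if k < M then a k else 0) * zeta t ^ k) = (\<Sum>k<M. a k * zeta t ^ k)" for t
  by (intro sum.mono_neutral_cong_right) auto
 have e2: "(\<Sum>k<M + N. (if k < N then b k else 0) * zeta t ^ k) = (\<Sum>k<N. b k * zeta t ^ k)" for t
  by (intro sum.mono_neutral_cong_right) auto
 have "f t + g t = (\<Sum>k<M + N. c k * zeta t ^ k)" for t
  unfolding c_def distrib_right sum.distrib e1 e2 a(2) b(2) ..
 moreover have "c k \<in> S" for k using a b by (auto simp: c_def intro!: add_S zero_S)
 ultimately show ?thesis unfolding Pol_def by blast
qed

lemma Pol_shift: assumes "Pol g" "c \<in> S" shows "Pol (%t. c * zeta t ^ n * g t)"
proof -
 obtain N b where b: "\<And>k. b k \<in> S" "\<And>t. g t = (\<Sum>k<N. b k * zeta t ^ k)" using assms(1) by (auto simp: Pol_def)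
 define d where "d k = (if k < n then 0 else c * b (k - n))" for k
 have "c * zeta t ^ n * g t = (\<Sum>k<n + N. d k * zeta t ^ k)" for t
 proof -
  have "(\<Sum>k<n + N. d k * zeta t ^ k) = (\<Sum>k\<in>{n..<n + N}. d k * zeta t ^ k)"
   by (intro sum.mono_neutral_right) (auto simp: d_def)
  also have "\<dots> = (\<Sum>k<N. d (k + n) * zeta t ^ (k + n))"
   using sum.shift_bounds_nat_ivl[of "%k. d k * zeta t ^ k" 0 n N] by (simp add: atLeast0LessThan add.commute)
  also have "\<dots> = (\<Sum>k<N. c * zeta t ^ n * (b k * zeta t ^ k))"
  proof (rule sum.cong)
   fix k
   have eq: "b k * zeta t ^ n = zeta t ^ n * b k" by (rule zeta_power_central[symmetric])
   have "d (k + n) * zeta t ^ (k + n) = c * (b k * zeta t ^ n) * zeta t ^ k"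
    by (simp only: d_def add.commute[of k n] power_add mult.assoc) (simp add: mult.assoc)
   also have "\<dots> = c * zeta t ^ n * (b k * zeta t ^ k)" by (simp only: eq mult.assoc)
   finally show "d (k + n) * zeta t ^ (k + n) = c * zeta t ^ n * (b k * zeta t ^ k)" .
  qed simp
  finally show ?thesis by (simp add: b sum_distrib_left)
 qed
 moreover have "d k \<in> S" for k using b assms(2) by (auto simp: d_def intro!: mult_S zero_S)
 ultimately show ?thesis unfolding Pol_def by blast
qed

lemma Pol_mult: assumes "Pol f" "Pol g" shows "Pol (%t. f t * g t)"
proof -
 obtain M a where a: "\<And>k. a k \<in> S" "\<And>t. f t = (\<Sum>k<M. a k * zeta t ^ k)" using assms(1) by (auto simp: Pol_def)
 have "Pol (%t. (\<Sum>k<n. a k * zeta t ^ k) * g t)" for n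
 proof (induction n)
  case (Suc n)
  then show ?case using Pol_add[OF Suc Pol_shift[OF assms(2) a(1)[of n], of n]] by (simp add: distrib_right)
 qed (simp add: Pol_0)
 then show ?thesis by (simp add: a(2))
qed

lemma Pol_monom: assumes "c \<in> S" shows "Pol (%t. c * zeta t ^ n)"
proof -
 have "Pol (%_. 1)" unfolding Pol_def
  by (intro exI[of _ 1] exI[of _ "%_. 1"]) (simp add: one_S)
 from Pol_shift[OF this assms, of n] show ?thesis by simp
qed

text \<open>Laurent polynomial loops. Asking for all large exponents instead of one makes sums and
  products combine without comparing pole orders.\<close>

definition Lau :: "(real => 'a) => bool" where
 "Lau g \<longleftrightarrow> (\<exists>n0. \<forall>n\<ge>n0. Pol (%t. zeta t ^ n * g t))"

lemma Lau_add: assumes "Lau f" "Lau g" shows "Lau (%t. f t + g t)"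
proof -
 obtain m n where "\<And>k. k >= m ==> Pol (%t. zeta t ^ k * f t)" "\<And>k. k >= n ==> Pol (%t. zeta t ^ k * g t)"
  using assms by (auto simp: Lau_def)
 then show ?thesis unfolding Lau_def by (intro exI[of _ "max m n"]) (auto simp: distrib_left intro!: Pol_add)
qed

lemma Lau_mult: assumes "Lau f" "Lau g" shows "Lau (%t. f t * g t)"
proof -
 obtain m n where mn: "\<And>k. k >= m ==> Pol (%t. zeta t ^ k * f t)" "\<And>k. k >= n ==> Pol (%t. zeta t ^ k * g t)"
  using assms by (auto simp: Lau_def)
 have "Pol (%t. zeta t ^ k * (f t * g t))" if k: "k >= m + n" for k
 proof -
  have "zeta t ^ k * (f t * g t) = (zeta t ^ (k - n) * f t) * (zeta t ^ n * g t)" for t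
  proof -
   have "zeta t ^ k = zeta t ^ (k - n) * (zeta t ^ n :: 'a)" using k by (simp flip: power_add)
   then have "zeta t ^ k * (f t * g t) = zeta t ^ (k - n) * (zeta t ^ n * f t) * g t" by (simp only: mult.assoc)
   also have "zeta t ^ n * f t = f t * zeta t ^ n" by (rule zeta_power_central)
   finally show ?thesis by (simp only: mult.assoc)
  qed
  then show ?thesis using Pol_mult[OF mn(1)[of "k - n"] mn(2)[of n]] k by simp
 qed
 then show ?thesis unfolding Lau_def by blast
qed

lemma Lau_const: "c \<in> S ==> Lau (%_. c)"
 unfolding Lau_def using Pol_monom by (simp only: zeta_power_central) blast

lemma Lau_zeta: "Lau zeta"
 unfolding Lau_def
proof (intro exI allI impI)
 fix n :: nat
 have "zeta t ^ n * zeta t = (1::'a) * zeta t ^ Suc n" for t :: real by (simp only: power_Suc2 mult_1_left)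
 then show "Pol (%t. zeta t ^ n * zeta t)" using Pol_monom[OF one_S, of "Suc n"] by (simp only:)
qed

lemma Lau_adj_zeta: "Lau (%t. adj (zeta t))"
 unfolding Lau_def
proof (intro exI[of _ 1] allI impI)
 fix n :: nat assume n: "n >= 1"
 have "zeta t ^ n * adj (zeta t) = (1::'a) * zeta t ^ (n - 1)" for t :: real
 proof -
  have "zeta t ^ n = zeta t ^ (n - 1) * (zeta t :: 'a)" using n by (metis Suc_diff_1 less_eq_Suc_le One_nat_def power_Suc2)
  then show ?thesis by (simp only: mult.assoc zeta_adj(1) mult_1_left mult_1_right)
 qed
 then show "Pol (%t. zeta t ^ n * adj (zeta t))" using Pol_monom[OF one_S, of "n - 1"] by (simp only:)
qed

lemma Lau_sum: "(\<And>i. i \<in> I ==> Lau (f i)) ==> Lau (%t. \<Sum>i\<in>I. f i t)"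
proof (induction I rule: infinite_finite_induct)
 case (insert x F)
 then show ?case by (simp add: Lau_add)
qed (auto intro: Lau_const[OF zero_S])

text \<open>A real linear functional of the point on the circle is a combination of
  \<open>zeta\<close> and its adjoint; sums and products follow.\<close>

lemma Lau_real_polynomial: "real_polynomial_function p ==> Lau (%t. p (circ t) *\<^sub>R 1)"
proof (induction p rule: real_polynomial_function.induct)
 case (linear f)
 have f: "f w = Re w * f 1 + Im w * f \<i>" for w
 proof -
  have "f w = f (Re w *\<^sub>R 1 + Im w *\<^sub>R \<i>)" by (simp add: scaleR_conv_of_real mult.commute flip: complex_eq)
  then show ?thesis using linear by (simp add: bounded_linear.linear linear_add linear_scale)
 qed
 have "f (circ t) *\<^sub>R 1 = (((f 1 / 2) *\<^sub>R 1 - (f \<i> / 2) *\<^sub>R J) * zeta t + ((f 1 / 2) *\<^sub>R 1 + (f \<i> / 2) *\<^sub>R J) * adj (zeta t) :: 'a)" for t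
  unfolding f[of "circ t"] zeta_def cplx_def
  by (simp add: adj_add adj_scaleR adj_J algebra_simps J_J flip: scaleR_add_left)
 moreover have "Lau (%t. ((f 1 / 2) *\<^sub>R 1 - (f \<i> / 2) *\<^sub>R J) * zeta t + ((f 1 / 2) *\<^sub>R 1 + (f \<i> / 2) *\<^sub>R J) * adj (zeta t))"
  by (intro Lau_add Lau_mult Lau_const Lau_zeta Lau_adj_zeta in_S J_S)
 ultimately show ?case by simp
next
 case (const c)
 then show ?case by (intro Lau_const in_S)
next
 case (add f g)
 then show ?case using Lau_add by (simp add: scaleR_left_distrib)
next
 case (mult f g)
 have "(f (circ t) * g (circ t)) *\<^sub>R (1::'a) = (f (circ t) *\<^sub>R 1) * (g (circ t) *\<^sub>R 1)" for t by simp
 then show ?case using Lau_mult[OF mult(3,4)] by (simp only:)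
qed

definition lp :: "(real => 'a) => bool" where
 "lp f \<longleftrightarrow> continuous_on {0..1} f & (\<forall>t\<in>{0..1}. f t \<in> S) & f 0 = f 1"

lemma lp_S: "lp f ==> t \<in> {0..1} ==> f t \<in> S" by (simp add: lp_def)
lemma lp_add: "lp f ==> lp g ==> lp (%t. f t + g t)" by (auto simp: lp_def intro!: continuous_intros in_S)
lemma lp_diff: "lp f ==> lp g ==> lp (%t. f t - g t)" by (auto simp: lp_def intro!: continuous_intros in_S)
lemma lp_minus: "lp f ==> lp (%t. - f t)" by (auto simp: lp_def intro!: continuous_intros in_S)
lemma lp_mult: "lp f ==> lp g ==> lp (%t. f t * g t)" by (auto simp: lp_def intro!: continuous_intros in_S)
lemma lp_const: "c \<in> S ==> lp (%_. c)" by (auto simp: lp_def)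
lemma lp_zeta: "lp (%t. zeta t ^ n)" by (auto simp: lp_def zeta_power_S zeta_ends intro!: continuous_intros zeta_cont)
lemma lp_adj: "lp f ==> lp (%t. adj (f t))" by (auto simp: lp_def intro!: continuous_on_adj in_S)
lemma lp_sum: "(\<And>i. i \<in> I ==> lp (f i)) ==> lp (%t. \<Sum>i\<in>I. f i t)"
 by (induction I rule: infinite_finite_induct) (auto intro: lp_const[OF zero_S] lp_add)
lemma lp_minv: "lp f ==> (\<And>t. t \<in> {0..1} ==> f t \<in> GL S) ==> lp (%t. minv (f t))"
 unfolding lp_def by (auto intro!: continuous_on_minv[where S = S] minv(3)[where S = S])
lemma lp_if: "(P ==> lp f) ==> (\<not> P ==> lp g) ==> lp (%t. if P then f t else g t)" by (cases P) auto

lemmas lp_intros = lp_add lp_diff lp_minus lp_mult lp_const lp_zeta lp_adj lp_sum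

lemma lp_bounded: assumes "lp f" obtains M where "M > 0" "\<And>t. t \<in> {0..1} ==> norm (f t) <= M"
proof -
 have "bounded (f ` {0..1})" using assms by (auto simp: lp_def intro!: compact_imp_bounded compact_continuous_image)
 then show ?thesis using that by (auto simp: bounded_pos)
qed

text \<open>A partition of unity on the circle replaces \<open>f\<close> by a combination of
  finitely many of its values with scalar coefficients, and Stone-Weierstrass replaces these
  coefficients by polynomials in the coordinates of the plane.\<close>

lemma Lau_approx:
 assumes f: "lp f" and e: "e > 0"
 obtains g where "Lau g" "\<And>t. t \<in> {0..1} ==> norm (f t - g t) < e"
proof -
 have fc: "continuous_on {0..1} f" "f 0 = f 1" and fS: "\<And>t. t \<in> {0..1} ==> f t \<in> S" using f by (auto simp: lp_def)
 have "e / 2 > 0" using e by simp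
 then obtain d where d: "d > 0" and fd: "\<And>s t. s \<in> {0..1} ==> t \<in> {0..1} ==> cmod (circ s - circ t) < d ==> norm (f s - f t) < e / 2"
  using loop_ucont[OF fc] by meson
 define C where "C = circ ` {0..1}"
 have C: "compact C" unfolding C_def cis_conv_exp by (intro compact_continuous_image continuous_intros compact_Icc)
 have "circ s \<in> ball (circ s) d" for s using d by simp
 then have cov: "C \<subseteq> (\<Union>s\<in>{0..1}. ball (circ s) d)" unfolding C_def by blast
 have "\<And>s. s \<in> {0..1} ==> open (ball (circ s) d)" by simp
 then obtain T0 where T0: "T0 \<subseteq> {0..1}" "finite T0" "C \<subseteq> (\<Union>s\<in>T0. ball (circ s) d)"
  using compactE_image[OF C _ cov] by blast
 define \<psi> where "\<psi> s w = max 0 (d - cmod (w - circ s))" for s w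
 define \<sigma> where "\<sigma> w = (\<Sum>s\<in>T0. \<psi> s w)" for w
 have c\<psi>: "continuous_on C (\<psi> s)" for s unfolding \<psi>_def by (intro continuous_intros)
 have c\<sigma>: "continuous_on C \<sigma>" unfolding \<sigma>_def by (intro continuous_intros c\<psi>)
 have \<psi>0: "\<psi> s w >= 0" for s w by (simp add: \<psi>_def)
 have \<sigma>0: "\<sigma> w > 0" if w: "w \<in> C" for w
 proof -
  obtain s where s: "s \<in> T0" "cmod (w - circ s) < d" using T0(3) w unfolding dist_norm[symmetric] dist_commute[of w] mem_ball[symmetric] by blast
  then have "\<psi> s w > 0" by (simp add: \<psi>_def)
  then show ?thesis unfolding \<sigma>_def using s T0(2) \<psi>0 by (intro sum_pos2) auto
 qed
 define K where "K = (\<Sum>s\<in>T0. norm (f s)) + 1"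
 have K: "K > 0" unfolding K_def by (simp add: add_nonneg_pos sum_nonneg)
 have "\<exists>p. real_polynomial_function p & (\<forall>w\<in>C. \<bar>\<psi> s w / \<sigma> w - p w\<bar> < e / (2 * K))" for s
 proof -
  have "continuous_on C (%w. \<psi> s w / \<sigma> w)" by (intro continuous_intros c\<psi> c\<sigma>) (use \<sigma>0 in force)
  moreover have "e / (2 * K) > 0" using e K by simp
  ultimately show ?thesis by (rule Stone_Weierstrass_real_polynomial_function[OF C]) blast
 qed
 then obtain p where p: "\<And>s. real_polynomial_function (p s)" "\<And>s w. w \<in> C ==> \<bar>\<psi> s w / \<sigma> w - p s w\<bar> < e / (2 * K)" by metis
 define g where "g t = (\<Sum>s\<in>T0. f s * (p s (circ t) *\<^sub>R 1))" for t
 have "Lau g" unfolding g_def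
  using T0(1) fS by (intro Lau_sum Lau_mult Lau_const Lau_real_polynomial p) auto
 moreover have "norm (f t - g t) < e" if t: "t \<in> {0..1}" for t
 proof -
  let ?w = "circ t"
  have wC: "?w \<in> C" using t by (auto simp: C_def)
  let ?q = "%s. \<psi> s ?w / \<sigma> ?w"
  have q1: "(\<Sum>s\<in>T0. ?q s) = 1" using \<sigma>0[OF wC] by (simp add: sum_divide_distrib[symmetric] flip: \<sigma>_def)
  have q0: "?q s >= 0" for s using \<psi>0 \<sigma>0[OF wC] by simp
  have "f t - (\<Sum>s\<in>T0. ?q s *\<^sub>R f s) = (\<Sum>s\<in>T0. ?q s *\<^sub>R (f t - f s))"
   by (simp add: scaleR_right_diff_distrib sum_subtractf q1 flip: scaleR_left.sum)
  also have "norm \<dots> <= (\<Sum>s\<in>T0. ?q s * (e / 2))"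
  proof (rule sum_norm_le)
   fix s assume s: "s \<in> T0"
   show "norm (?q s *\<^sub>R (f t - f s)) <= ?q s * (e / 2)"
   proof (cases "cmod (?w - circ s) < d")
    case True
    then have "norm (f t - f s) < e / 2" using fd t s T0(1) by auto
    then show ?thesis using q0[of s] by (simp only: norm_scaleR abs_of_nonneg) (intro mult_left_mono, auto)
   next
    case False
    then show ?thesis by (simp add: \<psi>_def)
   qed
  qed
  also have "\<dots> = e / 2" by (simp only: sum_distrib_right[symmetric] q1 mult_1_left)
  finally have 1: "norm (f t - (\<Sum>s\<in>T0. ?q s *\<^sub>R f s)) <= e / 2" .
  have "(\<Sum>s\<in>T0. ?q s *\<^sub>R f s) - g t = (\<Sum>s\<in>T0. (?q s - p s ?w) *\<^sub>R f s)"
   by (simp add: g_def sum_subtractf scaleR_left_diff_distrib)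
  also have "norm \<dots> <= (\<Sum>s\<in>T0. e / (2 * K) * norm (f s))"
   by (intro sum_norm_le, unfold norm_scaleR real_norm_def)
    (intro mult_right_mono less_imp_le[OF p(2)[OF wC]] norm_ge_zero)
  also have "\<dots> = e / (2 * K) * (K - 1)" by (simp add: K_def sum_distrib_left)
  also have "\<dots> < e / (2 * K) * K" using e K by (intro mult_strict_left_mono) auto
  also have "\<dots> = e / 2" using K by simp
  finally have 2: "norm ((\<Sum>s\<in>T0. ?q s *\<^sub>R f s) - g t) < e / 2" .
  show ?thesis using 1 2 norm_triangle_ineq[of "f t - (\<Sum>s\<in>T0. ?q s *\<^sub>R f s)" "(\<Sum>s\<in>T0. ?q s *\<^sub>R f s) - g t"] by simp
 qed
 ultimately show ?thesis using that by blast
qed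

text \<open>Approximate the left inverse by an invertible \<open>y'\<close>; then
  \<open>y' * x\<close> is close to 1, hence invertible, and so is \<open>x\<close>.\<close>

lemma left_inverse_GL:
 assumes d: "GLdense S" and x: "x \<in> S" "y \<in> S" "y * x = 1"
 shows "x \<in> GL S" "minv x = y"
proof -
 define N where "N = norm x + 1"
 have N: "N > 0" by (simp add: N_def add_nonneg_pos)
 obtain y' where y': "y' \<in> GL S" "norm (y - y') < 1 / N"
  using d x(2) N unfolding GLdense_def by (metis zero_less_divide_1_iff)
 have "1 - y' * x = (y - y') * x" using x(3) by (simp add: left_diff_distrib)
 then have "norm (1 - y' * x) <= norm (y - y') * norm x" by (simp only: norm_mult_ineq)
 also have "\<dots> <= norm (y - y') * N" by (intro mult_left_mono) (auto simp: N_def)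
 also have "\<dots> < 1" using y'(2) N by (simp add: field_simps)
 finally have g: "y' * x \<in> GL S" using y' x GL_subset by (intro GL_near_one in_S) auto
 have "minv y' * (y' * x) = x" using minv(2)[OF y'(1)] by (simp add: mult.assoc[symmetric])
 then show xG: "x \<in> GL S" using GL_mult[OF minv(4)[OF y'(1)] g] by simp
 have "y = y * (x * minv x)" using minv(1)[OF xG] by simp
 also have "\<dots> = minv x" using x(3) by (simp add: mult.assoc[symmetric])
 finally show "minv x = y" by simp
qed

end

section \<open>Completion of unimodular columns of loops to invertible matrix loops\<close>

definition rk1 :: "nat => (nat => 'a::ucstar) => 'a => (nat => 'a) => 'a mtx" where
 "rk1 m d a r = (%i k. if i < m & k < m then (if i = k then 1 else 0) + d i * a * r k else 0)"

lemma rk1_mm: "mm m (rk1 m d a r) (rk1 m d b r) = rk1 m d (a + b + a * (\<Sum>k<m. r k * d k) * b) r"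
proof (intro ext)
 fix i j
 show "mm m (rk1 m d a r) (rk1 m d b r) i j = rk1 m d (a + b + a * (\<Sum>k<m. r k * d k) * b) r i j"
 proof (cases "i < m & j < m")
  case True
  have "mm m (rk1 m d a r) (rk1 m d b r) i j =
   (\<Sum>k<m. ((if i = k then 1 else 0) + d i * a * r k) * ((if k = j then 1 else 0) + d k * b * r j))"
   unfolding mm_def rk1_def using True by (intro sum.cong) auto
  also have "\<dots> = (\<Sum>k<m. (if k = i then (if i = j then 1 else 0) else 0) + (if k = i then d i * b * r j else 0)
    + (if k = j then d i * a * r j else 0) + d i * a * (r k * d k) * (b * r j))"
   by (intro sum.cong refl) (auto simp: algebra_simps)
  also have "\<dots> = (if i = j then 1 else 0) + d i * b * r j + d i * a * r j + d i * a * (\<Sum>k<m. r k * d k) * (b * r j)"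
   using True by (simp add: sum.distrib sum_distrib_left[symmetric] sum_distrib_right[symmetric])
  finally show ?thesis using True by (simp add: rk1_def algebra_simps)
 qed (auto simp: mm_def rk1_def)
qed

lemma rk1_0: "rk1 m d 0 r = mI m"
 by (auto simp: rk1_def mI_def fun_eq_iff)

context csub
begin

definition gloop :: "nat => (real => 'a mtx) => (real => 'a mtx) => bool" where
 "gloop m E F \<longleftrightarrow> (\<forall>i j. lp (%t. E t i j)) & (\<forall>i j. lp (%t. F t i j)) \<and>
  (\<forall>t\<in>{0..1}. E t \<in> mats m S & F t \<in> mats m S & mm m (E t) (F t) = mI m & mm m (F t) (E t) = mI m)"

text \<open>The column lies in the orbit of the last unit vector under invertible matrix loops; the
  goal is that every unimodular column does.\<close>

definition Rch :: "nat => (real => nat => 'a) => bool" where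
 "Rch m v \<longleftrightarrow> (\<exists>E F. gloop m E F & (\<forall>t\<in>{0..1}. \<forall>i<m. v t i = E t i (m - 1)))"

lemma gloop_sym: "gloop m E F ==> gloop m F E" by (auto simp: gloop_def)

lemma gloop_mm:
 assumes E: "gloop m E F" and W: "gloop m W W'"
 shows "gloop m (%t. mm m (W t) (E t)) (%t. mm m (F t) (W' t))"
 unfolding gloop_def
proof (intro conjI allI ballI)
 show "lp (%t. mm m (W t) (E t) i j)" "lp (%t. mm m (F t) (W' t) i j)" for i j
  using E W unfolding mm_def gloop_def by (auto intro!: lp_sum lp_mult)
 fix t :: real assume t: "t \<in> {0..1}"
 have e: "E t \<in> mats m S" "F t \<in> mats m S" "W t \<in> mats m S" "W' t \<in> mats m S"
  "mm m (E t) (F t) = mI m" "mm m (F t) (E t) = mI m" "mm m (W t) (W' t) = mI m" "mm m (W' t) (W t) = mI m"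
  using E W t by (auto simp: gloop_def)
 show "mm m (W t) (E t) \<in> mats m S" "mm m (F t) (W' t) \<in> mats m S" using e by (auto intro: mm_mats)
 have "mm m (mm m (W t) (E t)) (mm m (F t) (W' t)) = mm m (W t) (mm m (mm m (E t) (F t)) (W' t))"
  "mm m (mm m (F t) (W' t)) (mm m (W t) (E t)) = mm m (F t) (mm m (mm m (W' t) (W t)) (E t))"
  by (simp_all only: mm_assoc)
 then show "mm m (mm m (W t) (E t)) (mm m (F t) (W' t)) = mI m" "mm m (mm m (F t) (W' t)) (mm m (W t) (E t)) = mI m"
  using e mm_mI_left[OF e(4)] mm_mI_left[OF e(1)] by simp_all
qed

lemma Rch_gloop:
 assumes W: "gloop m W W'" and R: "Rch m (%t i. \<Sum>k<m. W t i k * v t k)"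
 shows "Rch m v"
proof -
 obtain E F where E: "gloop m E F" "\<And>t i. t \<in> {0..1} ==> i < m ==> (\<Sum>k<m. W t i k * v t k) = E t i (m - 1)"
  using R by (auto simp: Rch_def)
 have "v t i = mm m (W' t) (E t) i (m - 1)" if t: "t \<in> {0..1}" and i: "i < m" for t i
 proof -
  have "mm m (W' t) (E t) i (m - 1) = (\<Sum>k<m. W' t i k * (\<Sum>l<m. W t k l * v t l))"
   unfolding mm_def using E(2)[OF t] by (intro sum.cong) auto
  also have "\<dots> = (\<Sum>k<m. \<Sum>l<m. W' t i k * W t k l * v t l)" by (simp add: sum_distrib_left mult.assoc)
  also have "\<dots> = (\<Sum>l<m. mm m (W' t) (W t) i l * v t l)"
   unfolding mm_def sum_distrib_right by (rule sum.swap)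
  also have "\<dots> = (\<Sum>l<m. if l = i then v t i else 0)"
   using W t i by (intro sum.cong) (auto simp: gloop_def mI_def)
  finally show ?thesis using i by simp
 qed
 then show ?thesis unfolding Rch_def using gloop_mm[OF E(1) gloop_sym[OF W]] by blast
qed

lemma Rch_cong:
 "Rch m v ==> (\<And>t i. t \<in> {0..1} ==> i < m ==> v t i = w t i) ==> Rch m w"
 unfolding Rch_def by metis

text \<open>For a column d and a row r the matrix 1 + d r is invertible as soon as 1 + r d is: with
  \<sigma> inverting 1 + r d, its inverse is 1 - d \<sigma> r.\<close>

lemma Rch_rank1:
 assumes d: "\<And>i. i < m ==> lp (%t. d t i)" and r: "\<And>i. i < m ==> lp (%t. r t i)"
  and s: "\<And>t. t \<in> {0..1} ==> 1 + (\<Sum>k<m. r t k * d t k) \<in> GL S"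
  and R: "Rch m (%t i. v t i + d t i * (\<Sum>k<m. r t k * v t k))"
 shows "Rch m v"
proof -
 define \<sigma> where "\<sigma> t = minv (1 + (\<Sum>k<m. r t k * d t k))" for t
 have ls: "lp (%t. 1 + (\<Sum>k<m. r t k * d t k))" by (intro lp_intros one_S) (auto intro: d r)
 have l\<sigma>: "lp \<sigma>" unfolding \<sigma>_def by (rule lp_minv[OF ls s])
 let ?W = "%t. rk1 m (d t) 1 (r t)" and ?W' = "%t. rk1 m (d t) (- \<sigma> t) (r t)"
 have lp1: "lp (%t. rk1 m (d t) (a t) (r t) i j)" if "lp a" for a i j
  unfolding rk1_def by (intro lp_if lp_add lp_mult lp_const that zero_S one_S) (auto intro: d r)
 have G: "gloop m ?W ?W'" unfolding gloop_def
 proof (intro conjI allI ballI lp1)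
  fix t :: real assume t: "t \<in> {0..1}"
  have m: "rk1 m (d t) a (r t) \<in> mats m S" if "a \<in> S" for a
   unfolding mats_def rk1_def using that lp_S[OF d t] lp_S[OF r t] by (auto intro!: in_S)
  show "?W t \<in> mats m S" "?W' t \<in> mats m S" using lp_S[OF l\<sigma> t] by (auto intro!: m in_S)
  let ?\<rho> = "\<Sum>k<m. r t k * d t k"
  have "(1 + ?\<rho>) * \<sigma> t = 1" "\<sigma> t * (1 + ?\<rho>) = 1" unfolding \<sigma>_def by (rule minv[OF s[OF t]])+
  then have "1 + - \<sigma> t + 1 * ?\<rho> * - \<sigma> t = 0" "- \<sigma> t + 1 + - \<sigma> t * ?\<rho> * 1 = 0"
   by (simp_all add: distrib_left distrib_right algebra_simps)
  then show "mm m (?W t) (?W' t) = mI m" "mm m (?W' t) (?W t) = mI m" by (simp_all only: rk1_mm rk1_0)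
 qed (auto intro: lp_const one_S lp_minus l\<sigma>)
 show ?thesis
 proof (rule Rch_gloop[OF G], rule Rch_cong[OF R])
  fix t i assume "t \<in> {0..1::real}" "i < m"
  then have "(\<Sum>k<m. rk1 m (d t) 1 (r t) i k * v t k) = (\<Sum>k<m. (if k = i then v t i else 0) + d t i * (r t k * v t k))"
   by (intro sum.cong) (auto simp: rk1_def algebra_simps)
  also have "\<dots> = v t i + d t i * (\<Sum>k<m. r t k * v t k)" using \<open>i < m\<close> by (simp add: sum.distrib sum_distrib_left)
  finally show "v t i + d t i * (\<Sum>k<m. r t k * v t k) = (\<Sum>k<m. rk1 m (d t) 1 (r t) i k * v t k)" by simp
 qed
qed

lemma Rch_add_row:
 assumes ij: "i < m" "j < m" "i ~= j" and c: "lp c"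
  and R: "Rch m (%t k. if k = i then v t i + c t * v t j else v t k)"
 shows "Rch m v"
proof (rule Rch_rank1[where d = "%t k. if k = i then c t else 0" and r = "%t k. if k = j then 1 else 0"])
 show "lp (%t. if k = i then c t else 0)" "lp (%t. if k = j then 1 else 0)" for k
  by (intro lp_if c lp_const zero_S one_S)+
 have "(\<Sum>k<m. (if k = j then 1 else 0) * (if k = i then c t else 0)) = 0" for t
  using ij by (intro sum.neutral) auto
 then show "1 + (\<Sum>k<m. (if k = j then 1 else 0) * (if k = i then c t else 0)) \<in> GL S" for t using GL_one by simp
 have "(\<Sum>k<m. (if k = j then 1 else 0) * v t k) = v t j" for t
  using ij by (subst sum_one[of j]) auto
 then show "Rch m (%t k. v t k + (if k = i then c t else 0) * (\<Sum>k<m. (if k = j then 1 else 0) * v t k))"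
  by (intro Rch_cong[OF R]) auto
qed

definition unimod :: "nat => (real => nat => 'a) => bool" where
 "unimod m v \<longleftrightarrow> (\<forall>i<m. lp (%t. v t i)) \<and>
  (\<exists>r. (\<forall>i<m. lp (%t. r t i)) & (\<forall>t\<in>{0..1}. (\<Sum>k<m. r t k * v t k) = 1))"

text \<open>If r v = 1, the matrix 1 + (v' - v) r sends v to v', and it is invertible because r (v'
  - v) has norm below 1. So a column may be replaced by any sufficiently close one.\<close>

lemma unimod_perturb:
 assumes v: "\<And>i. i < m ==> lp (%t. v t i)" and r: "\<And>i. i < m ==> lp (%t. r t i)"
  and rv: "\<And>t. t \<in> {0..1} ==> (\<Sum>k<m. r t k * v t k) = 1"
  and v': "\<And>i. i < m ==> lp (%t. v' t i)"
  and n: "\<And>t. t \<in> {0..1} ==> norm (\<Sum>k<m. r t k * (v' t k - v t k)) < 1"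
 shows "unimod m v'" "Rch m v' ==> Rch m v"
proof -
 define s where "s t = (\<Sum>k<m. r t k * v' t k)" for t
 have ls: "lp s" unfolding s_def by (intro lp_sum lp_mult) (auto intro: r v')
 have se: "s t = 1 + (\<Sum>k<m. r t k * (v' t k - v t k))" if "t \<in> {0..1}" for t
  using rv[OF that] by (simp add: s_def right_diff_distrib sum_subtractf)
 have sG: "s t \<in> GL S" if "t \<in> {0..1}" for t
  using n[OF that] se[OF that] lp_S[OF ls that] by (intro GL_near_one) auto
 have "lp (%t. minv (s t) * r t i)" if "i < m" for i by (intro lp_mult lp_minv ls sG r that)
 moreover have "(\<Sum>k<m. minv (s t) * r t k * v' t k) = 1" if "t \<in> {0..1}" for t
  using minv(2)[OF sG[OF that]] by (simp add: s_def sum_distrib_left mult.assoc)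
 ultimately show "unimod m v'" unfolding unimod_def using v'
  by (intro conjI exI[of _ "%t k. minv (s t) * r t k"]) auto
 assume R: "Rch m v'"
 show "Rch m v"
 proof (rule Rch_rank1[where d = "%t k. v' t k - v t k" and r = r])
  show "1 + (\<Sum>k<m. r t k * (v' t k - v t k)) \<in> GL S" if "t \<in> {0..1}" for t
   using sG[OF that] se[OF that] by simp
  show "Rch m (%t i. v t i + (v' t i - v t i) * (\<Sum>k<m. r t k * v t k))"
   by (rule Rch_cong[OF R]) (simp add: rv)
 qed (auto intro: lp_diff v v' r)
qed

lemma unimod_add_row:
 assumes ij: "i < m" "j < m" "i ~= j" and c: "lp c" and u: "unimod m v"
 shows "unimod m (%t k. if k = i then v t i + c t * v t j else v t k)"
proof -
 obtain r where r: "\<And>i. i < m ==> lp (%t. r t i)" "\<And>t. t \<in> {0..1} ==> (\<Sum>k<m. r t k * v t k) = 1"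
  and v: "\<And>i. i < m ==> lp (%t. v t i)" using u unfolding unimod_def by blast
 let ?r = "%t k. if k = j then r t j - r t i * c t else r t k"
 let ?v = "%t k. if k = i then v t i + c t * v t j else v t k"
 have "(\<Sum>k<m. ?r t k * ?v t k) = 1" if t: "t \<in> {0..1}" for t
 proof -
  have "(\<Sum>k<m. ?r t k * ?v t k) = (\<Sum>k<m. r t k * v t k + (if k = i then r t i * c t * v t j else 0) - (if k = j then r t i * c t * v t j else 0))"
   using ij by (intro sum.cong) (auto simp: algebra_simps)
  also have "\<dots> = 1" using ij r(2)[OF t] by (simp add: sum.distrib sum_subtractf)
  finally show ?thesis .
 qed
 moreover have "lp (%t. ?r t k)" "lp (%t. ?v t k)" if "k < m" for k
  by (intro lp_if lp_diff lp_add lp_mult c r v ij that)+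
 ultimately show ?thesis unfolding unimod_def by (intro conjI exI[of _ ?r]) auto
qed

lemma Rch_unit: assumes "m > 0" shows "Rch m (%t i. if i = m - 1 then 1 else 0)"
 unfolding Rch_def
proof (intro exI conjI ballI allI impI)
 show "gloop m (%_. mI m) (%_. mI m)" unfolding gloop_def
  by (auto simp: mI_mats mm_mI_left[OF mI_mats]) (auto simp: mI_def intro!: lp_const zero_S one_S)
 show "(if i = m - 1 then 1 else 0) = mI m i (m - 1)" if "i < m" for i using that by (auto simp: mI_def)
qed

text \<open>An invertible entry outside the last row creates a 1 there and is then cleared. If it
  sits in the last row itself, row 0 serves as an auxiliary place: a 1 is created there, used to
  turn the entry \<open>w\<close> into \<open>w + (1 - w)\<close>, and cleared afterwards. This is
  where two rows are required.\<close>

lemma Rch_single: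
 assumes m: "m >= 2" and i: "i < m" and w: "lp w" "lp w'" "\<And>t. t \<in> {0..1} ==> w' t * w t = 1"
  "\<And>t. t \<in> {0..1} ==> w t * w' t = 1"
  and v: "\<And>t k. t \<in> {0..1} ==> k < m ==> v t k = (if k = i then w t else 0)"
 shows "Rch m v"
proof (cases "i = m - 1")
 case False
 let ?l = "m - 1"
 have l: "?l < m" "?l ~= i" using m False by auto
 show ?thesis
 proof (rule Rch_add_row[OF l(1) i l(2) w(2)], rule Rch_add_row[OF i l(1) l(2)[symmetric] lp_minus[OF w(1)]])
  show "Rch m (%t k. if k = i then (if i = ?l then v t ?l + w' t * v t i else v t i) + - w t * (if ?l = ?l then v t ?l + w' t * v t i else v t ?l)
    else if k = ?l then v t ?l + w' t * v t i else v t k)"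
   using m v w i l by (intro Rch_cong[OF Rch_unit]) auto
 qed
next
 case True
 have z: "0 < m" "0 ~= i" "i ~= 0" using m True by auto
 let ?v1 = "%t k. if k = 0 then v t 0 + w' t * v t i else v t k"
 let ?v2 = "%t k. if k = i then ?v1 t i + (1 - w t) * ?v1 t 0 else ?v1 t k"
 let ?v3 = "%t k. if k = 0 then ?v2 t 0 + (- 1) * ?v2 t i else ?v2 t k"
 have "Rch m ?v3" using m v w i z True by (intro Rch_cong[OF Rch_unit]) auto
 then have "Rch m ?v2" by (rule Rch_add_row[OF z(1) i z(2) lp_const[OF minus_S[OF one_S]]])
 then have "Rch m ?v1" by (rule Rch_add_row[OF i z(1) z(3) lp_diff[OF lp_const[OF one_S] w(1)]])
 then show ?thesis by (rule Rch_add_row[OF z(1) i z(2) w(2)])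
qed

text \<open>Euclid's algorithm for polynomial loops; a leading coefficient becomes invertible after an
 arbitrarily small perturbation.\<close>

lemma Rch_polynomial:
 assumes d: "GLdense S" and m: "m >= 2"
  and u: "unimod m v" and a: "\<And>i k. a i k \<in> S"
  and v: "\<And>t i. i < m ==> v t i = (\<Sum>k<n i. a i k * zeta t ^ k)"
 shows "Rch m v"
 using u a v
proof (induction "\<Sum>i<m. n i" arbitrary: n a v rule: less_induct)
 case less
 note u = less.prems(1) and a = less.prems(2) and v = less.prems(3)
 obtain r where r: "\<And>i. i < m ==> lp (%t. r t i)" "\<And>t. t \<in> {0..1} ==> (\<Sum>k<m. r t k * v t k) = 1"
  and vl: "\<And>i. i < m ==> lp (%t. v t i)" using u unfolding unimod_def by blast
 show ?case
 \<comment> \<open>\<open>n i\<close> counts coefficients, so it is one more than the formal degree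
   and 0 for a zero entry; the leading coefficient has index \<open>n i - 1\<close>.\<close>
 proof (cases "\<exists>i<m. \<exists>j<m. i ~= j & n j > 0 & n i >= n j")
  case True
  then obtain i j where ij: "i < m" "j < m" "i ~= j" "n j > 0" "n i >= n j" by blast
  obtain M where M: "M > 0" "\<And>t. t \<in> {0..1} ==> norm (r t j) <= M" using lp_bounded[OF r(1)[OF ij(2)]] by blast
  obtain c where c: "c \<in> GL S" "norm (a j (n j - 1) - c) < 1 / M"
   using d a M(1) unfolding GLdense_def by (metis zero_less_divide_1_iff)
  have cS: "c \<in> S" using c GL_subset by blast
  define a1 where "a1 = a(j := (a j)(n j - 1 := c))"
  have a1S: "a1 k l \<in> S" for k l using a cS by (simp add: a1_def)
  define v1 where "v1 t k = (if k = j then v t j + (c - a j (n j - 1)) * zeta t ^ (n j - 1) else v t k)" for t k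
  have v1: "v1 t k = (\<Sum>l<n k. a1 k l * zeta t ^ l)" if "k < m" for t k
  proof (cases "k = j")
   case True
   have "(\<Sum>l<n j. a1 j l * zeta t ^ l) = (\<Sum>l<n j. a j l * zeta t ^ l + (if l = n j - 1 then (c - a j (n j - 1)) * zeta t ^ (n j - 1) else 0))"
    by (intro sum.cong) (auto simp: a1_def algebra_simps)
   then show ?thesis using True ij v[OF ij(2)] by (simp add: v1_def sum.distrib)
  next
   case False
   then show ?thesis using v[OF that] by (simp add: v1_def a1_def)
  qed
  have v1l: "lp (%t. v1 t k)" if "k < m" for k
   unfolding v1_def by (intro lp_if lp_add lp_mult lp_const lp_zeta diff_S cS a vl that ij)
  have nn: "norm (\<Sum>k<m. r t k * (v1 t k - v t k)) < 1" if t: "t \<in> {0..1}" for t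
  proof -
   have "(\<Sum>k<m. r t k * (v1 t k - v t k)) = r t j * ((c - a j (n j - 1)) * zeta t ^ (n j - 1))"
    using ij by (subst sum_one[of j]) (auto simp: v1_def)
   also have "norm \<dots> <= norm (r t j) * norm (c - a j (n j - 1))"
    using norm_mult_ineq[of "r t j"] by (metis norm_zeta_power(2))
   also have "\<dots> <= M * norm (c - a j (n j - 1))" using M(2)[OF t] by (intro mult_right_mono) auto
   also have "\<dots> < M * (1 / M)" using c(2) M(1) by (intro mult_strict_left_mono) (auto simp: norm_minus_commute)
   finally show ?thesis using M(1) by simp
  qed
  have pert: "unimod m v1" "Rch m v1 ==> Rch m v" using unimod_perturb[of m v r v1] vl r v1l nn by blast+
  \<comment> \<open>Subtracting \<open>b\<close> times entry j, shifted by \<open>D\<close>, cancels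
    the top coefficient of entry i; such a \<open>b\<close> exists because the perturbed leading
    coefficient \<open>c\<close> is invertible.\<close>
  define D b where "D = n i - n j" and "b = a i (n i - 1) * minv c"
  have bS: "b \<in> S" unfolding b_def by (intro mult_S a minv(3)[OF c(1)])
  have bc: "b * c = a i (n i - 1)" using minv(2)[OF c(1)] by (simp add: b_def mult.assoc)
  define q where "q t = - (b * zeta t ^ D)" for t
  have lq: "lp q" unfolding q_def by (intro lp_minus lp_mult lp_const bS lp_zeta)
  define v2 where "v2 = (%t k. if k = i then v1 t i + q t * v1 t j else v1 t k)"
  define n2 where "n2 = n(i := n i - 1)"
  define a2 where "a2 = a1(i := (%k. a1 i k - (if k >= D then b * a1 j (k - D) else 0)))"
  have a2S: "a2 k l \<in> S" for k l using a1S bS by (auto simp: a2_def intro!: in_S)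
  have v2: "v2 t k = (\<Sum>l<n2 k. a2 k l * zeta t ^ l)" if "k < m" for t k
  proof (cases "k = i")
   case True
   have ni: "n i = Suc (n i - 1)" using ij by simp
   have ns: "n i = D + n j" using ij by (simp add: D_def)
   have "b * zeta t ^ D * v1 t j = (\<Sum>l<n j. b * a1 j l * zeta t ^ (l + D))"
    unfolding v1[OF ij(2)] sum_distrib_left
   proof (rule sum.cong)
    fix l
    have "zeta t ^ D * a1 j l = a1 j l * zeta t ^ D" by (rule zeta_power_central)
    moreover have "b * zeta t ^ D * (a1 j l * zeta t ^ l) = b * (zeta t ^ D * a1 j l) * zeta t ^ l" by (simp only: mult.assoc)
    ultimately show "b * zeta t ^ D * (a1 j l * zeta t ^ l) = b * a1 j l * zeta t ^ (l + D)"
     by (simp only: mult.assoc power_add[symmetric] add.commute)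
   qed simp
   also have "\<dots> = (\<Sum>k\<in>{D..<D + n j}. b * a1 j (k - D) * zeta t ^ k)"
    using sum.shift_bounds_nat_ivl[of "%k. b * a1 j (k - D) * zeta t ^ k" 0 D "n j"] by (simp add: atLeast0LessThan add.commute)
   also have "\<dots> = (\<Sum>k<n i. (if k >= D then b * a1 j (k - D) else 0) * zeta t ^ k)"
    unfolding ns by (intro sum.mono_neutral_cong_left) auto
   finally have "v2 t i = (\<Sum>k<n i. a1 i k * zeta t ^ k) - (\<Sum>k<n i. (if k >= D then b * a1 j (k - D) else 0) * zeta t ^ k)"
    using v1[OF ij(1)] by (simp add: v2_def q_def)
   also have "\<dots> = (\<Sum>k<n i. a2 i k * zeta t ^ k)"
    by (simp add: a2_def left_diff_distrib sum_subtractf)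
   also have "\<dots> = (\<Sum>k<n i - 1. a2 i k * zeta t ^ k) + a2 i (n i - 1) * zeta t ^ (n i - 1)"
    by (subst ni, subst sum.lessThan_Suc) simp
   also have "a2 i (n i - 1) = 0"
   proof -
    have "n i - 1 - D = n j - 1" "D <= n i - 1" using ij by (auto simp: D_def)
    then show ?thesis using ij bc by (simp add: a2_def a1_def)
   qed
   finally show ?thesis using True by (simp add: n2_def)
  next
   case False
   then show ?thesis using v1[OF that] by (simp add: v2_def n2_def a2_def)
  qed
  have u2: "unimod m v2" unfolding v2_def by (rule unimod_add_row[OF ij(1-3) lq pert(1)])
  have "(\<Sum>k<m. n2 k) < (\<Sum>k<m. n k)"
   using ij by (intro sum_strict_mono_ex1) (auto simp: n2_def)
  then have "Rch m v2" using less.hyps[of n2 v2 a2] u2 a2S v2 by blast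
  then have "Rch m v1" unfolding v2_def by (rule Rch_add_row[OF ij(1-3) lq])
  then show ?thesis by (rule pert(2))
 next
  \<comment> \<open>No division is possible, so exactly one entry is nonzero. Unimodularity gives it
    a left inverse, which in stable rank one is two-sided.\<close>
  case False
  have one: "n i = 0 \<or> n j = 0" if "i < m" "j < m" "i ~= j" for i j
  proof (rule ccontr)
   assume "\<not> (n i = 0 \<or> n j = 0)"
   then have "n i > 0" "n j > 0" by auto
   then show False using False that by (cases "n j <= n i") (blast, metis nat_le_linear)
  qed
  have "\<exists>i<m. n i > 0"
  proof (rule ccontr)
   assume "\<not> ?thesis"
   then have "(\<Sum>k<m. r 0 k * v 0 k) = 0" using v by (intro sum.neutral) auto
   then show False using r(2)[of 0] by simp
  qed
  then obtain i where i: "i < m" "n i > 0" by blast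
  have v0: "v t k = 0" if "k < m" "k ~= i" for t k using v[OF that(1)] one[OF i(1) that(1)] i that by auto
  have ri: "r t i * v t i = 1" if "t \<in> {0..1}" for t
  proof -
   have "(\<Sum>k<m. r t k * v t k) = (\<Sum>k<m. if k = i then r t i * v t i else 0)"
    using v0 by (intro sum.cong) auto
   then show ?thesis using r(2)[OF that] i by simp
  qed
  show ?thesis
  proof (rule Rch_single[OF m i(1) vl[OF i(1)] r(1)[OF i(1)] ri])
   fix t :: real assume t: "t \<in> {0..1}"
   have "v t i \<in> GL S" "minv (v t i) = r t i"
    using left_inverse_GL[OF d lp_S[OF vl[OF i(1)] t] lp_S[OF r(1)[OF i(1)] t] ri[OF t]] by auto
   then show "v t i * r t i = 1" using minv(1) by metis
  qed (use v0 in auto)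
 qed
qed

text \<open>A power of \<open>zeta\<close> is a central unitary loop, so multiplying a column by it
  and absorbing its adjoint into the completing matrix changes nothing. Poles of Laurent columns can
  thus be cleared.\<close>

lemma Rch_zeta:
 assumes "Rch m (%t i. zeta t ^ n * v t i)"
 shows "Rch m v"
proof -
 obtain E F where E: "gloop m E F" "\<And>t i. t \<in> {0..1} ==> i < m ==> zeta t ^ n * v t i = E t i (m - 1)"
  using assms by (auto simp: Rch_def)
 let ?z = "%t. adj (zeta t ^ n) :: 'a"
 have za: "?z t * zeta t ^ n = 1" "zeta t ^ n * ?z t = 1" for t
  unfolding zeta_power adj_cplx by (simp_all add: cplx_mult[symmetric] cis_cnj cis_mult Complex.DeMoivre)
 have zc: "?z t * x = x * ?z t" for t x unfolding zeta_power adj_cplx by (rule cplx_central)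
 have "gloop m (%t i j. ?z t * E t i j) (%t i j. zeta t ^ n * F t i j)"
  unfolding gloop_def
 proof (intro conjI allI ballI)
  show "lp (%t. ?z t * E t i j)" "lp (%t. zeta t ^ n * F t i j)" for i j
   using E(1) by (auto simp: gloop_def intro!: lp_mult lp_adj lp_zeta)
  fix t :: real assume t: "t \<in> {0..1}"
  have EF: "E t \<in> mats m S" "F t \<in> mats m S" "mm m (E t) (F t) = mI m" "mm m (F t) (E t) = mI m"
   using E(1) t by (auto simp: gloop_def)
  show "(%i j. ?z t * E t i j) \<in> mats m S" "(%i j. zeta t ^ n * F t i j) \<in> mats m S"
   using EF by (auto simp: mats_def intro!: in_S zeta_power_S)
  have 1: "?z t * x * (zeta t ^ n * y) = x * y" for x y
  proof -
   have "?z t * x * (zeta t ^ n * y) = x * (?z t * zeta t ^ n) * y" by (simp only: zc mult.assoc)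
   then show ?thesis by (simp only: za mult_1_right)
  qed
  have 2: "zeta t ^ n * y * (?z t * x) = y * x" for x y
  proof -
   have "zeta t ^ n * y * (?z t * x) = y * (zeta t ^ n * ?z t) * x" by (simp only: zeta_power_central[of t n y] mult.assoc)
   then show ?thesis by (simp only: za mult_1_right)
  qed
  show "mm m (%i j. ?z t * E t i j) (%i j. zeta t ^ n * F t i j) = mI m"
   "mm m (%i j. zeta t ^ n * F t i j) (%i j. ?z t * E t i j) = mI m"
   using EF(3,4) unfolding mm_def 1 2 by auto
 qed
 moreover have "v t i = ?z t * E t i (m - 1)" if "t \<in> {0..1}" "i < m" for t i
  unfolding E(2)[OF that, symmetric] by (simp only: mult.assoc[symmetric] za mult_1_left)
 ultimately show ?thesis unfolding Rch_def
  by - (rule exI[of _ "%t i j. ?z t * E t i j"], rule exI[of _ "%t i j. zeta t ^ n * F t i j"], blast)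
qed

text \<open>Approximate the entries by Laurent polynomial loops, clear all poles by one common power
  of \<open>zeta\<close>, and complete the resulting polynomial column. Perturbation and
  multiplication by the power are both harmless.\<close>

theorem unimod_Rch:
 assumes d: "GLdense S" and m: "m >= 2" and u: "unimod m v"
 shows "Rch m v"
proof -
 obtain r where r: "\<And>i. i < m ==> lp (%t. r t i)" "\<And>t. t \<in> {0..1} ==> (\<Sum>k<m. r t k * v t k) = 1"
  and vl: "\<And>i. i < m ==> lp (%t. v t i)" using u unfolding unimod_def by blast
 have "\<forall>i\<in>{..<m}. \<exists>M>0. \<forall>t\<in>{0..1}. norm (r t i) <= M" using lp_bounded[OF r(1)] by (metis lessThan_iff)
 then obtain M where M: "\<And>i. i < m ==> M i > 0" "\<And>i t. i < m ==> t \<in> {0..1} ==> norm (r t i) <= M i" by (metis lessThan_iff)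
 \<comment> \<open>With error below \<open>1 / K\<close> in each entry, the perturbation condition
   sees at most \<open>(K - 1) / K < 1\<close>.\<close>
 define K where "K = (\<Sum>i<m. M i) + 1"
 have K: "K > 0" unfolding K_def using M(1) by (intro add_nonneg_pos sum_nonneg) (auto intro: less_imp_le)
 have "\<forall>i\<in>{..<m}. \<exists>g. Lau g & (\<forall>t\<in>{0..1}. norm (v t i - g t) < 1 / K)"
  using Lau_approx[OF vl, of _ "1 / K"] K by (metis lessThan_iff zero_less_divide_1_iff)
 then obtain g where g: "\<And>i. i < m ==> Lau (g i)" "\<And>i t. i < m ==> t \<in> {0..1} ==> norm (v t i - g i t) < 1 / K"
  by (metis lessThan_iff)
 have "\<forall>i\<in>{..<m}. \<exists>n0. \<forall>n\<ge>n0. Pol (%t. zeta t ^ n * g i t)" using g(1) by (auto simp: Lau_def)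
 then obtain n0 where n0: "\<And>i n. i < m ==> n >= n0 i ==> Pol (%t. zeta t ^ n * g i t)" by (metis lessThan_iff)
 define n where "n = (\<Sum>i<m. n0 i)"
 have "n >= n0 i" if "i < m" for i unfolding n_def using that by (intro member_le_sum) auto
 then have "\<forall>i\<in>{..<m}. \<exists>N a. (\<forall>k. a k \<in> S) & (\<forall>t. zeta t ^ n * g i t = (\<Sum>k<N. a k * zeta t ^ k))"
  using n0 unfolding Pol_def by blast
 then obtain N a where Na: "\<And>i k. i < m ==> a i k \<in> S" "\<And>i t. i < m ==> zeta t ^ n * g i t = (\<Sum>k<N i. a i k * zeta t ^ k)"
  by (metis lessThan_iff)
 define a' where "a' i k = (if i < m then a i k else 0)" for i k
 let ?p = "%t i. \<Sum>k<N i. a' i k * zeta t ^ k"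
 have a'S: "a' i k \<in> S" for i k using Na(1) zero_S by (auto simp: a'_def)
 have p: "?p t i = zeta t ^ n * g i t" if "i < m" for i t using Na(2)[OF that] that by (simp add: a'_def)
 have pl: "lp (%t. ?p t i)" for i by (intro lp_sum lp_mult lp_const a'S lp_zeta)
 let ?z = "%t. adj (zeta t ^ n) :: 'a"
 have za: "?z t * zeta t ^ n = 1" for t
  unfolding zeta_power adj_cplx by (simp_all add: cplx_mult[symmetric] cis_cnj cis_mult Complex.DeMoivre)
 have nz: "norm (?z t) = 1" for t using norm_zeta_power(1)[of t n 1] by simp
 have zz: "r t k * ?z t * (zeta t ^ n * x) = r t k * x" for t k x
 proof -
  have "r t k * ?z t * (zeta t ^ n * x) = r t k * (?z t * zeta t ^ n) * x" by (simp only: mult.assoc)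
  then show ?thesis by (simp only: za mult_1_right)
 qed
 have 1: "lp (%t. zeta t ^ n * v t i)" "lp (%t. r t i * ?z t)" if "i < m" for i
  by (intro lp_mult lp_zeta lp_adj vl r that)+
 have 2: "(\<Sum>k<m. r t k * ?z t * (zeta t ^ n * v t k)) = 1" if "t \<in> {0..1}" for t
  unfolding zz using r(2)[OF that] .
 have 3: "norm (\<Sum>k<m. r t k * ?z t * (?p t k - zeta t ^ n * v t k)) < 1" if t: "t \<in> {0..1}" for t
 proof -
  have "norm (\<Sum>k<m. r t k * ?z t * (?p t k - zeta t ^ n * v t k)) <= (\<Sum>k<m. M k * (1 / K))"
  proof (rule sum_norm_le)
   fix k assume "k \<in> {..<m}"
   then have k: "k < m" by simp
   have "r t k * ?z t * (?p t k - zeta t ^ n * v t k) = r t k * (g k t - v t k)"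
    unfolding p[OF k] right_diff_distrib[symmetric] by (rule zz)
   then have "norm (r t k * ?z t * (?p t k - zeta t ^ n * v t k)) <= norm (r t k) * norm (g k t - v t k)"
    by (simp only: norm_mult_ineq)
   also have "\<dots> <= M k * (1 / K)"
    using M[OF k] g(2)[OF k t] t by (intro mult_mono) (auto simp: norm_minus_commute less_imp_le)
   finally show "norm (r t k * ?z t * (?p t k - zeta t ^ n * v t k)) <= M k * (1 / K)" .
  qed
  also have "\<dots> = (K - 1) / K" by (simp add: K_def sum_divide_distrib)
  also have "\<dots> < 1" using K by simp
  finally show ?thesis .
 qed
 have pert: "unimod m ?p" "Rch m ?p ==> Rch m (%t i. zeta t ^ n * v t i)"
  using unimod_perturb[of m "%t i. zeta t ^ n * v t i" "%t k. r t k * ?z t" ?p] 1 2 pl 3 by blast+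
 have "Rch m ?p" by (rule Rch_polynomial[OF d m pert(1) a'S]) auto
 then have "Rch m (%t i. zeta t ^ n * v t i)" by (rule pert(2))
 then show ?thesis by (rule Rch_zeta)
qed

section \<open>Destabilisation of paths of invertible matrices\<close>

definition dg :: "nat => 'a => 'a mtx" where
 "dg m u = (%i j. if i = j & i < m then (if i = 0 then u else 1) else 0)"

definition glpath :: "nat => 'a => bool" where
 "glpath m u \<longleftrightarrow> (\<exists>G H :: real => 'a mtx. continuous_on {0..1} G & continuous_on {0..1} H \<and>
  (\<forall>t\<in>{0..1}. G t \<in> mats m S & H t \<in> mats m S & mm m (G t) (H t) = mI m & mm m (H t) (G t) = mI m) \<and>
  G 0 = mI m & G 1 = dg m u)"

definition blk :: "nat => 'a mtx => 'a mtx" where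
 "blk l P = (%i j. if i < l & j < l then P i j else 0)"

lemma blk_mm: "(\<And>i. i < l ==> P i l = 0) ==> blk l (mm (Suc l) P Q) = mm l (blk l P) (blk l Q)"
 by (auto simp: blk_def mm_def fun_eq_iff intro!: sum.neutral)

lemma blk_mI: "blk l (mI (Suc l)) = mI l"
 by (auto simp: blk_def mI_def fun_eq_iff)

lemma blk_mats: "P \<in> mats (Suc l) S ==> blk l P \<in> mats l S"
 by (auto simp: blk_def mats_def)

text \<open>At both ends of the path the last column is the last unit vector, so along the path it
  is a unimodular loop, a left inverse being the last row of the inverse path. Completing it to an
  invertible loop \<open>E\<close> and multiplying by the inverse \<open>F\<close> of
  \<open>E\<close> fixes the last column, so the upper left blocks form an invertible path of size
  one less.\<close>

lemma glpath_step:
 assumes d: "GLdense S" and l: "l >= 1" and u: "u \<in> GL S" and p: "glpath (Suc l) u"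
 shows "glpath l u"
proof -
 let ?m = "Suc l"
 obtain G H :: "real => 'a mtx" where c: "continuous_on {0..1} G" "continuous_on {0..1} H"
  and GH: "\<And>t. t \<in> {0..1} ==> G t \<in> mats ?m S" "\<And>t. t \<in> {0..1} ==> H t \<in> mats ?m S"
   "\<And>t. t \<in> {0..1} ==> mm ?m (G t) (H t) = mI ?m" "\<And>t. t \<in> {0..1} ==> mm ?m (H t) (G t) = mI ?m"
  and G0: "G 0 = mI ?m" and G1: "G 1 = dg ?m u"
  using p unfolding glpath_def by blast
 have H0: "H 0 = mI ?m" using GH(3)[of 0] GH(2)[of 0] G0 mm_mI_left[of "H 0" ?m S] by simp
 have H1: "H 1 l i = mI ?m l i" if i: "i < ?m" for i
 proof -
  have "mm ?m (H 1) (dg ?m u) l i = mI ?m l i" using GH(4)[of 1] G1 by simp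
  moreover have "mm ?m (H 1) (dg ?m u) l i = H 1 l i * (if i = 0 then u else 1)"
   unfolding mm_def using i by (subst sum_one[of i]) (auto simp: dg_def)
  ultimately have e: "H 1 l i * (if i = 0 then u else 1) = mI ?m l i" by simp
  show ?thesis
  proof (cases "i = 0")
   case True
   then have "H 1 l i * u = 0" using e l by (simp add: mI_def)
   then have "H 1 l i * (u * minv u) = 0" by (simp only: mult.assoc[symmetric]) simp
   then show ?thesis using minv(1)[OF u] True l by (simp add: mI_def)
  next
   case False
   then show ?thesis using e by simp
  qed
 qed
 define v where "v t i = G t i l" for t i
 have cG: "continuous_on {0..1} (%t. G t i j)" "continuous_on {0..1} (%t. H t i j)" for i j
  using c by (auto simp: continuous_on_mtx)
 have "unimod ?m v" unfolding unimod_def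
 proof (intro conjI exI[of _ "%t i. H t l i"] allI impI ballI)
  show "lp (%t. v t i)" if "i < ?m" for i
   unfolding lp_def v_def using GH(1) that cG G0 G1 l by (auto simp: mats_def mI_def dg_def)
  show "lp (%t. H t l i)" if "i < ?m" for i
   unfolding lp_def using GH(2) that cG H0 H1[OF that] by (auto simp: mats_def)
  fix t :: real assume "t \<in> {0..1}"
  then have "mm ?m (H t) (G t) l l = mI ?m l l" using GH(4) by simp
  then show "(\<Sum>k<?m. H t l k * v t k) = 1" by (simp add: mm_def v_def mI_def)
 qed
 then have "Rch ?m v" using l by (intro unimod_Rch d) auto
 then obtain E F where EF: "gloop ?m E F" and vE: "\<And>t i. t \<in> {0..1} ==> i < ?m ==> v t i = E t i l"
  by (auto simp: Rch_def)
 define N N' where "N t = mm ?m (F t) (G t)" and "N' t = mm ?m (H t) (E t)" for t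
 have ef: "E t \<in> mats ?m S" "F t \<in> mats ?m S" "mm ?m (E t) (F t) = mI ?m" "mm ?m (F t) (E t) = mI ?m" if "t \<in> {0..1}" for t
  using EF that by (auto simp: gloop_def)
 have NN: "N t \<in> mats ?m S" "N' t \<in> mats ?m S" "mm ?m (N t) (N' t) = mI ?m" "mm ?m (N' t) (N t) = mI ?m" if t: "t \<in> {0..1}" for t
 proof -
  show "N t \<in> mats ?m S" "N' t \<in> mats ?m S" unfolding N_def N'_def by (intro mm_mats ef GH t)+
  have "mm ?m (N t) (N' t) = mm ?m (F t) (mm ?m (mm ?m (G t) (H t)) (E t))" "mm ?m (N' t) (N t) = mm ?m (H t) (mm ?m (mm ?m (E t) (F t)) (G t))"
   unfolding N_def N'_def by (simp_all only: mm_assoc)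
  then show "mm ?m (N t) (N' t) = mI ?m" "mm ?m (N' t) (N t) = mI ?m"
   using GH(3,4)[OF t] ef(3,4)[OF t] mm_mI_left[OF ef(1)[OF t]] mm_mI_left[OF GH(1)[OF t]] by simp_all
 qed
 have Nl: "N t i l = mI ?m i l" if t: "t \<in> {0..1}" for t i
 proof -
  have "N t i l = mm ?m (F t) (E t) i l" unfolding N_def mm_def
   using vE[OF t] by (intro sum.cong) (auto simp: v_def)
  then show ?thesis using ef(4)[OF t] by simp
 qed
 have N'l: "N' t i l = mI ?m i l" if t: "t \<in> {0..1}" for t i
 proof -
  have "mm ?m (N' t) (N t) i l = N' t i l" unfolding mm_def
   by (subst sum_one[of l]) (auto simp: Nl[OF t] mI_def)
  then show ?thesis using NN(4)[OF t] by simp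
 qed
 define P P' where "P t = blk l (N t)" and "P' t = blk l (N' t)" for t
 have PP: "P t \<in> mats l S" "P' t \<in> mats l S" "mm l (P t) (P' t) = mI l" "mm l (P' t) (P t) = mI l" if t: "t \<in> {0..1}" for t
 proof -
  show "P t \<in> mats l S" "P' t \<in> mats l S" unfolding P_def P'_def using NN[OF t] by (auto intro: blk_mats)
  have "N t i l = 0" "N' t i l = 0" if "i < l" for i using Nl[OF t, of i] N'l[OF t, of i] that by (auto simp: mI_def)
  then show "mm l (P t) (P' t) = mI l" "mm l (P' t) (P t) = mI l" unfolding P_def P'_def
   using blk_mm[of l "N t" "N' t"] blk_mm[of l "N' t" "N t"] NN(3,4)[OF t] by (simp_all add: blk_mI)
 qed
 \<comment> \<open>Because the correction is a loop, the same matrix is applied at both ends; the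
   ends of the reduced path therefore still differ exactly by \<open>dg l u\<close>.\<close>
 have F01: "F 0 = F 1" using EF by (auto simp: gloop_def lp_def fun_eq_iff)
 have P1: "P 1 = mm l (P 0) (dg l u)"
 proof -
  have N0: "N 0 = F 0" unfolding N_def G0 using ef(2)[of 0] mm_mI_right[of "F 0" ?m S] by simp
  have "N 1 = mm ?m (N 0) (dg ?m u)" unfolding N0 unfolding N_def G1 F01 ..
  moreover have "N 0 i l = 0" if "i < l" for i using Nl[of 0 i] that by (auto simp: mI_def)
  ultimately have "P 1 = mm l (P 0) (blk l (dg ?m u))" unfolding P_def using blk_mm[of l "N 0" "dg ?m u"] by simp
  moreover have "blk l (dg ?m u) = dg l u" by (auto simp: blk_def dg_def fun_eq_iff)
  ultimately show ?thesis by simp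
 qed
 have cP: "continuous_on {0..1} P" "continuous_on {0..1} P'"
 proof -
  have "continuous_on {0..1} (%t. E t i j)" "continuous_on {0..1} (%t. F t i j)" for i j
   using EF by (auto simp: gloop_def lp_def)
  then have "continuous_on {0..1} E" "continuous_on {0..1} F" by (auto simp: continuous_on_mtx)
  then have "continuous_on {0..1} N" "continuous_on {0..1} N'"
   unfolding N_def N'_def by (auto intro!: continuous_on_mm c)
  then show "continuous_on {0..1} P" "continuous_on {0..1} P'"
   unfolding P_def P'_def continuous_on_mtx blk_def by (auto intro!: continuous_on_if_const continuous_intros)
 qed
 have z: "(0::real) \<in> {0..1}" by simp
 have dgS: "dg l u \<in> mats l S" using u GL_subset by (auto simp: dg_def mats_def intro: zero_S one_S)
 show ?thesis unfolding glpath_def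
 proof (rule exI[of _ "%t. mm l (P' 0) (P t)"], rule exI[of _ "%t. mm l (P' t) (P 0)"], intro conjI ballI)
  show "continuous_on {0..1} (%t. mm l (P' 0) (P t))" "continuous_on {0..1} (%t. mm l (P' t) (P 0))"
   by (intro continuous_on_mm cP continuous_on_const)+
  show "mm l (P' 0) (P 0) = mI l" using PP(4)[OF z] .
  have "mm l (P' 0) (P 1) = mm l (mm l (P' 0) (P 0)) (dg l u)" unfolding P1 by (simp only: mm_assoc)
  then show "mm l (P' 0) (P 1) = dg l u" using PP(4)[OF z] mm_mI_left[OF dgS] by simp
  fix t :: real assume t: "t \<in> {0..1}"
  show "mm l (P' 0) (P t) \<in> mats l S" "mm l (P' t) (P 0) \<in> mats l S" by (intro mm_mats PP t z)+
  have "mm l (mm l (P' 0) (P t)) (mm l (P' t) (P 0)) = mm l (P' 0) (mm l (mm l (P t) (P' t)) (P 0))"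
   "mm l (mm l (P' t) (P 0)) (mm l (P' 0) (P t)) = mm l (P' t) (mm l (mm l (P 0) (P' 0)) (P t))" by (simp_all only: mm_assoc)
  then show "mm l (mm l (P' 0) (P t)) (mm l (P' t) (P 0)) = mI l" "mm l (mm l (P' t) (P 0)) (mm l (P' 0) (P t)) = mI l"
   using PP(3,4)[OF z] PP(3,4)[OF t] mm_mI_left[OF PP(1)[OF z]] mm_mI_left[OF PP(1)[OF t]] by simp_all
 qed
qed

theorem glpath_connected:
 assumes d: "GLdense S" and u: "u \<in> UG S" and m: "m >= 1" and p: "glpath m u"
 shows "path_component (UG S) 1 u"
proof -
 have uG: "u \<in> GL S" by (rule UG_GL[OF u])
 have "glpath (Suc k) u ==> glpath 1 u" for k
 proof (induction k)
  case (Suc k)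
  have "glpath (Suc k) u" by (rule glpath_step[OF d _ uG Suc.prems]) simp
  then show ?case by (rule Suc.IH)
 qed simp
 moreover have "glpath (Suc (m - 1)) u" using m p by simp
 ultimately have "glpath 1 u" by blast
 then obtain G H :: "real => 'a mtx" where c: "continuous_on {0..1} G"
  and GH: "\<And>t. t \<in> {0..1} ==> G t \<in> mats 1 S & H t \<in> mats 1 S & mm 1 (G t) (H t) = mI 1 & mm 1 (H t) (G t) = mI 1"
  and G0: "G 0 = mI 1" and G1: "G 1 = dg 1 u"
  unfolding glpath_def by blast
 have "G t 0 0 \<in> GL S" if "t \<in> {0..1}" for t
 proof -
  have "mm 1 (G t) (H t) 0 0 = mI 1 0 0" "mm 1 (H t) (G t) 0 0 = mI 1 0 0" using GH[OF that] by simp_all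
  then have "G t 0 0 * H t 0 0 = 1" "H t 0 0 * G t 0 0 = 1" by (simp_all add: mm_def mI_def)
  then show ?thesis using GH[OF that] by (auto simp: GL_def mats_def)
 qed
 moreover have "continuous_on {0..1} (%t. G t 0 0)" using c by (simp add: continuous_on_mtx)
 ultimately have "path_component (GL S) 1 u" unfolding path_component_def
  by (intro exI[of _ "%t. G t 0 0"]) (auto simp: path_def path_image_def pathstart_def pathfinish_def G0 G1 mI_def dg_def)
 then show ?thesis using UG_path_component u UG_one by blast
qed

end

section \<open>A type containing all C*-algebra structures on a given type\<close>

lemma cstar_algebraD:
 assumes "cstar_algebra A"
 shows cs_zero: "zero A \<in> carrier A"
  and cs_add: "x \<in> carrier A ==> y \<in> carrier A ==> add A x y \<in> carrier A"
  and cs_mul: "x \<in> carrier A ==> y \<in> carrier A ==> mul A x y \<in> carrier A"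
  and cs_smul: "x \<in> carrier A ==> smul A c x \<in> carrier A"
  and cs_star: "x \<in> carrier A ==> star A x \<in> carrier A"
  and cs_add_assoc: "x \<in> carrier A ==> y \<in> carrier A ==> z \<in> carrier A ==> add A (add A x y) z = add A x (add A y z)"
  and cs_add_comm: "x \<in> carrier A ==> y \<in> carrier A ==> add A x y = add A y x"
  and cs_add_zero: "x \<in> carrier A ==> add A x (zero A) = x"
  and cs_add_neg: "x \<in> carrier A ==> add A x (smul A (-1) x) = zero A"
  and cs_smul_add: "x \<in> carrier A ==> y \<in> carrier A ==> smul A c (add A x y) = add A (smul A c x) (smul A c y)"
  and cs_add_smul: "x \<in> carrier A ==> smul A (c + d) x = add A (smul A c x) (smul A d x)"
  and cs_mult_smul: "x \<in> carrier A ==> smul A (c * d) x = smul A c (smul A d x)"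
  and cs_smul_one: "x \<in> carrier A ==> smul A 1 x = x"
  and cs_mul_assoc: "x \<in> carrier A ==> y \<in> carrier A ==> z \<in> carrier A ==> mul A (mul A x y) z = mul A x (mul A y z)"
  and cs_mul_add: "x \<in> carrier A ==> y \<in> carrier A ==> z \<in> carrier A ==> mul A x (add A y z) = add A (mul A x y) (mul A x z)"
  and cs_add_mul: "x \<in> carrier A ==> y \<in> carrier A ==> z \<in> carrier A ==> mul A (add A x y) z = add A (mul A x z) (mul A y z)"
  and cs_smul_mul: "x \<in> carrier A ==> y \<in> carrier A ==> mul A (smul A c x) y = smul A c (mul A x y)"
  and cs_mul_smul: "x \<in> carrier A ==> y \<in> carrier A ==> mul A x (smul A c y) = smul A c (mul A x y)"
  and cs_star_star: "x \<in> carrier A ==> star A (star A x) = x"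
  and cs_star_add: "x \<in> carrier A ==> y \<in> carrier A ==> star A (add A x y) = add A (star A x) (star A y)"
  and cs_star_smul: "x \<in> carrier A ==> star A (smul A c x) = smul A (cnj c) (star A x)"
  and cs_star_mul: "x \<in> carrier A ==> y \<in> carrier A ==> star A (mul A x y) = mul A (star A y) (star A x)"
  and cs_nrm_nonneg: "x \<in> carrier A ==> nrm A x >= 0"
  and cs_nrm_zero: "x \<in> carrier A ==> nrm A x = 0 \<longleftrightarrow> x = zero A"
  and cs_nrm_add: "x \<in> carrier A ==> y \<in> carrier A ==> nrm A (add A x y) <= nrm A x + nrm A y"
  and cs_nrm_smul: "x \<in> carrier A ==> nrm A (smul A c x) = cmod c * nrm A x"
  and cs_nrm_mul: "x \<in> carrier A ==> y \<in> carrier A ==> nrm A (mul A x y) <= nrm A x * nrm A y"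
  and cs_cstar: "x \<in> carrier A ==> nrm A (mul A (star A x) x) = (nrm A x)\<^sup>2"
  and cs_complete: "(\<And>n. f n \<in> carrier A) ==>
     (\<And>e. e > 0 ==> \<exists>N. \<forall>m\<ge>N. \<forall>n\<ge>N. nrm A (sub A (f m) (f n)) < e) ==>
     \<exists>x\<in>carrier A. (%n. nrm A (sub A (f n) x)) \<longlonglongrightarrow> 0"
proof -
 note ax = assms[unfolded cstar_algebra_def]
 note a0 = ax
 note a1 = a0[THEN conjunct2]
 note a2 = a1[THEN conjunct2]
 note a3 = a2[THEN conjunct2]
 note a4 = a3[THEN conjunct2]
 note a5 = a4[THEN conjunct2]
 note a6 = a5[THEN conjunct2]
 note a7 = a6[THEN conjunct2]
 note a8 = a7[THEN conjunct2]
 note a9 = a8[THEN conjunct2]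
 note a10 = a9[THEN conjunct2]
 note a11 = a10[THEN conjunct2]
 note a12 = a11[THEN conjunct2]
 note a13 = a12[THEN conjunct2]
 note a14 = a13[THEN conjunct2]
 note a15 = a14[THEN conjunct2]
 note a16 = a15[THEN conjunct2]
 note a17 = a16[THEN conjunct2]
 note a18 = a17[THEN conjunct2]
 note a19 = a18[THEN conjunct2]
 note a20 = a19[THEN conjunct2]
 note a21 = a20[THEN conjunct2]
 note a22 = a21[THEN conjunct2]
 note a23 = a22[THEN conjunct2]
 note a24 = a23[THEN conjunct2]
 note a25 = a24[THEN conjunct2]
 show "zero A \<in> carrier A"
  by (rule a0[THEN conjunct1, rule_format])
 show "x \<in> carrier A ==> y \<in> carrier A ==> add A x y \<in> carrier A"
  by (rule a1[THEN conjunct1, rule_format, THEN conjunct1])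
 show "x \<in> carrier A ==> y \<in> carrier A ==> mul A x y \<in> carrier A"
  by (rule a1[THEN conjunct1, rule_format, THEN conjunct2])
 show "x \<in> carrier A ==> smul A c x \<in> carrier A"
  by (rule a2[THEN conjunct1, rule_format])
 show "x \<in> carrier A ==> star A x \<in> carrier A"
  by (rule a3[THEN conjunct1, rule_format])
 show "x \<in> carrier A ==> y \<in> carrier A ==> z \<in> carrier A ==> add A (add A x y) z = add A x (add A y z)"
  by (rule a4[THEN conjunct1, rule_format])
 show "x \<in> carrier A ==> y \<in> carrier A ==> add A x y = add A y x"
  by (rule a5[THEN conjunct1, rule_format])
 show "x \<in> carrier A ==> add A x (zero A) = x"
  by (rule a6[THEN conjunct1, rule_format])
 show "x \<in> carrier A ==> add A x (smul A (-1) x) = zero A"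
  by (rule a7[THEN conjunct1, rule_format])
 show "x \<in> carrier A ==> y \<in> carrier A ==> smul A c (add A x y) = add A (smul A c x) (smul A c y)"
  by (rule a8[THEN conjunct1, rule_format])
 show "x \<in> carrier A ==> smul A (c + d) x = add A (smul A c x) (smul A d x)"
  by (rule a9[THEN conjunct1, rule_format])
 show "x \<in> carrier A ==> smul A (c * d) x = smul A c (smul A d x)"
  by (rule a10[THEN conjunct1, rule_format])
 show "x \<in> carrier A ==> smul A 1 x = x"
  by (rule a11[THEN conjunct1, rule_format])
 show "x \<in> carrier A ==> y \<in> carrier A ==> z \<in> carrier A ==> mul A (mul A x y) z = mul A x (mul A y z)"
  by (rule a12[THEN conjunct1, rule_format])
 show "x \<in> carrier A ==> y \<in> carrier A ==> z \<in> carrier A ==> mul A x (add A y z) = add A (mul A x y) (mul A x z)"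
  by (rule a13[THEN conjunct1, rule_format])
 show "x \<in> carrier A ==> y \<in> carrier A ==> z \<in> carrier A ==> mul A (add A x y) z = add A (mul A x z) (mul A y z)"
  by (rule a14[THEN conjunct1, rule_format])
 show "x \<in> carrier A ==> y \<in> carrier A ==> mul A (smul A c x) y = smul A c (mul A x y)"
  by (rule a15[THEN conjunct1, rule_format, THEN conjunct1])
 show "x \<in> carrier A ==> y \<in> carrier A ==> mul A x (smul A c y) = smul A c (mul A x y)"
  by (rule a15[THEN conjunct1, rule_format, THEN conjunct2])
 show "x \<in> carrier A ==> star A (star A x) = x"
  by (rule a16[THEN conjunct1, rule_format])
 show "x \<in> carrier A ==> y \<in> carrier A ==> star A (add A x y) = add A (star A x) (star A y)"
  by (rule a17[THEN conjunct1, rule_format])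
 show "x \<in> carrier A ==> star A (smul A c x) = smul A (cnj c) (star A x)"
  by (rule a18[THEN conjunct1, rule_format])
 show "x \<in> carrier A ==> y \<in> carrier A ==> star A (mul A x y) = mul A (star A y) (star A x)"
  by (rule a19[THEN conjunct1, rule_format])
 show "x \<in> carrier A ==> nrm A x >= 0"
  by (rule a20[THEN conjunct1, rule_format, THEN conjunct1])
 show "x \<in> carrier A ==> nrm A x = 0 \<longleftrightarrow> x = zero A"
  by (rule a20[THEN conjunct1, rule_format, THEN conjunct2])
 show "x \<in> carrier A ==> y \<in> carrier A ==> nrm A (add A x y) <= nrm A x + nrm A y"
  by (rule a21[THEN conjunct1, rule_format])
 show "x \<in> carrier A ==> nrm A (smul A c x) = cmod c * nrm A x"
  by (rule a22[THEN conjunct1, rule_format])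
 show "x \<in> carrier A ==> y \<in> carrier A ==> nrm A (mul A x y) <= nrm A x * nrm A y"
  by (rule a23[THEN conjunct1, rule_format])
 show "x \<in> carrier A ==> nrm A (mul A (star A x) x) = (nrm A x)\<^sup>2"
  by (rule a24[THEN conjunct1, rule_format])
 show "(\<And>n. f n \<in> carrier A) ==>
     (\<And>e. e > 0 ==> \<exists>N. \<forall>m\<ge>N. \<forall>n\<ge>N. nrm A (sub A (f m) (f n)) < e) ==>
     \<exists>x\<in>carrier A. (%n. nrm A (sub A (f n) x)) \<longlonglongrightarrow> 0"
  using a25[rule_format] by blast
qed

text \<open>The one-point algebra, a witness that the type of all structures is inhabited.\<close>

definition trivial_alg :: "'a cstar_alg" where
 "trivial_alg = \<lparr>carrier = {undefined}, zero = undefined, add = (%_ _. undefined), mul = (%_ _. undefined),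
  smul = (%_ _. undefined), star = (%_. undefined), nrm = (%_. 0)\<rparr>"

lemma cstar_trivial: "cstar_algebra trivial_alg"
 unfolding cstar_algebra_def trivial_alg_def by simp

typedef 'a cs = "{A :: 'a cstar_alg. cstar_algebra A}"
 using cstar_trivial by blast

lemma Rep_cs_cstar: "cstar_algebra (Rep_cs i)"
 using Rep_cs by blast

lemmas Rep_cs_closed = cs_zero[OF Rep_cs_cstar] cs_add[OF Rep_cs_cstar] cs_mul[OF Rep_cs_cstar]
 cs_smul[OF Rep_cs_cstar] cs_star[OF Rep_cs_cstar]

lemma cs_smul_zero: assumes A: "cstar_algebra A" shows "smul A c (zero A) = zero A"
 using cs_nrm_smul[OF A cs_zero[OF A], of c] cs_nrm_zero[OF A cs_zero[OF A]]
  cs_nrm_zero[OF A cs_smul[OF A cs_zero[OF A], of c]] by simp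

lemma cs_zero_smul: assumes A: "cstar_algebra A" and x: "x \<in> carrier A" shows "smul A 0 x = zero A"
 using cs_nrm_smul[OF A x, of 0] cs_nrm_zero[OF A cs_smul[OF A x, of 0]] by simp

lemma cs_nrm_0: assumes A: "cstar_algebra A" shows "nrm A (zero A) = 0"
 using cs_nrm_zero[OF A cs_zero[OF A]] by simp

lemma cs_zero_mul: assumes A: "cstar_algebra A" and x: "x \<in> carrier A"
 shows "mul A (zero A) x = zero A" "mul A x (zero A) = zero A"
proof -
 note z = cs_zero[OF A]
 have "nrm A (mul A (zero A) x) <= 0" "nrm A (mul A x (zero A)) <= 0"
  using cs_nrm_mul[OF A z x] cs_nrm_mul[OF A x z] cs_nrm_0[OF A] by simp_all
 then have "nrm A (mul A (zero A) x) = 0" "nrm A (mul A x (zero A)) = 0"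
  using cs_nrm_nonneg[OF A cs_mul[OF A z x]] cs_nrm_nonneg[OF A cs_mul[OF A x z]] by simp_all
 then show "mul A (zero A) x = zero A" "mul A x (zero A) = zero A"
  using cs_nrm_zero[OF A cs_mul[OF A z x]] cs_nrm_zero[OF A cs_mul[OF A x z]] by simp_all
qed

lemma cs_star_zero: assumes A: "cstar_algebra A" shows "star A (zero A) = zero A"
 using cs_star_smul[OF A cs_zero[OF A], of 0] cs_zero_smul[OF A] cs_zero[OF A] cs_star[OF A] by simp

lemma cs_nrm_star: assumes A: "cstar_algebra A" and x: "x \<in> carrier A" shows "nrm A (star A x) = nrm A x"
proof -
 have le: "nrm A y <= nrm A (star A y)" if y: "y \<in> carrier A" for y
 proof (cases "nrm A y = 0")
  case True
  then show ?thesis using cs_nrm_nonneg[OF A cs_star[OF A y]] by simp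
 next
  case False
  have "nrm A y * nrm A y <= nrm A (star A y) * nrm A y"
   using cs_cstar[OF A y] cs_nrm_mul[OF A cs_star[OF A y] y] by (simp add: power2_eq_square)
  then show ?thesis using False cs_nrm_nonneg[OF A y] by (simp add: mult_le_cancel_right)
 qed
 show ?thesis using le[OF x] le[OF cs_star[OF A x]] cs_star_star[OF A x] by simp
qed

text \<open>The counterpart of \<open>ucstar\<close> without a unit. There is no element
  \<open>J\<close> to carry the complex structure, so multiplication by the imaginary unit is an
  operation of its own.\<close>

class ncstar = real_normed_algebra + banach +
 fixes adjn :: "'a => 'a" and mulI :: "'a => 'a"
 assumes adjn_add: "adjn (x + y) = adjn x + adjn y"
  and adjn_scaleR: "adjn (r *\<^sub>R x) = r *\<^sub>R adjn x"
  and adjn_mult: "adjn (x * y) = adjn y * adjn x"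
  and adjn_adjn: "adjn (adjn x) = x"
  and cstarn: "norm (adjn x * x) = (norm x)\<^sup>2"
  and mulI_add: "mulI (x + y) = mulI x + mulI y"
  and mulI_scaleR: "mulI (r *\<^sub>R x) = r *\<^sub>R mulI x"
  and mulI_mulI: "mulI (mulI x) = - x"
  and mulI_mult: "mulI x * y = mulI (x * y)"
  and mult_mulI: "x * mulI y = mulI (x * y)"
  and adjn_mulI: "adjn (mulI x) = - mulI (adjn x)"
  and norm_mulI: "norm (mulI x) = norm x"

text \<open>The bounded product of all C*-algebra structures on the type. A type cannot depend on a
  record, but this one contains every algebra as a coordinate and is itself an instance of the
  class.\<close>

typedef 'a prd = "{f :: 'a cs => 'a. (\<forall>i. f i \<in> carrier (Rep_cs i)) & (\<exists>K. \<forall>i. nrm (Rep_cs i) (f i) <= K)}"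
 morphisms crd Pr
 by (rule exI[of _ "%i. zero (Rep_cs i)"]) (auto simp: Rep_cs_closed cs_nrm_0[OF Rep_cs_cstar])

setup_lifting type_definition_prd

lemma crd_in: "crd f i \<in> carrier (Rep_cs i)" using crd[of f] by blast

lemma crd_bdd: "bdd_above (range (%i. nrm (Rep_cs i) (crd f i)))"
 using crd[of f] by (auto simp: bdd_above_def)

lemma pr_eqI: "(\<And>i. crd f i = crd g i) ==> f = g"
 by (metis crd_inject ext)

instantiation prd :: (type) ab_group_add
begin

lift_definition zero_prd :: "'a prd" is "%i. zero (Rep_cs i)"
 by (auto simp: Rep_cs_closed cs_nrm_0[OF Rep_cs_cstar])

lift_definition plus_prd :: "'a prd => 'a prd => 'a prd" is "%f g i. add (Rep_cs i) (f i) (g i)"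
proof (intro conjI allI)
 fix f g :: "'a cs => 'a"
 assume f: "(\<forall>i. f i \<in> carrier (Rep_cs i)) & (\<exists>K. \<forall>i. nrm (Rep_cs i) (f i) <= K)"
  and g: "(\<forall>i. g i \<in> carrier (Rep_cs i)) & (\<exists>K. \<forall>i. nrm (Rep_cs i) (g i) <= K)"
 show "add (Rep_cs i) (f i) (g i) \<in> carrier (Rep_cs i)" for i using f g by (simp add: Rep_cs_closed)
 obtain K L where K: "\<And>i. nrm (Rep_cs i) (f i) <= K" "\<And>i. nrm (Rep_cs i) (g i) <= L" using f g by blast
 have "nrm (Rep_cs i) (add (Rep_cs i) (f i) (g i)) <= K + L" for i
  using K[of i] f g by (intro order_trans[OF cs_nrm_add[OF Rep_cs_cstar]] add_mono) auto
 then show "\<exists>K. \<forall>i. nrm (Rep_cs i) (add (Rep_cs i) (f i) (g i)) <= K" by blast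
qed

lift_definition uminus_prd :: "'a prd => 'a prd" is "%f i. smul (Rep_cs i) (-1) (f i)"
 by (auto simp: Rep_cs_closed cs_nrm_smul[OF Rep_cs_cstar])

definition minus_prd :: "'a prd => 'a prd => 'a prd" where "minus_prd f g = f + (- g)"

instance
proof
 fix a b c :: "'a prd"
 show "a + b + c = a + (b + c)"
  by (rule pr_eqI) (simp add: plus_prd.rep_eq cs_add_assoc[OF Rep_cs_cstar] crd_in)
 show "a + b = b + a"
  by (rule pr_eqI) (simp add: plus_prd.rep_eq cs_add_comm[OF Rep_cs_cstar] crd_in)
 then show "0 + a = a"
  by (metis (mono_tags, lifting) pr_eqI plus_prd.rep_eq zero_prd.rep_eq cs_add_zero[OF Rep_cs_cstar] cs_add_comm[OF Rep_cs_cstar] crd_in)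
 show "- a + a = 0"
  by (rule pr_eqI) (simp add: plus_prd.rep_eq uminus_prd.rep_eq zero_prd.rep_eq
   cs_add_comm[OF Rep_cs_cstar, of "smul _ _ _"] cs_add_neg[OF Rep_cs_cstar] crd_in Rep_cs_closed)
qed (simp add: minus_prd_def)

end

lemma scale_bdd:
 "(\<forall>i. f i \<in> carrier (Rep_cs i)) & (\<exists>K. \<forall>i. nrm (Rep_cs i) (f i) <= K) ==>
 (\<forall>i. smul (Rep_cs i) c (f i) \<in> carrier (Rep_cs i)) & (\<exists>K. \<forall>i. nrm (Rep_cs i) (smul (Rep_cs i) c (f i)) <= K)"
proof (intro conjI allI)
 assume f: "(\<forall>i. f i \<in> carrier (Rep_cs i)) & (\<exists>K. \<forall>i. nrm (Rep_cs i) (f i) <= K)"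
 then show "smul (Rep_cs i) c (f i) \<in> carrier (Rep_cs i)" for i by (simp add: Rep_cs_closed)
 obtain K where K: "\<And>i. nrm (Rep_cs i) (f i) <= K" using f by blast
 then have "nrm (Rep_cs i) (smul (Rep_cs i) c (f i)) <= cmod c * K" for i
  using f by (simp add: cs_nrm_smul[OF Rep_cs_cstar] mult_left_mono)
 then show "\<exists>K. \<forall>i. nrm (Rep_cs i) (smul (Rep_cs i) c (f i)) <= K" by blast
qed

instantiation prd :: (type) real_vector
begin

lift_definition scaleR_prd :: "real => 'a prd => 'a prd" is "%r f i. smul (Rep_cs i) (of_real r) (f i)"
 by (rule scale_bdd)

instance
proof
 fix x y :: "'a prd" and a b :: real
 note C = Rep_cs_cstar
 show "a *\<^sub>R (x + y) = a *\<^sub>R x + a *\<^sub>R y"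
  by (rule pr_eqI) (simp add: plus_prd.rep_eq scaleR_prd.rep_eq cs_smul_add[OF C] crd_in)
 show "(a + b) *\<^sub>R x = a *\<^sub>R x + b *\<^sub>R x"
  by (rule pr_eqI) (simp add: plus_prd.rep_eq scaleR_prd.rep_eq cs_add_smul[OF C] crd_in)
 show "a *\<^sub>R b *\<^sub>R x = (a * b) *\<^sub>R x"
  by (rule pr_eqI) (simp add: scaleR_prd.rep_eq cs_mult_smul[OF C] crd_in)
 show "1 *\<^sub>R x = x"
  by (rule pr_eqI) (simp add: scaleR_prd.rep_eq cs_smul_one[OF C] crd_in)
qed

end

instantiation prd :: (type) real_normed_algebra
begin

lift_definition times_prd :: "'a prd => 'a prd => 'a prd" is "%f g i. mul (Rep_cs i) (f i) (g i)"
proof (intro conjI allI)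
 fix f g :: "'a cs => 'a"
 assume f: "(\<forall>i. f i \<in> carrier (Rep_cs i)) & (\<exists>K. \<forall>i. nrm (Rep_cs i) (f i) <= K)"
  and g: "(\<forall>i. g i \<in> carrier (Rep_cs i)) & (\<exists>K. \<forall>i. nrm (Rep_cs i) (g i) <= K)"
 show "mul (Rep_cs i) (f i) (g i) \<in> carrier (Rep_cs i)" for i using f g by (simp add: Rep_cs_closed)
 obtain K L where K: "\<And>i. nrm (Rep_cs i) (f i) <= K" "\<And>i. nrm (Rep_cs i) (g i) <= L" using f g by blast
 have nn: "0 <= nrm (Rep_cs i) (f i)" "0 <= nrm (Rep_cs i) (g i)" for i
  using f g by (auto intro: cs_nrm_nonneg[OF Rep_cs_cstar])
 have "nrm (Rep_cs i) (mul (Rep_cs i) (f i) (g i)) <= K * L" for i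
  using K[of i] nn[of i] f g
  by (intro order_trans[OF cs_nrm_mul[OF Rep_cs_cstar]] mult_mono) auto
 then show "\<exists>K. \<forall>i. nrm (Rep_cs i) (mul (Rep_cs i) (f i) (g i)) <= K" by blast
qed

definition norm_prd :: "'a prd => real" where
 "norm_prd f = (SUP i. nrm (Rep_cs i) (crd f i))"

definition dist_prd :: "'a prd => 'a prd => real" where "dist_prd f g = norm (f - g)"
definition sgn_prd :: "'a prd => 'a prd" where "sgn_prd f = f /\<^sub>R norm f"
definition uniformity_prd :: "('a prd \<times> 'a prd) filter" where
 "uniformity_prd = (INF e\<in>{0<..}. principal {(x, y). dist x y < e})"
definition open_prd :: "'a prd set => bool" where
 "open_prd U \<longleftrightarrow> (\<forall>x\<in>U. eventually (%(x', y). x' = x --> y \<in> U) uniformity)"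

lemma pr_coord_le: "nrm (Rep_cs i) (crd f i) <= norm f"
 unfolding norm_prd_def by (rule cSUP_upper[OF UNIV_I crd_bdd])

lemma pr_norm_le: "(\<And>i. nrm (Rep_cs i) (crd f i) <= K) ==> norm f <= K"
 unfolding norm_prd_def by (rule cSUP_least) auto

lemma pr_norm_nonneg: "norm (f :: 'a prd) >= 0"
 using pr_coord_le[of undefined f] cs_nrm_nonneg[OF Rep_cs_cstar crd_in, of undefined f] by linarith

lemma pr_minus: "crd (f - g) i = sub (Rep_cs i) (crd f i) (crd g i)"
 by (simp only: minus_prd_def plus_prd.rep_eq uminus_prd.rep_eq sub_def)

lemmas pr_simps = plus_prd.rep_eq uminus_prd.rep_eq zero_prd.rep_eq times_prd.rep_eq scaleR_prd.rep_eq

lemma norm_smul_prd: "(\<And>i. crd g i = smul (Rep_cs i) c (crd f i)) ==> norm g = cmod c * norm (f :: 'a prd)"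
proof -
 have le: "norm g <= cmod c * norm f" if "\<And>i. crd g i = smul (Rep_cs i) c (crd f i)" for c and f g :: "'a prd"
  by (rule pr_norm_le) (simp add: that cs_nrm_smul[OF Rep_cs_cstar] crd_in pr_coord_le mult_left_mono)
 assume eq: "\<And>i. crd g i = smul (Rep_cs i) c (crd f i)"
 show ?thesis
 proof (cases "c = 0")
  case True
  then show ?thesis using le[OF eq] pr_norm_nonneg[of g] by simp
 next
  case False
  have "crd f i = smul (Rep_cs i) (1 / c) (crd g i)" for i
   using False by (simp add: eq cs_mult_smul[OF Rep_cs_cstar, symmetric] crd_in cs_smul_one[OF Rep_cs_cstar])
  then have "norm f <= cmod (1 / c) * norm g" by (rule le)
  then have "cmod c * norm f <= norm g" using False by (simp add: norm_divide field_simps)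
  then show ?thesis using le[OF eq] by simp
 qed
qed

instance
proof
 fix x y z :: "'a prd" and a b :: real
 note C = Rep_cs_cstar
 show "dist x y = norm (x - y)" by (simp add: dist_prd_def)
 show "sgn x = x /\<^sub>R norm x" by (simp add: sgn_prd_def)
 show "uniformity = (INF e\<in>{0<..}. principal {(x, y :: 'a prd). dist x y < e})" by (simp add: uniformity_prd_def)
 show "open U \<longleftrightarrow> (\<forall>x\<in>U. eventually (%(x', y). x' = x --> y \<in> U) uniformity)" for U :: "'a prd set" by (simp add: open_prd_def)
 show "norm (a *\<^sub>R x) = \<bar>a\<bar> * norm x" using norm_smul_prd[of "a *\<^sub>R x" "of_real a" x] by (simp add: pr_simps)
 show "norm x = 0 \<longleftrightarrow> x = 0"
 proof
  assume "norm x = 0"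
  then have "nrm (Rep_cs i) (crd x i) = 0" for i
   using pr_coord_le[of i x] cs_nrm_nonneg[OF C crd_in, of i x] by simp
  then have "crd x i = zero (Rep_cs i)" for i using cs_nrm_zero[OF C crd_in, of i x] by simp
  then show "x = 0" by (intro pr_eqI) (simp add: pr_simps)
 next
  assume "x = 0"
  then have "norm x <= 0" by (intro pr_norm_le) (simp add: pr_simps cs_nrm_0[OF C])
  then show "norm x = 0" using pr_norm_nonneg[of x] by simp
 qed
 show "norm (x + y) <= norm x + norm y"
  by (rule pr_norm_le) (simp add: pr_simps, meson C add_mono cs_nrm_add order_trans pr_coord_le crd_in)
 show "x * y * z = x * (y * z)"
  by (rule pr_eqI) (simp add: pr_simps cs_mul_assoc[OF C] crd_in)
 show "(x + y) * z = x * z + y * z"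
  by (rule pr_eqI) (simp add: pr_simps cs_add_mul[OF C] crd_in)
 show "x * (y + z) = x * y + x * z"
  by (rule pr_eqI) (simp add: pr_simps cs_mul_add[OF C] crd_in)
 show "a *\<^sub>R x * y = a *\<^sub>R (x * y)"
  by (rule pr_eqI) (simp add: pr_simps cs_smul_mul[OF C] crd_in)
 show "x * a *\<^sub>R y = a *\<^sub>R (x * y)"
  by (rule pr_eqI) (simp add: pr_simps cs_mul_smul[OF C] crd_in)
 show "norm (x * y) <= norm x * norm y"
 proof (rule pr_norm_le)
  fix i
  have "nrm (Rep_cs i) (crd (x * y) i) <= nrm (Rep_cs i) (crd x i) * nrm (Rep_cs i) (crd y i)"
   by (simp add: pr_simps cs_nrm_mul[OF C] crd_in)
  also have "\<dots> <= norm x * norm y"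
   by (intro mult_mono pr_coord_le pr_norm_nonneg cs_nrm_nonneg[OF C] crd_in)
  finally show "nrm (Rep_cs i) (crd (x * y) i) <= norm x * norm y" .
 qed
qed

end

text \<open>Limits exist in each coordinate, and the Cauchy estimate passes to them with the same
  threshold for all coordinates. This bounds the family of limits and gives convergence in the
  supremum norm.\<close>

lemma prd_complete:
 fixes X :: "nat => 'a prd"
 assumes X: "Cauchy X"
 shows "convergent X"
proof -
 note C = Rep_cs_cstar
 have Xd: "\<exists>M. \<forall>m\<ge>M. \<forall>n\<ge>M. norm (X m - X n) < e" if "e > 0" for e
  using metric_CauchyD[OF X that] by (auto simp: dist_prd_def)
 have "\<exists>l\<in>carrier (Rep_cs i). (%n. nrm (Rep_cs i) (sub (Rep_cs i) (crd (X n) i) l)) \<longlonglongrightarrow> 0" for i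
 proof (rule cs_complete[OF C crd_in])
  fix e :: real assume "e > 0"
  then obtain M where "\<And>m n. m >= M ==> n >= M ==> norm (X m - X n) < e" using Xd by meson
  then show "\<exists>N. \<forall>m\<ge>N. \<forall>n\<ge>N. nrm (Rep_cs i) (sub (Rep_cs i) (crd (X m) i) (crd (X n) i)) < e"
   unfolding pr_minus[symmetric] by (meson le_less_trans pr_coord_le)
 qed
 then obtain L where L: "\<And>i. L i \<in> carrier (Rep_cs i)"
  "\<And>i. (%n. nrm (Rep_cs i) (sub (Rep_cs i) (crd (X n) i) (L i))) \<longlonglongrightarrow> 0" by metis
 have subtri: "nrm A (sub A x z) <= nrm A (sub A x y) + nrm A (sub A y z)"
  if A: "cstar_algebra A" and xyz: "x \<in> carrier A" "y \<in> carrier A" "z \<in> carrier A" for A :: "'a cstar_alg" and x y z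
 proof -
  let ?n = "smul A (-1)"
  have n: "?n y \<in> carrier A" "?n z \<in> carrier A" using xyz by (auto intro: cs_smul[OF A])
  have "add A (add A x (?n y)) (add A y (?n z)) = add A x (add A (?n y) (add A y (?n z)))"
   by (intro cs_add_assoc[OF A] xyz n cs_add[OF A])
  also have "add A (?n y) (add A y (?n z)) = add A (add A (?n y) y) (?n z)"
   by (intro cs_add_assoc[OF A, symmetric] xyz n)
  also have "add A (?n y) y = zero A" using cs_add_comm[OF A n(1) xyz(2)] cs_add_neg[OF A xyz(2)] by simp
  also have "add A (zero A) (?n z) = ?n z" using cs_add_comm[OF A cs_zero[OF A] n(2)] cs_add_zero[OF A n(2)] by simp
  finally have "sub A x z = add A (sub A x y) (sub A y z)" by (simp add: sub_def)
  then show ?thesis using cs_nrm_add[OF A, of "sub A x y" "sub A y z"] xyz n by (simp add: sub_def cs_add[OF A])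
 qed
 have bound: "nrm (Rep_cs i) (sub (Rep_cs i) (crd (X m) i) (L i)) <= e"
  if M: "\<And>m n. m >= M ==> n >= M ==> norm (X m - X n) < e" and m: "m >= M" for e M m i
 proof -
  let ?s = "%n. nrm (Rep_cs i) (sub (Rep_cs i) (crd (X n) i) (L i))"
  have "?s m <= e + ?s n" if n: "n >= M" for n
  proof -
   have "nrm (Rep_cs i) (sub (Rep_cs i) (crd (X m) i) (crd (X n) i)) <= e"
    unfolding pr_minus[symmetric] using pr_coord_le[of i "X m - X n"] M[OF m n] by linarith
   then show ?thesis using subtri[OF C[of i] crd_in[of "X m" i] crd_in[of "X n" i] L(1)[of i]] by linarith
  qed
  moreover have "(%n. e + ?s n) \<longlonglongrightarrow> e + 0" by (intro tendsto_intros L)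
  ultimately show ?thesis by (intro LIMSEQ_le_const[where X = "%n. e + ?s n" and x = e]) (auto intro!: exI[of _ M])
 qed
 have ad: "add A (sub A x y) y = x" if A: "cstar_algebra A" and xy: "x \<in> carrier A" "y \<in> carrier A" for A :: "'a cstar_alg" and x y
  using cs_add_assoc[OF A xy(1) cs_smul[OF A xy(2)] xy(2)] cs_add_comm[OF A cs_smul[OF A xy(2)] xy(2)] cs_add_neg[OF A xy(2)] cs_add_zero[OF A xy(1)]
  by (simp add: sub_def)
 obtain M where M: "\<And>m n. m >= M ==> n >= M ==> norm (X m - X n) < 1" using Xd[of 1] by auto
 have "nrm (Rep_cs i) (L i) <= 1 + norm (X M)" for i
 proof -
  let ?A = "Rep_cs i" and ?x = "crd (X M) i"
  have sx: "sub ?A (L i) ?x \<in> carrier ?A" by (simp add: sub_def Rep_cs_closed L crd_in)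
  have "sub ?A (L i) ?x = smul ?A (-1) (sub ?A ?x (L i))"
   using cs_add_comm[OF C, of "L i" i "smul ?A (-1) ?x"]
   by (simp add: sub_def cs_smul_add[OF C] Rep_cs_closed L crd_in cs_mult_smul[OF C, symmetric] cs_smul_one[OF C])
  then have "nrm ?A (sub ?A (L i) ?x) <= 1"
   using bound[where M = M and e = 1 and m = M and i = i] M by (simp add: cs_nrm_smul[OF C] sub_def Rep_cs_closed L crd_in)
  moreover have "nrm ?A (add ?A (sub ?A (L i) ?x) ?x) <= nrm ?A (sub ?A (L i) ?x) + nrm ?A ?x"
   by (intro cs_nrm_add[OF C] sx crd_in)
  ultimately show ?thesis using ad[OF C L(1) crd_in, of i "X M"] pr_coord_le[of i "X M"] by simp
 qed
 then have "(\<forall>i. L i \<in> carrier (Rep_cs i)) & (\<exists>K. \<forall>i. nrm (Rep_cs i) (L i) <= K)" using L(1) by blast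
 then have PL: "crd (Pr L) = L" by (simp add: Pr_inverse)
 have "X \<longlonglongrightarrow> Pr L"
  unfolding tendsto_iff eventually_sequentially dist_prd_def
 proof (intro allI impI)
  fix e :: real assume "e > 0"
  then obtain M where M: "\<And>m n. m >= M ==> n >= M ==> norm (X m - X n) < e / 2" using Xd[of "e / 2"] by auto
  have "norm (X m - Pr L) <= e / 2" if "m >= M" for m
   by (rule pr_norm_le, unfold pr_minus PL) (rule bound[where M = M], use M that in auto)
  then show "\<exists>N. \<forall>n\<ge>N. norm (X n - Pr L) < e" using \<open>e > 0\<close> by (intro exI[of _ M]) fastforce
 qed
 then show "convergent X" by (auto simp: convergent_def)
qed

instantiation prd :: (type) ncstar
begin

lift_definition mulI_prd :: "'a prd => 'a prd" is "%f i. smul (Rep_cs i) \<i> (f i)"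
 by (rule scale_bdd)

lift_definition adjn_prd :: "'a prd => 'a prd" is "%f i. star (Rep_cs i) (f i)"
 by (auto simp: Rep_cs_closed cs_nrm_star[OF Rep_cs_cstar])

instance
proof
 fix x y :: "'a prd" and a :: real
 note C = Rep_cs_cstar
 note pr_simps = pr_simps mulI_prd.rep_eq adjn_prd.rep_eq
 show "norm (mulI x) = norm x" using norm_smul_prd[of "mulI x" \<i> x] by (simp add: pr_simps)
 show "adjn (x + y) = adjn x + adjn y" by (rule pr_eqI) (simp add: pr_simps cs_star_add[OF C] crd_in)
 show "adjn (a *\<^sub>R x) = a *\<^sub>R adjn x" by (rule pr_eqI) (simp add: pr_simps cs_star_smul[OF C] crd_in)
 show "adjn (x * y) = adjn y * adjn x" by (rule pr_eqI) (simp add: pr_simps cs_star_mul[OF C] crd_in)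
 show "adjn (adjn x) = x" by (rule pr_eqI) (simp add: pr_simps cs_star_star[OF C] crd_in)
 show "norm (adjn x * x) = (norm x)\<^sup>2"
 proof (rule antisym)
  have c: "nrm (Rep_cs i) (crd (adjn x * x) i) = (nrm (Rep_cs i) (crd x i))\<^sup>2" for i
   by (simp add: pr_simps cs_cstar[OF C] crd_in)
  show "norm (adjn x * x) <= (norm x)\<^sup>2"
   by (rule pr_norm_le, unfold c) (intro power_mono pr_coord_le cs_nrm_nonneg[OF C] crd_in)
  have "nrm (Rep_cs i) (crd x i) <= sqrt (norm (adjn x * x))" for i
   using pr_coord_le[of i "adjn x * x"] unfolding c by (rule real_le_rsqrt)
  then have "norm x <= sqrt (norm (adjn x * x))" by (rule pr_norm_le)
  then show "(norm x)\<^sup>2 <= norm (adjn x * x)" using pr_norm_nonneg by (metis power_mono real_sqrt_pow2)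
 qed
 show "mulI (x + y) = mulI x + mulI y" by (rule pr_eqI) (simp add: pr_simps cs_smul_add[OF C] crd_in)
 show "mulI (a *\<^sub>R x) = a *\<^sub>R mulI x"
  by (rule pr_eqI) (simp add: pr_simps cs_mult_smul[OF C, symmetric] crd_in mult.commute)
 show "mulI (mulI x) = - x" by (rule pr_eqI) (simp add: pr_simps cs_mult_smul[OF C, symmetric] crd_in)
 show "mulI x * y = mulI (x * y)" by (rule pr_eqI) (simp add: pr_simps cs_smul_mul[OF C] crd_in)
 show "x * mulI y = mulI (x * y)" by (rule pr_eqI) (simp add: pr_simps cs_mul_smul[OF C] crd_in)
 show "adjn (mulI x) = - mulI (adjn x)"
  by (rule pr_eqI) (simp add: pr_simps cs_star_smul[OF C] cs_mult_smul[OF C, symmetric] crd_in Rep_cs_closed)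
qed (rule prd_complete)

end

section \<open>Unitization\<close>

definition sc :: "complex => 'a::ncstar => 'a" where
 "sc c x = Re c *\<^sub>R x + Im c *\<^sub>R mulI x"

lemma mulI_0: "mulI (0::'a::ncstar) = 0"
 using norm_mulI[of "0::'a"] by simp

lemma sc_right_add: "sc c (x + y) = sc c x + sc c y"
 by (simp add: sc_def mulI_add algebra_simps)

lemma sc_left_add: "sc (c + d) x = sc c x + sc d x"
 by (simp add: sc_def algebra_simps)

lemma sc_mult: "sc (c * d) x = sc c (sc d x)"
 by (simp add: sc_def mulI_add mulI_scaleR mulI_mulI algebra_simps)

lemma sc_swap: "sc c (sc d x) = sc d (sc c x)"
 by (metis mult.commute sc_mult)

lemma sc_of_real: "sc (of_real r) x = r *\<^sub>R x"
 by (simp add: sc_def)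

lemma sc_0 [simp]: "sc 0 x = 0" "sc c 0 = 0" and sc_1 [simp]: "sc 1 x = x"
 by (simp_all add: sc_def mulI_0)

lemma sc_mul: "sc c x * y = sc c (x * y)"
 by (simp add: sc_def mulI_mult algebra_simps)

lemma mul_sc: "x * sc c y = sc c (x * y)"
 by (simp add: sc_def mult_mulI algebra_simps)

lemma adjn_0 [simp]: "adjn (0::'a::ncstar) = 0"
 using adjn_scaleR[of 0 "0::'a"] by simp

lemma adjn_sc: "adjn (sc c x) = sc (cnj c) (adjn x)"
 by (simp add: sc_def adjn_add adjn_scaleR adjn_mulI)

lemma norm_sc: "norm (sc c x) = cmod c * norm x"
proof -
 have "(norm (sc c x))\<^sup>2 = norm (sc (cnj c * c) (adjn x * x))"
  unfolding cstarn[symmetric] by (simp add: adjn_sc sc_mul mul_sc sc_mult sc_swap[of c "cnj c"])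
 also have "cnj c * c = of_real ((cmod c)\<^sup>2)"
  by (metis complex_norm_square mult.commute)
 finally have "(norm (sc c x))\<^sup>2 = (cmod c * norm x)\<^sup>2"
  by (simp only: sc_of_real) (simp add: cstarn power_mult_distrib)
 then show ?thesis by (simp add: power2_eq_iff_nonneg)
qed

lemma norm_adjn: "norm (adjn x) = norm (x::'a::ncstar)"
proof -
 have le: "norm y <= norm (adjn y)" for y :: 'a
 proof (cases "norm y = 0")
  case False
  have "norm y * norm y <= norm (adjn y) * norm y"
   using cstarn[of y] norm_mult_ineq[of "adjn y" y] by (simp add: power2_eq_square)
  then show ?thesis using False by (simp add: mult_le_cancel_right)
 qed simp
 show ?thesis using le[of x] le[of "adjn x"] by (simp add: adjn_adjn)
qed

text \<open>A fresh datatype, because pairs already carry a norm of their own, which is not a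
  C*-norm for this product.\<close>

datatype 'b ue = UE (uv: 'b) (us: complex)

definition act :: "'b::ncstar ue => 'b => 'b" where
 "act x b = uv x * b + sc (us x) b"

lemma bounded_linear_act: "bounded_linear (act x)"
proof (rule bounded_linear_intro[where K = "norm (uv x) + cmod (us x)"])
 fix b
 have "norm (act x b) <= norm (uv x * b) + norm (sc (us x) b)" unfolding act_def by (rule norm_triangle_ineq)
 also have "\<dots> <= norm (uv x) * norm b + cmod (us x) * norm b" by (simp add: norm_sc norm_mult_ineq)
 finally show "norm (act x b) <= norm b * (norm (uv x) + cmod (us x))" by (simp add: algebra_simps)
qed (simp_all add: act_def sc_def mulI_add mulI_scaleR algebra_simps)

lemma onorm_act_le: "onorm (act x) <= norm (uv x) + cmod (us x)"
proof (rule onorm_bound)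
 fix b
 have "norm (act x b) <= norm (uv x * b) + norm (sc (us x) b)" unfolding act_def by (rule norm_triangle_ineq)
 also have "\<dots> <= norm (uv x) * norm b + cmod (us x) * norm b" by (simp add: norm_sc norm_mult_ineq)
 finally show "norm (act x b) <= (norm (uv x) + cmod (us x)) * norm b" by (simp add: algebra_simps)
qed simp

lemma norm_le_onorm_act:
 assumes "us x = 0"
 shows "norm (uv x) <= onorm (act x)"
proof (cases "uv x = 0")
 case True
 then show ?thesis using onorm_pos_le[OF bounded_linear_act, of x] by simp
next
 case False
 have "norm (uv x * adjn (uv x)) = (norm (uv x))\<^sup>2"
  using cstarn[of "adjn (uv x)"] by (simp add: adjn_adjn norm_adjn)
 moreover have "norm (act x (adjn (uv x))) <= onorm (act x) * norm (adjn (uv x))"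
  by (rule onorm[OF bounded_linear_act])
 ultimately have "norm (uv x) * norm (uv x) <= onorm (act x) * norm (uv x)"
  using assms by (simp add: act_def norm_adjn power2_eq_square)
 then show ?thesis using False by (simp add: mult_le_cancel_right)
qed

instantiation ue :: (ncstar) real_vector
begin
definition "zero_ue = UE 0 0"
definition "plus_ue x y = UE (uv x + uv y) (us x + us y)"
definition "minus_ue x y = UE (uv x - uv y) (us x - us y)"
definition "uminus_ue x = UE (- uv x) (- us x)"
definition "scaleR_ue r x = UE (r *\<^sub>R uv x) (r *\<^sub>R us x)"
instance
 by standard
  (auto simp: zero_ue_def plus_ue_def minus_ue_def uminus_ue_def scaleR_ue_def algebra_simps ue.expand)
end

lemmas ue_simps = zero_ue_def plus_ue_def minus_ue_def uminus_ue_def scaleR_ue_def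

lemma act_linear:
 "act (x + y) b = act x b + act y b" "act (r *\<^sub>R x) b = r *\<^sub>R act x b" "act 0 b = 0"
 by (simp_all add: act_def ue_simps algebra_simps sc_left_add, simp add: sc_def algebra_simps)

instantiation ue :: (ncstar) real_normed_vector
begin
text \<open>The operator norm of left multiplication is only a seminorm if the algebra already has a
  unit; the maximum with the modulus of the scalar part is definite, still satisfies the
  C*-identity, and makes the character contractive.\<close>

definition norm_ue :: "'a ue => real" where "norm_ue x = max (cmod (us x)) (onorm (act x))"
definition dist_ue :: "'a ue => 'a ue => real" where "dist_ue f g = norm (f - g)"
definition sgn_ue :: "'a ue => 'a ue" where "sgn_ue f = f /\<^sub>R norm f"
definition uniformity_ue :: "('a ue \<times> 'a ue) filter" where
 "uniformity_ue = (INF e\<in>{0<..}. principal {(x, y). dist x y < e})"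
definition open_ue :: "'a ue set => bool" where
 "open_ue U \<longleftrightarrow> (\<forall>x\<in>U. eventually (%(x', y). x' = x --> y \<in> U) uniformity)"
instance
proof
 fix x y :: "'a ue" and a :: real
 show "dist x y = norm (x - y)" by (simp add: dist_ue_def)
 show "sgn x = x /\<^sub>R norm x" by (simp add: sgn_ue_def)
 show "uniformity = (INF e\<in>{0<..}. principal {(x, y :: 'a ue). dist x y < e})" by (simp add: uniformity_ue_def)
 show "open U \<longleftrightarrow> (\<forall>x\<in>U. eventually (%(x', y). x' = x --> y \<in> U) uniformity)" for U :: "'a ue set" by (simp add: open_ue_def)
 have o0: "onorm (act (0 :: 'a ue)) = 0" using onorm_act_le[of "0 :: 'a ue"] onorm_pos_le[OF bounded_linear_act, of "0 :: 'a ue"] by (simp add: ue_simps)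
 show "norm x = 0 \<longleftrightarrow> x = 0"
 proof
  assume "norm x = 0"
  then have "cmod (us x) <= 0" "onorm (act x) <= 0" by (auto simp: norm_ue_def max_def split: if_splits)
  then have "us x = 0" by simp
  then have "norm (uv x) <= onorm (act x)" by (rule norm_le_onorm_act)
  also have "\<dots> <= 0" by fact
  finally have "us x = 0" "uv x = 0" using \<open>us x = 0\<close> by simp_all
  then show "x = 0" by (simp add: ue_simps ue.expand)
 qed (use o0 in \<open>simp add: norm_ue_def\<close>, simp add: ue_simps)
 have "onorm (act (x + y)) <= onorm (act x) + onorm (act y)"
  using onorm_triangle[OF bounded_linear_act bounded_linear_act, of x y] by (simp add: act_linear(1)[abs_def])
 moreover have "cmod (us (x + y)) <= cmod (us x) + cmod (us y)" by (simp add: ue_simps norm_triangle_ineq)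
 ultimately show "norm (x + y) <= norm x + norm y" unfolding norm_ue_def by (auto intro: add_mono order_trans)
 have "onorm (act (a *\<^sub>R x)) = \<bar>a\<bar> * onorm (act x)"
  using onorm_scaleR[OF bounded_linear_act, of a x] by (simp add: act_linear(2)[abs_def])
 moreover have "cmod (us (a *\<^sub>R x)) = \<bar>a\<bar> * cmod (us x)" by (simp add: ue_simps)
 ultimately show "norm (a *\<^sub>R x) = \<bar>a\<bar> * norm x" unfolding norm_ue_def by (simp add: max_mult_distrib_left)
qed
end

lemma us_le_norm: "cmod (us x) <= norm (x :: 'b::ncstar ue)"
 by (simp add: norm_ue_def)

lemma norm_ue_le: "norm (x :: 'b::ncstar ue) <= norm (uv x) + cmod (us x)"
 using onorm_act_le[of x] by (simp add: norm_ue_def)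

lemma uv_le_norm: "norm (uv x) <= 2 * norm (x :: 'b::ncstar ue)"
proof -
 let ?a = "UE (uv x) 0" and ?l = "UE 0 (us x) :: 'b ue"
 have "norm (uv x) <= norm ?a" using norm_le_onorm_act[of ?a] by (simp add: norm_ue_def)
 also have "?a = x - ?l" by (simp add: ue_simps ue.expand)
 also have "norm \<dots> <= norm x + norm ?l" by (rule norm_triangle_ineq4)
 also have "norm ?l <= norm x" using norm_ue_le[of ?l] us_le_norm[of x] by simp
 finally show ?thesis by simp
qed

instantiation ue :: (ncstar) real_normed_algebra_1
begin
definition "one_ue = UE 0 1"
definition "times_ue x y = UE (uv x * uv y + sc (us x) (uv y) + sc (us y) (uv x)) (us x * us y)"
instance
proof
 fix x y z :: "'a ue" and a :: real
 show "x * y * z = x * (y * z)"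
  by (simp add: times_ue_def algebra_simps sc_mul mul_sc sc_right_add sc_mult)
   (simp add: sc_mult[symmetric] mult.commute)
 show "1 * x = x" "x * 1 = x" by (simp_all add: times_ue_def one_ue_def ue.expand)
 show "(0::'a ue) ~= 1" by (simp add: zero_ue_def one_ue_def)
 show "(x + y) * z = x * z + y * z" "x * (y + z) = x * y + x * z"
  by (simp_all add: times_ue_def plus_ue_def algebra_simps sc_right_add sc_left_add)
 have sr: "sc (a *\<^sub>R c) b = a *\<^sub>R sc c b" "sc c (a *\<^sub>R b) = a *\<^sub>R sc c b" for b :: 'a and c
  by (simp_all add: sc_def mulI_scaleR algebra_simps)
 show "a *\<^sub>R x * y = a *\<^sub>R (x * y)" "x * a *\<^sub>R y = a *\<^sub>R (x * y)"
  by (simp_all add: times_ue_def scaleR_ue_def sr scaleR_right_distrib)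
 have "act (x * y) b = act x (act y b)" for b
  by (simp add: act_def times_ue_def algebra_simps sc_mul mul_sc sc_right_add sc_mult)
 then have "act (x * y) = act x \<circ> act y" by auto
 then have "onorm (act (x * y)) <= onorm (act x) * onorm (act y)"
  using onorm_compose[OF bounded_linear_act bounded_linear_act, of x y] by simp
 also have "\<dots> <= norm x * norm y"
  by (intro mult_mono) (auto simp: norm_ue_def onorm_pos_le[OF bounded_linear_act] intro: order_trans[OF norm_ge_zero[of "us x"]])
 finally have "onorm (act (x * y)) <= norm x * norm y" .
 moreover have "cmod (us (x * y)) <= norm x * norm y"
  using mult_mono[OF us_le_norm[of x] us_le_norm[of y]] by (simp add: times_ue_def norm_mult)
 ultimately show "norm (x * y) <= norm x * norm y" by (simp add: norm_ue_def[of "x * y"])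
 have "onorm (act (1 :: 'a ue)) <= 1" using onorm_act_le[of "1 :: 'a ue"] by (simp add: one_ue_def)
 then show "norm (1 :: 'a ue) = 1" by (simp add: norm_ue_def one_ue_def)
qed
end

lemma act_mult: "act (x * y) b = act x (act y (b::'b::ncstar))"
 by (simp add: act_def times_ue_def algebra_simps sc_mul mul_sc sc_right_add sc_mult)

lemma ue_complete:
 fixes X :: "nat => 'b::ncstar ue"
 assumes X: "Cauchy X"
 shows "convergent X"
proof -
 have "Cauchy (%n. uv (X n))" "Cauchy (%n. us (X n))"
 proof -
  have d: "uv (X m) - uv (X n) = uv (X m - X n)" "us (X m) - us (X n) = us (X m - X n)" for m n
   by (simp_all add: ue_simps)
  show "Cauchy (%n. uv (X n))"
  proof (rule CauchyI)
   fix e :: real assume "e > 0"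
   then obtain M where "\<And>m n. m >= M ==> n >= M ==> norm (X m - X n) < e / 2"
    using CauchyD[OF X, of "e / 2"] by auto
   then have "norm (uv (X m) - uv (X n)) < e" if "m >= M" "n >= M" for m n
    unfolding d using uv_le_norm[of "X m - X n"] that by force
   then show "\<exists>M. \<forall>m\<ge>M. \<forall>n\<ge>M. norm (uv (X m) - uv (X n)) < e" by blast
  qed
  show "Cauchy (%n. us (X n))"
  proof (rule CauchyI)
   fix e :: real assume "e > 0"
   then obtain M where "\<And>m n. m >= M ==> n >= M ==> norm (X m - X n) < e"
    using CauchyD[OF X, of e] by auto
   then have "norm (us (X m) - us (X n)) < e" if "m >= M" "n >= M" for m n
    unfolding d using us_le_norm[of "X m - X n"] that by force
   then show "\<exists>M. \<forall>m\<ge>M. \<forall>n\<ge>M. norm (us (X m) - us (X n)) < e" by blast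
  qed
 qed
 then obtain a l where al: "(%n. uv (X n)) \<longlonglongrightarrow> a" "(%n. us (X n)) \<longlonglongrightarrow> l"
  by (auto simp: Cauchy_convergent_iff convergent_def)
 have "(%n. norm (uv (X n) - a) + cmod (us (X n) - l)) \<longlonglongrightarrow> norm (a - a) + cmod (l - l)"
  by (intro tendsto_intros al)
 then have lim0: "(%n. norm (uv (X n) - a) + cmod (us (X n) - l)) \<longlonglongrightarrow> 0" by simp
 have "norm (X n - UE a l) <= norm (uv (X n) - a) + cmod (us (X n) - l)" for n
  using norm_ue_le[of "X n - UE a l"] by (simp add: ue_simps)
 then have "(%n. X n - UE a l) \<longlonglongrightarrow> 0" by (rule Lim_null_comparison[OF always_eventually lim0, rule_format])
 then have "X \<longlonglongrightarrow> UE a l" by (rule LIM_zero_cancel)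
 then show ?thesis unfolding convergent_def by blast
qed

instantiation ue :: (ncstar) ucstar
begin
definition "adj_ue x = UE (adjn (uv x)) (cnj (us x))"
definition "J_ue = UE 0 \<i>"
instance
proof
 fix x y :: "'a ue" and r :: real
 have sr: "sc \<i> b = mulI b" for b :: 'a by (simp add: sc_def)
 show "adj (x + y) = adj x + adj y" by (simp add: adj_ue_def plus_ue_def adjn_add)
 show "adj (r *\<^sub>R x) = r *\<^sub>R adj x" by (simp add: adj_ue_def scaleR_ue_def adjn_scaleR)
 show "adj (x * y) = adj y * adj x" by (simp add: adj_ue_def times_ue_def adjn_add adjn_mult adjn_sc mult.commute algebra_simps)
 show aa: "adj (adj x) = x" for x :: "'a ue" by (simp add: adj_ue_def adjn_adjn ue.expand)
 show "J * x = x * J" by (simp add: J_ue_def times_ue_def mult.commute)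
 show "J * J = (- 1 :: 'a ue)" by (simp add: J_ue_def times_ue_def one_ue_def uminus_ue_def)
 show "adj J = (- J :: 'a ue)" by (simp add: J_ue_def adj_ue_def uminus_ue_def)
 \<comment> \<open>The square of the norm of x b is the norm of \<open>adjn b\<close> times the
   value of \<open>act (adj x * x)\<close> at b, which gives the nontrivial half of the C*-identity
   for the operator norm.\<close>
 have sq: "(onorm (act x))\<^sup>2 <= onorm (act (adj x * x))" for x :: "'a ue"
 proof -
  have "norm (act x b) <= sqrt (onorm (act (adj x * x))) * norm b" for b
  proof -
   have "adjn (act x b) * act x b = adjn b * act (adj x * x) b"
    unfolding act_mult by (simp add: act_def adj_ue_def adjn_add adjn_mult adjn_sc algebra_simps sc_mul mul_sc sc_right_add sc_swap[of "us x" "cnj (us x)"])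
   then have "(norm (act x b))\<^sup>2 = norm (adjn b * act (adj x * x) b)" by (simp add: cstarn[symmetric])
   also have "\<dots> <= norm (adjn b) * norm (act (adj x * x) b)" by (rule norm_mult_ineq)
   also have "\<dots> <= norm b * (onorm (act (adj x * x)) * norm b)"
    unfolding norm_adjn by (intro mult_left_mono onorm[OF bounded_linear_act]) auto
   also have "\<dots> = (sqrt (onorm (act (adj x * x))) * norm b)\<^sup>2"
    by (simp add: power_mult_distrib onorm_pos_le[OF bounded_linear_act] power2_eq_square)
   finally show ?thesis by (rule power2_le_imp_le) (simp add: onorm_pos_le[OF bounded_linear_act])
  qed
  then have "onorm (act x) <= sqrt (onorm (act (adj x * x)))"
   by (intro onorm_bound) (simp_all add: onorm_pos_le[OF bounded_linear_act])
  then have "(onorm (act x))\<^sup>2 <= (sqrt (onorm (act (adj x * x))))\<^sup>2" by (intro power_mono onorm_pos_le[OF bounded_linear_act])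
  then show ?thesis by (simp add: onorm_pos_le[OF bounded_linear_act])
 qed
 have com: "onorm (act (x * y)) <= onorm (act x) * onorm (act y)" for x y :: "'a ue"
  using onorm_compose[OF bounded_linear_act bounded_linear_act, of x y] by (simp add: o_def act_mult[abs_def])
 have le: "onorm (act x) <= onorm (act (adj x))" for x :: "'a ue"
 proof (cases "onorm (act x) = 0")
  case True
  then show ?thesis using onorm_pos_le[OF bounded_linear_act, of "adj x"] by simp
 next
  case False
  then have "onorm (act x) > 0" using onorm_pos_le[OF bounded_linear_act, of x] by simp
  moreover have "onorm (act x) * onorm (act x) <= onorm (act (adj x)) * onorm (act x)"
   using sq[of x] com[of "adj x" x] by (simp add: power2_eq_square)
  ultimately show ?thesis by (simp add: mult_le_cancel_right)
 qed
 have eq: "onorm (act (adj x)) = onorm (act x)" using le[of x] le[of "adj x"] by (simp add: aa)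
 have "onorm (act (adj x * x)) = (onorm (act x))\<^sup>2"
  using sq[of x] com[of "adj x" x] by (simp add: eq power2_eq_square)
 moreover have "cmod (us (adj x * x)) = (cmod (us x))\<^sup>2"
  by (simp add: adj_ue_def times_ue_def norm_mult power2_eq_square)
 moreover have "max (c\<^sup>2) (d\<^sup>2) = (max c d)\<^sup>2" if "0 <= c" "0 <= d" for c d :: real
  using that by (cases "c <= d") (simp_all add: max_absorb1 max_absorb2 power_mono)
 ultimately show "norm (adj x * x) = (norm x)\<^sup>2"
  by (simp add: norm_ue_def onorm_pos_le[OF bounded_linear_act])
qed (rule ue_complete)
end

lemma cplx_ue: "cplx c = (UE 0 c :: 'b::ncstar ue)"
 by (simp add: cplx_def J_ue_def one_ue_def scaleR_ue_def plus_ue_def complex_eq_iff)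

interpretation us: character "us :: 'b::ncstar ue => complex"
 by unfold_locales (simp_all add: plus_ue_def times_ue_def adj_ue_def cplx_ue us_le_norm)

section \<open>Embedding a C*-algebra structure\<close>

text \<open>A closed *-subalgebra is hereditary as soon as it absorbs the positive parts of its positive elements.\<close>

lemma her_from_positive:
 fixes A B :: "'a::ucstar set"
 assumes A: "cideal chi A" and B: "cideal chi B" and sub: "B \<subseteq> A"
  and H: "\<And>b y z. b \<in> B ==> y \<in> A ==> z \<in> A ==> b = adj y * y + adj z * z ==> adj y * y \<in> B"
 shows "her chi A B"
proof -
 interpret A: cideal chi A by (rule A)
 interpret B: cideal chi B by (rule B)
 have idl: "x * a \<in> A" if x: "x \<in> unz chi A" and a: "a \<in> A" for x a
 proof (rule A.unz_chi0)
  show "x * a \<in> unz chi A" by (intro A.U.mult_S x A.unz_A a)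
  show "chi (x * a) = 0" by (simp add: A.chi_mult A.chi_A[OF a])
 qed
 have 1: "adj b * (k * k) * b \<in> B" if b: "b \<in> B" and k: "k \<in> A" "adj k = k" "norm k <= 1" for b k
 proof -
  have s: "sac k" using k by (simp add: sac_def)
  \<comment> \<open>\<open>d\<close> is the complementary root with
    \<open>d * d = 1 - k * k\<close>; it splits \<open>adj b * b\<close> into two positive elements,
    one of which is the wanted \<open>adj b * (k * k) * b\<close>.\<close>
  let ?f = "%t::real. sqrt (1 - t * t)"
  have cf: "continuous_on {-1..1} ?f" by (intro continuous_intros)
  define d where "d = fc ?f k"
  have dS: "d \<in> unz chi A" unfolding d_def by (rule A.U.fc_S[OF A.unz_A[OF k(1)] s cf])
  have ad: "adj d = d" unfolding d_def by (rule fc_adj[OF s cf])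
  have "d * d = fc (%t. ?f t * ?f t) k" unfolding d_def by (simp only: fc_mult[OF s cf cf])
  also have "\<dots> = fc (%t. 1 - t * t) k"
  proof (rule fc_cong[OF s])
   show "continuous_on {-1..1} (%t. ?f t * ?f t)" by (intro continuous_intros)
   fix t :: real assume "t \<in> {-1..1}"
   then have "t * t <= 1" using abs_square_le_1[of t] by (auto simp: power2_eq_square)
   then show "?f t * ?f t = 1 - t * t" by simp
  qed
  also have "\<dots> = 1 - k * k"
   by (simp add: fc_diff[OF s] fc_mult[OF s] fc_const[OF s] fc_id[OF s] continuous_intros)
  finally have dd: "d * d = 1 - k * k" .
  have bA: "b \<in> A" using b sub by blast
  have kb: "k * b \<in> A" "d * b \<in> A" using idl[OF A.unz_A[OF k(1)] bA] idl[OF dS bA] by auto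
  have e1: "adj (k * b) * (k * b) = adj b * (k * k) * b" by (simp add: adj_mult k mult.assoc)
  have e2: "adj (d * b) * (d * b) = adj b * (d * d) * b" by (simp add: adj_mult ad mult.assoc)
  have "adj b * b = adj (k * b) * (k * b) + adj (d * b) * (d * b)"
   unfolding e1 e2 dd by (simp add: right_diff_distrib left_diff_distrib)
  then have "adj (k * b) * (k * b) \<in> B" using H[OF B.mult_A[OF B.adj_A[OF b] b] kb] by simp
  then show ?thesis by (simp add: e1)
 qed
 have 2: "adj b * (k * k) * c \<in> B" if b: "b \<in> B" and c: "c \<in> B" and k: "k \<in> A" "adj k = k" "norm k <= 1" for b c k
 proof -
  define P where "P = k * k"
  \<comment> \<open>Polarization: summing over the four fourth roots of unity isolates the mixed
    term \<open>adj b * P * c\<close>, four times.\<close>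
  define q where "q w = cplx w * (adj (c + cplx w * b) * P * (c + cplx w * b))" for w
  have qB: "q w \<in> B" for w unfolding q_def P_def by (intro B.cplx_A 1 B.add_A c B.cplx_A b k)
  have e: "q w = cplx w * (adj c * P * c) + cplx (w * w) * (adj c * P * b) + cplx (w * cnj w) * (adj b * P * c)
   + cplx (w * w * cnj w) * (adj b * P * b)" for w
  proof -
   have c1: "adj b * cplx (cnj w) = cplx (cnj w) * adj b" by (rule cplx_central[symmetric])
   have c2: "x * (cplx w * y) = cplx w * (x * y)" for x y :: 'a
   proof -
    have "x * (cplx w * y) = (cplx w * x) * y" by (simp only: mult.assoc[symmetric] cplx_central[of w x])
    then show ?thesis by (simp only: mult.assoc)
   qed
   have "adj (c + cplx w * b) * P * (c + cplx w * b) = adj c * P * c + (adj c * P) * (cplx w * b)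
     + (cplx (cnj w) * adj b * P * c + (cplx (cnj w) * adj b * P) * (cplx w * b))"
    unfolding adj_add adj_mult adj_cplx c1 by (simp only: distrib_left distrib_right ac_simps)
   also have "\<dots> = adj c * P * c + cplx w * (adj c * P * b)
     + (cplx (cnj w) * (adj b * P * c) + cplx w * (cplx (cnj w) * (adj b * P * b)))"
    unfolding c2[of "adj c * P" b] c2[of "cplx (cnj w) * adj b * P" b] by (simp only: mult.assoc)
   finally show ?thesis unfolding q_def by (simp only: distrib_left cplx_mult mult.assoc add.assoc)
  qed
  have four: "x + (x + (x + x)) = 4 *\<^sub>R x" for x :: 'a
  proof -
   have "x + (x + (x + x)) = 2 *\<^sub>R x + 2 *\<^sub>R x" by (simp add: scaleR_2 add.assoc)
   also have "\<dots> = 4 *\<^sub>R x" by (simp flip: scaleR_left_distrib)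
   finally show ?thesis .
  qed
  have "q 1 + q \<i> + (q (- 1) + q (- \<i>)) = 4 *\<^sub>R (adj b * P * c)"
   unfolding e by (simp add: cplx_minus algebra_simps four)
  moreover have "q 1 + q \<i> + (q (- 1) + q (- \<i>)) \<in> B" by (intro B.add_A qB)
  ultimately have "(1/4) *\<^sub>R (4 *\<^sub>R (adj b * P * c)) \<in> B" by (metis B.scaleR_A)
  then show ?thesis by (simp add: P_def)
 qed
 have 3: "adj b * h * c \<in> B" if b: "b \<in> B" and c: "c \<in> B" and h: "h \<in> A" "adj h = h" "norm h <= 1" for b c h
 proof -
  have s: "sac h" using h by (simp add: sac_def)
  \<comment> \<open>Roots of the positive and negative part write a self-adjoint \<open>h\<close> as
    a difference of squares; both roots vanish at 0, so they have no scalar part and stay in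
    \<open>A\<close>.\<close>
  let ?p = "%t::real. sqrt (max t 0)" and ?m = "%t::real. sqrt (max (- t) 0)"
  have cp: "continuous_on {-1..1} ?p" and cm: "continuous_on {-1..1} ?m" by (intro continuous_intros)+
  define p m where "p = fc ?p h" and "m = fc ?m h"
  have pA: "p \<in> A" "m \<in> A" unfolding p_def m_def
   by (auto intro!: A.unz_chi0 A.U.fc_S[OF A.unz_A[OF h(1)] s] cp cm simp: A.chi_fc[OF s cp] A.chi_fc[OF s cm] A.chi_A[OF h(1)])
  have pa: "adj p = p" "adj m = m" unfolding p_def m_def by (intro fc_adj[OF s] cp cm)+
  have pn: "norm p <= 1" "norm m <= 1" unfolding p_def m_def by (rule fc_norm[OF s]; auto intro: cp cm)+
  have "p * p - m * m = fc (%t. ?p t * ?p t - ?m t * ?m t) h"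
   unfolding p_def m_def by (simp only: fc_diff[OF s continuous_on_mult[OF cp cp] continuous_on_mult[OF cm cm]] fc_mult[OF s cp cp] fc_mult[OF s cm cm])
  also have "\<dots> = fc (%t. t) h"
   by (rule fc_cong[OF s], intro continuous_intros) (auto simp: max_def)
  finally have "h = p * p - m * m" by (simp add: fc_id[OF s])
  then have "adj b * h * c = adj b * (p * p) * c - adj b * (m * m) * c"
   by (simp add: right_diff_distrib left_diff_distrib)
  then show ?thesis using 2[OF b c pA(1) pa(1) pn(1)] 2[OF b c pA(2) pa(2) pn(2)] by (simp add: B.diff_A)
 qed
 have 4: "adj b * h * c \<in> B" if b: "b \<in> B" and c: "c \<in> B" and h: "h \<in> A" "adj h = h" for b c h
 proof -
  define r where "r = norm h + 1"
  have r: "r > 0" by (simp add: r_def add_nonneg_pos)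
  have "adj b * ((1/r) *\<^sub>R h) * c \<in> B"
   using h r by (intro 3 b c A.scaleR_A) (auto simp: adj_scaleR r_def field_simps)
  then have "r *\<^sub>R (adj b * ((1/r) *\<^sub>R h) * c) \<in> B" by (rule B.scaleR_A)
  then show ?thesis using r by simp
 qed
 show ?thesis
 proof
  show "B \<subseteq> A" by (rule sub)
  fix b a c assume b: "b \<in> B" and a: "a \<in> A" and c: "c \<in> B"
  define h1 h2 where "h1 = (1/2) *\<^sub>R (a + adj a)" and "h2 = (1/2) *\<^sub>R (cplx \<i> * (adj a - a))"
  have hA: "h1 \<in> A" "h2 \<in> A" unfolding h1_def h2_def by (intro A.scaleR_A A.add_A A.cplx_A A.diff_A A.adj_A a)+
  have "adj h1 = h1" by (simp add: h1_def adj_scaleR adj_add add.commute)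
  moreover have "adj h2 = h2"
  proof -
   have "adj h2 = (1/2) *\<^sub>R ((a - adj a) * cplx (- \<i>))" by (simp add: h2_def adj_scaleR adj_mult adj_diff adj_cplx)
   also have "(a - adj a) * cplx (- \<i>) = cplx (- \<i>) * (a - adj a)" by (rule cplx_central[symmetric])
   also have "\<dots> = cplx \<i> * (adj a - a)" by (simp only: cplx_minus minus_mult_left[symmetric] minus_mult_right minus_diff_eq)
   finally show ?thesis by (simp only: h2_def)
  qed
  moreover have "a = h1 + cplx \<i> * h2"
  proof -
   have "cplx \<i> * (cplx \<i> * x) = - x" for x :: 'a by (simp add: mult.assoc[symmetric] cplx_mult[symmetric] cplx_minus)
   then show ?thesis by (simp add: h1_def h2_def algebra_simps flip: scaleR_left_distrib)
  qed
  ultimately have "b * a * c = adj (adj b) * h1 * c + cplx \<i> * (adj (adj b) * h2 * c)"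
   by (simp add: distrib_left distrib_right mult.assoc) (metis cplx_central mult.assoc)
  then show "b * a * c \<in> B"
   using 4[OF B.adj_A[OF b] c hA(1) \<open>adj h1 = h1\<close>] 4[OF B.adj_A[OF b] c hA(2) \<open>adj h2 = h2\<close>]
   by (simp only: B.add_A B.cplx_A)
 qed
qed

text \<open>The algebra sits in the coordinate indexed by itself, with zeros elsewhere, so algebraic
  laws and norm are inherited coordinatewise.\<close>

definition incl :: "'a cstar_alg => 'a => 'a prd" where
 "incl A a = Pr (%i. if Rep_cs i = A then a else zero (Rep_cs i))"

definition emb :: "'a cstar_alg => 'a \<times> complex => 'a prd ue" where
 "emb A x = UE (incl A (fst x)) (snd x)"

definition unemb :: "'a cstar_alg => 'a prd ue => 'a \<times> complex" where
 "unemb A y = (crd (uv y) (Abs_cs A), us y)"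

definition ide :: "'a cstar_alg => 'a set => 'a prd ue set" where
 "ide A B = (%b. emb A (b, 0)) ` B"

definition subalg :: "'a cstar_alg => 'a set => bool" where
 "subalg A B \<longleftrightarrow> B \<subseteq> carrier A & zero A \<in> B \<and>
  (\<forall>x\<in>B. \<forall>y\<in>B. add A x y \<in> B & mul A x y \<in> B) \<and>
  (\<forall>c. \<forall>x\<in>B. smul A c x \<in> B) & (\<forall>x\<in>B. star A x \<in> B) \<and>
  (\<forall>f x. (\<forall>n. f n \<in> B) & x \<in> carrier A & (%n. nrm A (sub A (f n) x)) \<longlonglongrightarrow> 0 --> x \<in> B)"

lemma subalg_hereditary: "hereditary_subalg A B ==> subalg A B"
 unfolding hereditary_subalg_def subalg_def by blast

locale calg =
 fixes A :: "'a cstar_alg"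
 assumes cstar: "cstar_algebra A"
begin

lemmas closed = cs_zero[OF cstar] cs_add[OF cstar] cs_mul[OF cstar] cs_smul[OF cstar] cs_star[OF cstar]

lemma subalg_carrier: "subalg A (carrier A)"
 unfolding subalg_def by (auto intro: closed)

lemma Rep_Abs: "Rep_cs (Abs_cs A) = A" by (rule Abs_cs_inverse) (simp add: cstar)

lemma crd_incl:
 assumes "a \<in> carrier A"
 shows "crd (incl A a) i = (if Rep_cs i = A then a else zero (Rep_cs i))"
proof -
 have "(\<forall>i. (if Rep_cs i = A then a else zero (Rep_cs i)) \<in> carrier (Rep_cs i)) \<and>
  (\<exists>K. \<forall>i. nrm (Rep_cs i) (if Rep_cs i = A then a else zero (Rep_cs i)) <= K)"
  using assms cs_nrm_nonneg[OF cstar assms]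
  by (auto simp: Rep_cs_closed cs_nrm_0[OF Rep_cs_cstar] intro!: exI[of _ "nrm A a"])
 then show ?thesis unfolding incl_def by (subst Pr_inverse) auto
qed

lemma incl_eqI: "(\<And>i. crd x i = (if Rep_cs i = A then a else zero (Rep_cs i))) ==> a \<in> carrier A ==> x = incl A a"
 by (rule pr_eqI) (simp add: crd_incl)

lemma incl_add: "a \<in> carrier A ==> b \<in> carrier A ==> incl A a + incl A b = incl A (add A a b)"
 by (rule incl_eqI) (auto simp: plus_prd.rep_eq crd_incl closed cs_add_zero[OF Rep_cs_cstar] Rep_cs_closed)

lemma incl_mul: "a \<in> carrier A ==> b \<in> carrier A ==> incl A a * incl A b = incl A (mul A a b)"
 by (rule incl_eqI) (auto simp: times_prd.rep_eq crd_incl closed cs_zero_mul[OF Rep_cs_cstar] Rep_cs_closed)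

lemma incl_star: "a \<in> carrier A ==> adjn (incl A a) = incl A (star A a)"
 by (rule incl_eqI) (auto simp: adjn_prd.rep_eq crd_incl closed cs_star_zero[OF Rep_cs_cstar])

lemma incl_scaleR: "a \<in> carrier A ==> r *\<^sub>R incl A a = incl A (smul A (of_real r) a)"
 by (rule incl_eqI) (auto simp: scaleR_prd.rep_eq crd_incl closed cs_smul_zero[OF Rep_cs_cstar])

lemma incl_mulI: "a \<in> carrier A ==> mulI (incl A a) = incl A (smul A \<i> a)"
 by (rule incl_eqI) (auto simp: mulI_prd.rep_eq crd_incl closed cs_smul_zero[OF Rep_cs_cstar])

lemma incl_sc: "a \<in> carrier A ==> sc c (incl A a) = incl A (smul A c a)"
proof -
 assume a: "a \<in> carrier A"
 have "sc c (incl A a) = incl A (add A (smul A (of_real (Re c)) a) (smul A (of_real (Im c)) (smul A \<i> a)))"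
  by (simp add: sc_def incl_scaleR incl_mulI a closed incl_add)
 also have "smul A (of_real (Im c)) (smul A \<i> a) = smul A (of_real (Im c) * \<i>) a" by (simp add: cs_mult_smul[OF cstar a])
 also have "add A (smul A (of_real (Re c)) a) (smul A (of_real (Im c) * \<i>) a) = smul A c a"
  unfolding cs_add_smul[OF cstar a, symmetric] by (simp add: mult.commute flip: complex_eq)
 finally show ?thesis .
qed

lemma incl_zero: "incl A (zero A) = 0"
 by (rule incl_eqI[symmetric]) (auto simp: zero_prd.rep_eq closed)

lemma norm_incl: assumes a: "a \<in> carrier A" shows "norm (incl A a) = nrm A a"
proof (rule antisym)
 show "norm (incl A a) <= nrm A a"
  by (rule pr_norm_le) (auto simp: crd_incl a cs_nrm_0[OF Rep_cs_cstar] cs_nrm_nonneg[OF cstar])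
 show "nrm A a <= norm (incl A a)" using pr_coord_le[of "Abs_cs A" "incl A a"] by (simp add: crd_incl a Rep_Abs)
qed

lemma unemb_emb: "x \<in> carrier A \<times> UNIV ==> unemb A (emb A x) = x"
 by (auto simp: unemb_def emb_def crd_incl Rep_Abs)

lemma emb_eq_iff: "x \<in> carrier A \<times> UNIV ==> y \<in> carrier A \<times> UNIV ==> emb A x = emb A y \<longleftrightarrow> x = y"
 using unemb_emb by metis

lemma emb_uadd: "x \<in> carrier A \<times> UNIV ==> y \<in> carrier A \<times> UNIV ==> emb A (uadd A x y) = emb A x + emb A y"
 by (auto simp: emb_def uadd_def plus_ue_def incl_add)

lemma emb_umul: "x \<in> carrier A \<times> UNIV ==> y \<in> carrier A \<times> UNIV ==> emb A (umul A x y) = emb A x * emb A y"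
 by (auto simp: emb_def umul_def times_ue_def incl_add incl_mul incl_sc closed)

lemma emb_ustar: "x \<in> carrier A \<times> UNIV ==> emb A (ustar A x) = adj (emb A x)"
 by (auto simp: emb_def ustar_def adj_ue_def incl_star)

lemma emb_uneg: "x \<in> carrier A \<times> UNIV ==> emb A (uneg A x) = - emb A x"
 using incl_scaleR[of "fst x" "-1"] by (auto simp: emb_def uneg_def uminus_ue_def)

lemma emb_uone: "emb A (uone A) = 1" by (simp add: emb_def uone_def one_ue_def incl_zero)
lemma emb_uzero: "emb A (uzero A) = 0" by (simp add: emb_def uzero_def zero_ue_def incl_zero)

lemma emb_smul: "b \<in> carrier A ==> cplx c * emb A (b, 0) = emb A (smul A c b, 0)"
 by (simp add: cplx_ue emb_def times_ue_def incl_sc)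

lemma emb_split: "emb A (b, c) = cplx c + emb A (b, 0)"
 by (simp add: cplx_ue emb_def plus_ue_def)

lemma ucl: "x \<in> carrier A \<times> UNIV ==> y \<in> carrier A \<times> UNIV ==> uadd A x y \<in> carrier A \<times> UNIV"
 "x \<in> carrier A \<times> UNIV ==> y \<in> carrier A \<times> UNIV ==> umul A x y \<in> carrier A \<times> UNIV"
 "x \<in> carrier A \<times> UNIV ==> ustar A x \<in> carrier A \<times> UNIV" "x \<in> carrier A \<times> UNIV ==> uneg A x \<in> carrier A \<times> UNIV"
 "uone A \<in> carrier A \<times> UNIV" "uzero A \<in> carrier A \<times> UNIV"
 by (auto simp: uadd_def umul_def ustar_def uneg_def uone_def uzero_def closed)

text \<open>The l1-distance and the C*-distance are equivalent: the constant 3 is 2 for the algebra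
  part and 1 for the scalar part.\<close>

lemma udist_bounds:
 assumes "x \<in> carrier A \<times> UNIV" "y \<in> carrier A \<times> UNIV"
 shows "norm (emb A x - emb A y) <= udist A x y" "udist A x y <= 3 * norm (emb A x - emb A y)"
proof -
 let ?d = "uadd A x (uneg A y)"
 have d: "?d \<in> carrier A \<times> UNIV" by (intro ucl assms)
 have e: "emb A x - emb A y = emb A ?d" by (simp add: emb_uadd emb_uneg ucl assms)
 have u: "unorm A ?d = norm (uv (emb A ?d)) + cmod (us (emb A ?d))"
  using d by (auto simp: unorm_def emb_def norm_incl)
 show "norm (emb A x - emb A y) <= udist A x y" unfolding e udist_def u by (rule norm_ue_le)
 show "udist A x y <= 3 * norm (emb A x - emb A y)" unfolding e udist_def u
  using uv_le_norm[of "emb A ?d"] us_le_norm[of "emb A ?d"] by linarith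
qed

lemma sub_in: "x \<in> carrier A ==> y \<in> carrier A ==> sub A x y \<in> carrier A"
 by (simp add: sub_def closed)

lemma incl_sub: "x \<in> carrier A ==> y \<in> carrier A ==> incl A x - incl A y = incl A (sub A x y)"
 using incl_scaleR[of y "-1"] by (simp add: sub_def closed flip: incl_add)

lemma nrm_sub: "x \<in> carrier A ==> y \<in> carrier A ==> nrm A (sub A x y) = norm (incl A x - incl A y)"
 by (simp add: incl_sub norm_incl sub_in)

lemma emb_diff0: "x \<in> carrier A ==> y \<in> carrier A ==> emb A (x, 0) - emb A (y, 0) = emb A (sub A x y, 0)"
 by (simp add: emb_def minus_ue_def incl_sub)

context
 fixes B assumes B: "subalg A B"
begin

lemma sB: "B \<subseteq> carrier A" using B by (simp add: subalg_def)

lemma unz_ide: "unz us (ide A B) = emb A ` (B \<times> UNIV)"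
proof
 show "unz us (ide A B) \<subseteq> emb A ` (B \<times> UNIV)"
 proof
  fix x assume "x \<in> unz us (ide A B)"
  then obtain b where b: "b \<in> B" "x - cplx (us x) = emb A (b, 0)" by (auto simp: unz_def ide_def)
  then have "x = emb A (b, us x)" using emb_split[of b "us x"] by (simp add: algebra_simps)
  then show "x \<in> emb A ` (B \<times> UNIV)" using b by blast
 qed
 show "emb A ` (B \<times> UNIV) \<subseteq> unz us (ide A B)"
  using emb_split by (auto simp: unz_def ide_def emb_def plus_ue_def cplx_ue minus_ue_def)
qed

lemma cideal_ide: "cideal us (ide A B)"
proof
 note b = B[unfolded subalg_def] and s = sB
 have "zero A \<in> B" using b by blast
 then show "0 \<in> ide A B" using incl_zero by (force simp: ide_def emb_def zero_ue_def)
 show "us x = 0" if "x \<in> ide A B" for x using that by (auto simp: ide_def emb_def)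
 have E: "\<exists>a\<in>B. a \<in> carrier A & x = emb A (a, 0)" if "x \<in> ide A B" for x using that s by (auto simp: ide_def)
 have I: "emb A (a, 0) \<in> ide A B" if "a \<in> B" for a using that by (auto simp: ide_def)
 show "cplx c * x \<in> ide A B" "adj x \<in> ide A B" if x: "x \<in> ide A B" for x c
 proof -
  obtain a where a: "a \<in> B" "a \<in> carrier A" "x = emb A (a, 0)" using E[OF x] by blast
  have "smul A c a \<in> B" "star A a \<in> B" using b a(1) by blast+
  then show "cplx c * x \<in> ide A B" "adj x \<in> ide A B"
   using I[of "smul A c a"] I[of "star A a"] a by (simp_all add: emb_smul) (simp add: emb_def adj_ue_def incl_star)
 qed
 show "x + y \<in> ide A B" "x * y \<in> ide A B" if xy: "x \<in> ide A B" "y \<in> ide A B" for x y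
 proof -
  obtain a a' where a: "a \<in> B" "a \<in> carrier A" "x = emb A (a, 0)" "a' \<in> B" "a' \<in> carrier A" "y = emb A (a', 0)"
   using E[OF xy(1)] E[OF xy(2)] by blast
  have "add A a a' \<in> B" "mul A a a' \<in> B" using b a(1,4) by blast+
  then show "x + y \<in> ide A B" "x * y \<in> ide A B"
   using I[of "add A a a'"] I[of "mul A a a'"] a by (simp_all add: emb_def plus_ue_def times_ue_def incl_add incl_mul)
 qed
 show "closed (ide A B)"
  unfolding closed_sequential_limits
 proof (intro allI impI, elim conjE)
  fix X l assume X: "\<forall>n. X n \<in> ide A B" "X \<longlonglongrightarrow> l"
  have "\<forall>n. \<exists>a. a \<in> B & X n = emb A (a, 0)" using E X(1) by blast
  then obtain g where g: "\<And>n. g n \<in> B" "\<And>n. X n = emb A (g n, 0)" using choice[of "%n a. a \<in> B & X n = emb A (a, 0)"] by blast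
  have gc: "g n \<in> carrier A" for n using g(1) s by blast
  have l0: "(%n. 2 * norm (X n - l)) \<longlonglongrightarrow> 0"
   using tendsto_mult_right_zero[OF tendsto_norm_zero[OF LIM_zero[OF X(2)]], of 2] by simp
  have v: "norm (incl A (g n) - uv l) <= 2 * norm (X n - l)" for n
   using uv_le_norm[of "X n - l"] by (simp add: g(2) emb_def minus_ue_def)
  have u: "cmod (us l) <= norm (X n - l)" for n
   using us_le_norm[of "X n - l"] by (simp add: g(2) emb_def minus_ue_def)
  have "cmod (us l) <= 0"
   using LIMSEQ_le_const[OF tendsto_norm_zero[OF LIM_zero[OF X(2)]]] u by blast
  then have us0: "us l = 0" by simp
  define b where "b = crd (uv l) (Abs_cs A)"
  have bc: "b \<in> carrier A" unfolding b_def using crd_in[of "uv l" "Abs_cs A"] by (simp add: Rep_Abs)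
  \<comment> \<open>The approximating elements vanish in every coordinate other than that of
    \<open>A\<close>, hence so does the limit, which is therefore again in the image of the
    embedding.\<close>
  have cc: "nrm (Rep_cs i) (sub (Rep_cs i) (crd (incl A (g n)) i) (crd (uv l) i)) <= 2 * norm (X n - l)" for n i
   using pr_coord_le[of i "incl A (g n) - uv l"] v[of n] by (simp only: pr_minus)
  have "crd (uv l) i = (if Rep_cs i = A then b else zero (Rep_cs i))" for i
  proof (cases "Rep_cs i = A")
   case True
   then have "i = Abs_cs A" by (metis Rep_cs_inverse)
   then show ?thesis using True by (simp add: b_def)
  next
   case False
   let ?A = "Rep_cs i" and ?y = "crd (uv l) i"
   have "nrm ?A (sub ?A (zero ?A) ?y) = nrm ?A ?y"
    by (simp add: sub_def cs_add_comm[OF Rep_cs_cstar cs_zero[OF Rep_cs_cstar]] cs_add_zero[OF Rep_cs_cstar]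
     Rep_cs_closed crd_in cs_nrm_smul[OF Rep_cs_cstar])
   then have "nrm ?A ?y <= 2 * norm (X n - l)" for n using cc[of i n] False by (simp add: crd_incl[OF gc])
   then have "nrm ?A ?y <= 0" using LIMSEQ_le_const[OF l0] by blast
   then have "nrm ?A ?y = 0" using cs_nrm_nonneg[OF Rep_cs_cstar crd_in, of i "uv l"] by simp
   then show ?thesis using False cs_nrm_zero[OF Rep_cs_cstar crd_in, of i "uv l"] by simp
  qed
  then have ul: "uv l = incl A b" using bc by (rule incl_eqI)
  have "(%n. nrm A (sub A (g n) b)) \<longlonglongrightarrow> 0"
  proof (rule Lim_null_comparison[OF always_eventually l0], intro allI)
   show "norm (nrm A (sub A (g n) b)) <= 2 * norm (X n - l)" for n
    using v[of n] by (simp add: ul nrm_sub[OF gc bc])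
  qed
  then have "b \<in> B" using b g(1) bc by (elim conjE) blast
  moreover have "l = emb A (b, 0)" using ul us0 by (simp add: emb_def ue.expand)
  ultimately show "l \<in> ide A B" by (simp add: ide_def)
 qed
qed

end

text \<open>Membership in \<open>Lg A 1\<close> provides only a left inverse \<open>w\<close> of
  \<open>y\<close>. Approximating \<open>w\<close> by a left invertible \<open>w'\<close> makes
  \<open>w' * y\<close> invertible, so \<open>w'\<close> also has a right inverse; thus
  \<open>w'\<close> is invertible, and with it \<open>y\<close>.\<close>

lemma GLdense_ide_iff:
 "Lg_dense A 1 \<longleftrightarrow> GLdense (unz us (ide A (carrier A)))"
proof -
 let ?S = "unz us (ide A (carrier A))"
 interpret I: cideal us "ide A (carrier A)" by (rule cideal_ide[OF subalg_carrier])
 have S: "?S = emb A ` (carrier A \<times> UNIV)" by (rule unz_ide[OF subalg_carrier])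
 have u1: "usum A f 1 = f 0" if "f 0 \<in> carrier A \<times> UNIV" for f
 proof -
  have "emb A (usum A f 1) = emb A (f 0)" using that by (simp add: emb_uadd emb_uzero ucl)
  moreover have "usum A f 1 \<in> carrier A \<times> UNIV" using that by (simp add: ucl)
  ultimately show ?thesis using emb_eq_iff[OF _ that, of "usum A f 1"] by simp
 qed
 show ?thesis
 proof
  assume L: "Lg_dense A 1"
  have left: "\<exists>y w. y \<in> ?S & w \<in> ?S & w * y = 1 & norm (x - y) < e" if x: "x \<in> ?S" and e: "e > 0" for x e
  proof -
   obtain v where v: "v \<in> carrier A \<times> UNIV" "x = emb A v" using x S by blast
   have "\<exists>w\<in>Lg A 1. \<forall>i<1. udist A v (w i) < e" using L e v(1) unfolding Lg_dense_def by (elim allE[of _ "%_. v"]) auto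
   then obtain w where w: "w \<in> Lg A 1" "udist A v (w 0) < e" by auto
   then have w0: "w 0 \<in> carrier A \<times> UNIV" and "\<exists>w'. w' 0 \<in> carrier A \<times> UNIV & usum A (%i. umul A (w' i) (w i)) 1 = uone A"
    by (simp_all add: Lg_def)
   then obtain w' where "w' 0 \<in> carrier A \<times> UNIV & usum A (%i. umul A (w' i) (w i)) 1 = uone A" by (elim exE)
   then have w': "w 0 \<in> carrier A \<times> UNIV" "w' 0 \<in> carrier A \<times> UNIV" "usum A (%i. umul A (w' i) (w i)) 1 = uone A"
    using w0 by simp_all
   have "umul A (w' 0) (w 0) = uone A" using u1[of "%i. umul A (w' i) (w i)", OF ucl(2)[OF w'(2,1)]] w'(3) by simp
   then have "emb A (w' 0) * emb A (w 0) = 1" using emb_umul[OF w'(2,1)] emb_uone by simp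
   moreover have "norm (x - emb A (w 0)) < e" using udist_bounds(1)[OF v(1) w'(1)] w(2) v(2) by simp
   ultimately show ?thesis unfolding S
    by - (rule exI[of _ "emb A (w 0)"], rule exI[of _ "emb A (w' 0)"], simp only: imageI[OF w'(1)] imageI[OF w'(2)] simp_thms)
  qed
  show "GLdense ?S" unfolding GLdense_def
  proof (intro ballI allI impI)
   fix x and e :: real assume x: "x \<in> ?S" and e: "e > 0"
   obtain y w where yw: "y \<in> ?S" "w \<in> ?S" "w * y = 1" "norm (x - y) < e" using left[OF x e] by blast
   define N where "N = norm y + 1"
   have N: "N > 0" by (simp add: N_def add_nonneg_pos)
   obtain w' z where w': "w' \<in> ?S" "z \<in> ?S" "z * w' = 1" "norm (w - w') < 1 / N"
    using left[OF yw(2), of "1 / N"] N by auto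
   have "1 - w' * y = (w - w') * y" using yw(3) by (simp add: left_diff_distrib)
   then have "norm (1 - w' * y) <= norm (w - w') * norm y" by (simp only: norm_mult_ineq)
   also have "\<dots> <= norm (w - w') * N" by (intro mult_left_mono) (auto simp: N_def)
   also have "\<dots> < 1" using w'(4) N by (simp add: field_simps)
   finally have g: "w' * y \<in> GL ?S" by (intro I.U.GL_near_one I.U.mult_S w' yw)
   let ?r = "y * minv (w' * y)"
   have r: "w' * ?r = 1" using minv(1)[OF g] by (simp add: mult.assoc)
   have "z = z * (w' * ?r)" using r by simp
   also have "\<dots> = ?r" using w'(3) by (simp add: mult.assoc[symmetric])
   finally have "w' * z = 1" using r by simp
   then have w'G: "w' \<in> GL ?S" using w' by (auto simp: GL_def)
   have "minv w' * (w' * y) = y" using minv(2)[OF w'G] by (simp add: mult.assoc[symmetric])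
   then have "y \<in> GL ?S" using I.U.GL_mult[OF minv(4)[OF w'G] g] by simp
   then show "\<exists>y\<in>GL ?S. norm (x - y) < e" using yw by blast
  qed
 next
  assume G: "GLdense ?S"
  show "Lg_dense A 1" unfolding Lg_dense_def
  proof (intro allI impI)
   fix v :: "nat => 'a \<times> complex" and e :: real
   assume v: "\<forall>i<1. v i \<in> carrier A \<times> UNIV" and e: "e > 0"
   then have v0: "v 0 \<in> carrier A \<times> UNIV" by simp
   have "e / 3 > 0" using e by simp
   then obtain y where y: "y \<in> GL ?S" "norm (emb A (v 0) - y) < e / 3" using G imageI[OF v0, of "emb A"] unfolding GLdense_def S by meson
   have "y \<in> emb A ` (carrier A \<times> UNIV)" using y(1) GL_subset unfolding S[symmetric] by (rule subsetD[rotated])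
   then obtain w where w: "y = emb A w" "w \<in> carrier A \<times> UNIV" by (rule imageE)
   note w = w(2,1)
   obtain w' where w': "minv y = emb A w'" "w' \<in> carrier A \<times> UNIV" using minv(3)[OF y(1)] unfolding S by (rule imageE)
   note w' = w'(2,1)
   have "emb A (umul A w' w) = emb A (uone A)" using minv(2)[OF y(1)] emb_umul[OF w'(1) w(1)] emb_uone w w' by simp
   then have "umul A w' w = uone A" using emb_eq_iff[OF ucl(2)[OF w'(1) w(1)] ucl(5)] by simp
   then have "usum A (%i. umul A w' w) 1 = uone A" using u1[of "%i. umul A w' w"] ucl(5) by simp
   then have "(%_. w) \<in> Lg A 1" unfolding Lg_def using w w' by (auto intro!: exI[of _ "%_. w'"])
   moreover have "udist A (v 0) w < e" using udist_bounds(2)[OF v0 w(1)] y(2) w(2) by simp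
   ultimately show "\<exists>w\<in>Lg A 1. \<forall>i<1. udist A (v i) (w i) < e" by (intro bexI[of _ "%_. w"]) auto
  qed
 qed
qed

lemma positiveD:
 assumes "positive A x" obtains y where "y \<in> carrier A" "emb A (x, 0) = adj (emb A (y, 0)) * emb A (y, 0)"
proof -
 obtain y where y: "y \<in> carrier A" "x = mul A (star A y) y" using assms by (auto simp: positive_def)
 have "emb A (x, 0) = adj (emb A (y, 0)) * emb A (y, 0)"
  by (simp add: y emb_def adj_ue_def times_ue_def incl_star incl_mul closed)
 then show ?thesis using that y by blast
qed

lemma positiveI:
 assumes "y \<in> carrier A" "x \<in> carrier A" "emb A (x, 0) = adj (emb A (y, 0)) * emb A (y, 0)"
 shows "positive A x"
proof -
 have "emb A (x, 0) = emb A (mul A (star A y) y, 0)"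
  using assms by (simp add: emb_def adj_ue_def times_ue_def incl_star incl_mul closed)
 then have "x = mul A (star A y) y" using emb_eq_iff[of "(x, 0)" "(mul A (star A y) y, 0)"] assms closed by auto
 then show ?thesis using assms by (auto simp: positive_def)
qed

lemma her_ide:
 assumes H: "hereditary_subalg A B"
 shows "her us (ide A (carrier A)) (ide A B)"
proof (rule her_from_positive)
 note sB = subalg_hereditary[OF H]
 show "cideal us (ide A (carrier A))" "cideal us (ide A B)" by (intro cideal_ide subalg_carrier sB)+
 have Bc: "B \<subseteq> carrier A" using sB by (simp add: subalg_def)
 then show "ide A B \<subseteq> ide A (carrier A)" by (auto simp: ide_def)
 fix b y z assume "b \<in> ide A B" "y \<in> ide A (carrier A)" "z \<in> ide A (carrier A)" and e: "b = adj y * y + adj z * z"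
 then obtain b' y' z' where b: "b' \<in> B" "b = emb A (b', 0)" and y: "y' \<in> carrier A" "y = emb A (y', 0)"
  and z: "z' \<in> carrier A" "z = emb A (z', 0)" by (auto simp: ide_def)
 define a where "a = mul A (star A y') y'"
 have a: "a \<in> carrier A" unfolding a_def by (intro closed y)
 have ea: "emb A (a, 0) = adj y * y" by (simp add: a_def y emb_def adj_ue_def times_ue_def incl_star incl_mul closed)
 have pa: "positive A a" by (rule positiveI[OF y(1) a]) (simp add: ea y(2))
 have bc: "b' \<in> carrier A" using b Bc by blast
 have "emb A (sub A b' a, 0) = b - adj y * y" using emb_diff0[OF bc a] by (simp only: ea b(2))
 then have "emb A (sub A b' a, 0) = adj z * z" by (simp add: e)
 then have "positive A (sub A b' a)" using b a Bc by (intro positiveI[OF z(1)] sub_in) (auto simp: z(2))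
 then have "a \<in> B" using H a b pa unfolding hereditary_subalg_def by blast
 then show "adj y * y \<in> ide A B" unfolding ide_def ea[symmetric] by (rule imageI)
qed

text \<open>If 0 <= a <= b and b f = 0, write a and b - a as y' y and z' z, primes denoting
  adjoints. Then the absolute squares of y f and z f add up to 0, so y f = 0 and a f = 0.
  Annihilators are the subalgebras in which the local connection argument needs connected
  unitaries.\<close>

lemma hereditary_ann:
 assumes f: "adj f = f"
 defines "B \<equiv> {b \<in> carrier A. emb A (b, 0) \<in> ann (ide A (carrier A)) f}"
 shows "hereditary_subalg A B" "ide A B = ann (ide A (carrier A)) f"
proof -
 let ?I = "ide A (carrier A)"
 interpret I: cideal us ?I by (rule cideal_ide[OF subalg_carrier])
 interpret N: cideal us "ann ?I f" by (rule I.cideal_ann[OF f])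
 have mem: "b \<in> B \<longleftrightarrow> b \<in> carrier A & emb A (b, 0) \<in> ann ?I f" for b by (auto simp: B_def)
 show "ide A B = ann ?I f" by (auto simp: B_def ide_def ann_def)
 show "hereditary_subalg A B" unfolding hereditary_subalg_def
 proof (intro conjI ballI allI impI)
  show "B \<subseteq> carrier A" by (auto simp: B_def)
  show "zero A \<in> B" using N.zero_A by (simp add: mem closed emb_def incl_zero zero_ue_def)
  fix x assume x: "x \<in> B"
  then have xc: "x \<in> carrier A" and xa: "emb A (x, 0) \<in> ann ?I f" by (auto simp: mem)
  show "smul A c x \<in> B" for c using N.cplx_A[OF xa, of c] xc by (simp add: mem closed emb_smul)
  show "star A x \<in> B" using N.adj_A[OF xa] xc by (simp add: mem closed emb_def adj_ue_def incl_star)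
  fix y assume y: "y \<in> B"
  then have yc: "y \<in> carrier A" and ya: "emb A (y, 0) \<in> ann ?I f" by (auto simp: mem)
  show "add A x y \<in> B" using N.add_A[OF xa ya] xc yc by (simp add: mem closed emb_def plus_ue_def incl_add)
  show "mul A x y \<in> B" using N.mult_A[OF xa ya] xc yc by (simp add: mem closed emb_def times_ue_def incl_mul)
 next
  fix g x assume g: "(\<forall>n. g n \<in> B) & x \<in> carrier A & (%n. nrm A (sub A (g n) x)) \<longlonglongrightarrow> 0"
  then have gc: "g n \<in> carrier A" and ga: "emb A (g n, 0) \<in> ann ?I f" for n by (auto simp: mem)
  have lim: "(%n. nrm A (sub A (g n) x)) \<longlonglongrightarrow> 0" and xc: "x \<in> carrier A" using g by auto
  have "norm (emb A (g n, 0) - emb A (x, 0)) <= nrm A (sub A (g n) x)" for n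
   unfolding emb_diff0[OF gc xc]
   using norm_ue_le[of "emb A (sub A (g n) x, 0)"] by (simp add: gc xc emb_def norm_incl sub_in)
  then have "(%n. emb A (g n, 0) - emb A (x, 0)) \<longlonglongrightarrow> 0"
   by (rule Lim_null_comparison[OF always_eventually lim, rule_format])
  then have "(%n. emb A (g n, 0)) \<longlonglongrightarrow> emb A (x, 0)" by (rule LIM_zero_cancel)
  then have "emb A (x, 0) \<in> ann ?I f" using closed_sequentially[OF N.closed_A, of "%n. emb A (g n, 0)" "emb A (x, 0)"] ga by blast
  then show "x \<in> B" using xc by (simp add: mem)
 next
  fix a b assume a: "a \<in> carrier A" and b: "b \<in> B" and p: "positive A a & positive A (sub A b a)"
  have bc: "b \<in> carrier A" and ba: "emb A (b, 0) * f = 0" using b by (auto simp: mem ann_def)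
  obtain y where y: "y \<in> carrier A" "emb A (a, 0) = adj (emb A (y, 0)) * emb A (y, 0)" using positiveD p by blast
  obtain z where z: "z \<in> carrier A" "emb A (sub A b a, 0) = adj (emb A (z, 0)) * emb A (z, 0)" using positiveD p by blast
  let ?y = "emb A (y, 0)" and ?z = "emb A (z, 0)"
  have "emb A (b, 0) = adj ?y * ?y + adj ?z * ?z" using emb_diff0[OF bc a] y z by (simp add: algebra_simps)
  then have "adj (?y * f) * (?y * f) + adj (?z * f) * (?z * f) = f * (emb A (b, 0) * f)"
   by (simp add: adj_mult f distrib_left distrib_right mult.assoc)
  then have "adj (?y * f) * (?y * f) + adj (?z * f) * (?z * f) = 0" using ba by simp
  then have "?y * f = 0" by (rule pos_zero_sum)
  then have af: "emb A (a, 0) * f = 0" by (simp add: y mult.assoc)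
  then have "adj (emb A (a, 0) * f) = 0" by simp
  then have "f * emb A (a, 0) = 0" by (simp add: adj_mult f y)
  then show "a \<in> B" using a af by (auto simp: mem ann_def ide_def)
 qed
qed

section \<open>Unitary matrices and \<open>K1_zero\<close> through the embedding\<close>

lemma emb_usum:
 assumes "\<And>k. k < m ==> f k \<in> carrier A \<times> UNIV"
 shows "usum A f m \<in> carrier A \<times> UNIV & emb A (usum A f m) = (\<Sum>k<m. emb A (f k))"
 using assms
proof (induction m)
 case (Suc m)
 then have "usum A f m \<in> carrier A \<times> UNIV" "emb A (usum A f m) = (\<Sum>k<m. emb A (f k))" "f m \<in> carrier A \<times> UNIV" by auto
 then show ?case by (simp add: emb_uadd ucl)
qed (simp add: emb_uzero ucl)

definition embm :: "nat => 'a umat => 'a prd ue mtx" where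
 "embm m U = (%i j. if i < m & j < m then emb A (U i j) else 0)"

lemma unitary_mat_iff:
 assumes B: "subalg A B" and U: "\<And>i j. i < m ==> j < m ==> U i j \<in> B \<times> UNIV"
 shows "unitary_mat A B m U \<longleftrightarrow> embm m U \<in> UGM m (unz us (ide A B))"
proof -
 have Bc: "B \<subseteq> carrier A" using B by (simp add: subalg_def)
 have Uc: "U i j \<in> carrier A \<times> UNIV" if "i < m" "j < m" for i j using U[OF that] Bc by auto
 have mul: "mat_mul A m P Q i j \<in> carrier A \<times> UNIV & emb A (mat_mul A m P Q i j) = mm m (embm m P) (embm m Q) i j"
  if "i < m" "j < m" "\<And>i j. i < m ==> j < m ==> P i j \<in> carrier A \<times> UNIV" "\<And>i j. i < m ==> j < m ==> Q i j \<in> carrier A \<times> UNIV" for P Q i j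
  using emb_usum[of m "%k. umul A (P i k) (Q k j)"] that
  by (simp add: mat_mul_def mm_def embm_def emb_umul ucl)
 have star: "embm m (mat_star A U) = madj (embm m U)"
  by (auto simp: embm_def madj_def mat_star_def fun_eq_iff emb_ustar Uc)
 have starc: "mat_star A U i j \<in> carrier A \<times> UNIV" if "i < m" "j < m" for i j
  using Uc[OF that(2,1)] by (simp add: mat_star_def ucl)
 have one: "emb A (mat_one A i j) = mI m i j" "mat_one A i j \<in> carrier A \<times> UNIV" if "i < m" for i j
  using that by (auto simp: mat_one_def mI_def emb_uone emb_uzero ucl)
 have eq: "mat_eq m P (mat_one A) \<longleftrightarrow> Q = mI m"
  if P: "\<And>i j. i < m ==> j < m ==> P i j \<in> carrier A \<times> UNIV & emb A (P i j) = Q i j" and Q: "\<And>i j. \<not> (i < m & j < m) ==> Q i j = 0" for P Q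
 proof
  assume e: "mat_eq m P (mat_one A)"
  show "Q = mI m"
  proof (intro ext)
   show "Q i j = mI m i j" for i j
    using e P[of i j] Q[of i j] one[of i j] by (cases "i < m & j < m") (auto simp: mat_eq_def mI_def)
  qed
 next
  assume "Q = mI m"
  then show "mat_eq m P (mat_one A)" unfolding mat_eq_def using P one emb_eq_iff by metis
 qed
 have z: "mm m (madj (embm m U)) (embm m U) i j = 0" "mm m (embm m U) (madj (embm m U)) i j = 0" if "\<not> (i < m & j < m)" for i j
  using that by (auto simp: mm_def embm_def madj_def intro!: sum.neutral)
 have "mat_eq m (mat_mul A m (mat_star A U) U) (mat_one A) \<longleftrightarrow> mm m (madj (embm m U)) (embm m U) = mI m"
  by (rule eq) (use mul[OF _ _ starc Uc] z in \<open>auto simp: star\<close>)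
 moreover have "mat_eq m (mat_mul A m U (mat_star A U)) (mat_one A) \<longleftrightarrow> mm m (embm m U) (madj (embm m U)) = mI m"
  by (rule eq) (use mul[OF _ _ Uc starc] z in \<open>auto simp: star\<close>)
 moreover have "embm m U \<in> mats m (unz us (ide A B))"
  using U unfolding unz_ide[OF B] by (auto simp: mats_def embm_def)
 ultimately show ?thesis using U by (auto simp: unitary_mat_def UGM_def)
qed

text \<open>Injectivity of U/U0 into K1: regard \<open>u\<close> as a matrix of size 1, take the
  stabilised path supplied by the hypothesis, and bring it back to size 1 with
  \<open>glpath_connected\<close>.\<close>

lemma K1_zero_connected:
 assumes B: "subalg A B" and d: "GLdense (unz us (ide A B))" and K: "K1_zero A B"
  and u: "u \<in> UG (unz us (ide A B))"
 shows "path_component (UG (unz us (ide A B))) 1 u"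
proof -
 let ?S = "unz us (ide A B)"
 interpret N: cideal us "ide A B" by (rule cideal_ide[OF B])
 have Bc: "B \<subseteq> carrier A" using B by (simp add: subalg_def)
 obtain v where v: "v \<in> B \<times> UNIV" "u = emb A v" using UG_D(1)[OF u] unz_ide[OF B] by blast
 define U where "U = (%(i::nat) (j::nat). v)"
 have "embm 1 U \<in> UGM 1 ?S"
  using UG_D[OF u] v by (auto simp: UGM_def mats_def embm_def U_def mm_def madj_def mI_def fun_eq_iff)
 then have "unitary_mat A B 1 U" using unitary_mat_iff[OF B, of 1 U] v by (simp add: U_def)
 then obtain m where m: "m >= 1" "unitary_conn_one A B m (mat_ext A 1 U)" using K unfolding K1_zero_def by blast
 then obtain \<gamma> :: "real => 'a umat" where g: "\<And>t. t \<in> {0..1} ==> unitary_mat A B m (\<gamma> t)"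
  "\<And>t e. t \<in> {0..1} ==> e > 0 ==> \<exists>d>0. \<forall>s\<in>{0..1}. \<bar>s - t\<bar> < d --> (\<forall>i<m. \<forall>j<m. udist A (\<gamma> s i j) (\<gamma> t i j) < e)"
  "mat_eq m (\<gamma> 0) (mat_one A)" "mat_eq m (\<gamma> 1) (mat_ext A 1 U)"
  unfolding unitary_conn_one_def by blast
 have gB: "\<gamma> t i j \<in> B \<times> UNIV" if "t \<in> {0..1}" "i < m" "j < m" for t i j using g(1)[OF that(1)] that by (auto simp: unitary_mat_def)
 then have gc: "\<gamma> t i j \<in> carrier A \<times> UNIV" if "t \<in> {0..1}" "i < m" "j < m" for t i j using that Bc by fastforce
 define G where "G t = embm m (\<gamma> t)" for t
 have GU: "G t \<in> UGM m ?S" if t: "t \<in> {0..1}" for t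
  using unitary_mat_iff[OF B gB[OF t]] g(1)[OF t] by (simp add: G_def)
 have cG: "continuous_on {0..1} G"
  unfolding continuous_on_mtx
 proof (intro allI)
  fix i j
  show "continuous_on {0..1} (%t. G t i j)"
  proof (cases "i < m & j < m")
   case True
   show ?thesis unfolding continuous_on_iff
   proof (intro ballI allI impI)
    fix t e :: real assume t: "t \<in> {0..1}" and e: "e > 0"
    obtain d where d: "d > 0" "\<And>s. s \<in> {0..1} ==> \<bar>s - t\<bar> < d ==> udist A (\<gamma> s i j) (\<gamma> t i j) < e"
     using g(2)[OF t e] True by blast
    have "dist (G s i j) (G t i j) < e" if s: "s \<in> {0..1}" "dist s t < d" for s
     using udist_bounds(1)[OF gc[OF s(1)] gc[OF t], of i j i j] d(2)[of s] s True
     by (simp add: G_def embm_def dist_norm)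
    then show "\<exists>d>0. \<forall>x'\<in>{0..1}. dist x' t < d --> dist (G x' i j) (G t i j) < e" using d(1) by blast
   qed
  next
   case False
   then have "(%t. G t i j) = (%_. 0)" by (auto simp: G_def embm_def)
   then show ?thesis by (simp only: continuous_on_const)
  qed
 qed
 have "N.U.glpath m u" unfolding N.U.glpath_def
 proof (rule exI[of _ G], rule exI[of _ "%t. madj (G t)"], intro conjI ballI)
  show "continuous_on {0..1} G" "continuous_on {0..1} (%t. madj (G t))" by (intro cG continuous_on_madj)+
  show "G t \<in> mats m ?S" "madj (G t) \<in> mats m ?S" "mm m (G t) (madj (G t)) = mI m" "mm m (madj (G t)) (G t) = mI m" if "t \<in> {0..1}" for t
   using GU[OF that] N.U.madj_mats by (auto simp: UGM_def)
  show "G 0 = mI m" using g(3) by (auto simp: G_def embm_def mat_eq_def mat_one_def mI_def emb_uone emb_uzero fun_eq_iff)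
  show "G 1 = N.U.dg m u" using g(4) m(1) v
   by (auto simp: G_def embm_def mat_eq_def mat_ext_def mat_one_def N.U.dg_def U_def emb_uone emb_uzero fun_eq_iff)
 qed
 then show ?thesis by (rule N.U.glpath_connected[OF d u m(1)])
qed

text \<open>Column reduction connects the matrix at its own size, so \<open>m = n\<close> is the
  witness.\<close>

lemma connected_K1_zero:
 assumes B: "subalg A B" and d: "GLdense (unz us (ide A B))"
  and conn: "\<And>u. u \<in> UG (unz us (ide A B)) ==> path_component (UG (unz us (ide A B))) 1 u"
 shows "K1_zero A B"
 unfolding K1_zero_def
proof (intro allI impI)
 let ?S = "unz us (ide A B)"
 interpret N: cideal us "ide A B" by (rule cideal_ide[OF B])
 have Bc: "B \<subseteq> carrier A" using B by (simp add: subalg_def)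
 fix n U assume U: "unitary_mat A B n U"
 then have UB: "U i j \<in> B \<times> UNIV" if "i < n" "j < n" for i j using that by (auto simp: unitary_mat_def)
 have "embm n U \<in> UGM n ?S" using unitary_mat_iff[OF B UB] U by simp
 then have "embm n U \<in> N.U.Conn n" using N.U.UGM_connected[OF d conn] by blast
 then obtain g :: "real => 'a prd ue mtx" where g: "\<And>t. t \<in> {0..1} ==> g t \<in> UGM n ?S" "continuous_on {0..1} g" "g 0 = mI n" "g 1 = embm n U"
  using N.U.ConnE by blast
 define \<gamma> where "\<gamma> t i j = unemb A (g t i j)" for t i j
 have ge: "\<gamma> t i j \<in> B \<times> UNIV & emb A (\<gamma> t i j) = g t i j" if t: "t \<in> {0..1}" and ij: "i < n" "j < n" for t i j
 proof -
  have "g t i j \<in> emb A ` (B \<times> UNIV)" using g(1)[OF t] ij unz_ide[OF B] by (auto simp: UGM_def mats_def)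
  then obtain x where x: "x \<in> B \<times> UNIV" "g t i j = emb A x" by blast
  moreover have "x \<in> carrier A \<times> UNIV" using x Bc by auto
  ultimately show ?thesis by (simp add: \<gamma>_def unemb_emb)
 qed
 have gc: "\<gamma> t i j \<in> carrier A \<times> UNIV" if "t \<in> {0..1}" "i < n" "j < n" for t i j using ge[OF that] Bc by auto
 have em: "embm n (\<gamma> t) = g t" if t: "t \<in> {0..1}" for t
  using ge[OF t] g(1)[OF t] by (auto simp: embm_def fun_eq_iff UGM_def mats_def)
 have "unitary_conn_one A B n (mat_ext A n U)" unfolding unitary_conn_one_def
 proof (intro exI[of _ \<gamma>] conjI ballI allI impI)
  show "unitary_mat A B n (\<gamma> t)" if t: "t \<in> {0..1}" for t
   using unitary_mat_iff[OF B, of n "\<gamma> t"] ge[OF t] em[OF t] g(1)[OF t] by simp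
  show "mat_eq n (\<gamma> 0) (mat_one A)" unfolding mat_eq_def
  proof (intro allI impI)
   fix i j assume ij: "i < n" "j < n"
   have "emb A (\<gamma> 0 i j) = emb A (mat_one A i j)" using ge[of 0 i j] ij g(3) by (auto simp: mat_one_def mI_def emb_uone emb_uzero)
   then show "\<gamma> 0 i j = mat_one A i j" using emb_eq_iff gc[of 0 i j] ij ucl by (auto simp: mat_one_def)
  qed
  show "mat_eq n (\<gamma> 1) (mat_ext A n U)" unfolding mat_eq_def
  proof (intro allI impI)
   fix i j assume ij: "i < n" "j < n"
   have "emb A (\<gamma> 1 i j) = emb A (U i j)" using ge[of 1 i j] ij g(4) by (auto simp: embm_def)
   moreover have "U i j \<in> carrier A \<times> UNIV" using UB[OF ij] Bc by auto
   ultimately show "\<gamma> 1 i j = mat_ext A n U i j" using emb_eq_iff gc[of 1 i j] ij by (auto simp: mat_ext_def)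
  qed
  fix t e :: real assume t: "t \<in> {0..1}" and e: "e > 0"
  have e3: "e / 3 > 0" using e by simp
  have c: "continuous_on {0..1} (%t. g t i j)" for i j using g(2) by (simp add: continuous_on_mtx)
  have "\<forall>p\<in>{..<n} \<times> {..<n}. \<exists>d>0. \<forall>s\<in>{0..1}. dist s t < d --> dist (g s (fst p) (snd p)) (g t (fst p) (snd p)) < e / 3"
   using c t e3 unfolding continuous_on_iff by blast
  then obtain D where D: "\<And>p. p \<in> {..<n} \<times> {..<n} ==> D p > 0 & (\<forall>s\<in>{0..1}. dist s t < D p --> dist (g s (fst p) (snd p)) (g t (fst p) (snd p)) < e / 3)"
   by metis
  define d where "d = Min (insert 1 (D ` ({..<n} \<times> {..<n})))"
  have fin: "finite (insert 1 (D ` ({..<n} \<times> {..<n})))" by simp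
  have d0: "d > 0" unfolding d_def using fin D by (subst Min_gr_iff) auto
  have dl: "d <= D (i, j)" if "i < n" "j < n" for i j unfolding d_def using that by (intro Min_le) auto
  have "udist A (\<gamma> s i j) (\<gamma> t i j) < e" if s: "s \<in> {0..1}" "\<bar>s - t\<bar> < d" and ij: "i < n" "j < n" for s i j
  proof -
   have "dist s t < D (i, j)" using s(2) dl[OF ij] by (simp add: dist_real_def)
   then have "norm (g s i j - g t i j) < e / 3" using D[of "(i, j)"] s(1) ij by (auto simp: dist_norm)
   then show ?thesis using udist_bounds(2)[OF gc[OF s(1) ij] gc[OF t ij]] ge[OF s(1) ij] ge[OF t ij] by simp
  qed
  then show "\<exists>d>0. \<forall>s\<in>{0..1}. \<bar>s - t\<bar> < d --> (\<forall>i<n. \<forall>j<n. udist A (\<gamma> s i j) (\<gamma> t i j) < e)" using d0 by blast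
 qed
 then show "\<exists>m\<ge>n. unitary_conn_one A B m (mat_ext A n U)" by blast
qed

end

section \<open>Topology of compact metric spaces of dimension zero and one\<close>

lemma finite_clopen_disjoint_refinement:
 assumes "finite K" "\<And>U. U \<in> K ==> openin T U & closedin T U"
 shows "\<exists>V. finite V & (\<forall>U\<in>V. openin T U & closedin T U) & \<Union>V = \<Union>K & (\<forall>W\<in>V. \<exists>U\<in>K. W \<subseteq> U) & disjoint V"
 using assms
proof (induction K rule: finite_induct)
 case (insert C K)
 have "\<exists>V. finite V & (\<forall>U\<in>V. openin T U & closedin T U) & \<Union>V = \<Union>K & (\<forall>W\<in>V. \<exists>U\<in>K. W \<subseteq> U) & disjoint V"
  by (rule insert.IH) (use insert.prems in simp)
 then obtain V where V: "finite V" "\<forall>U\<in>V. openin T U & closedin T U" "\<Union>V = \<Union>K" "\<forall>W\<in>V. \<exists>U\<in>K. W \<subseteq> U" "disjoint V" by (elim exE conjE)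
 have o: "openin T (\<Union>V)" using V(2) by blast
 have c: "closedin T (\<Union>V)" using V(1,2) by (intro closedin_Union) auto
 have C: "openin T C" "closedin T C" using insert.prems by auto
 show ?case
 proof (intro exI[of _ "insert (C - \<Union>V) V"] conjI)
  show "\<forall>U\<in>insert (C - \<Union>V) V. openin T U & closedin T U"
   using V(2) openin_diff[OF C(1) c] closedin_diff[OF C(2) o] by blast
  show "\<Union>(insert (C - \<Union>V) V) = \<Union>(insert C K)" using V(3) by auto
  show "\<forall>W\<in>insert (C - \<Union>V) V. \<exists>U\<in>insert C K. W \<subseteq> U" using V(4) by blast
  show "disjoint (insert (C - \<Union>V) V)" using V(5) by (auto simp: pairwise_insert disjnt_def)
 qed (use V(1) in simp)
qed (rule exI[of _ "{}"], simp)

lemma compact_openin_subcover: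
 assumes "compact X" "\<And>U. U \<in> \<U> ==> openin (top_of_set X) U" "X \<subseteq> \<Union>\<U>"
 shows "\<exists>K. finite K & K \<subseteq> \<U> & X \<subseteq> \<Union>K"
proof -
 have "compact_space (top_of_set X)" using assms(1) by (simp add: compact_space_subtopology)
 then show ?thesis using assms(2,3) unfolding compact_space_alt by simp
qed

text \<open>Otherwise all components are points. In a compact Hausdorff space they coincide with the
  quasi-components, so clopen sets form a base; every finite open cover is then refined by finitely
  many disjoint clopen sets, and the dimension would be 0.\<close>

lemma nondegenerate_continuum:
 fixes X :: "'x::metric_space set"
 assumes X: "compact X" and d: "\<not> covering_dim_le X 0"
 shows "\<exists>C p q. connected C & C \<subseteq> X & p \<in> C & q \<in> C & p ~= q"
proof (rule ccontr)
 assume no: "\<not> ?thesis"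
 let ?T = "top_of_set X"
 have cs: "compact_space ?T" using X by (simp add: compact_space_subtopology compactin_euclidean_iff)
 have H: "Hausdorff_space ?T" by (simp add: Hausdorff_space_subtopology Hausdorff_space_euclidean)
 have qc: "C = {x}" if C: "C \<in> quasi_components_of ?T" "x \<in> C" for C x
 proof -
  have "quasi_components_of ?T = connected_components_of ?T"
   using cs H quasi_eq_connected_components_of by blast
  then have "connectedin ?T C" using C connectedin_connected_components_of by blast
  then have "connected C" "C \<subseteq> X" by (simp_all add: connectedin_subtopology connectedin_iff_connected)
  then show ?thesis using no C(2) by blast
 qed
 have small: "\<exists>K. openin ?T K & closedin ?T K & x \<in> K & K \<subseteq> U" if x: "x \<in> X" and U: "openin ?T U" "x \<in> U" for x U
 proof -
  let ?C = "quasi_component_of_set ?T x"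
  have C: "?C \<in> quasi_components_of ?T" using x by (simp add: quasi_components_of_def)
  have Cx: "?C = {x}" by (rule qc[OF C]) (use x in simp)
  have "closedin ?T (X - U)" using U(1) openin_closedin_eq by fastforce
  then have "compactin ?T (X - U)" using cs closedin_compact_space by blast
  then have "separated_between ?T ?C (X - U)"
   using separated_between_quasi_component_compact[OF C] Cx U(2) by (simp add: disjnt_def)
  then obtain P Q where PQ: "openin ?T P" "openin ?T Q" "P \<union> Q = X" "disjnt P Q" "x \<in> P" "X - U \<subseteq> Q"
   unfolding separated_between_def Cx by auto
  have "P = X - Q" using PQ(3,4) by (auto simp: disjnt_def)
  then have "closedin ?T P" using PQ(2) by (metis closedin_diff closedin_topspace topspace_euclidean_subtopology)
  moreover have "P \<subseteq> U" using PQ by (auto simp: disjnt_def)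
  ultimately show ?thesis using PQ by blast
 qed
 have "covering_dim_le X 0" unfolding covering_dim_le_def
 proof (intro allI impI, elim conjE)
  fix \<U> assume U: "finite \<U>" "\<forall>U\<in>\<U>. openin ?T U" "\<Union>\<U> = X"
  let ?K = "{K. openin ?T K & closedin ?T K & (\<exists>U\<in>\<U>. K \<subseteq> U)}"
  have "X \<subseteq> \<Union>?K"
  proof
   fix x assume x: "x \<in> X"
   then obtain U where U': "U \<in> \<U>" "x \<in> U" using U(3) by blast
   then obtain K where "openin ?T K" "closedin ?T K" "x \<in> K" "K \<subseteq> U" using small[OF x, of U] U(2) by blast
   then show "x \<in> \<Union>?K" using U'(1) by blast
  qed
  then have "\<exists>K. finite K & K \<subseteq> ?K & X \<subseteq> \<Union>K" by (intro compact_openin_subcover[OF X]) blast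
  then obtain K where K: "finite K" "K \<subseteq> ?K" "X \<subseteq> \<Union>K" by (elim exE conjE)
  have Kc: "openin ?T U & closedin ?T U" if "U \<in> K" for U using K(2) that by blast
  have "\<exists>V. finite V & (\<forall>U\<in>V. openin ?T U & closedin ?T U) & \<Union>V = \<Union>K & (\<forall>W\<in>V. \<exists>U\<in>K. W \<subseteq> U) & disjoint V"
   by (rule finite_clopen_disjoint_refinement[OF K(1) Kc])
  then obtain V where V: "finite V" "\<forall>U\<in>V. openin ?T U & closedin ?T U" "\<Union>V = \<Union>K" "\<forall>W\<in>V. \<exists>U\<in>K. W \<subseteq> U" "disjoint V"
   by (elim exE conjE)
  have "U \<subseteq> X" if "U \<in> K" for U using Kc[OF that] openin_subset[of ?T U] by simp
  then have "\<Union>K \<subseteq> X" by blast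
  then have "\<Union>V = X" using V(3) K(3) by blast
  moreover have "\<forall>W\<in>V. \<exists>U\<in>\<U>. W \<subseteq> U"
  proof
   fix W assume "W \<in> V"
   then obtain K' where "K' \<in> K" "W \<subseteq> K'" using V(4) by blast
   moreover have "\<exists>U\<in>\<U>. K' \<subseteq> U" using subsetD[OF K(2) \<open>K' \<in> K\<close>] by simp
   ultimately show "\<exists>U\<in>\<U>. W \<subseteq> U" by (meson order_trans)
  qed
  moreover have "card {W \<in> V. x \<in> W} <= 0 + 1" for x
  proof -
   have "W = W'" if "W \<in> V" "W' \<in> V" "x \<in> W" "x \<in> W'" for W W'
    using V(5) that by (auto simp: pairwise_def disjnt_def)
   then show ?thesis using V(1) by (simp add: card_le_Suc0_iff_eq)
  qed
  ultimately show "\<exists>\<V>. finite \<V> & (\<forall>V\<in>\<V>. openin ?T V) & \<Union>\<V> = X \<and>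
     (\<forall>V\<in>\<V>. \<exists>U\<in>\<U>. V \<subseteq> U) & (\<forall>x\<in>X. card {V\<in>\<V>. x \<in> V} <= 0 + 1)"
   using V(1,2) by (intro exI[of _ V]) simp
 qed
 then show False using d by blast
qed

lemma finite_partition_of_unity:
 fixes X :: "'x::metric_space set"
 assumes X: "compact X" and V: "finite V" "\<And>U. U \<in> V ==> openin (top_of_set X) U" "\<Union>V = X"
 shows "\<exists>F. (\<forall>U\<in>V. continuous_on X (F U)) & (\<forall>U\<in>V. \<forall>x\<in>X. 0 <= F U x & (x \<notin> U --> F U x = (0::real))) \<and>
  (\<forall>x\<in>X. (\<Sum>U\<in>V. F U x) = 1)"
proof -
 \<comment> \<open>The distance to an empty set is 0 by convention, hence the separate value for
   \<open>U = X\<close>.\<close>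
 define D where "D U x = (if U = X then 1 else infdist x (X - U))" for U :: "'x set" and x
 have D0: "D U x >= 0" for U x by (simp add: D_def infdist_nonneg)
 have Dc: "continuous_on X (D U)" for U by (cases "U = X") (auto simp: D_def intro!: continuous_intros)
 have DU: "D U x > 0 \<longleftrightarrow> x \<in> U" if "U \<in> V" "x \<in> X" for U x
 proof (cases "U = X")
  case False
  have "U \<subseteq> X" using that V(3) by blast
  then have ne: "X - U ~= {}" using False by blast
  have "closedin (top_of_set X) (X - U)" using V(2)[OF that(1)] openin_closedin_eq by fastforce
  then have "closed (X - U)" using closedin_closed_trans compact_imp_closed[OF X] by blast
  then show ?thesis using in_closed_iff_infdist_zero[OF _ ne] D0[of U x] False that(2) by (auto simp: D_def less_le)
 qed (use that in \<open>simp add: D_def\<close>)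
 have s: "(\<Sum>U\<in>V. D U x) > 0" if x: "x \<in> X" for x
 proof -
  obtain U where "U \<in> V" "x \<in> U" using V(3) x by blast
  then show ?thesis using V(1) D0 DU x by (intro sum_pos2[of V U]) auto
 qed
 show ?thesis
 proof (intro exI[of _ "%U x. D U x / (\<Sum>W\<in>V. D W x)"] conjI ballI impI)
  show "continuous_on X (%x. D U x / (\<Sum>W\<in>V. D W x))" for U
   using s by (intro continuous_intros Dc) force
  show "0 <= D U x / (\<Sum>W\<in>V. D W x)" for U x by (intro divide_nonneg_nonneg sum_nonneg D0)
  show "D U x / (\<Sum>W\<in>V. D W x) = 0" if "U \<in> V" "x \<in> X" "x \<notin> U" for U x
   using DU[OF that(1,2)] D0[of U x] that(3) by simp
  show "(\<Sum>U\<in>V. D U x / (\<Sum>W\<in>V. D W x)) = 1" if "x \<in> X" for x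
   using s[OF that] by (simp flip: sum_divide_distrib)
 qed
qed

text \<open>For a cover of order at most two the partition of unity maps \<open>X\<close> into the
  nerve, a graph. Its vertices are sent to points of \<open>G\<close> near \<open>f\<close>, its
  edges to paths in \<open>G\<close>, and the weight of one endpoint serves as the parameter along
  an edge.\<close>

theorem one_dimensional_selection:
 fixes X :: "'x::metric_space set" and f :: "'x => 'y::metric_space"
 assumes X: "compact X" "covering_dim_le X 1" and f: "continuous_on X f"
  and dense: "\<And>x e. x \<in> X ==> e > 0 ==> \<exists>y\<in>G. dist (f x) y < e"
  and \<delta>: "\<delta> > 0" and th: "\<theta> > 0"
  and conn: "\<And>x y z. x \<in> X ==> y \<in> G ==> z \<in> G ==> dist (f x) y < \<delta> ==> dist (f x) z < \<delta> ==>
   path_component (G \<inter> ball (f x) \<theta>) y z"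
 shows "\<exists>g. continuous_on X g & g ` X \<subseteq> G & (\<forall>x\<in>X. dist (f x) (g x) < 2 * \<theta>)"
proof -
 let ?T = "top_of_set X"
 \<comment> \<open>On a set of the cover \<open>f\<close> varies by less than \<open>\<eta>\<close>,
   and the vertex value lies within \<open>2 * \<eta> <= \<delta>\<close> of it, so that
   \<open>conn\<close> applies on overlaps; along an edge the error is at most
   \<open>\<eta> + \<theta> < 2 * \<theta>\<close>.\<close>
 define \<eta> where "\<eta> = min \<delta> \<theta> / 2"
 have \<eta>: "\<eta> > 0" "2 * \<eta> <= \<delta>" "\<eta> < \<theta>" using \<delta> th by (auto simp: \<eta>_def)
 define N where "N x = {y \<in> X. dist (f y) (f x) < \<eta> / 2}" for x
 have No: "openin ?T (N x)" for x
 proof -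
  have "N x = X \<inter> f -` ball (f x) (\<eta> / 2)" by (auto simp: N_def dist_commute)
  then show ?thesis using continuous_openin_preimage_gen[OF f] by auto
 qed
 have "X \<subseteq> \<Union>(N ` X)" using \<eta> by (auto simp: N_def)
 then have "\<exists>K. finite K & K \<subseteq> N ` X & X \<subseteq> \<Union>K" using No by (intro compact_openin_subcover[OF X(1)]) blast
 then obtain \<U> where U: "finite \<U>" "\<U> \<subseteq> N ` X" "X \<subseteq> \<Union>\<U>" by (elim exE conjE)
 have "\<Union>\<U> = X" using U by (auto simp: N_def)
 moreover have "\<forall>W\<in>\<U>. openin ?T W" using U(2) No by blast
 ultimately have "\<exists>\<V>. finite \<V> & (\<forall>V\<in>\<V>. openin ?T V) & \<Union>\<V> = X \<and>
  (\<forall>V\<in>\<V>. \<exists>U\<in>\<U>. V \<subseteq> U) & (\<forall>x\<in>X. card {V\<in>\<V>. x \<in> V} <= 1 + 1)"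
  using X(2)[unfolded covering_dim_le_def, THEN spec[of _ \<U>]] U(1) by simp
 then obtain \<V>' where V': "finite \<V>'" "\<forall>V\<in>\<V>'. openin ?T V" "\<Union>\<V>' = X"
  "\<forall>V\<in>\<V>'. \<exists>U\<in>\<U>. V \<subseteq> U" "\<forall>x\<in>X. card {V\<in>\<V>'. x \<in> V} <= 1 + 1" by (elim exE conjE)
 define \<V> where "\<V> = \<V>' - {{}}"
 have V: "finite \<V>" "\<And>V. V \<in> \<V> ==> openin ?T V" "\<Union>\<V> = X" "\<And>V. V \<in> \<V> ==> V ~= {}" using V' by (auto simp: \<V>_def)
 have osc: "dist (f x) (f y) < \<eta>" if "V \<in> \<V>" "x \<in> V" "y \<in> V" for V x y
 proof -
  have "\<exists>U\<in>\<U>. V \<subseteq> U" using that(1) by (intro bspec[OF V'(4)]) (simp add: \<V>_def)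
  then obtain U' where U': "U' \<in> \<U>" "V \<subseteq> U'" by (elim bexE)
  obtain z where "U' = N z" using subsetD[OF U(2) U'(1)] by (elim imageE)
  then have "V \<subseteq> N z" using U'(2) by simp
  then have "dist (f x) (f z) < \<eta> / 2" "dist (f y) (f z) < \<eta> / 2" using that by (auto simp: N_def)
  then show ?thesis using dist_triangle_half_r by (metis dist_commute)
 qed
 have ord: "V = V' \<or> V = W \<or> V' = W" if "V \<in> \<V>" "V' \<in> \<V>" "W \<in> \<V>" "x \<in> V" "x \<in> V'" "x \<in> W" for V V' W x
 proof (rule ccontr)
  assume ne: "\<not> ?thesis"
  have "card {V, V', W} <= card {V\<in>\<V>'. x \<in> V}" using that V'(1) by (intro card_mono) (auto simp: \<V>_def)
  moreover have "x \<in> X" using that V(3) by blast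
  moreover have "card {V, V', W} = 3" using ne by (auto simp: card_insert_if)
  ultimately show False using V'(5) by fastforce
 qed
 have "\<exists>y. y \<in> G & (\<forall>x\<in>V. dist (f x) y < 2 * \<eta>)" if VV: "V \<in> \<V>" for V
 proof -
  obtain p where p: "p \<in> V" using V(4)[OF VV] by blast
  then have "p \<in> X" using V(3) VV by blast
  then obtain y where y: "y \<in> G" "dist (f p) y < \<eta>" using dense \<eta> by blast
  have "dist (f x) y < 2 * \<eta>" if "x \<in> V" for x
   using osc[OF VV that p] y(2) dist_triangle[of "f x" y "f p"] by linarith
  then show ?thesis using y by blast
 qed
 then obtain y where y: "\<And>V. V \<in> \<V> ==> y V \<in> G" "\<And>V x. V \<in> \<V> ==> x \<in> V ==> dist (f x) (y V) < 2 * \<eta>" by metis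
 have ex: "\<exists>\<gamma>. continuous_on {0..1::real} \<gamma> & \<gamma> ` {0..1} \<subseteq> G & \<gamma> 0 = y V & \<gamma> 1 = y W \<and>
  (\<forall>x\<in>V\<inter>W. \<forall>t\<in>{0..1}. dist (f x) (\<gamma> t) < 2 * \<theta>)" if VW: "V \<in> \<V>" "W \<in> \<V>" "V \<inter> W ~= {}" for V W
 proof -
  obtain p where p: "p \<in> V" "p \<in> W" using VW(3) by blast
  then have "p \<in> X" using V(3) VW by blast
  moreover have "dist (f p) (y V) < \<delta>" "dist (f p) (y W) < \<delta>" using y(2)[OF VW(1) p(1)] y(2)[OF VW(2) p(2)] \<eta> by auto
  ultimately have "path_component (G \<inter> ball (f p) \<theta>) (y V) (y W)" using conn y(1) VW by blast
  then obtain \<gamma> where g: "path \<gamma>" "path_image \<gamma> \<subseteq> G \<inter> ball (f p) \<theta>" "pathstart \<gamma> = y V" "pathfinish \<gamma> = y W"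
   unfolding path_component_def by blast
  have "dist (f x) (\<gamma> t) < 2 * \<theta>" if "x \<in> V" "t \<in> {0..1}" for x t
  proof -
   have "dist (f p) (\<gamma> t) < \<theta>" using subsetD[OF g(2), of "\<gamma> t"] that(2) by (simp add: path_image_def)
   then show ?thesis using osc[OF VW(1) that(1) p(1)] \<eta> dist_triangle[of "f x" "\<gamma> t" "f p"] by linarith
  qed
  then show ?thesis using g by (intro exI[of _ \<gamma>]) (auto simp: path_def path_image_def pathstart_def pathfinish_def)
 qed
 define \<gamma> where "\<gamma> V W = (SOME \<gamma>. continuous_on {0..1::real} \<gamma> & \<gamma> ` {0..1} \<subseteq> G & \<gamma> 0 = y V & \<gamma> 1 = y W \<and>
  (\<forall>x\<in>V\<inter>W. \<forall>t\<in>{0..1}. dist (f x) (\<gamma> t) < 2 * \<theta>))" for V W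
 have \<gamma>: "continuous_on {0..1::real} (\<gamma> V W) & \<gamma> V W ` {0..1} \<subseteq> G \<and>
  \<gamma> V W 0 = y V & \<gamma> V W 1 = y W & (\<forall>x\<in>V\<inter>W. \<forall>t\<in>{0..1}. dist (f x) (\<gamma> V W t) < 2 * \<theta>)"
  if "V \<in> \<V>" "W \<in> \<V>" "V \<inter> W ~= {}" for V W
  unfolding \<gamma>_def by (rule someI_ex[OF ex[OF that]])
 obtain F :: "'x set => 'x => real" where F: "\<And>U. U \<in> \<V> ==> continuous_on X (F U)" "\<And>U x. U \<in> \<V> ==> x \<in> X ==> 0 <= F U x"
  "\<And>U x. U \<in> \<V> ==> x \<in> X ==> x \<notin> U ==> F U x = 0" "\<And>x. x \<in> X ==> (\<Sum>U\<in>\<V>. F U x) = 1"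
 proof -
  have "\<exists>F. (\<forall>U\<in>\<V>. continuous_on X (F U)) & (\<forall>U\<in>\<V>. \<forall>x\<in>X. 0 <= F U x & (x \<notin> U --> F U x = (0::real))) \<and>
   (\<forall>x\<in>X. (\<Sum>U\<in>\<V>. F U x) = 1)" by (rule finite_partition_of_unity[OF X(1) V(1-3)])
  then obtain F :: "'x set => 'x => real" where "\<forall>U\<in>\<V>. continuous_on X (F U)" "\<forall>U\<in>\<V>. \<forall>x\<in>X. 0 <= F U x & (x \<notin> U --> F U x = (0::real))"
   "\<forall>x\<in>X. (\<Sum>U\<in>\<V>. F U x) = 1" by (elim exE conjE)
  then show ?thesis by (intro that[of F]) simp_all
 qed
 have F1: "F U x \<in> {0..1}" if "U \<in> \<V>" "x \<in> X" for U x
  using F(2)[OF that] F(4)[OF that(2)] member_le_sum[of U \<V> "%U. F U x"] F(2)[OF _ that(2)] that(1) V(1) by auto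
 \<comment> \<open>Numbering the cover orients every edge, so that only one of the two paths between
   a pair of vertices is used.\<close>
 obtain k :: "'x set => nat" where k: "inj_on k \<V>" using finite_imp_inj_to_nat_seg[OF V(1)] by blast
 define P where "P = {(V, W). V \<in> \<V> & W \<in> \<V> & (V = W \<or> k V < k W & V \<inter> W ~= {})}"
 have finP: "finite P" by (rule finite_subset[of _ "\<V> \<times> \<V>"]) (use V(1) in \<open>auto simp: P_def\<close>)
 \<comment> \<open>Points at which no weight other than those of V and W is active. These finitely
   many sets are closed, as pasting requires, and they cover \<open>X\<close> because the order is
   at most two.\<close>
 define C where "C = (%(V, W). {x \<in> X. \<forall>U\<in>\<V> - {V, W}. F U x = 0})"
 define h where "h = (%(V, W) x. if V = W then y V else \<gamma> V W (F W x))"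
 have clo: "closedin ?T (C i)" if "i \<in> P" for i
 proof -
  obtain V W where i: "i = (V, W)" by (cases i)
  have "(\<forall>U\<in>\<V> - {V, W}. F U x = 0) \<longleftrightarrow> (\<Sum>U\<in>\<V> - {V, W}. F U x) = 0" if "x \<in> X" for x
   using sum_nonneg_eq_0_iff[of "\<V> - {V, W}" "%U. F U x"] V(1) F(2)[OF _ that] by simp
  then have "C i = X \<inter> (%x. \<Sum>U\<in>\<V> - {V, W}. F U x) -` {0}" unfolding C_def i by fastforce
  moreover have "closedin ?T (X \<inter> (%x. \<Sum>U\<in>\<V> - {V, W}. F U x) -` {0})"
   by (rule continuous_closedin_preimage) (auto intro!: continuous_on_sum F(1))
  ultimately show ?thesis by simp
 qed
 have cont: "continuous_map (subtopology ?T (C i)) euclidean (h i)" if i: "i \<in> P" for i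
 proof -
  obtain V W where VW: "i = (V, W)" by (cases i)
  have CX: "C i \<subseteq> X" by (auto simp: C_def VW)
  have "continuous_on (C i) (h i)"
  proof (cases "V = W")
   case False
   then have PW: "V \<in> \<V>" "W \<in> \<V>" "V \<inter> W ~= {}" using i by (auto simp: P_def VW)
   have "continuous_on (C i) (%x. \<gamma> V W (F W x))"
    by (rule continuous_on_compose2[OF conjunct1[OF \<gamma>[OF PW]] continuous_on_subset[OF F(1)[OF PW(2)] CX]])
     (use F1[OF PW(2)] CX in blast)
   then show ?thesis using False by (simp add: h_def VW)
  qed (simp add: h_def VW)
  then show ?thesis using CX by (simp add: subtopology_subtopology inf.absorb2)
 qed
 \<comment> \<open>Where one weight is 1 every local definition yields the vertex value; elsewhere
   exactly two weights are active and determine the edge, so the pieces agree.\<close>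
 have one: "h (V, W) x = y U" if "(V, W) \<in> P" "x \<in> C (V, W)" "U \<in> \<V>" "F U x = 1" for V W U x
 proof -
  have x: "x \<in> X" and PW: "V \<in> \<V>" "W \<in> \<V>" using that by (auto simp: C_def P_def)
  have U: "U = V \<or> U = W"
  proof (rule ccontr)
   assume "\<not> ?thesis"
   then have "U \<in> \<V> - {V, W}" using that(3) by simp
   then have "F U x = 0" using that(2) by (simp add: C_def)
   then show False using that(4) by simp
  qed
  have z: "F U' x = 0" if U': "U' \<in> \<V>" "U' ~= U" for U'
  proof -
   have "sum (%U. F U x) {U, U'} <= sum (%U. F U x) \<V>" using U' \<open>U \<in> \<V>\<close> F(2) x V(1) by (intro sum_mono2) auto
   then show ?thesis using F(4)[OF x] F(2)[OF U'(1) x] \<open>F U x = 1\<close> U'(2) by simp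
  qed
  show ?thesis
  proof (cases "V = W")
   case False
   then have "V \<inter> W ~= {}" using that(1) by (auto simp: P_def)
   note g = \<gamma>[OF PW this]
   show ?thesis using U
   proof
    assume "U = V"
    then have "F W x = 0" using z PW(2) False by blast
    then show ?thesis using g False \<open>U = V\<close> by (simp add: h_def)
   next
    assume "U = W"
    then show ?thesis using g False that(4) by (simp add: h_def)
   qed
  qed (use U in \<open>simp add: h_def\<close>)
 qed
 have agree: "h i x = h j x" if ij: "i \<in> P" "j \<in> P" "x \<in> topspace ?T \<inter> C i \<inter> C j" for i j x
 proof -
  obtain V W where i: "i = (V, W)" by (cases i)
  obtain V' W' where j: "j = (V', W')" by (cases j)
  have x: "x \<in> X" using ij(3) by simp
  let ?s = "{U \<in> \<V>. F U x ~= 0}"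
  have s: "?s \<subseteq> {V, W}" "?s \<subseteq> {V', W'}" using ij(3) by (auto simp: C_def i j)
  have sum: "sum (%U. F U x) ?s = 1"
   using F(4)[OF x] by (subst sum.mono_neutral_left[OF V(1), of ?s]) auto
  then have "?s ~= {}" by (metis sum.empty zero_neq_one)
  then obtain U where U: "U \<in> ?s" by blast
  show ?thesis
  proof (cases "?s = {U}")
   case True
   then have "F U x = 1" using sum by simp
   then show ?thesis using one[of V W x U] one[of V' W' x U] ij U by (simp add: i j)
  next
   case False
   then obtain U' where U': "U' \<in> ?s" "U' ~= U" using U by blast
   have "V ~= W" "V' ~= W'" "{V, W} = {U, U'}" "{V', W'} = {U, U'}" using s U U' by auto
   moreover have "V ~= W ==> k V < k W" "V' ~= W' ==> k V' < k W'" using ij by (auto simp: P_def i j)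
   ultimately have "V = V' & W = W'" by (metis doubleton_eq_iff order.asym)
   then show ?thesis by (simp add: i j)
  qed
 qed
 have cov: "\<exists>i\<in>P. x \<in> C i & h i x \<in> G & dist (f x) (h i x) < 2 * \<theta>" if x: "x \<in> X" for x
 proof -
  obtain V where VV: "V \<in> \<V>" "x \<in> V" using V(3) x by blast
  show ?thesis
  proof (cases "\<exists>W\<in>\<V>. x \<in> W & W ~= V")
   case False
   then have "x \<in> C (V, V)" using F(3) x by (auto simp: C_def)
   moreover have "dist (f x) (y V) < 2 * \<theta>" using y(2)[OF VV] \<eta> by linarith
   ultimately show ?thesis using VV y(1) by (intro bexI[of _ "(V, V)"]) (auto simp: P_def h_def)
  next
   case True
   then obtain W where W: "W \<in> \<V>" "x \<in> W" "W ~= V" by blast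
   have main: "\<exists>i\<in>P. x \<in> C i & h i x \<in> G & dist (f x) (h i x) < 2 * \<theta>"
    if VW: "V \<in> \<V>" "W \<in> \<V>" "x \<in> V" "x \<in> W" "k V < k W" for V W
   proof -
    have ne: "V \<inter> W ~= {}" "V ~= W" using VW by auto
    note g = \<gamma>[OF VW(1,2) ne(1)]
    have Cx: "F U x = 0" if "U \<in> \<V>" "U ~= V" "U ~= W" for U
     using F(3)[OF that(1) x] ord[OF VW(1,2) that(1) VW(3,4)] that ne by blast
    then have "x \<in> C (V, W)" using x by (auto simp: C_def)
    moreover have "h (V, W) x = \<gamma> V W (F W x)" using ne by (simp add: h_def)
    moreover have "\<gamma> V W (F W x) \<in> G" "dist (f x) (\<gamma> V W (F W x)) < 2 * \<theta>"
     using g F1[OF VW(2) x] VW(3,4) by blast+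
    moreover have "(V, W) \<in> P" using VW ne by (simp add: P_def)
    ultimately show ?thesis by (intro bexI[of _ "(V, W)"]) simp_all
   qed
   have "k V ~= k W" using k VV W by (auto simp: inj_on_def)
   then show ?thesis using main[of V W] main[of W V] VV W by (cases "k V < k W") auto
  qed
 qed
 then have cov': "topspace ?T \<subseteq> \<Union>(C ` P)" by auto
 have "\<exists>g. continuous_map ?T euclidean g & (\<forall>x i. i \<in> P --> x \<in> topspace ?T \<inter> C i --> g x = h i x)"
  by (rule pasting_lemma_exists_closed[OF finP cov' clo cont agree]) (assumption+, rule exI, rule conjI, assumption, intro allI impI, simp)
 then obtain g where g: "continuous_map ?T euclidean g" "\<forall>x i. i \<in> P --> x \<in> topspace ?T \<inter> C i --> g x = h i x" by (elim exE conjE)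
 have "g x \<in> G & dist (f x) (g x) < 2 * \<theta>" if x: "x \<in> X" for x
 proof -
  obtain i where "i \<in> P" "x \<in> C i" "h i x \<in> G" "dist (f x) (h i x) < 2 * \<theta>" using cov[OF x] by blast
  then show ?thesis using g(2)[rule_format, of i x] x by simp
 qed
 then show ?thesis using g(1) by (intro exI[of _ g]) auto
qed

section \<open>Continuous functions with values in a C*-algebra\<close>

lemma stable_rank_eq_1_iff: "stable_rank A = 1 \<longleftrightarrow> Lg_dense A 1"
proof
 assume s: "stable_rank A = 1"
 show "Lg_dense A 1"
 proof (rule ccontr)
  assume n: "\<not> Lg_dense A 1"
  have "enat 2 <= enat n" if "n \<in> {n. n >= 1 & Lg_dense A n}" for n
   using that n by (cases "n = 1") auto
  then have "enat 2 <= stable_rank A" unfolding stable_rank_def by (rule INF_greatest)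
  then show False using s by (simp add: one_enat_def)
 qed
next
 assume "Lg_dense A 1"
 then have "stable_rank A <= enat 1" unfolding stable_rank_def by (intro INF_lower) simp
 moreover have "enat 1 <= stable_rank A" unfolding stable_rank_def by (rule INF_greatest) simp
 ultimately show "stable_rank A = 1" by (simp add: one_enat_def)
qed

lemma stable_rank_eq_2:
 assumes n: "\<not> Lg_dense A 1" and d: "Lg_dense A 2"
 shows "stable_rank A = 2"
proof -
 have "enat 2 <= enat n" if "n \<in> {n. n >= 1 & Lg_dense A n}" for n
  using that n by (cases "n = 1") auto
 then have "enat 2 <= stable_rank A" unfolding stable_rank_def by (rule INF_greatest)
 moreover have "stable_rank A <= enat 2" unfolding stable_rank_def by (rule INF_lower) (simp add: d)
 ultimately have "stable_rank A = enat 2" by simp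
 then show ?thesis by (simp add: numeral_eq_enat)
qed

lemma (in csub) GL_adj: assumes "x \<in> GL S" shows "adj x \<in> GL S"
proof -
 have "adj x * adj (minv x) = 1" "adj (minv x) * adj x = 1"
  using arg_cong[OF minv(2)[OF assms], of adj] arg_cong[OF minv(1)[OF assms], of adj] by (simp_all add: adj_mult)
 then show ?thesis using minv(3)[OF assms] assms by (auto simp: GL_def intro: adj_S)
qed

text \<open>With \<open>k = b * minv a\<close> the sum is
  \<open>adj a * (1 + adj k * k) * a\<close>, a product of invertible elements.\<close>

lemma (in csub) GL_adj_mult_sum:
 assumes a: "a \<in> GL S" and b: "b \<in> S"
 shows "adj a * a + adj b * b \<in> GL S"
proof -
 define k where "k = b * minv a"
 have ka: "k * a = b" using minv(2)[OF a] by (simp add: k_def mult.assoc)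
 have kS: "k \<in> S" unfolding k_def by (intro in_S b minv(3)[OF a])
 have "adj k * k + 1 *\<^sub>R 1 \<in> GL S" by (rule pos_plus_GL) (auto intro: in_S kS pos_adj_mult)
 then have "adj a * (adj k * k + 1 *\<^sub>R 1) * a \<in> GL S" by (intro GL_mult GL_adj a)
 moreover have "adj a * (adj k * k + 1 *\<^sub>R 1) * a = adj a * a + adj (k * a) * (k * a)"
  by (simp add: adj_mult distrib_left distrib_right mult.assoc add.commute)
 ultimately show ?thesis by (simp add: ka)
qed

definition evp :: "'x => ('x => 'a) \<times> complex => 'a \<times> complex" where
 "evp x v = (fst v x, snd v)"

context calg
begin

abbreviation "SA \<equiv> unz us (ide A (carrier A))"

lemma SA_eq: "SA = emb A ` (carrier A \<times> UNIV)" by (rule unz_ide[OF subalg_carrier])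

lemma emb_in_SA: "v \<in> carrier A \<times> UNIV ==> emb A v \<in> SA" unfolding SA_eq by (rule imageI)

lemma us_emb: "us (emb A v) = snd v" by (simp add: emb_def)

lemma emb0_add: "a \<in> carrier A ==> b \<in> carrier A ==> emb A (add A a b, 0) = emb A (a, 0) + emb A (b, 0)"
 and emb0_mul: "a \<in> carrier A ==> b \<in> carrier A ==> emb A (mul A a b, 0) = emb A (a, 0) * emb A (b, 0)"
 and emb0_star: "a \<in> carrier A ==> emb A (star A a, 0) = adj (emb A (a, 0))"
 by (simp_all add: emb_def plus_ue_def times_ue_def adj_ue_def incl_add incl_mul incl_star)

lemma nrm_sub_emb:
 assumes "a \<in> carrier A" "b \<in> carrier A"
 shows "norm (emb A (a, 0) - emb A (b, 0)) <= nrm A (sub A a b)"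
  and "nrm A (sub A a b) <= 2 * norm (emb A (a, 0) - emb A (b, 0))"
proof -
 have s: "sub A a b \<in> carrier A" by (rule sub_in[OF assms])
 show "norm (emb A (a, 0) - emb A (b, 0)) <= nrm A (sub A a b)" unfolding emb_diff0[OF assms]
  using norm_ue_le[of "emb A (sub A a b, 0)"] by (simp add: emb_def norm_incl s)
 show "nrm A (sub A a b) <= 2 * norm (emb A (a, 0) - emb A (b, 0))" unfolding emb_diff0[OF assms]
  using uv_le_norm[of "emb A (sub A a b, 0)"] by (simp add: emb_def norm_incl s)
qed

lemma emb_usum_eq:
 assumes "\<And>i. i < n ==> f i \<in> carrier A \<times> UNIV"
 shows "usum A f n \<in> carrier A \<times> UNIV & emb A (usum A f n) = (\<Sum>i<n. emb A (f i))"
 using assms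
proof (induction n)
 case (Suc n)
 then have "usum A f n \<in> carrier A \<times> UNIV" "emb A (usum A f n) = (\<Sum>i<n. emb A (f i))" "f n \<in> carrier A \<times> UNIV" by simp_all
 then show ?case by (simp only: usum.simps ucl emb_uadd sum.lessThan_Suc simp_thms)
qed (simp add: ucl emb_uzero)

end

section \<open>The algebra of continuous functions and its evaluation maps\<close>

locale cx = calg A for A :: "'a cstar_alg" +
 fixes X :: "'x::metric_space set"
 assumes cpt: "compact X" and ne: "X ~= {}"
begin

abbreviation "CA \<equiv> CX X A"

lemma op: "x \<in> X ==> add CA f g x = add A (f x) (g x)" "x \<in> X ==> mul CA f g x = mul A (f x) (g x)"
 "x \<in> X ==> smul CA c f x = smul A c (f x)" "x \<in> X ==> star CA f x = star A (f x)"
 "zero CA x = zero A" "x \<in> X ==> sub CA f g x = sub A (f x) (g x)"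
 by (simp_all add: CX_def sub_def)

lemma op_out: "x \<notin> X ==> add CA f g x = zero A" "x \<notin> X ==> mul CA f g x = zero A"
 "x \<notin> X ==> smul CA c f x = zero A" "x \<notin> X ==> star CA f x = zero A"
 by (simp_all add: CX_def)

text \<open>The metric condition in \<open>CX\<close> becomes topological continuity of the embedded
  function, so the continuity rules of the ambient type apply.\<close>

lemma mem: "f \<in> carrier CA \<longleftrightarrow> (\<forall>x\<in>X. f x \<in> carrier A) & (\<forall>x. x \<notin> X --> f x = zero A) \<and>
  continuous_on X (%x. emb A (f x, 0))"
proof -
 have "(\<forall>x\<in>X. \<forall>e>0. \<exists>d>0. \<forall>y\<in>X. dist y x < d --> nrm A (sub A (f y) (f x)) < e) \<longleftrightarrow>
  continuous_on X (%x. emb A (f x, 0))" (is "?l \<longleftrightarrow> ?r") if c: "\<forall>x\<in>X. f x \<in> carrier A"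
 proof
  assume l: ?l
  show ?r unfolding continuous_on_iff
  proof (intro ballI allI impI)
   fix x and e :: real assume x: "x \<in> X" and e: "e > 0"
   obtain d where d: "d > 0" "\<And>y. y \<in> X ==> dist y x < d ==> nrm A (sub A (f y) (f x)) < e" using l x e by blast
   have "dist (emb A (f y, 0)) (emb A (f x, 0)) < e" if "y \<in> X" "dist y x < d" for y
    using nrm_sub_emb(1)[of "f y" "f x"] d(2)[OF that] c x that by (simp add: dist_norm)
   then show "\<exists>d>0. \<forall>y\<in>X. dist y x < d --> dist (emb A (f y, 0)) (emb A (f x, 0)) < e" using d(1) by blast
  qed
 next
  assume r: ?r
  show ?l
  proof (intro ballI allI impI)
   fix x and e :: real assume x: "x \<in> X" and e: "e > 0"
   have "e / 2 > 0" using e by simp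
   then obtain d where d: "d > 0" "\<And>y. y \<in> X ==> dist y x < d ==> dist (emb A (f y, 0)) (emb A (f x, 0)) < e / 2"
    using r x unfolding continuous_on_iff by blast
   have "nrm A (sub A (f y) (f x)) < e" if "y \<in> X" "dist y x < d" for y
    using nrm_sub_emb(2)[of "f y" "f x"] d(2)[OF that] c x that by (simp add: dist_norm)
   then show "\<exists>d>0. \<forall>y\<in>X. dist y x < d --> nrm A (sub A (f y) (f x)) < e" using d(1) by blast
  qed
 qed
 then show ?thesis by (auto simp: CX_def)
qed

lemma pt: "f \<in> carrier CA ==> x \<in> X ==> f x \<in> carrier A" by (simp add: mem)

lemma CX_closed: "zero CA \<in> carrier CA"
 "f \<in> carrier CA ==> g \<in> carrier CA ==> add CA f g \<in> carrier CA"
 "f \<in> carrier CA ==> g \<in> carrier CA ==> mul CA f g \<in> carrier CA"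
 "f \<in> carrier CA ==> smul CA c f \<in> carrier CA" "f \<in> carrier CA ==> star CA f \<in> carrier CA"
proof -
 show "zero CA \<in> carrier CA" by (simp add: mem op closed)
 assume f: "f \<in> carrier CA"
 then have cf: "continuous_on X (%x. emb A (f x, 0))" by (simp add: mem)
 have "continuous_on X (%x. emb A (smul CA c f x, 0))"
  by (rule continuous_on_eq[OF continuous_on_mult[OF continuous_on_const[of _ "cplx c"] cf]]) (simp add: op emb_smul pt[OF f])
 then show "smul CA c f \<in> carrier CA" by (simp add: mem op op_out closed pt[OF f])
 have "continuous_on X (%x. emb A (star CA f x, 0))"
  by (rule continuous_on_eq[OF continuous_on_adj[OF cf]]) (simp add: op emb0_star pt[OF f])
 then show "star CA f \<in> carrier CA" by (simp add: mem op op_out closed pt[OF f])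
 assume g: "g \<in> carrier CA"
 then have cg: "continuous_on X (%x. emb A (g x, 0))" by (simp add: mem)
 have "continuous_on X (%x. emb A (add CA f g x, 0))"
  by (rule continuous_on_eq[OF continuous_on_add[OF cf cg]]) (simp add: op emb0_add pt[OF f] pt[OF g])
 then show "add CA f g \<in> carrier CA" by (simp add: mem op op_out closed pt[OF f] pt[OF g])
 have "continuous_on X (%x. emb A (mul CA f g x, 0))"
  by (rule continuous_on_eq[OF continuous_on_mult[OF cf cg]]) (simp add: op emb0_mul pt[OF f] pt[OF g])
 then show "mul CA f g \<in> carrier CA" by (simp add: mem op op_out closed pt[OF f] pt[OF g])
qed

lemma CX_eqI:
 assumes "f \<in> carrier CA" "g \<in> carrier CA" "\<And>x. x \<in> X ==> f x = g x"
 shows "f = g"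
proof
 show "f x = g x" for x using assms by (cases "x \<in> X") (simp_all add: mem)
qed

lemma CX_nrm: "nrm CA f = Sup ((%x. nrm A (f x)) ` X)" by (simp add: CX_def)

lemma continuous_image_bound:
 assumes "continuous_on X g" shows "\<exists>K\<ge>0. \<forall>x\<in>X. norm (g x :: 'b::real_normed_vector) <= K"
 using compact_imp_bounded[OF compact_continuous_image[OF assms cpt]] unfolding bounded_pos by (auto intro: less_imp_le)

lemma CX_nrm_ge: assumes f: "f \<in> carrier CA" and x: "x \<in> X" shows "nrm A (f x) <= nrm CA f"
proof -
 obtain K where K: "\<And>x. x \<in> X ==> norm (emb A (f x, 0)) <= K"
  using continuous_image_bound[of "%x. emb A (f x, 0)"] f by (auto simp: mem)
 have "nrm A (f x) <= 2 * K" if "x \<in> X" for x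
  using uv_le_norm[of "emb A (f x, 0)"] K[OF that] by (simp add: emb_def norm_incl pt[OF f that])
 then show ?thesis unfolding CX_nrm using x by (intro cSup_upper bdd_aboveI[of _ "2 * K"]) auto
qed

lemma CX_nrm_le: "(\<And>x. x \<in> X ==> nrm A (f x) <= K) ==> nrm CA f <= K"
 unfolding CX_nrm using ne by (intro cSup_least) auto

lemma CX_nrm_nonneg: assumes f: "f \<in> carrier CA" shows "nrm CA f >= 0"
proof -
 obtain x where "x \<in> X" using ne by blast
 then show ?thesis using CX_nrm_ge[OF f] cs_nrm_nonneg[OF cstar pt[OF f]] by (meson order_trans)
qed

lemma CX_complete:
 assumes f: "\<And>n. f n \<in> carrier CA" and cau: "\<And>e. e > 0 ==> \<exists>N. \<forall>m\<ge>N. \<forall>n\<ge>N. nrm CA (sub CA (f m) (f n)) < e"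
 shows "\<exists>F\<in>carrier CA. (%n. nrm CA (sub CA (f n) F)) \<longlonglongrightarrow> 0"
proof -
 have sub: "sub CA g h \<in> carrier CA" if "g \<in> carrier CA" "h \<in> carrier CA" for g h
  unfolding sub_def by (intro CX_closed that)
 have ptw: "nrm A (sub A (f m x) (f n x)) <= nrm CA (sub CA (f m) (f n))" if "x \<in> X" for m n x
  using CX_nrm_ge[OF sub[OF f f] that, of m n] by (simp add: op that)
 have "\<exists>a. a \<in> carrier A & (%n. nrm A (sub A (f n x) a)) \<longlonglongrightarrow> 0" if x: "x \<in> X" for x
 proof -
  have "\<exists>a\<in>carrier A. (%n. nrm A (sub A (f n x) a)) \<longlonglongrightarrow> 0"
  proof (rule cs_complete[OF cstar])
   fix e :: real assume "e > 0"
   then obtain N where N: "\<forall>m\<ge>N. \<forall>n\<ge>N. nrm CA (sub CA (f m) (f n)) < e" using cau by blast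
   have "nrm A (sub A (f m x) (f n x)) < e" if "m >= N" "n >= N" for m n
    using ptw[OF x, of m n] N that by (meson le_less_trans)
   then show "\<exists>N. \<forall>m\<ge>N. \<forall>n\<ge>N. nrm A (sub A (f m x) (f n x)) < e" by blast
  qed (rule pt[OF f x])
  then show ?thesis by blast
 qed
 then obtain L where L: "\<And>x. x \<in> X ==> L x \<in> carrier A" "\<And>x. x \<in> X ==> (%n. nrm A (sub A (f n x) (L x))) \<longlonglongrightarrow> 0" by metis
 define F where "F x = (if x \<in> X then L x else zero A)" for x
 have unif: "\<exists>N. \<forall>n\<ge>N. \<forall>x\<in>X. nrm A (sub A (f n x) (L x)) <= e" if e: "e > 0" for e
 proof -
  obtain N where N: "\<forall>m\<ge>N. \<forall>n\<ge>N. nrm CA (sub CA (f m) (f n)) < e" using cau[OF e] by blast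
  have "nrm A (sub A (f n x) (L x)) <= e" if n: "n >= N" and x: "x \<in> X" for n x
  proof (rule LIMSEQ_le_const)
   have "(%m. e + nrm A (sub A (f m x) (L x))) \<longlonglongrightarrow> e + 0" by (intro tendsto_intros L(2) x)
   then show "(%m. e + nrm A (sub A (f m x) (L x))) \<longlonglongrightarrow> e" by simp
   have "nrm A (sub A (f n x) (L x)) <= e + nrm A (sub A (f m x) (L x))" if m: "m >= N" for m
   proof -
    note c = pt[OF f x] L(1)[OF x]
    have "norm (incl A (f n x) - incl A (L x)) <= norm (incl A (f n x) - incl A (f m x)) + norm (incl A (f m x) - incl A (L x))"
     by (rule norm_diff_triangle_le[OF order_refl order_refl])
    moreover have "norm (incl A (f n x) - incl A (f m x)) <= e"
     using ptw[OF x, of n m] N n m by (simp add: nrm_sub c) (meson less_imp_le order_trans)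
    ultimately show ?thesis by (simp add: nrm_sub c)
   qed
   then show "\<exists>N. \<forall>m\<ge>N. nrm A (sub A (f n x) (L x)) <= e + nrm A (sub A (f m x) (L x))" by blast
  qed
  then show ?thesis by blast
 qed
 have "uniform_limit X (%n x. emb A (f n x, 0)) (%x. emb A (L x, 0)) sequentially"
 proof (rule uniform_limitI)
  fix e :: real assume "e > 0"
  then obtain N where N: "\<forall>n\<ge>N. \<forall>x\<in>X. nrm A (sub A (f n x) (L x)) <= e / 2" using unif[of "e / 2"] by auto
  have "dist (emb A (f n x, 0)) (emb A (L x, 0)) < e" if "n >= N" "x \<in> X" for n x
   using nrm_sub_emb(1)[OF pt[OF f that(2)] L(1)[OF that(2)], of n] N that \<open>e > 0\<close> by (force simp: dist_norm)
  then show "\<forall>\<^sub>F n in sequentially. \<forall>x\<in>X. dist (emb A (f n x, 0)) (emb A (L x, 0)) < e"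
   unfolding eventually_sequentially by blast
 qed
 then have "continuous_on X (%x. emb A (L x, 0))"
  by (rule uniform_limit_theorem[rotated]) (use f in \<open>auto simp: mem\<close>)
 then have "continuous_on X (%x. emb A (F x, 0))" by (rule continuous_on_eq) (simp add: F_def)
 then have FC: "F \<in> carrier CA" by (simp add: mem) (simp add: F_def L(1))
 have "(%n. nrm CA (sub CA (f n) F)) \<longlonglongrightarrow> 0"
 proof (rule LIMSEQ_I)
  fix e :: real assume e: "e > 0"
  then obtain N where N: "\<forall>n\<ge>N. \<forall>x\<in>X. nrm A (sub A (f n x) (L x)) <= e / 2" using unif[of "e / 2"] by auto
  have "norm (nrm CA (sub CA (f n) F) - 0) < e" if "n >= N" for n
  proof -
   have "nrm CA (sub CA (f n) F) <= e / 2" by (rule CX_nrm_le) (use N that in \<open>simp add: op F_def\<close>)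
   then show ?thesis using CX_nrm_nonneg[OF sub[OF f FC], of n] e by simp
  qed
  then show "\<exists>N. \<forall>n\<ge>N. norm (nrm CA (sub CA (f n) F) - 0) < e" by blast
 qed
 then show ?thesis using FC by blast
qed

lemma cstar_CX: "cstar_algebra CA"
 unfolding cstar_algebra_def
proof (intro conjI ballI allI impI)
 note [simp] = op CX_closed pt
 show "zero CA \<in> carrier CA" by simp
 fix f assume f: "f \<in> carrier CA"
 show "star CA f \<in> carrier CA" "smul CA c f \<in> carrier CA" for c using f by simp_all
 show "add CA f (zero CA) = f" by (rule CX_eqI) (use f in \<open>simp_all add: cs_add_zero[OF cstar]\<close>)
 show "add CA f (smul CA (-1) f) = zero CA" by (rule CX_eqI) (use f in \<open>simp_all add: cs_add_neg[OF cstar]\<close>)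
 show "smul CA (c + d) f = add CA (smul CA c f) (smul CA d f)" for c d
  by (rule CX_eqI) (use f in \<open>simp_all add: cs_add_smul[OF cstar]\<close>)
 show "smul CA (c * d) f = smul CA c (smul CA d f)" for c d
  by (rule CX_eqI) (use f in \<open>simp_all add: cs_mult_smul[OF cstar]\<close>)
 show "smul CA 1 f = f" by (rule CX_eqI) (use f in \<open>simp_all add: cs_smul_one[OF cstar]\<close>)
 show "star CA (star CA f) = f" by (rule CX_eqI) (use f in \<open>simp_all add: cs_star_star[OF cstar]\<close>)
 show "star CA (smul CA c f) = smul CA (cnj c) (star CA f)" for c
  by (rule CX_eqI) (use f in \<open>simp_all add: cs_star_smul[OF cstar]\<close>)
 show n0: "0 <= nrm CA f" by (rule CX_nrm_nonneg[OF f])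
 show "nrm CA f = 0 \<longleftrightarrow> f = zero CA"
 proof
  assume z: "nrm CA f = 0"
  show "f = zero CA"
  proof (rule CX_eqI[OF f])
   fix x assume x: "x \<in> X"
   have "nrm A (f x) = 0" using CX_nrm_ge[OF f x] cs_nrm_nonneg[OF cstar pt[OF f x]] z by linarith
   then show "f x = zero CA x" using cs_nrm_zero[OF cstar pt[OF f x]] by simp
  qed simp
 next
  assume "f = zero CA"
  then have "nrm CA f <= 0" by (intro CX_nrm_le) (simp add: cs_nrm_0[OF cstar])
  then show "nrm CA f = 0" using n0 by simp
 qed
 show "nrm CA (smul CA c f) = cmod c * nrm CA f" for c
 proof (rule antisym)
  show "nrm CA (smul CA c f) <= cmod c * nrm CA f"
   by (rule CX_nrm_le) (use f in \<open>simp add: cs_nrm_smul[OF cstar] CX_nrm_ge mult_left_mono\<close>)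
  show "cmod c * nrm CA f <= nrm CA (smul CA c f)"
  proof (cases "c = 0")
   case True
   then show ?thesis using CX_nrm_nonneg[OF CX_closed(4)[OF f]] by simp
  next
   case False
   have "nrm CA f <= nrm CA (smul CA c f) / cmod c"
   proof (rule CX_nrm_le)
    fix x assume x: "x \<in> X"
    have "cmod c * nrm A (f x) <= nrm CA (smul CA c f)"
     using CX_nrm_ge[OF CX_closed(4)[OF f] x, of c] x by (simp add: cs_nrm_smul[OF cstar pt[OF f x]])
    then show "nrm A (f x) <= nrm CA (smul CA c f) / cmod c" using False by (simp add: field_simps)
   qed
   then show ?thesis using False by (simp add: field_simps)
  qed
 qed
 show "nrm CA (mul CA (star CA f) f) = (nrm CA f)\<^sup>2"
 proof (rule antisym)
  have e: "nrm A (mul CA (star CA f) f x) = (nrm A (f x))\<^sup>2" if "x \<in> X" for x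
   using that f by (simp add: cs_cstar[OF cstar])
  show "nrm CA (mul CA (star CA f) f) <= (nrm CA f)\<^sup>2"
   by (rule CX_nrm_le, subst e) (use f in \<open>auto intro!: power_mono CX_nrm_ge cs_nrm_nonneg[OF cstar]\<close>)
  let ?k = "nrm CA (mul CA (star CA f) f)"
  have k: "?k >= 0" by (rule CX_nrm_nonneg) (use f in simp)
  have "nrm CA f <= sqrt ?k"
  proof (rule CX_nrm_le)
   fix x assume x: "x \<in> X"
   have "(nrm A (f x))\<^sup>2 <= ?k" using CX_nrm_ge[OF CX_closed(3)[OF CX_closed(5)[OF f] f] x] e[OF x] by simp
   then show "nrm A (f x) <= sqrt ?k" by (rule real_le_rsqrt)
  qed
  then have "(nrm CA f)\<^sup>2 <= (sqrt ?k)\<^sup>2" by (rule power_mono[OF _ n0])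
  then show "(nrm CA f)\<^sup>2 <= ?k" using k by simp
 qed
 fix g assume g: "g \<in> carrier CA"
 show "add CA f g \<in> carrier CA" "mul CA f g \<in> carrier CA" using f g by simp_all
 show "add CA f g = add CA g f" by (rule CX_eqI) (use f g in \<open>simp_all add: cs_add_comm[OF cstar, of "f _" "g _"]\<close>)
 show "smul CA c (add CA f g) = add CA (smul CA c f) (smul CA c g)" for c
  by (rule CX_eqI) (use f g in \<open>simp_all add: cs_smul_add[OF cstar]\<close>)
 show "mul CA (smul CA c f) g = smul CA c (mul CA f g)" for c
  by (rule CX_eqI) (use f g in \<open>simp_all add: cs_smul_mul[OF cstar]\<close>)
 show "mul CA f (smul CA c g) = smul CA c (mul CA f g)" for c
  by (rule CX_eqI) (use f g in \<open>simp_all add: cs_mul_smul[OF cstar]\<close>)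
 show "star CA (add CA f g) = add CA (star CA f) (star CA g)"
  by (rule CX_eqI) (use f g in \<open>simp_all add: cs_star_add[OF cstar]\<close>)
 show "star CA (mul CA f g) = mul CA (star CA g) (star CA f)"
  by (rule CX_eqI) (use f g in \<open>simp_all add: cs_star_mul[OF cstar]\<close>)
 show "nrm CA (add CA f g) <= nrm CA f + nrm CA g"
 proof (rule CX_nrm_le)
  fix x assume x: "x \<in> X"
  have "nrm A (add CA f g x) <= nrm A (f x) + nrm A (g x)" using cs_nrm_add[OF cstar pt[OF f x] pt[OF g x]] x by simp
  then show "nrm A (add CA f g x) <= nrm CA f + nrm CA g" using CX_nrm_ge[OF f x] CX_nrm_ge[OF g x] by linarith
 qed
 show "nrm CA (mul CA f g) <= nrm CA f * nrm CA g"
 proof (rule CX_nrm_le)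
  fix x assume x: "x \<in> X"
  have "nrm A (mul CA f g x) <= nrm A (f x) * nrm A (g x)" using cs_nrm_mul[OF cstar pt[OF f x] pt[OF g x]] x by simp
  also have "\<dots> <= nrm CA f * nrm CA g"
   by (intro mult_mono CX_nrm_ge f g x n0 cs_nrm_nonneg[OF cstar pt[OF g x]])
  finally show "nrm A (mul CA f g x) <= nrm CA f * nrm CA g" .
 qed
 fix h assume h: "h \<in> carrier CA"
 show "add CA (add CA f g) h = add CA f (add CA g h)" by (rule CX_eqI) (use f g h in \<open>simp_all add: cs_add_assoc[OF cstar]\<close>)
 show "mul CA (mul CA f g) h = mul CA f (mul CA g h)" by (rule CX_eqI) (use f g h in \<open>simp_all add: cs_mul_assoc[OF cstar]\<close>)
 show "mul CA f (add CA g h) = add CA (mul CA f g) (mul CA f h)" by (rule CX_eqI) (use f g h in \<open>simp_all add: cs_mul_add[OF cstar]\<close>)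
 show "mul CA (add CA f g) h = add CA (mul CA f h) (mul CA g h)" by (rule CX_eqI) (use f g h in \<open>simp_all add: cs_add_mul[OF cstar]\<close>)
next
 fix f :: "nat => 'x => 'a" assume "(\<forall>n. f n \<in> carrier CA) & (\<forall>e>0. \<exists>N. \<forall>m\<ge>N. \<forall>n\<ge>N. nrm CA (sub CA (f m) (f n)) < e)"
 then show "\<exists>F\<in>carrier CA. (%n. nrm CA (sub CA (f n) F)) \<longlonglongrightarrow> 0" by (intro CX_complete) blast+
qed

sublocale C: calg CA by unfold_locales (rule cstar_CX)

lemma evp_op: "x \<in> X ==> evp x (uadd CA v w) = uadd A (evp x v) (evp x w)"
 "x \<in> X ==> evp x (umul CA v w) = umul A (evp x v) (evp x w)"
 "x \<in> X ==> evp x (uneg CA v) = uneg A (evp x v)"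
 "evp x (uone CA) = uone A" "evp x (uzero CA) = uzero A"
 by (simp_all add: evp_def uadd_def umul_def uneg_def uone_def uzero_def op)

lemma evp_usum: "x \<in> X ==> evp x (usum CA f n) = usum A (%i. evp x (f i)) n"
 by (induction n) (simp_all add: evp_op)

lemma evp_in: "v \<in> carrier CA \<times> UNIV ==> x \<in> X ==> evp x v \<in> carrier A \<times> UNIV"
 by (auto simp: evp_def pt)

lemma evp_ext:
 assumes v: "v \<in> carrier CA \<times> UNIV" and w: "w \<in> carrier CA \<times> UNIV" and e: "\<And>x. x \<in> X ==> evp x v = evp x w"
 shows "v = w"
proof (rule prod_eqI)
 show "fst v = fst w" using v w e by (intro CX_eqI) (auto simp: evp_def)
 show "snd v = snd w" using ne e by (auto simp: evp_def)
qed

lemma evp_cont: assumes v: "v \<in> carrier CA \<times> UNIV" shows "continuous_on X (%x. emb A (evp x v))"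
proof -
 have "fst v \<in> carrier CA" using v by auto
 then have "continuous_on X (%x. emb A (fst v x, 0))" by (simp add: mem)
 then show ?thesis unfolding evp_def by (subst emb_split) (intro continuous_intros)
qed

text \<open>The scalar part does not depend on the point, so the distance of functions is a supremum
  in the algebra part plus one constant; the factor 3 is that of
  \<open>udist_bounds\<close>.\<close>

lemma udist_CX:
 assumes v: "v \<in> carrier CA \<times> UNIV" and w: "w \<in> carrier CA \<times> UNIV"
 shows "\<And>x. x \<in> X ==> udist A (evp x v) (evp x w) <= udist CA v w"
  and "(\<And>x. x \<in> X ==> norm (emb A (evp x v) - emb A (evp x w)) <= e) ==> udist CA v w <= 3 * e"
proof -
 define d where "d = uadd CA v (uneg CA w)"
 have "d \<in> carrier CA \<times> UNIV" unfolding d_def by (intro C.ucl v w)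
 then have dc: "fst d \<in> carrier CA" by auto
 have u: "udist A (evp x v) (evp x w) = nrm A (fst d x) + cmod (snd d)" if "x \<in> X" for x
  using that by (simp add: udist_def unorm_def d_def flip: evp_op) (simp add: evp_def)
 have c: "udist CA v w = nrm CA (fst d) + cmod (snd d)" by (simp add: udist_def unorm_def d_def)
 show "udist A (evp x v) (evp x w) <= udist CA v w" if "x \<in> X" for x
  unfolding u[OF that] c using CX_nrm_ge[OF dc that] by simp
 assume le: "\<And>x. x \<in> X ==> norm (emb A (evp x v) - emb A (evp x w)) <= e"
 have "nrm A (fst d x) <= 3 * e - cmod (snd d)" if x: "x \<in> X" for x
  using udist_bounds(2)[OF evp_in[OF v x] evp_in[OF w x]] le[OF x] u[OF x] by linarith
 then have "nrm CA (fst d) <= 3 * e - cmod (snd d)" by (rule CX_nrm_le)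
 then show "udist CA v w <= 3 * e" unfolding c by linarith
qed

lemma lift:
 assumes g: "continuous_on X g" "\<And>x. x \<in> X ==> g x \<in> SA" "\<And>x. x \<in> X ==> us (g x) = l"
 shows "\<exists>v. v \<in> carrier CA \<times> UNIV & snd v = l & (\<forall>x\<in>X. emb A (evp x v) = g x)"
proof -
 have "\<exists>b. b \<in> carrier A & g x = emb A (b, l)" if x: "x \<in> X" for x
 proof -
  obtain p where p: "g x = emb A p" "p \<in> carrier A \<times> UNIV" using g(2)[OF x] unfolding SA_eq by (rule imageE)
  then have "snd p = l" using g(3)[OF x] us_emb by simp
  then show ?thesis using p by (intro exI[of _ "fst p"]) auto
 qed
 then obtain b where b: "\<And>x. x \<in> X ==> b x \<in> carrier A" "\<And>x. x \<in> X ==> g x = emb A (b x, l)" by metis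
 define F where "F x = (if x \<in> X then b x else zero A)" for x
 have "continuous_on X (%x. emb A (F x, 0))"
  by (rule continuous_on_eq[OF continuous_on_diff[OF g(1) continuous_on_const[of _ "cplx l"]]])
   (simp add: F_def b(2) emb_split[of _ l])
 then have "F \<in> carrier CA" by (simp add: mem) (simp add: F_def b(1))
 then show ?thesis using b(2) by (intro exI[of _ "(F, l)"]) (simp add: evp_def F_def)
qed

lemma Lg_CX_I:
 assumes v: "\<And>i. i < n ==> v i \<in> carrier CA \<times> UNIV"
  and W: "\<And>i. i < n ==> continuous_on X (W i)" "\<And>i x. i < n ==> x \<in> X ==> W i x \<in> SA"
   "\<And>i x. i < n ==> x \<in> X ==> us (W i x) = l i"
  and s: "\<And>x. x \<in> X ==> (\<Sum>i<n. W i x * emb A (evp x (v i))) = 1"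
 shows "v \<in> Lg CA n"
proof -
 have "\<exists>u. u \<in> carrier CA \<times> UNIV & (\<forall>x\<in>X. emb A (evp x u) = W i x)" if "i < n" for i
  using lift[OF W(1)[OF that] W(2)[OF that] W(3)[OF that]] by meson
 then obtain w where w: "\<And>i. i < n ==> w i \<in> carrier CA \<times> UNIV" "\<And>i x. i < n ==> x \<in> X ==> emb A (evp x (w i)) = W i x" by metis
 have "usum CA (%i. umul CA (w i) (v i)) n = uone CA"
 proof (rule evp_ext)
  show "usum CA (%i. umul CA (w i) (v i)) n \<in> carrier CA \<times> UNIV"
   by (rule conjunct1[OF C.emb_usum_eq]) (intro C.ucl w v)
  show "uone CA \<in> carrier CA \<times> UNIV" by (rule C.ucl)
  fix x assume x: "x \<in> X"
  let ?u = "usum A (%i. umul A (evp x (w i)) (evp x (v i))) n"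
  have m: "umul A (evp x (w i)) (evp x (v i)) \<in> carrier A \<times> UNIV" if "i < n" for i
   by (intro ucl evp_in w v x that)
  have u: "?u \<in> carrier A \<times> UNIV & emb A ?u = (\<Sum>i<n. emb A (umul A (evp x (w i)) (evp x (v i))))" by (rule emb_usum_eq[OF m])
  have "emb A (umul A (evp x (w i)) (evp x (v i))) = W i x * emb A (evp x (v i))" if "i < n" for i
   using emb_umul[OF evp_in[OF w(1)[OF that] x] evp_in[OF v[OF that] x]] w(2)[OF that x] by simp
  then have "emb A ?u = 1" using u s[OF x] by simp
  then have "emb A ?u = emb A (uone A)" by (simp add: emb_uone)
  then have "?u = uone A" using emb_eq_iff[OF conjunct1[OF u] ucl(5)] by simp
  then show "evp x (usum CA (%i. umul CA (w i) (v i)) n) = evp x (uone CA)" by (simp add: evp_usum evp_op x)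
 qed
 then show ?thesis unfolding Lg_def using v w(1) by blast
qed

lemma perturb:
 assumes v: "v \<in> carrier CA \<times> UNIV" and e: "e > 0"
 shows "\<exists>w. w \<in> carrier CA \<times> UNIV & snd w ~= 0 & (\<forall>x\<in>X. norm (emb A (evp x v) - emb A (evp x w)) <= e)"
proof -
 define l where "l = (if snd v = 0 then of_real e else snd v)"
 have l: "l ~= 0" "cmod (snd v - l) <= e" using e by (auto simp: l_def)
 have "emb A (evp x v) - emb A (evp x (fst v, l)) = cplx (snd v - l)" for x
  unfolding evp_def by (simp add: emb_split[of _ "snd v"] emb_split[of _ l] us.chi_diff) (simp add: cplx_ue ue_simps)
 then show ?thesis using l v by (intro exI[of _ "(fst v, l)"]) auto
qed

text \<open>An element of the forced unitization has constant scalar part, which a pointwise construction does not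
 respect; rescaling pointwise by a scalar close to 1 repairs it.\<close>

lemma normalise:
 assumes v: "v \<in> carrier CA \<times> UNIV" "snd v ~= 0" and e: "e > 0"
 shows "\<exists>\<eta>>0. \<forall>g. continuous_on X g --> (\<forall>x\<in>X. g x \<in> SA) --> (\<forall>x\<in>X. norm (g x - emb A (evp x v)) <= \<eta>) -->
  (\<exists>w. w \<in> carrier CA \<times> UNIV & snd w = snd v & (\<forall>x\<in>X. norm (emb A (evp x v) - emb A (evp x w)) <= e) \<and>
   (\<forall>x\<in>X. \<exists>c. c ~= 0 & emb A (evp x w) = cplx c * g x))"
proof -
 interpret I: cideal us "ide A (carrier A)" by (rule cideal_ide[OF subalg_carrier])
 define l where "l = snd v"
 have l: "cmod l > 0" using v by (simp add: l_def)
 obtain M where M: "M >= 0" "\<And>x. x \<in> X ==> norm (emb A (evp x v)) <= M"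
  using continuous_image_bound[OF evp_cont[OF v(1)]] by blast
 \<comment> \<open>The factor \<open>l / us (g x)\<close> differs from 1 by at most
   \<open>2 * \<eta> / cmod l\<close> and multiplies an element of norm at most
   \<open>M + 1\<close>; adding the distance \<open>\<eta>\<close> of \<open>g\<close> itself gives
   \<open>\<eta> * Q\<close>.\<close>
 define Q where "Q = 1 + 2 * (M + 1) / cmod l"
 have Q: "Q > 0" using M l by (simp add: Q_def add_pos_nonneg)
 define \<eta> where "\<eta> = min 1 (min (cmod l / 2) (e / Q))"
 have "\<eta> <= e / Q" by (simp add: \<eta>_def)
 then have "\<eta> * Q <= e" using Q by (simp add: pos_le_divide_eq)
 moreover have "\<eta> > 0" using l e Q by (simp add: \<eta>_def)
 moreover have "\<eta> <= 1" "\<eta> <= cmod l / 2" unfolding \<eta>_def by (meson min.cobounded1 min.cobounded2 order_trans)+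
 ultimately have \<eta>: "\<eta> > 0" "\<eta> <= 1" "\<eta> <= cmod l / 2" "\<eta> * Q <= e" by blast+
 show ?thesis
 proof (intro exI[of _ \<eta>] conjI allI impI)
  fix g assume g: "continuous_on X g" "\<forall>x\<in>X. g x \<in> SA" "\<forall>x\<in>X. norm (g x - emb A (evp x v)) <= \<eta>"
  have al: "cmod (us (g x) - l) <= \<eta>" if x: "x \<in> X" for x
  proof -
   have "us (g x - emb A (evp x v)) = us (g x) - l" by (simp add: us.chi_diff us_emb evp_def l_def)
   then show ?thesis using us_le_norm[of "g x - emb A (evp x v)"] bspec[OF g(3) x] by simp
  qed
  have a: "cmod (us (g x)) >= cmod l / 2" if x: "x \<in> X" for x
   using al[OF x] \<eta>(3) norm_triangle_ineq3[of "us (g x)" l] by linarith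
  have a0: "us (g x) ~= 0" if "x \<in> X" for x using a[OF that] l by auto
  define k where "k x = cplx (l / us (g x)) * g x" for x
  have "continuous_on X k" unfolding k_def by (intro continuous_intros us.continuous_on_chi g(1)) (use a0 in blast)
  moreover have "k x \<in> SA" "us (k x) = l" if "x \<in> X" for x
   unfolding k_def using g(2) that a0[OF that] by (auto intro!: I.U.mult_S I.U.cplx_S simp: us.chi_mult us.chi_cplx)
  ultimately obtain w where w: "w \<in> carrier CA \<times> UNIV" "snd w = l" "\<forall>x\<in>X. emb A (evp x w) = k x"
   using lift[of k l] by metis
  have near: "norm (emb A (evp x v) - k x) <= e" if x: "x \<in> X" for x
  proof -
   let ?E = "emb A (evp x v)"
   have ng: "norm (g x) <= M + 1" using norm_triangle_sub[of "g x" ?E] g(3) x M(2)[OF x] \<eta>(2) by (smt (verit))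
   have "l / us (g x) - 1 = (l - us (g x)) / us (g x)" using a0[OF x] by (simp add: field_simps)
   then have "cmod (l / us (g x) - 1) = cmod (us (g x) - l) / cmod (us (g x))" by (simp add: norm_divide norm_minus_commute)
   also have "\<dots> <= \<eta> / (cmod l / 2)" using al[OF x] a[OF x] l \<eta>(1) by (intro frac_le) auto
   finally have q: "cmod (l / us (g x) - 1) <= 2 * \<eta> / cmod l" by (simp add: mult.commute)
   have "k x - ?E = cplx (l / us (g x) - 1) * g x + (g x - ?E)"
   proof -
    have c1: "cplx (l / us (g x)) = cplx (l / us (g x) - 1) + 1" using cplx_add[of "l / us (g x) - 1" 1] by (simp add: cplx_def)
    have "k x = cplx (l / us (g x) - 1) * g x + g x" unfolding k_def by (subst c1) (simp add: distrib_right)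
    then show ?thesis by simp
   qed
   then have "norm (k x - ?E) <= cmod (l / us (g x) - 1) * norm (g x) + norm (g x - ?E)"
    using norm_triangle_ineq[of "cplx (l / us (g x) - 1) * g x" "g x - ?E"] by (simp only: norm_cplx_mult)
   also have "\<dots> <= 2 * \<eta> / cmod l * (M + 1) + \<eta>"
    using q ng g(3) x M(1) \<eta>(1) l by (intro add_mono mult_mono) auto
   also have "\<dots> = \<eta> * Q" using l by (simp add: Q_def field_simps)
   finally show ?thesis using \<eta>(4) by (simp add: norm_minus_commute)
  qed
  show "\<exists>w. w \<in> carrier CA \<times> UNIV & snd w = snd v & (\<forall>x\<in>X. norm (emb A (evp x v) - emb A (evp x w)) <= e) \<and>
   (\<forall>x\<in>X. \<exists>c. c ~= 0 & emb A (evp x w) = cplx c * g x)"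
  proof (intro exI[of _ w] conjI ballI)
   fix x assume x: "x \<in> X"
   show "norm (emb A (evp x v) - emb A (evp x w)) <= e" using near[OF x] w(3) x by simp
   show "\<exists>c. c ~= 0 & emb A (evp x w) = cplx c * g x"
    using w(3) x a0[OF x] l by (intro exI[of _ "l / us (g x)"]) (auto simp: k_def)
  qed (use w in \<open>simp_all add: l_def\<close>)
 qed (rule \<eta>(1))
qed

text \<open>After scaling, all values of the function satisfy the hypotheses of the local connection
  result with one common scalar part, so a single \<open>\<delta>\<close> serves at every point and
  the selection theorem produces an invertible function nearby. Its scalar part is then made
  constant by \<open>normalise\<close>.\<close>

theorem Lg_dense_1:
 assumes dim: "covering_dim_le X 1" and d: "GLdense SA"
  and conn: "\<And>f u. f \<in> SA ==> adj f = f ==> u \<in> UG (unz us (ann (ide A (carrier A)) f)) ==>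
   path_component (UG (unz us (ann (ide A (carrier A)) f))) 1 u"
 shows "Lg_dense CA 1"
 unfolding Lg_dense_def
proof (intro allI impI)
 interpret I: cideal us "ide A (carrier A)" by (rule cideal_ide[OF subalg_carrier])
 fix v :: "nat => ('x => 'a) \<times> complex" and e :: real
 assume "\<forall>i<1. v i \<in> carrier CA \<times> UNIV" and e: "e > 0"
 then have v0: "v 0 \<in> carrier CA \<times> UNIV" by simp
 \<comment> \<open>Two errors of e/12 in the C*-norm make e/6, which is at most e/2 in the
   l1-distance.\<close>
 have e12: "e / 12 > 0" using e by simp
 obtain v' where v': "v' \<in> carrier CA \<times> UNIV" "snd v' ~= 0" "\<forall>x\<in>X. norm (emb A (evp x (v 0)) - emb A (evp x v')) <= e / 12"
  using perturb[OF v0 e12] by (elim exE conjE)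
 define l where "l = snd v'"
 have l: "cmod l > 0" using v'(2) by (simp add: l_def)
 obtain M where M: "M >= 0" "\<And>x. x \<in> X ==> norm (emb A (evp x v')) <= M"
  using continuous_image_bound[OF evp_cont[OF v'(1)]] by blast
 obtain \<eta> where \<eta>: "\<eta> > 0" and norma: "\<forall>g. continuous_on X g --> (\<forall>x\<in>X. g x \<in> SA) --> (\<forall>x\<in>X. norm (g x - emb A (evp x v')) <= \<eta>) -->
  (\<exists>w. w \<in> carrier CA \<times> UNIV & snd w = snd v' & (\<forall>x\<in>X. norm (emb A (evp x v') - emb A (evp x w)) <= e / 12) \<and>
   (\<forall>x\<in>X. \<exists>c. c ~= 0 & emb A (evp x w) = cplx c * g x))"
  using normalise[OF v'(1,2) e12] by (elim exE conjE)
 \<comment> \<open>Multiplication by \<open>s = r / l\<close> turns the scalar part \<open>l\<close>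
   into the positive number \<open>r\<close> and brings the norm below 1/2.\<close>
 define r where "r = cmod l / (2 * M + 1)"
 have "r / cmod l = 1 / (2 * M + 1)" using l by (simp add: r_def)
 then have r: "r / cmod l * M <= 1 / 2" using M(1) by (simp add: divide_le_eq)
 have r0: "r > 0" using l M(1) by (simp add: r_def add_nonneg_pos)
 note r = r0 r
 define s where "s = of_real r / l"
 have s0: "s ~= 0" using r0 l by (simp add: s_def)
 have cs: "cmod s = r / cmod l" using r0 by (simp add: s_def norm_divide)
 define f where "f x = cplx s * emb A (evp x v')" for x
 have fc: "continuous_on X f" unfolding f_def by (intro continuous_intros evp_cont v')
 have fS: "f x \<in> SA" "norm (f x) <= 1 / 2" "us (f x) = of_real r" if x: "x \<in> X" for x
 proof -
  show "f x \<in> SA" unfolding f_def by (intro I.U.mult_S I.U.cplx_S emb_in_SA evp_in v' x)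
  have "norm (f x) = r / cmod l * norm (emb A (evp x v'))" by (simp add: f_def cs)
  also have "\<dots> <= r / cmod l * M" using M(2)[OF x] r(1) l by (intro mult_left_mono) auto
  finally show "norm (f x) <= 1 / 2" using r(2) by linarith
  show "us (f x) = of_real r" using l by (simp add: f_def us.chi_mult us.chi_cplx us_emb evp_def s_def l_def[symmetric])
 qed
 define \<theta> where "\<theta> = \<eta> * cmod s / 2"
 have th: "\<theta> > 0" using \<eta> s0 by (simp add: \<theta>_def)
 obtain \<delta> where \<delta>: "\<delta> > 0" "\<forall>x\<in>SA. norm x <= 1/2 --> us x = of_real r -->
  (\<forall>y0\<in>GL SA. \<forall>y1\<in>GL SA. norm (y0 - x) < \<delta> --> norm (y1 - x) < \<delta> --> path_component (GL SA \<inter> ball x \<theta>) y0 y1)"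
  using I.local_connection[OF conn r(1) th] by blast
 have "\<exists>g. continuous_on X g & g ` X \<subseteq> GL SA & (\<forall>x\<in>X. dist (f x) (g x) < 2 * \<theta>)"
 proof (rule one_dimensional_selection[OF cpt dim fc _ \<delta>(1) th])
  show "\<exists>y\<in>GL SA. dist (f x) y < e" if "x \<in> X" "e > 0" for x e
   using d[unfolded GLdense_def, rule_format, OF fS(1)[OF that(1)] that(2)] by (simp add: dist_norm)
  show "path_component (GL SA \<inter> ball (f x) \<theta>) y z"
   if "x \<in> X" "y \<in> GL SA" "z \<in> GL SA" "dist (f x) y < \<delta>" "dist (f x) z < \<delta>" for x y z
   using \<delta>(2)[rule_format, OF fS[OF that(1)] that(2,3)] that(4,5) by (simp add: dist_norm norm_minus_commute)
 qed
 then obtain g where g: "continuous_on X g" "g ` X \<subseteq> GL SA" "\<And>x. x \<in> X ==> dist (f x) (g x) < 2 * \<theta>" by blast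
 define h where "h x = cplx (1 / s) * g x" for x
 have hG: "h x \<in> GL SA" if "x \<in> X" for x
  unfolding h_def using g(2) that s0 by (intro I.U.GL_mult I.U.GL_cplx) auto
 have "norm (h x - emb A (evp x v')) <= \<eta>" if x: "x \<in> X" for x
 proof -
  have "emb A (evp x v') = cplx (1 / s) * f x" using s0 by (simp add: f_def mult.assoc[symmetric] cplx_mult[symmetric])
  then have "norm (h x - emb A (evp x v')) = norm (g x - f x) / cmod s"
   by (simp add: h_def norm_divide flip: right_diff_distrib)
  also have "\<dots> <= \<eta>" using g(3)[OF x] s0 by (simp add: \<theta>_def dist_norm norm_minus_commute field_simps)
  finally show ?thesis .
 qed
 then have hn: "\<forall>x\<in>X. norm (h x - emb A (evp x v')) <= \<eta>" by simp
 have hc: "continuous_on X h" unfolding h_def by (intro continuous_intros g(1))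
 have hS: "\<forall>x\<in>X. h x \<in> SA" using subsetD[OF GL_subset hG] by simp
 obtain w where w: "w \<in> carrier CA \<times> UNIV" "snd w = snd v'" "\<forall>x\<in>X. norm (emb A (evp x v') - emb A (evp x w)) <= e / 12"
   "\<forall>x\<in>X. \<exists>c. c ~= 0 & emb A (evp x w) = cplx c * h x"
  using norma[THEN spec, THEN mp, OF hc, THEN mp, OF hS, THEN mp, OF hn] by (elim exE conjE)
 have wG: "emb A (evp x w) \<in> GL SA" if x: "x \<in> X" for x
 proof -
  obtain c where "c ~= 0" "emb A (evp x w) = cplx c * h x" using w(4) x by blast
  then show ?thesis using I.U.GL_mult[OF I.U.GL_cplx hG[OF x]] by simp
 qed
 have "(%_. w) \<in> Lg CA 1"
 proof (rule Lg_CX_I[where W = "%_ x. minv (emb A (evp x w))" and l = "%_. 1 / l"])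
  show "continuous_on X (%x. minv (emb A (evp x w)))" by (rule continuous_on_minv[OF evp_cont[OF w(1)] wG])
  fix x assume x: "x \<in> X"
  show "minv (emb A (evp x w)) \<in> SA" by (rule minv(3)[OF wG[OF x]])
  have "us (minv (emb A (evp x w))) * us (emb A (evp x w)) = 1"
   using minv(2)[OF wG[OF x]] us.chi_mult us.chi_1 by metis
  then show "us (minv (emb A (evp x w))) = 1 / l" using w(2) l by (simp add: us_emb evp_def l_def field_simps)
  show "(\<Sum>i<(1::nat). minv (emb A (evp x w)) * emb A (evp x w)) = 1" using minv(2)[OF wG[OF x]] by simp
 qed (rule w(1))
 moreover have "udist CA (v 0) w <= 3 * (e / 6)"
 proof (rule udist_CX(2)[OF v0 w(1)])
  fix x assume x: "x \<in> X"
  show "norm (emb A (evp x (v 0)) - emb A (evp x w)) <= e / 6"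
   using norm_diff_triangle_le[OF v'(3)[rule_format, OF x] w(3)[rule_format, OF x]] by simp
 qed
 ultimately show "\<exists>w\<in>Lg CA 1. \<forall>i<1. udist CA (v i) (w i) < e" using e by (intro bexI[of _ "%_. w"]) auto
qed

end

section \<open>Pairs with an invertible entry and stable rank at most two\<close>

context cx
begin

text \<open>A pair with one invertible entry is left invertible: if \<open>D\<close> is the sum of
  the two absolute squares, a left inverse is \<open>minv D\<close> times the adjoints. The set of
  such pairs satisfies the hypotheses of the selection theorem.\<close>

theorem Lg_dense_2:
 assumes dim: "covering_dim_le X 1" and d: "GLdense SA"
 shows "Lg_dense CA 2"
 unfolding Lg_dense_def
proof (intro allI impI)
 interpret I: cideal us "ide A (carrier A)" by (rule cideal_ide[OF subalg_carrier])
 fix v :: "nat => ('x => 'a) \<times> complex" and e :: real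
 assume v: "\<forall>i<2. v i \<in> carrier CA \<times> UNIV" and e: "e > 0"
 have v01: "v 0 \<in> carrier CA \<times> UNIV" "v 1 \<in> carrier CA \<times> UNIV" using v by simp_all
 have e12: "e / 12 > 0" using e by simp
 obtain p where p: "p \<in> carrier CA \<times> UNIV" "snd p ~= 0" "\<forall>x\<in>X. norm (emb A (evp x (v 0)) - emb A (evp x p)) <= e / 12"
  using perturb[OF v01(1) e12] by (elim exE conjE)
 obtain q where q: "q \<in> carrier CA \<times> UNIV" "snd q ~= 0" "\<forall>x\<in>X. norm (emb A (evp x (v 1)) - emb A (evp x q)) <= e / 12"
  using perturb[OF v01(2) e12] by (elim exE conjE)
 let ?N = "%v' \<eta>. \<forall>g. continuous_on X g --> (\<forall>x\<in>X. g x \<in> SA) --> (\<forall>x\<in>X. norm (g x - emb A (evp x v')) <= \<eta>) -->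
  (\<exists>w. w \<in> carrier CA \<times> UNIV & snd w = snd v' & (\<forall>x\<in>X. norm (emb A (evp x v') - emb A (evp x w)) <= e / 12) \<and>
   (\<forall>x\<in>X. \<exists>c. c ~= 0 & emb A (evp x w) = cplx c * g x))"
 obtain \<eta>0 where \<eta>0: "\<eta>0 > 0" "?N p \<eta>0" using normalise[OF p(1,2) e12] by (elim exE conjE)
 obtain \<eta>1 where \<eta>1: "\<eta>1 > 0" "?N q \<eta>1" using normalise[OF q(1,2) e12] by (elim exE conjE)
 define \<eta> where "\<eta> = min \<eta>0 \<eta>1"
 have \<eta>: "\<eta> > 0" "\<eta> <= \<eta>0" "\<eta> <= \<eta>1" using \<eta>0 \<eta>1 by (auto simp: \<eta>_def)
 define a b where "a x = emb A (evp x p)" and "b x = emb A (evp x q)" for x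
 have ab: "a x \<in> SA" "b x \<in> SA" if "x \<in> X" for x unfolding a_def b_def by (intro emb_in_SA evp_in p q that)+
 \<comment> \<open>Density of invertible elements places a pair \<open>(y', z')\<close> with both
   entries invertible near every value; it serves as a hub. Any nearby pair of \<open>G\<close>
   keeps its invertible entry while the other one moves to the hub, and then the roles are
   exchanged.\<close>
 define G where "G = {(y, z). y \<in> SA & z \<in> SA & (y \<in> GL SA \<or> z \<in> GL SA)}"
 have conv: "(1 - s) *\<^sub>R y + s *\<^sub>R z \<in> SA" if "y \<in> SA" "z \<in> SA" for y z and s :: real
  using that by (intro I.U.add_S I.U.scaleR_S)
 have GS: "y \<in> SA" if "y \<in> GL SA" for y using that GL_subset by (rule subsetD[rotated])
 have "\<exists>g. continuous_on X g & g ` X \<subseteq> G & (\<forall>x\<in>X. dist (a x, b x) (g x) < 2 * (\<eta> / 2))"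
 proof (rule one_dimensional_selection[OF cpt dim, of "%x. (a x, b x)" G "\<eta> / 4" "\<eta> / 2"])
  show "continuous_on X (%x. (a x, b x))" unfolding a_def b_def by (intro continuous_intros evp_cont p q)
  show "\<eta> / 4 > 0" "\<eta> / 2 > 0" using \<eta> by simp_all
  fix x assume x: "x \<in> X"
  show "\<exists>y\<in>G. dist (a x, b x) y < r" if r: "r > 0" for r
  proof -
   obtain y where y: "y \<in> GL SA" "norm (a x - y) < r" using d[unfolded GLdense_def, rule_format, OF ab(1)[OF x] r] by blast
   then show ?thesis using ab(2)[OF x] GS by (intro bexI[of _ "(y, b x)"]) (auto simp: G_def dist_Pair_Pair dist_norm)
  qed
  have \<eta>4: "\<eta> / 4 > 0" using \<eta> by simp
  let ?T = "G \<inter> ball (a x, b x) (\<eta> / 2)"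
  have inT: "(y, z) \<in> ?T" if "(y, z) \<in> G" "y \<in> ball (a x) (\<eta> / 4)" "z \<in> ball (b x) (\<eta> / 4)" for y z
  proof -
   have "dist (a x, b x) (y, z) <= dist (a x) y + dist (b x) z"
    unfolding dist_Pair_Pair by (rule sqrt_sum_squares_le_sum) simp_all
   then show ?thesis using that by simp
  qed
  have cb: "(1 - s) *\<^sub>R y + s *\<^sub>R z \<in> ball m (\<eta> / 4)" if "y \<in> ball m (\<eta> / 4)" "z \<in> ball m (\<eta> / 4)" "s \<in> {0..1}"
   for y z m :: "'a prd ue" and s
   using convexD[OF convex_ball that(1,2), of "1 - s" s] that(3) by simp
  obtain y' where y': "y' \<in> GL SA" "y' \<in> ball (a x) (\<eta> / 4)"
   using d[unfolded GLdense_def, rule_format, OF ab(1)[OF x] \<eta>4] by (auto simp: dist_norm)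
  obtain z' where z': "z' \<in> GL SA" "z' \<in> ball (b x) (\<eta> / 4)"
   using d[unfolded GLdense_def, rule_format, OF ab(2)[OF x] \<eta>4] by (auto simp: dist_norm)
  have segz: "path_component ?T (y, z) (y, w)" if "y \<in> GL SA" "z \<in> SA" "w \<in> SA" "y \<in> ball (a x) (\<eta> / 4)"
   "z \<in> ball (b x) (\<eta> / 4)" "w \<in> ball (b x) (\<eta> / 4)" for y z w
  proof (rule path_component_linepath_image)
   fix s :: real assume s: "s \<in> {0..1}"
   have "(1 - s) *\<^sub>R (y, z) + s *\<^sub>R (y, w) = (y, (1 - s) *\<^sub>R z + s *\<^sub>R w)" by (simp flip: scaleR_left_distrib)
   then show "(1 - s) *\<^sub>R (y, z) + s *\<^sub>R (y, w) \<in> ?T"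
    using inT[OF _ that(4) cb[OF that(5,6) s]] GS[OF that(1)] conv[OF that(2,3)] that(1) by (simp add: G_def)
  qed
  have segy: "path_component ?T (y, z) (w, z)" if "z \<in> GL SA" "y \<in> SA" "w \<in> SA" "z \<in> ball (b x) (\<eta> / 4)"
   "y \<in> ball (a x) (\<eta> / 4)" "w \<in> ball (a x) (\<eta> / 4)" for y z w
  proof (rule path_component_linepath_image)
   fix s :: real assume s: "s \<in> {0..1}"
   have "(1 - s) *\<^sub>R (y, z) + s *\<^sub>R (w, z) = ((1 - s) *\<^sub>R y + s *\<^sub>R w, z)" by (simp flip: scaleR_left_distrib)
   then show "(1 - s) *\<^sub>R (y, z) + s *\<^sub>R (w, z) \<in> ?T"
    using inT[OF _ cb[OF that(5,6) s] that(4)] GS[OF that(1)] conv[OF that(2,3)] that(1) by (simp add: G_def)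
  qed
  have hub: "path_component ?T g (y', z')" if g: "g \<in> G" "dist (a x, b x) g < \<eta> / 4" for g
  proof -
   obtain y z where yz: "g = (y, z)" by (cases g)
   have S: "y \<in> SA" "z \<in> SA" and or: "y \<in> GL SA \<or> z \<in> GL SA" using g(1) by (auto simp: G_def yz)
   have B: "y \<in> ball (a x) (\<eta> / 4)" "z \<in> ball (b x) (\<eta> / 4)"
    using dist_fst_le[of "(a x, b x)" g] dist_snd_le[of "(a x, b x)" g] g(2) by (simp_all add: yz)
   show ?thesis unfolding yz using or
   proof
    assume y: "y \<in> GL SA"
    show "path_component ?T (y, z) (y', z')"
     by (rule path_component_trans[OF segz[OF y S(2) GS[OF z'(1)] B z'(2)] segy[OF z'(1) S(1) GS[OF y'(1)] z'(2) B(1) y'(2)]])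
   next
    assume z: "z \<in> GL SA"
    show "path_component ?T (y, z) (y', z')"
     by (rule path_component_trans[OF segy[OF z S(1) GS[OF y'(1)] B(2,1) y'(2)] segz[OF y'(1) S(2) GS[OF z'(1)] y'(2) B(2) z'(2)]])
   qed
  qed
  show "path_component ?T g h" if "g \<in> G" "h \<in> G" "dist (a x, b x) g < \<eta> / 4" "dist (a x, b x) h < \<eta> / 4" for g h
   by (rule path_component_trans[OF hub[OF that(1,3)] path_component_sym[OF hub[OF that(2,4)]]])
 qed
 then obtain g where g: "continuous_on X g" "g ` X \<subseteq> G" "\<forall>x\<in>X. dist (a x, b x) (g x) < 2 * (\<eta> / 2)" by (elim exE conjE)
 have gx: "fst (g x) \<in> SA" "snd (g x) \<in> SA" "fst (g x) \<in> GL SA \<or> snd (g x) \<in> GL SA"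
  "norm (fst (g x) - a x) <= \<eta>0" "norm (snd (g x) - b x) <= \<eta>1" if x: "x \<in> X" for x
 proof -
  have "g x \<in> G" using subsetD[OF g(2) imageI[OF x]] .
  then show "fst (g x) \<in> SA" "snd (g x) \<in> SA" "fst (g x) \<in> GL SA \<or> snd (g x) \<in> GL SA" by (auto simp: G_def)
  show "norm (fst (g x) - a x) <= \<eta>0" "norm (snd (g x) - b x) <= \<eta>1"
   using dist_fst_le[of "(a x, b x)" "g x"] dist_snd_le[of "(a x, b x)" "g x"] bspec[OF g(3) x] \<eta>
   by (simp_all add: dist_norm norm_minus_commute)
 qed
 have "\<exists>w. w \<in> carrier CA \<times> UNIV & snd w = snd p & (\<forall>x\<in>X. norm (emb A (evp x p) - emb A (evp x w)) <= e / 12) \<and>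
   (\<forall>x\<in>X. \<exists>c. c ~= 0 & emb A (evp x w) = cplx c * fst (g x))"
  by (rule \<eta>0(2)[rule_format, of "%x. fst (g x)"]) (use gx in \<open>auto intro!: continuous_intros g(1) simp: a_def\<close>)
 then obtain w0 where w0: "w0 \<in> carrier CA \<times> UNIV" "snd w0 = snd p" "\<forall>x\<in>X. norm (emb A (evp x p) - emb A (evp x w0)) <= e / 12"
   "\<forall>x\<in>X. \<exists>c. c ~= 0 & emb A (evp x w0) = cplx c * fst (g x)" by (elim exE conjE)
 have "\<exists>w. w \<in> carrier CA \<times> UNIV & snd w = snd q & (\<forall>x\<in>X. norm (emb A (evp x q) - emb A (evp x w)) <= e / 12) \<and>
   (\<forall>x\<in>X. \<exists>c. c ~= 0 & emb A (evp x w) = cplx c * snd (g x))"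
  by (rule \<eta>1(2)[rule_format, of "%x. snd (g x)"]) (use gx in \<open>auto intro!: continuous_intros g(1) simp: b_def\<close>)
 then obtain w1 where w1: "w1 \<in> carrier CA \<times> UNIV" "snd w1 = snd q" "\<forall>x\<in>X. norm (emb A (evp x q) - emb A (evp x w1)) <= e / 12"
   "\<forall>x\<in>X. \<exists>c. c ~= 0 & emb A (evp x w1) = cplx c * snd (g x)" by (elim exE conjE)
 define \<alpha> \<beta> where "\<alpha> x = emb A (evp x w0)" and "\<beta> x = emb A (evp x w1)" for x
 have S: "\<alpha> x \<in> SA" "\<beta> x \<in> SA" if "x \<in> X" for x unfolding \<alpha>_def \<beta>_def by (intro emb_in_SA evp_in w0 w1 that)+
 have c: "continuous_on X \<alpha>" "continuous_on X \<beta>" unfolding \<alpha>_def \<beta>_def by (intro evp_cont w0 w1)+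
 have us: "us (\<alpha> x) = snd p" "us (\<beta> x) = snd q" for x by (simp_all add: \<alpha>_def \<beta>_def us_emb evp_def w0(2) w1(2))
 define D where "D x = adj (\<alpha> x) * \<alpha> x + adj (\<beta> x) * \<beta> x" for x
 have DG: "D x \<in> GL SA" if x: "x \<in> X" for x
  using gx(3)[OF x]
 proof
  assume y: "fst (g x) \<in> GL SA"
  obtain c where "c ~= 0" "\<alpha> x = cplx c * fst (g x)" using bspec[OF w0(4) x] unfolding \<alpha>_def by (elim exE conjE)
  then have "\<alpha> x \<in> GL SA" using I.U.GL_mult[OF I.U.GL_cplx y] by simp
  then show ?thesis unfolding D_def by (rule I.U.GL_adj_mult_sum[OF _ S(2)[OF x]])
 next
  assume z: "snd (g x) \<in> GL SA"
  obtain c where "c ~= 0" "\<beta> x = cplx c * snd (g x)" using bspec[OF w1(4) x] unfolding \<beta>_def by (elim exE conjE)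
  then have "\<beta> x \<in> GL SA" using I.U.GL_mult[OF I.U.GL_cplx z] by simp
  then show ?thesis unfolding D_def add.commute[of "adj (\<alpha> x) * \<alpha> x"] by (rule I.U.GL_adj_mult_sum[OF _ S(1)[OF x]])
 qed
 have Dc: "continuous_on X (%x. minv (D x))"
  by (rule continuous_on_minv[where S = SA]) (use DG in \<open>auto simp: D_def intro!: continuous_intros continuous_on_adj c\<close>)
 define m where "m = 1 / (cnj (snd p) * snd p + cnj (snd q) * snd q)"
 \<comment> \<open>The scalar part of the inverse is the same at every point, as an element of the
   forced unitization must have.\<close>
 have usD: "us (minv (D x)) = m" if x: "x \<in> X" for x
 proof -
  have "us (minv (D x)) * us (D x) = 1" using minv(2)[OF DG[OF x]] us.chi_mult us.chi_1 by metis
  moreover have "us (D x) = cnj (snd p) * snd p + cnj (snd q) * snd q"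
   by (simp add: D_def us.chi_add us.chi_mult us.chi_adj us)
  ultimately show ?thesis unfolding m_def by (metis mult_zero_right nonzero_eq_divide_eq zero_neq_one)
 qed
 define w where "w i = (if i = 0 then w0 else w1)" for i :: nat
 have "w \<in> Lg CA 2"
 proof (rule Lg_CX_I[where W = "%i x. minv (D x) * adj (emb A (evp x (w i)))" and l = "%i. m * cnj (snd (w i))"])
  show wi: "w i \<in> carrier CA \<times> UNIV" for i using w0(1) w1(1) by (simp add: w_def)
  show "continuous_on X (%x. minv (D x) * adj (emb A (evp x (w i))))" for i
   by (intro continuous_on_mult Dc continuous_on_adj evp_cont wi)
  fix x assume x: "x \<in> X"
  show "minv (D x) * adj (emb A (evp x (w i))) \<in> SA" for i
   by (intro I.U.mult_S I.U.adj_S minv(3)[OF DG[OF x]] emb_in_SA evp_in wi x)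
  show "us (minv (D x) * adj (emb A (evp x (w i)))) = m * cnj (snd (w i))" for i
   by (simp add: us.chi_mult us.chi_adj usD x us_emb evp_def)
  have "(\<Sum>i<2. minv (D x) * adj (emb A (evp x (w i))) * emb A (evp x (w i))) = minv (D x) * D x"
   by (simp add: numeral_2_eq_2 w_def D_def \<alpha>_def \<beta>_def distrib_left mult.assoc)
  then show "(\<Sum>i<2. minv (D x) * adj (emb A (evp x (w i))) * emb A (evp x (w i))) = 1" using minv(2)[OF DG[OF x]] by simp
 qed
 moreover have "udist CA (v i) (w i) < e" if i: "i < 2" for i
 proof -
  have "udist CA (v i) (w i) <= 3 * (e / 6)"
  proof (rule udist_CX(2))
   show "v i \<in> carrier CA \<times> UNIV" using v i by simp
   show "w i \<in> carrier CA \<times> UNIV" using w0(1) w1(1) by (simp add: w_def)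
   fix x assume x: "x \<in> X"
   show "norm (emb A (evp x (v i)) - emb A (evp x (w i))) <= e / 6"
   proof (cases "i = 0")
    case True
    then show ?thesis using norm_diff_triangle_le[OF bspec[OF p(3) x] bspec[OF w0(3) x]] by (simp add: w_def)
   next
    case False
    then have "i = 1" using i by simp
    then show ?thesis using norm_diff_triangle_le[OF bspec[OF q(3) x] bspec[OF w1(3) x]] by (simp add: w_def)
   qed
  qed
  then show ?thesis using e by simp
 qed
 ultimately show "\<exists>w\<in>Lg CA 2. \<forall>i<2. udist CA (v i) (w i) < e" by (intro bexI[of _ w]) simp_all
qed

section \<open>Vanishing of K1 from stable rank one of the function algebra\<close>

lemma hereditary_CX:
 assumes H: "hereditary_subalg A B"
 shows "hereditary_subalg CA {f \<in> carrier CA. \<forall>x\<in>X. f x \<in> B}"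
proof -
 note h = H[unfolded hereditary_subalg_def]
 have sc: "sub CA f g \<in> carrier CA" if "f \<in> carrier CA" "g \<in> carrier CA" for f g
  unfolding sub_def by (intro CX_closed that)
 have pos: "positive A (f x)" if p: "positive CA f" and x: "x \<in> X" for f x
 proof -
  obtain g where g: "g \<in> carrier CA" "f = mul CA (star CA g) g" using p unfolding positive_def by blast
  show ?thesis unfolding positive_def by (rule bexI[of _ "g x"]) (simp_all add: g(2) op x pt[OF g(1) x])
 qed
 show ?thesis unfolding hereditary_subalg_def
 proof (intro conjI ballI allI impI)
  show "zero CA \<in> {f \<in> carrier CA. \<forall>x\<in>X. f x \<in> B}" using h by (simp add: CX_closed op)
  fix f assume "f \<in> {f \<in> carrier CA. \<forall>x\<in>X. f x \<in> B}"
  then have f: "f \<in> carrier CA" "\<And>x. x \<in> X ==> f x \<in> B" by simp_all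
  show "smul CA c f \<in> {f \<in> carrier CA. \<forall>x\<in>X. f x \<in> B}" for c using h f by (simp add: CX_closed op)
  show "star CA f \<in> {f \<in> carrier CA. \<forall>x\<in>X. f x \<in> B}" using h f by (simp add: CX_closed op)
  fix g assume "g \<in> {f \<in> carrier CA. \<forall>x\<in>X. f x \<in> B}"
  then have g: "g \<in> carrier CA" "\<And>x. x \<in> X ==> g x \<in> B" by simp_all
  show "add CA f g \<in> {f \<in> carrier CA. \<forall>x\<in>X. f x \<in> B}" using h f g by (simp add: CX_closed op)
  show "mul CA f g \<in> {f \<in> carrier CA. \<forall>x\<in>X. f x \<in> B}" using h f g by (simp add: CX_closed op)
 next
  fix f F assume a: "(\<forall>n. f n \<in> {f \<in> carrier CA. \<forall>x\<in>X. f x \<in> B}) & F \<in> carrier CA & (%n. nrm CA (sub CA (f n) F)) \<longlonglongrightarrow> 0"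
  then have f: "f n \<in> carrier CA" "\<And>x. x \<in> X ==> f n x \<in> B" and F: "F \<in> carrier CA" and
   lim: "(%n. nrm CA (sub CA (f n) F)) \<longlonglongrightarrow> 0" for n by auto
  have "F x \<in> B" if x: "x \<in> X" for x
  proof -
   have "norm (nrm A (sub A (f n x) (F x))) <= nrm CA (sub CA (f n) F)" for n
    using CX_nrm_ge[OF sc[OF f(1) F] x, of n] cs_nrm_nonneg[OF cstar sub_in[OF pt[OF f(1) x] pt[OF F x]], of n] by (simp add: op x)
   then have "(%n. nrm A (sub A (f n x) (F x))) \<longlonglongrightarrow> 0" by (intro Lim_null_comparison[OF always_eventually lim] allI)
   then have "(\<forall>n. f n x \<in> B) & F x \<in> carrier A & (%n. nrm A (sub A (f n x) (F x))) \<longlonglongrightarrow> 0" using f(2)[OF x] pt[OF F x] by simp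
   then show ?thesis using h[THEN conjunct2, THEN conjunct2, THEN conjunct2, THEN conjunct2, THEN conjunct2, THEN conjunct1, rule_format, of "%n. f n x" "F x"] by simp
  qed
  then show "F \<in> {f \<in> carrier CA. \<forall>x\<in>X. f x \<in> B}" using F by simp
 next
  fix a b assume a: "a \<in> carrier CA" and b: "b \<in> {f \<in> carrier CA. \<forall>x\<in>X. f x \<in> B}" and p: "positive CA a & positive CA (sub CA b a)"
  have "a x \<in> B" if x: "x \<in> X" for x
  proof -
   have "b x \<in> B" using b x by simp
   moreover have "positive A (a x)" using pos p x by blast
   moreover have "positive A (sub A (b x) (a x))" using pos[OF conjunct2[OF p] x] by (simp add: op x)
   ultimately show ?thesis
    using h[THEN conjunct2, THEN conjunct2, THEN conjunct2, THEN conjunct2, THEN conjunct2, THEN conjunct2, rule_format, OF pt[OF a x], of "b x"] by simp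
  qed
  then show "a \<in> {f \<in> carrier CA. \<forall>x\<in>X. f x \<in> B}" using a by simp
 qed simp
qed

text \<open>Functions with values in \<open>B\<close> form a hereditary subalgebra of the function
  algebra, so an invertible approximant can be found with values in the unitization of
  \<open>B\<close>. Evaluated along a connected set it links 1 to the given unitary, and
  \<open>connected_K1_zero\<close> passes from single unitaries to matrices.\<close>

theorem K1_zero_if_dense:
 assumes dA: "GLdense SA" and dC: "Lg_dense CA 1" and dim: "\<not> covering_dim_le X 0" and H: "hereditary_subalg A B"
 shows "K1_zero A B"
proof -
 let ?B = "{f \<in> carrier CA. \<forall>x\<in>X. f x \<in> B}" and ?S = "unz us (ide A B)"
 have sB: "subalg A B" by (rule subalg_hereditary[OF H])
 have Bc: "B \<subseteq> carrier A" using sB by (simp add: subalg_def)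
 interpret N: cideal us "ide A B" by (rule cideal_ide[OF sB])
 have S: "?S = emb A ` (B \<times> UNIV)" by (rule unz_ide[OF sB])
 have dB: "GLdense ?S" by (rule her.GLdense_hereditary[OF her_ide[OF H] dA])
 have HC: "hereditary_subalg CA ?B" by (rule hereditary_CX[OF H])
 let ?SC = "unz us (ide CA ?B)"
 have SC: "?SC = emb CA ` (?B \<times> UNIV)" by (rule C.unz_ide[OF subalg_hereditary[OF HC]])
 have "GLdense C.SA" using C.GLdense_ide_iff dC by simp
 then have dBC: "GLdense ?SC" by (rule her.GLdense_hereditary[OF C.her_ide[OF HC]])
 obtain K p q where K: "connected K" "K \<subseteq> X" "p \<in> K" "q \<in> K" "p ~= q" using nondegenerate_continuum[OF cpt dim] by blast
 have pq: "p \<in> X" "q \<in> X" using K by auto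
 have BX: "v \<in> carrier CA \<times> UNIV" if "v \<in> ?B \<times> UNIV" for v using that by auto
 have evB: "emb A (evp x v) \<in> ?S" if "v \<in> ?B \<times> UNIV" "x \<in> X" for v x
  unfolding S using that by (intro imageI) (auto simp: evp_def)
 have main: "path_component (GL ?S) 1 u" if u: "u \<in> UG ?S" "us u = 1" for u
 proof -
  obtain b0 where b0: "u = emb A b0" "b0 \<in> B \<times> UNIV" using UG_D(1)[OF u(1)] unfolding S by (rule imageE)
  define b where "b = fst b0"
  have b: "b \<in> B" "u = emb A (b, 1)" using b0 u(2) us_emb[of b0] by (auto simp: b_def)
  have bA: "b \<in> carrier A" using b Bc by blast
  \<comment> \<open>\<open>h\<close> is 0 at \<open>p\<close> and 1 at \<open>q\<close>, so
    \<open>(f, 1)\<close> has constant scalar part and takes the value 1 at \<open>p\<close> and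
    \<open>u\<close> at \<open>q\<close>.\<close>
  define h where "h x = min 1 (dist x p / dist q p)" for x
  have h: "continuous_on X h" "h p = 0" "h q = 1" unfolding h_def using K(5) by (auto intro!: continuous_intros)
  define f where "f x = (if x \<in> X then smul A (of_real (h x)) b else zero A)" for x
  have "continuous_on X (%x. cplx (of_real (h x)) * emb A (b, 0))" by (intro continuous_intros h(1))
  then have "continuous_on X (%x. emb A (f x, 0))"
   by (rule continuous_on_eq) (simp add: f_def emb_smul[OF bA])
  then have fC: "f \<in> carrier CA" by (simp add: mem) (simp add: f_def closed bA)
  have "f x \<in> B" if "x \<in> X" for x using that b(1) sB by (simp add: f_def subalg_def)
  then have F: "(f, 1) \<in> ?B \<times> UNIV" using fC by simp
  have "emb CA (f, 1) \<in> ?SC" unfolding SC using F by (rule imageI)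
  then obtain Y where Y: "Y \<in> GL ?SC" "norm (emb CA (f, 1) - Y) < 1 / 6"
   using dBC[unfolded GLdense_def, rule_format, of _ "1/6"] by (meson divide_pos_pos zero_less_numeral zero_less_one)
  obtain y where y: "Y = emb CA y" "y \<in> ?B \<times> UNIV" using subsetD[OF GL_subset Y(1)] unfolding SC by (rule imageE)
  obtain z where z: "minv Y = emb CA z" "z \<in> ?B \<times> UNIV" using minv(3)[OF Y(1)] unfolding SC by (rule imageE)
  have inv: "umul CA y z = uone CA" "umul CA z y = uone CA"
  proof -
   have "emb CA (umul CA y z) = emb CA (uone CA)" "emb CA (umul CA z y) = emb CA (uone CA)"
    using minv(1,2)[OF Y(1)] by (simp_all only: y(1) z(1)[unfolded y(1)] C.emb_umul[OF BX[OF y(2)] BX[OF z(2)]] C.emb_umul[OF BX[OF z(2)] BX[OF y(2)]] C.emb_uone)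
   then show "umul CA y z = uone CA" "umul CA z y = uone CA"
    using C.emb_eq_iff[OF C.ucl(2)[OF BX[OF y(2)] BX[OF z(2)]] C.ucl(5)]
     C.emb_eq_iff[OF C.ucl(2)[OF BX[OF z(2)] BX[OF y(2)]] C.ucl(5)] by simp_all
  qed
  define k where "k x = emb A (evp x y)" for x
  have kG: "k x \<in> GL ?S" if x: "x \<in> X" for x
  proof -
   note yz = evp_in[OF BX[OF y(2)] x] evp_in[OF BX[OF z(2)] x]
   have "umul A (evp x y) (evp x z) = uone A" "umul A (evp x z) (evp x y) = uone A"
    using arg_cong[OF inv(1), of "evp x"] arg_cong[OF inv(2), of "evp x"] by (simp_all only: evp_op x)
   then have "k x * emb A (evp x z) = 1" "emb A (evp x z) * k x = 1"
    unfolding k_def using emb_umul[OF yz] emb_umul[OF yz(2,1)] emb_uone by simp_all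
   then show ?thesis using evB[OF y(2) x] evB[OF z(2) x] unfolding GL_def k_def by blast
  qed
  have kc: "continuous_on X k" unfolding k_def by (rule evp_cont[OF BX[OF y(2)]])
  have near: "norm (emb A (evp x (f, 1)) - k x) < 1" if x: "x \<in> X" for x
  proof -
   have "norm (emb A (evp x (f, 1)) - k x) <= udist A (evp x (f, 1)) (evp x y)"
    unfolding k_def by (rule udist_bounds(1)[OF evp_in[OF BX[OF F] x] evp_in[OF BX[OF y(2)] x]])
   also have "\<dots> <= udist CA (f, 1) y" by (rule udist_CX(1)[OF BX[OF F] BX[OF y(2)] x])
   also have "\<dots> <= 3 * norm (emb CA (f, 1) - Y)" unfolding y(1) by (rule C.udist_bounds(2)[OF BX[OF F] BX[OF y(2)]])
   finally show ?thesis using Y(2) by linarith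
  qed
  have seg: "path_component (GL ?S) x y" if x: "x \<in> GL ?S" and y: "y \<in> ?S" and xy: "norm (x - y) * norm (minv x) < 1" for x y
  proof (rule path_component_linepath_image)
   fix s :: real assume s: "s \<in> {0..1}"
   have e: "x - ((1 - s) *\<^sub>R x + s *\<^sub>R y) = s *\<^sub>R (x - y)" by (simp add: algebra_simps)
   have "s * norm (x - y) <= 1 * norm (x - y)" using s by (intro mult_right_mono) auto
   then have "norm (s *\<^sub>R (x - y)) * norm (minv x) <= norm (x - y) * norm (minv x)" using s by (intro mult_right_mono) auto
   then show "(1 - s) *\<^sub>R x + s *\<^sub>R y \<in> GL ?S" using xy subsetD[OF GL_subset x] y e
    by (intro N.U.GL_near[OF x] N.U.add_S N.U.scaleR_S) auto
  qed
  have "path_component (GL ?S) 1 (k p)"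
  proof (rule seg[OF N.U.GL_one subsetD[OF GL_subset kG[OF pq(1)]]])
   have "f p = smul A 0 b" using pq h by (simp add: f_def)
   then have "emb A (evp p (f, 1)) = 1" using cs_zero_smul[OF cstar bA] emb_uone by (simp add: evp_def uone_def)
   then show "norm (1 - k p) * norm (minv (1 :: 'a prd ue)) < 1" using near[OF pq(1)] minv_eq[of "1 :: 'a prd ue" 1] by simp
  qed
  \<comment> \<open>The connected set need not be path connected. Being joined inside the open set
    of invertible elements is an equivalence relation that holds locally along \<open>k\<close>,
    hence on the whole connected set.\<close>
  moreover have "path_component (GL ?S) (k p) (k q)"
  proof (rule connected_equivalence_relation[OF K(1,3,4)])
   fix x assume xK: "x \<in> K"
   then have x: "x \<in> X" using K(2) by blast
   define r where "r = 1 / (norm (minv (k x)) + 1)"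
   have r: "r > 0" by (simp add: r_def add_nonneg_pos)
   have "continuous_on K k" using continuous_on_subset[OF kc K(2)] .
   then have "openin (top_of_set K) (K \<inter> k -` ball (k x) r)" by (intro continuous_openin_preimage_gen) auto
   moreover have "path_component (GL ?S) (k x) (k x')" if x': "x' \<in> K \<inter> k -` ball (k x) r" for x'
   proof (rule seg[OF kG[OF x]])
    show "k x' \<in> ?S" using subsetD[OF GL_subset kG] x' K(2) by blast
    have "norm (k x - k x') < r" using x' by (simp add: dist_norm)
    moreover have np: "norm (minv (k x)) + 1 > 0" by (simp add: add_nonneg_pos)
    ultimately have "norm (k x - k x') * (norm (minv (k x)) + 1) < r * (norm (minv (k x)) + 1)" by (intro mult_strict_right_mono)
    moreover have "r * (norm (minv (k x)) + 1) = 1" using np by (simp add: r_def)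
    moreover have "norm (k x - k x') * norm (minv (k x)) <= norm (k x - k x') * (norm (minv (k x)) + 1)" by (intro mult_left_mono) simp_all
    ultimately show "norm (k x - k x') * norm (minv (k x)) < 1" by linarith
   qed
   ultimately show "\<exists>T. openin (top_of_set K) T & x \<in> T & (\<forall>x'\<in>T. path_component (GL ?S) (k x) (k x'))"
    using r xK by (intro exI[of _ "K \<inter> k -` ball (k x) r"]) simp
  qed (blast intro: path_component_sym path_component_trans)+
  moreover have "path_component (GL ?S) u (k q)"
  proof (rule seg[OF N.U.UG_GL[OF u(1)] subsetD[OF GL_subset kG[OF pq(2)]]])
   have "f q = b" using pq h cs_smul_one[OF cstar bA] by (simp add: f_def)
   then have "emb A (evp q (f, 1)) = u" by (simp add: evp_def b(2))
   moreover have "norm (minv u) = 1"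
   proof -
    have "minv u = adj u" using UG_D(2,3)[OF u(1)] by (intro minv_eq)
    moreover have "adj u \<in> UG ?S" using u(1) N.U.adj_S by (auto simp: UG_def)
    ultimately show ?thesis using UG_D(4) by metis
   qed
   ultimately show "norm (u - k q) * norm (minv u) < 1" using near[OF pq(2)] by simp
  qed
  ultimately show ?thesis by (meson path_component_sym path_component_trans)
 qed
 show ?thesis
 proof (rule connected_K1_zero[OF sB dB])
  fix u assume u: "u \<in> UG ?S"
  \<comment> \<open>A general unitary has a scalar part of modulus 1, whereas the argument above
    needs scalar part 1; rotating along the circle removes it without leaving the invertible
    elements.\<close>
  define m where "m = us u"
  have "cnj m * m = us (adj u * u)" by (simp add: us.chi_mult us.chi_adj m_def)
  then have mm: "cnj m * m = 1" "m * cnj m = 1" using UG_D(2)[OF u] by (simp_all add: mult.commute)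
  have "complex_of_real ((cmod m)\<^sup>2) = 1" using mm(2) by (simp only: complex_norm_square)
  then have "(cmod m)\<^sup>2 = 1" by (simp only: of_real_eq_1_iff)
  then have "cmod m = 1" using power2_eq_imp_eq[of "cmod m" 1] by simp
  then obtain t where t: "m = cis t" by (metis cis_Arg norm_eq_zero sgn_div_norm inverse_1 scaleR_one zero_neq_one)
  define w where "w = cplx (cnj m) * u"
  have uw: "u = cplx m * w" using mm by (simp add: w_def mult.assoc[symmetric] cplx_mult[symmetric])
  have wS: "w \<in> ?S" unfolding w_def by (intro N.U.mult_S N.U.cplx_S UG_D(1)[OF u])
  have w1: "us w = 1" using mm by (simp add: w_def us.chi_mult us.chi_cplx m_def)
  have wU: "w \<in> UG ?S"
  proof -
   have aw: "adj w = cplx m * adj u" by (simp add: w_def adj_mult adj_cplx cplx_central)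
   have "adj w * w = cplx m * (adj u * cplx (cnj m) * u)" unfolding aw by (simp only: w_def mult.assoc)
   also have "adj u * cplx (cnj m) = cplx (cnj m) * adj u" by (rule cplx_central[symmetric])
   also have "cplx m * (cplx (cnj m) * adj u * u) = cplx (m * cnj m) * (adj u * u)" by (simp only: cplx_mult mult.assoc)
   finally have 1: "adj w * w = 1" using mm UG_D(2)[OF u] by simp
   have "w * adj w = cplx (cnj m) * (u * cplx m * adj u)" unfolding aw by (simp only: w_def mult.assoc)
   also have "u * cplx m = cplx m * u" by (rule cplx_central[symmetric])
   also have "cplx (cnj m) * (cplx m * u * adj u) = cplx (cnj m * m) * (u * adj u)" by (simp only: cplx_mult mult.assoc)
   finally have 2: "w * adj w = 1" using mm UG_D(3)[OF u] by simp
   show ?thesis using wS 1 2 by (simp add: UG_def)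
  qed
  have "path_component (GL ?S) w u"
   unfolding path_component_def
  proof (intro exI conjI)
   let ?g = "%s. cplx (cis (s * t)) * w"
   show "path ?g" unfolding path_def by (intro continuous_intros)
   show "path_image ?g \<subseteq> GL ?S" unfolding path_image_def
    using N.U.GL_mult[OF N.U.GL_cplx N.U.UG_GL[OF wU]] by auto
   show "pathstart ?g = w" by (simp add: pathstart_def)
   show "pathfinish ?g = u" by (simp add: pathfinish_def uw t)
  qed
  then have "path_component (GL ?S) 1 u" using main[OF wU w1] by (meson path_component_trans)
  then show "path_component (UG ?S) 1 u"
   by (rule N.U.UG_path_component) (use u N.U.one_S in \<open>auto simp: UG_def\<close>)
 qed
qed

end

theorem theorem1p9:
  fixes A :: "'a cstar_alg" and X :: "'x::metric_space set"
  assumes "cstar_algebra A"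
    and "stable_rank A = 1"
    and "compact X"
    and "covering_dim_one X"
  shows "stable_rank (CX X A) = (if no_K1_obstructions A then 1 else 2)"
proof -
 have dim: "covering_dim_le X 1" "\<not> covering_dim_le X 0" using assms(4) by (simp_all add: covering_dim_one_def)
 have "X ~= {}"
 proof
  assume "X = {}"
  \<comment> \<open>The empty cover of the empty set has order 0, so the empty space does not have
    dimension one.\<close>
  then have "covering_dim_le X 0" by (auto simp: covering_dim_le_def intro!: exI[of _ "{}"])
  then show False using dim(2) by blast
 qed
 then interpret cx A X using assms(1,3) by unfold_locales
 have LA: "Lg_dense A 1" using assms(2) by (simp add: stable_rank_eq_1_iff)
 then have d: "GLdense SA" using GLdense_ide_iff by simp
 show ?thesis
 proof (cases "no_K1_obstructions A")
  case True
  have "Lg_dense CA 1"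
  proof (rule Lg_dense_1[OF dim(1) d])
   fix f u assume f: "f \<in> SA" "adj f = f" and u: "u \<in> UG (unz us (ann (ide A (carrier A)) f))"
   \<comment> \<open>The annihilator arising in the local argument is the image of a hereditary
     subalgebra of \<open>A\<close>, to which the vanishing of K1 applies once density of
     invertibles has been passed to it.\<close>
   define B where "B = {b \<in> carrier A. emb A (b, 0) \<in> ann (ide A (carrier A)) f}"
   have H: "hereditary_subalg A B" and iB: "ide A B = ann (ide A (carrier A)) f"
    unfolding B_def by (rule hereditary_ann[OF f(2)])+
   have dB: "GLdense (unz us (ide A B))" by (rule her.GLdense_hereditary[OF her_ide[OF H] d])
   have "K1_zero A B" using True H by (simp add: no_K1_obstructions_def)
   then have "path_component (UG (unz us (ide A B))) 1 u"
    using K1_zero_connected[OF subalg_hereditary[OF H] dB] u by (simp add: iB)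
   then show "path_component (UG (unz us (ann (ide A (carrier A)) f))) 1 u" by (simp only: iB)
  qed
  then show ?thesis using True by (simp add: stable_rank_eq_1_iff)
 next
  case False
  have "\<not> Lg_dense CA 1"
  proof
   assume "Lg_dense CA 1"
   then have "no_K1_obstructions A" unfolding no_K1_obstructions_def
    using assms(2) K1_zero_if_dense[OF d _ dim(2)] by blast
   then show False using False by simp
  qed
  then have "stable_rank CA = 2" using Lg_dense_2[OF dim(1) d] by (rule stable_rank_eq_2)
  then show ?thesis using False by simp
 qed
qed

end
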